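(* Let $F$ be a finite group acting coherently on a $G$-graded fusion category $\mathcal{C}$ with respect to a given action by group automorphisms of $F$ on the finite group $G$. Then the Grothendieck ring of $\mathcal{C}^F$ has the multiplicative structure $$(\alpha\beta)_g=\sum_{(h,k)}m_{h,k}(\alpha_h,\beta_k)\qquad(\mathrm{M})$$ on the space $A^F$ of $F$-invariants of a $G$-graded vector space $A=\bigoplus_{g\in G}A(g)$ with structure maps $m_{g,h}$, $c_{x,g}$; here $\alpha,\beta\in A^F$, $g\in G$, and $(h,k)$ runs over a set of representatives of the orbits of the diagonal action of the stabilizer $F_g$ on $\{(h,k)\in G\times G: hk=g\}$.
   Context: $k$ is an algebraically closed field. A fusion category over $k$ is a rigid semisimple $k$-linear tensor category with finitely many simple objects, finite dimensional Hom spaces and simple unit object. $G$-graded means $\mathcal{C}=\bigoplus_{g\in G}\mathcal{C}_g$ as abelian categories with $\mathcal{C}_g\otimes\mathcal{C}_h\subset\mathcal{C}_{gh}$. Coherent action. $F$ acts on $\mathcal{C}$ by tensor autoequivalences: there are $k$-linear tensor autoequivalences $T^x$ ($x\in F$) with tensor structures $(T_2^x)^{M,N}:T^x(M\otimes N)\to T^x(M)\otimes T^x(N)$ and natural isomorphisms of tensor functors $T_2^{x,y}:T^xT^y\to T^{xy}$ with $(T_2^{xy,z})_M(T_2^{x,y})_{T^z(M)}=(T_2^{x,yz})_MT^x((T_2^{y,z})_M)$, normalized so that $T^1=\mathrm{id}$ and $T_2^{x,1}$, $T_2^{1,x}$ are identities. The action is coherent with respect to the action $(x,g)\mapsto{}^xg$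 of $F$ on $G$ by group automorphisms if $T^x(\mathcal{C}_g)\subset\mathcal{C}_{{}^xg}$ for all $x\in F$, $g\in G$. $F_g=\{x\in F:{}^xg=g\}$. Rings with the multiplicative structure (M). Let $A=\bigoplus_{g\in G}A(g)$ be a graded vector space with linear maps $m_{g,h}:A(g)\otimes A(h)\to A(gh)$ and $c_{x,g}:A(g)\to A({}^xg)$ ($g,h\in G$, $x\in F$); put $c_x=\bigoplus_gc_{x,g}:A\to A$ and $A^F=\{a\in A: c_x(a)=a\text{ for all }x\in F\}$. The conditions required are: (C1) $c_1=\mathrm{id}$ and $c_{xy}=c_xc_y$; (C2) $c_{x,g}=\mathrm{id}_{A(g)}$ if $x\in F_g$; (C3) $c_xm_{g,h}=m_{{}^xg,{}^xh}(c_x\times c_x)$; (C4) there is $1\in A(1)$ with $c_x(1)=1$ for all $x\in F$ and $m_{1,g}(1,\alpha_g)=m_{g,1}(\alpha_g,1)=\alpha_g$; (C5) for all $g\in G$ and $\alpha,\beta,\gamma\in A^F$, $\sum_{(d,e,f)\in T_g}m_{de,f}(m_{d,e}(\alpha_d,\beta_e),\gamma_f)=\sum_{(d,e,f)\in T_g}m_{d,ef}(\alpha_d,m_{e,f}(\beta_e,\gamma_f))$, where $T_g$ is a set of representatives of the orbits of the diagonal action of $F_g$ on $\{(d,e,f)\in G^3: def=g\}$. Under (C1)-(C4), the multiplication (M) on $A^F$ is associative if and only if (C5) holds, and it does not depend on the choice of representatives. The data for which (M) is considered here. $A(g)=K_0(\mathcal{C}_g^{F_g})$, treated as a vector space; $c_{x,g}([M])=[T^x(M)]$;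 and $m_{g,h}([M],[N])=\big[\mathrm{Ind}_{F_g\cap F_h}^{F_{gh}}(\mathrm{Res}^{F_g}_{F_g\cap F_h}(M)\otimes\mathrm{Res}^{F_h}_{F_g\cap F_h}(N))\big]$. Equivariantization. For $H\le F$ and a subcategory $\mathcal{D}$ of $\mathcal{C}$ stable under $T^h$, $h\in H$, $\mathcal{D}^H$ is the category of pairs $(M,\mu)$, $M\in\mathcal{D}$, $\mu=(\mu^h:T^h(M)\xrightarrow{\sim}M)_{h\in H}$ with $\mu^{h}T^{h}(\mu^{h'})=\mu^{hh'}(T_2^{h,h'})_M$, $\mu^1=\mathrm{id}$; morphisms are morphisms of $\mathcal{C}$ commuting with the $\mu$'s. Tensor product in $\mathcal{C}^H$: $(M,\mu)\otimes(N,\nu)=(M\otimes N,((\mu^h\otimes\nu^h)(T_2^h)^{M,N})_h)$. $\mathrm{Res}^A_B$ ($B\le A\le F$) keeps only $\mu^b$, $b\in B$. For a set $\mathcal{R}$ of representatives of $A/B$, $\mathrm{Ind}_B^A(V,\mu)=(\bigoplus_{t\in\mathcal{R}}T^t(V),\nu)$ with $\nu^a$ given on $T^aT^t(V)$ by $T^s(\mu^b)(T_2^{s,b})_V^{-1}(T_2^{a,t})_V:T^aT^t(V)\to T^s(V)$, where $at=sb$, $s\in\mathcal{R}$, $b\in B$. For $x\in F$ and $(V,\mu)\in\mathcal{C}^H$, $T^x(V,\mu)=(T^x(V),{}^x\mu)\in\mathcal{C}^{xHx^{-1}}$ with ${}^x\mu^{xhx^{-1}}=T^x(\mu^h)(T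_2^{x,h})_V^{-1}(T_2^{xhx^{-1},x})_V$.
   Formalization: Condition (C5) as printed fails for these data (e.g. Z/2 acting by inversion on Z/11, C = Vec_G: the two sides have ranks 4 and 2); instead of (C5) the theorem asserts associativity of (M) directly, alongside (C1)-(C4) and the ring isomorphism with K_0(C^F). *)

theory Defs
  imports
    "HOL-Library.Poly_Mapping"
    "HOL-Computational_Algebra.Polynomial"
    "HOL-Algebra.Bij"
    "HOL-Algebra.Group_Action"
    "HOL-Algebra.QuotRing"
    "HOL-Algebra.Module"
begin

section \<open>Linear categories\<close>

definition scalars :: "'a::comm_ring_1 ring" where
  "scalars = \<lparr>carrier = UNIV, mult = (*), one = 1, zero = 0, add = (+)\<rparr>"

text \<open>
  The hom spaces are modules over the type of scalars; the \<open>mult\<close> and \<open>one\<close> fields of these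
  records are never used. Distinct hom sets are not required to be disjoint: a morphism of an
  equivariantization is literally a morphism of the underlying category. Since every category can
  be presented with disjoint hom sets, composition as one operation on all morphisms (and likewise
  tensor products and functors on morphisms) is no restriction.
\<close>

record ('o, 'm, 'k) lincat =
  Obj :: "'o set"
  Hom :: "'o \<Rightarrow> 'o \<Rightarrow> ('k, 'm) module"
  Comp :: "'m \<Rightarrow> 'm \<Rightarrow> 'm"  (infixr "\<bullet>\<index>" 72)
  Idn :: "'o \<Rightarrow> 'm"

abbreviation Arr :: "('o, 'm, 'k, 'z) lincat_scheme \<Rightarrow> 'o \<Rightarrow> 'o \<Rightarrow> 'm set" where
  "Arr C A B \<equiv> carrier (Hom C A B)"

locale linear_category =
  fixes C :: "('o, 'm, 'k::field, 'z) lincat_scheme" (structure)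
  assumes Hom_module: "\<lbrakk>A \<in> Obj C; B \<in> Obj C\<rbrakk> \<Longrightarrow> module scalars (Hom C A B)"
    and Idn_closed: "A \<in> Obj C \<Longrightarrow> Idn C A \<in> Arr C A A"
    and Comp_closed: "\<lbrakk>A \<in> Obj C; B \<in> Obj C; D \<in> Obj C; f \<in> Arr C A B; g \<in> Arr C B D\<rbrakk>
          \<Longrightarrow> g \<bullet> f \<in> Arr C A D"
    and Comp_Idn_left: "\<lbrakk>A \<in> Obj C; B \<in> Obj C; f \<in> Arr C A B\<rbrakk> \<Longrightarrow> Idn C B \<bullet> f = f"
    and Comp_Idn_right: "\<lbrakk>A \<in> Obj C; B \<in> Obj C; f \<in> Arr C A B\<rbrakk> \<Longrightarrow> f \<bullet> Idn C A = f"
    and Comp_assoc: "\<lbrakk>A \<in> Obj C; B \<in> Obj C; D \<in> Obj C; E \<in> Obj C;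
            f \<in> Arr C A B; g \<in> Arr C B D; h \<in> Arr C D E\<rbrakk> \<Longrightarrow> (h \<bullet> g) \<bullet> f = h \<bullet> (g \<bullet> f)"
    and Comp_add_left: "\<lbrakk>A \<in> Obj C; B \<in> Obj C; D \<in> Obj C;
            f \<in> Arr C A B; g \<in> Arr C B D; h \<in> Arr C B D\<rbrakk>
          \<Longrightarrow> (g \<oplus>\<^bsub>Hom C B D\<^esub> h) \<bullet> f = (g \<bullet> f) \<oplus>\<^bsub>Hom C A D\<^esub> (h \<bullet> f)"
    and Comp_add_right: "\<lbrakk>A \<in> Obj C; B \<in> Obj C; D \<in> Obj C;
            f \<in> Arr C A B; g \<in> Arr C A B; h \<in> Arr C B D\<rbrakk>
          \<Longrightarrow> h \<bullet> (f \<oplus>\<^bsub>Hom C A B\<^esub> g) = (h \<bullet> f) \<oplus>\<^bsub>Hom C A D\<^esub> (h \<bullet> g)"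
    and Comp_smult_left: "\<lbrakk>A \<in> Obj C; B \<in> Obj C; D \<in> Obj C; f \<in> Arr C A B; g \<in> Arr C B D\<rbrakk>
          \<Longrightarrow> (r \<odot>\<^bsub>Hom C B D\<^esub> g) \<bullet> f = r \<odot>\<^bsub>Hom C A D\<^esub> (g \<bullet> f)"
    and Comp_smult_right: "\<lbrakk>A \<in> Obj C; B \<in> Obj C; D \<in> Obj C; f \<in> Arr C A B; g \<in> Arr C B D\<rbrakk>
          \<Longrightarrow> g \<bullet> (r \<odot>\<^bsub>Hom C A B\<^esub> f) = r \<odot>\<^bsub>Hom C A D\<^esub> (g \<bullet> f)"

definition inverse_arrows :: "('o, 'm, 'k, 'z) lincat_scheme \<Rightarrow> 'o \<Rightarrow> 'o \<Rightarrow> 'm \<Rightarrow> 'm \<Rightarrow> bool" where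
  "inverse_arrows C A B f g \<longleftrightarrow> f \<in> Arr C A B \<and> g \<in> Arr C B A \<and>
     g \<bullet>\<^bsub>C\<^esub> f = Idn C A \<and> f \<bullet>\<^bsub>C\<^esub> g = Idn C B"

definition is_iso :: "('o, 'm, 'k, 'z) lincat_scheme \<Rightarrow> 'o \<Rightarrow> 'o \<Rightarrow> 'm \<Rightarrow> bool" where
  "is_iso C A B f \<longleftrightarrow> (\<exists>g. inverse_arrows C A B f g)"

definition inv_arr :: "('o, 'm, 'k, 'z) lincat_scheme \<Rightarrow> 'o \<Rightarrow> 'o \<Rightarrow> 'm \<Rightarrow> 'm" where
  "inv_arr C A B f = (THE g. inverse_arrows C A B f g)"

definition zero_object :: "('o, 'm, 'k, 'z) lincat_scheme \<Rightarrow> 'o \<Rightarrow> bool" where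
  "zero_object C Z \<longleftrightarrow> Z \<in> Obj C \<and>
     (\<forall>A\<in>Obj C. (\<exists>!f. f \<in> Arr C A Z) \<and> (\<exists>!f. f \<in> Arr C Z A))"

definition is_mono :: "('o, 'm, 'k, 'z) lincat_scheme \<Rightarrow> 'o \<Rightarrow> 'o \<Rightarrow> 'm \<Rightarrow> bool" where
  "is_mono C A B f \<longleftrightarrow> f \<in> Arr C A B \<and>
     (\<forall>X\<in>Obj C. \<forall>g\<in>Arr C X A. \<forall>h\<in>Arr C X A. f \<bullet>\<^bsub>C\<^esub> g = f \<bullet>\<^bsub>C\<^esub> h \<longrightarrow> g = h)"

definition is_epi :: "('o, 'm, 'k, 'z) lincat_scheme \<Rightarrow> 'o \<Rightarrow> 'o \<Rightarrow> 'm \<Rightarrow> bool" where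
  "is_epi C A B f \<longleftrightarrow> f \<in> Arr C A B \<and>
     (\<forall>X\<in>Obj C. \<forall>g\<in>Arr C B X. \<forall>h\<in>Arr C B X. g \<bullet>\<^bsub>C\<^esub> f = h \<bullet>\<^bsub>C\<^esub> f \<longrightarrow> g = h)"

definition is_kernel :: "('o, 'm, 'k, 'z) lincat_scheme \<Rightarrow> 'o \<Rightarrow> 'o \<Rightarrow> 'm \<Rightarrow> 'o \<Rightarrow> 'm \<Rightarrow> bool" where
  "is_kernel C A B f K i \<longleftrightarrow> f \<in> Arr C A B \<and> K \<in> Obj C \<and> i \<in> Arr C K A \<and>
     f \<bullet>\<^bsub>C\<^esub> i = \<zero>\<^bsub>Hom C K B\<^esub> \<and>
     (\<forall>X\<in>Obj C. \<forall>g\<in>Arr C X A. f \<bullet>\<^bsub>C\<^esub> g = \<zero>\<^bsub>Hom C X B\<^esub> \<longrightarrow>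
        (\<exists>!h. h \<in> Arr C X K \<and> i \<bullet>\<^bsub>C\<^esub> h = g))"

definition is_cokernel :: "('o, 'm, 'k, 'z) lincat_scheme \<Rightarrow> 'o \<Rightarrow> 'o \<Rightarrow> 'm \<Rightarrow> 'o \<Rightarrow> 'm \<Rightarrow> bool" where
  "is_cokernel C A B f Q p \<longleftrightarrow> f \<in> Arr C A B \<and> Q \<in> Obj C \<and> p \<in> Arr C B Q \<and>
     p \<bullet>\<^bsub>C\<^esub> f = \<zero>\<^bsub>Hom C A Q\<^esub> \<and>
     (\<forall>X\<in>Obj C. \<forall>g\<in>Arr C B X. g \<bullet>\<^bsub>C\<^esub> f = \<zero>\<^bsub>Hom C A X\<^esub> \<longrightarrow>
        (\<exists>!h. h \<in> Arr C Q X \<and> h \<bullet>\<^bsub>C\<^esub> p = g))"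

definition short_exact :: "('o, 'm, 'k, 'z) lincat_scheme \<Rightarrow> 'o \<Rightarrow> 'o \<Rightarrow> 'o \<Rightarrow> 'm \<Rightarrow> 'm \<Rightarrow> bool" where
  "short_exact C A B D i p \<longleftrightarrow> is_kernel C B D p A i \<and> is_cokernel C A B i D p"

definition is_biproduct ::
  "('o, 'm, 'k, 'z) lincat_scheme \<Rightarrow> 'i set \<Rightarrow> ('i \<Rightarrow> 'o) \<Rightarrow> 'o \<Rightarrow> ('i \<Rightarrow> 'm) \<Rightarrow> ('i \<Rightarrow> 'm) \<Rightarrow> bool" where
  "is_biproduct C I X P \<iota> \<pi> \<longleftrightarrow> finite I \<and> P \<in> Obj C \<and>
     (\<forall>i\<in>I. X i \<in> Obj C \<and> \<iota> i \<in> Arr C (X i) P \<and> \<pi> i \<in> Arr C P (X i)) \<and>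
     (\<forall>i\<in>I. \<forall>j\<in>I. \<pi> j \<bullet>\<^bsub>C\<^esub> \<iota> i = (if i = j then Idn C (X i) else \<zero>\<^bsub>Hom C (X i) (X j)\<^esub>)) \<and>
     finsum (Hom C P P) (\<lambda>i. \<iota> i \<bullet>\<^bsub>C\<^esub> \<pi> i) I = Idn C P"

locale abelian_category = linear_category +
  assumes ex_zero_object: "\<exists>Z. zero_object C Z"
    and ex_biproduct: "\<lbrakk>A \<in> Obj C; B \<in> Obj C\<rbrakk>
          \<Longrightarrow> \<exists>P \<iota> \<pi>. is_biproduct C (UNIV :: bool set) (\<lambda>b. if b then A else B) P \<iota> \<pi>"
    and ex_kernel: "\<lbrakk>A \<in> Obj C; B \<in> Obj C; f \<in> Arr C A B\<rbrakk> \<Longrightarrow> \<exists>K i. is_kernel C A B f K i"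
    and ex_cokernel: "\<lbrakk>A \<in> Obj C; B \<in> Obj C; f \<in> Arr C A B\<rbrakk> \<Longrightarrow> \<exists>Q p. is_cokernel C A B f Q p"
    and mono_is_kernel: "\<lbrakk>A \<in> Obj C; B \<in> Obj C; is_mono C A B f\<rbrakk>
          \<Longrightarrow> \<exists>D\<in>Obj C. \<exists>g. is_kernel C B D g A f"
    and epi_is_cokernel: "\<lbrakk>A \<in> Obj C; B \<in> Obj C; is_epi C A B f\<rbrakk>
          \<Longrightarrow> \<exists>D\<in>Obj C. \<exists>g. is_cokernel C D A g B f"

definition simple_object :: "('o, 'm, 'k, 'z) lincat_scheme \<Rightarrow> 'o \<Rightarrow> bool" where
  "simple_object C S \<longleftrightarrow> S \<in> Obj C \<and> \<not> zero_object C S \<and>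
     (\<forall>X\<in>Obj C. \<forall>i. is_mono C X S i \<longrightarrow> zero_object C X \<or> is_iso C X S i)"

locale semisimple_category = abelian_category +
  assumes semisimple: "A \<in> Obj C \<Longrightarrow> \<exists>(n::nat) S \<iota> \<pi>.
    (\<forall>i<n. simple_object C (S i)) \<and> is_biproduct C {..<n} S A \<iota> \<pi>"


section \<open>Fusion categories\<close>

text \<open>
  \<open>Assoc A B D\<close> goes from \<open>(A \<boxtimes> B) \<boxtimes> D\<close> to \<open>A \<boxtimes> (B \<boxtimes> D)\<close>, \<open>LUnit A\<close> from \<open>Unit \<boxtimes> A\<close>
  to \<open>A\<close> and \<open>RUnit A\<close> from \<open>A \<boxtimes> Unit\<close> to \<open>A\<close>.
\<close>

record ('o, 'm, 'k) moncat = "('o, 'm, 'k) lincat" +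
  TensO :: "'o \<Rightarrow> 'o \<Rightarrow> 'o"  (infixr "\<boxtimes>\<index>" 76)
  TensA :: "'m \<Rightarrow> 'm \<Rightarrow> 'm"  (infixr "\<boxdot>\<index>" 76)
  Unit :: 'o
  Assoc :: "'o \<Rightarrow> 'o \<Rightarrow> 'o \<Rightarrow> 'm"
  LUnit :: "'o \<Rightarrow> 'm"
  RUnit :: "'o \<Rightarrow> 'm"

locale linear_monoidal_category = linear_category C
  for C :: "('o, 'm, 'k::field, 'z) moncat_scheme" (structure) +
  assumes TensO_closed: "\<lbrakk>A \<in> Obj C; B \<in> Obj C\<rbrakk> \<Longrightarrow> A \<boxtimes> B \<in> Obj C"
    and TensA_closed: "\<lbrakk>A \<in> Obj C; B \<in> Obj C; A' \<in> Obj C; B' \<in> Obj C;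
            f \<in> Arr C A A'; g \<in> Arr C B B'\<rbrakk> \<Longrightarrow> f \<boxdot> g \<in> Arr C (A \<boxtimes> B) (A' \<boxtimes> B')"
    and TensA_Idn: "\<lbrakk>A \<in> Obj C; B \<in> Obj C\<rbrakk> \<Longrightarrow> Idn C A \<boxdot> Idn C B = Idn C (A \<boxtimes> B)"
    and TensA_Comp: "\<lbrakk>A \<in> Obj C; A' \<in> Obj C; A'' \<in> Obj C; B \<in> Obj C; B' \<in> Obj C; B'' \<in> Obj C;
            f \<in> Arr C A A'; f' \<in> Arr C A' A''; g \<in> Arr C B B'; g' \<in> Arr C B' B''\<rbrakk>
          \<Longrightarrow> (f' \<bullet> f) \<boxdot> (g' \<bullet> g) = (f' \<boxdot> g') \<bullet> (f \<boxdot> g)"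
    and TensA_add_left: "\<lbrakk>A \<in> Obj C; B \<in> Obj C; A' \<in> Obj C; B' \<in> Obj C;
            f \<in> Arr C A A'; f' \<in> Arr C A A'; g \<in> Arr C B B'\<rbrakk>
          \<Longrightarrow> (f \<oplus>\<^bsub>Hom C A A'\<^esub> f') \<boxdot> g = (f \<boxdot> g) \<oplus>\<^bsub>Hom C (A \<boxtimes> B) (A' \<boxtimes> B')\<^esub> (f' \<boxdot> g)"
    and TensA_add_right: "\<lbrakk>A \<in> Obj C; B \<in> Obj C; A' \<in> Obj C; B' \<in> Obj C;
            f \<in> Arr C A A'; g \<in> Arr C B B'; g' \<in> Arr C B B'\<rbrakk>
          \<Longrightarrow> f \<boxdot> (g \<oplus>\<^bsub>Hom C B B'\<^esub> g') = (f \<boxdot> g) \<oplus>\<^bsub>Hom C (A \<boxtimes> B) (A' \<boxtimes> B')\<^esub> (f \<boxdot> g')"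
    and TensA_smult_left: "\<lbrakk>A \<in> Obj C; B \<in> Obj C; A' \<in> Obj C; B' \<in> Obj C;
            f \<in> Arr C A A'; g \<in> Arr C B B'\<rbrakk>
          \<Longrightarrow> (r \<odot>\<^bsub>Hom C A A'\<^esub> f) \<boxdot> g = r \<odot>\<^bsub>Hom C (A \<boxtimes> B) (A' \<boxtimes> B')\<^esub> (f \<boxdot> g)"
    and TensA_smult_right: "\<lbrakk>A \<in> Obj C; B \<in> Obj C; A' \<in> Obj C; B' \<in> Obj C;
            f \<in> Arr C A A'; g \<in> Arr C B B'\<rbrakk>
          \<Longrightarrow> f \<boxdot> (r \<odot>\<^bsub>Hom C B B'\<^esub> g) = r \<odot>\<^bsub>Hom C (A \<boxtimes> B) (A' \<boxtimes> B')\<^esub> (f \<boxdot> g)"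
    and Unit_closed: "Unit C \<in> Obj C"
    and Assoc_iso: "\<lbrakk>A \<in> Obj C; B \<in> Obj C; D \<in> Obj C\<rbrakk>
          \<Longrightarrow> is_iso C ((A \<boxtimes> B) \<boxtimes> D) (A \<boxtimes> (B \<boxtimes> D)) (Assoc C A B D)"
    and Assoc_natural: "\<lbrakk>A \<in> Obj C; B \<in> Obj C; D \<in> Obj C; A' \<in> Obj C; B' \<in> Obj C; D' \<in> Obj C;
            f \<in> Arr C A A'; g \<in> Arr C B B'; h \<in> Arr C D D'\<rbrakk>
          \<Longrightarrow> Assoc C A' B' D' \<bullet> ((f \<boxdot> g) \<boxdot> h) = (f \<boxdot> (g \<boxdot> h)) \<bullet> Assoc C A B D"
    and LUnit_iso: "A \<in> Obj C \<Longrightarrow> is_iso C (Unit C \<boxtimes> A) A (LUnit C A)"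
    and LUnit_natural: "\<lbrakk>A \<in> Obj C; B \<in> Obj C; f \<in> Arr C A B\<rbrakk>
          \<Longrightarrow> LUnit C B \<bullet> (Idn C (Unit C) \<boxdot> f) = f \<bullet> LUnit C A"
    and RUnit_iso: "A \<in> Obj C \<Longrightarrow> is_iso C (A \<boxtimes> Unit C) A (RUnit C A)"
    and RUnit_natural: "\<lbrakk>A \<in> Obj C; B \<in> Obj C; f \<in> Arr C A B\<rbrakk>
          \<Longrightarrow> RUnit C B \<bullet> (f \<boxdot> Idn C (Unit C)) = f \<bullet> RUnit C A"
    and pentagon: "\<lbrakk>A \<in> Obj C; B \<in> Obj C; D \<in> Obj C; E \<in> Obj C\<rbrakk>
          \<Longrightarrow> (Idn C A \<boxdot> Assoc C B D E) \<bullet> Assoc C A (B \<boxtimes> D) E \<bullet> (Assoc C A B D \<boxdot> Idn C E)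
            = Assoc C A B (D \<boxtimes> E) \<bullet> Assoc C (A \<boxtimes> B) D E"
    and triangle: "\<lbrakk>A \<in> Obj C; B \<in> Obj C\<rbrakk>
          \<Longrightarrow> (Idn C A \<boxdot> LUnit C B) \<bullet> Assoc C A (Unit C) B = RUnit C A \<boxdot> Idn C B"

text \<open>\<open>D\<close> is a left dual of \<open>A\<close>, equivalently \<open>A\<close> is a right dual of \<open>D\<close>.\<close>

definition is_left_dual :: "('o, 'm, 'k, 'z) moncat_scheme \<Rightarrow> 'o \<Rightarrow> 'o \<Rightarrow> 'm \<Rightarrow> 'm \<Rightarrow> bool" where
  "is_left_dual C A D ev coev \<longleftrightarrow> A \<in> Obj C \<and> D \<in> Obj C \<and>
     ev \<in> Arr C (D \<boxtimes>\<^bsub>C\<^esub> A) (Unit C) \<and> coev \<in> Arr C (Unit C) (A \<boxtimes>\<^bsub>C\<^esub> D) \<and>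
     RUnit C A \<bullet>\<^bsub>C\<^esub> (Idn C A \<boxdot>\<^bsub>C\<^esub> ev) \<bullet>\<^bsub>C\<^esub> Assoc C A D A \<bullet>\<^bsub>C\<^esub> (coev \<boxdot>\<^bsub>C\<^esub> Idn C A) = LUnit C A \<and>
     LUnit C D \<bullet>\<^bsub>C\<^esub> (ev \<boxdot>\<^bsub>C\<^esub> Idn C D)
       \<bullet>\<^bsub>C\<^esub> inv_arr C ((D \<boxtimes>\<^bsub>C\<^esub> A) \<boxtimes>\<^bsub>C\<^esub> D) (D \<boxtimes>\<^bsub>C\<^esub> (A \<boxtimes>\<^bsub>C\<^esub> D)) (Assoc C D A D)
       \<bullet>\<^bsub>C\<^esub> (Idn C D \<boxdot>\<^bsub>C\<^esub> coev) = RUnit C D"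

locale fusion_category = linear_monoidal_category C + semisimple_category C
  for C :: "('o, 'm, 'k::field, 'z) moncat_scheme" (structure) +
  assumes finite_dim_Hom: "\<lbrakk>A \<in> Obj C; B \<in> Obj C\<rbrakk> \<Longrightarrow> \<exists>E. finite E \<and> E \<subseteq> Arr C A B \<and>
            (\<forall>f\<in>Arr C A B. \<exists>r. f = finsum (Hom C A B) (\<lambda>e. r e \<odot>\<^bsub>Hom C A B\<^esub> e) E)"
    and finitely_many_simples: "\<exists>S. finite S \<and>
            (\<forall>A. simple_object C A \<longrightarrow> (\<exists>B\<in>S. B \<in> Obj C \<and> (\<exists>f. is_iso C A B f)))"
    and simple_Unit: "simple_object C (Unit C)"
    and ex_left_dual: "A \<in> Obj C \<Longrightarrow> \<exists>D ev coev. is_left_dual C A D ev coev"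
    and ex_right_dual: "A \<in> Obj C \<Longrightarrow> \<exists>D ev coev. is_left_dual C D A ev coev"

text \<open>
  \<open>Cg g\<close> is the set of objects of the full subcategory \<open>C\<^sub>g\<close>, which need not be closed under
  isomorphism. Since the subcategories are full and orthogonal, \<open>grading_decomp\<close> says that the
  category is their direct sum.
\<close>

abbreviation full_subcategory :: "('o, 'm, 'k, 'z) lincat_scheme \<Rightarrow> 'o set \<Rightarrow> ('o, 'm, 'k, 'z) lincat_scheme" where
  "full_subcategory C D \<equiv> C\<lparr>Obj := D\<rparr>"

locale graded_fusion_category = fusion_category C + G: group G
  for C :: "('o, 'm, 'k::field, 'z) moncat_scheme" (structure)
    and G :: "('g, 'y) monoid_scheme" and Cg :: "'g \<Rightarrow> 'o set" +
  assumes Cg_subset: "g \<in> carrier G \<Longrightarrow> Cg g \<subseteq> Obj C"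
    and Cg_abelian: "g \<in> carrier G \<Longrightarrow> abelian_category (full_subcategory C (Cg g))"
    and Cg_orthogonal: "\<lbrakk>g \<in> carrier G; h \<in> carrier G; g \<noteq> h; A \<in> Cg g; B \<in> Cg h\<rbrakk>
          \<Longrightarrow> Arr C A B = {\<zero>\<^bsub>Hom C A B\<^esub>}"
    and grading_decomp: "A \<in> Obj C \<Longrightarrow> \<exists>X \<iota> \<pi>. (\<forall>g\<in>carrier G. X g \<in> Cg g) \<and>
          is_biproduct C (carrier G) X A \<iota> \<pi>"
    and Cg_TensO: "\<lbrakk>g \<in> carrier G; h \<in> carrier G; A \<in> Cg g; B \<in> Cg h\<rbrakk>
          \<Longrightarrow> A \<boxtimes> B \<in> Cg (g \<otimes>\<^bsub>G\<^esub> h)"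


section \<open>Coherent actions\<close>

locale linear_endofunctor = linear_category C
  for C :: "('o, 'm, 'k::field, 'z) lincat_scheme" (structure)
    and TO :: "'o \<Rightarrow> 'o" and TA :: "'m \<Rightarrow> 'm" +
  assumes TO_closed: "A \<in> Obj C \<Longrightarrow> TO A \<in> Obj C"
    and TA_closed: "\<lbrakk>A \<in> Obj C; B \<in> Obj C; f \<in> Arr C A B\<rbrakk> \<Longrightarrow> TA f \<in> Arr C (TO A) (TO B)"
    and TA_Idn: "A \<in> Obj C \<Longrightarrow> TA (Idn C A) = Idn C (TO A)"
    and TA_Comp: "\<lbrakk>A \<in> Obj C; B \<in> Obj C; D \<in> Obj C; f \<in> Arr C A B; g \<in> Arr C B D\<rbrakk>
          \<Longrightarrow> TA (g \<bullet> f) = TA g \<bullet> TA f"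
    and TA_add: "\<lbrakk>A \<in> Obj C; B \<in> Obj C; f \<in> Arr C A B; g \<in> Arr C A B\<rbrakk>
          \<Longrightarrow> TA (f \<oplus>\<^bsub>Hom C A B\<^esub> g) = TA f \<oplus>\<^bsub>Hom C (TO A) (TO B)\<^esub> TA g"
    and TA_smult: "\<lbrakk>A \<in> Obj C; B \<in> Obj C; f \<in> Arr C A B\<rbrakk>
          \<Longrightarrow> TA (r \<odot>\<^bsub>Hom C A B\<^esub> f) = r \<odot>\<^bsub>Hom C (TO A) (TO B)\<^esub> TA f"

definition natural_iso ::
  "('o, 'm, 'k, 'z) lincat_scheme \<Rightarrow> ('o \<Rightarrow> 'o) \<Rightarrow> ('m \<Rightarrow> 'm) \<Rightarrow> ('o \<Rightarrow> 'o) \<Rightarrow> ('m \<Rightarrow> 'm) \<Rightarrow> ('o \<Rightarrow> 'm) \<Rightarrow> bool" where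
  "natural_iso C SO SA TO TA \<eta> \<longleftrightarrow>
     (\<forall>A\<in>Obj C. is_iso C (SO A) (TO A) (\<eta> A)) \<and>
     (\<forall>A\<in>Obj C. \<forall>B\<in>Obj C. \<forall>f\<in>Arr C A B. TA f \<bullet>\<^bsub>C\<^esub> \<eta> A = \<eta> B \<bullet>\<^bsub>C\<^esub> SA f)"

locale linear_autoequivalence = linear_endofunctor C TO TA
  for C :: "('o, 'm, 'k::field, 'z) lincat_scheme" (structure)
    and TO :: "'o \<Rightarrow> 'o" and TA :: "'m \<Rightarrow> 'm" +
  assumes ex_quasi_inverse: "\<exists>SO SA \<eta> \<theta>. linear_endofunctor C SO SA \<and>
     natural_iso C (\<lambda>A. A) (\<lambda>f. f) (\<lambda>A. SO (TO A)) (\<lambda>f. SA (TA f)) \<eta> \<and>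
     natural_iso C (\<lambda>A. TO (SO A)) (\<lambda>f. TA (SA f)) (\<lambda>A. A) (\<lambda>f. f) \<theta>"

text \<open>
  \<open>J A B : T (A \<boxtimes> B) \<rightarrow> T A \<boxtimes> T B\<close> and \<open>e : T Unit \<rightarrow> Unit\<close>. For an autoequivalence the unit
  isomorphism \<open>e\<close> exists and is uniquely determined by \<open>J\<close>; it is kept as a component because it
  is the equivariant structure of the unit object of the equivariantization.
\<close>

locale tensor_autoequivalence =
  linear_monoidal_category C + linear_autoequivalence C TO TA
  for C :: "('o, 'm, 'k::field, 'z) moncat_scheme" (structure)
    and TO :: "'o \<Rightarrow> 'o" and TA :: "'m \<Rightarrow> 'm" and J :: "'o \<Rightarrow> 'o \<Rightarrow> 'm" and e :: 'm +
  assumes J_iso: "\<lbrakk>A \<in> Obj C; B \<in> Obj C\<rbrakk> \<Longrightarrow> is_iso C (TO (A \<boxtimes> B)) (TO A \<boxtimes> TO B) (J A B)"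
    and J_natural: "\<lbrakk>A \<in> Obj C; B \<in> Obj C; A' \<in> Obj C; B' \<in> Obj C;
            f \<in> Arr C A A'; g \<in> Arr C B B'\<rbrakk>
          \<Longrightarrow> (TA f \<boxdot> TA g) \<bullet> J A B = J A' B' \<bullet> TA (f \<boxdot> g)"
    and J_assoc: "\<lbrakk>A \<in> Obj C; B \<in> Obj C; D \<in> Obj C\<rbrakk>
          \<Longrightarrow> Assoc C (TO A) (TO B) (TO D) \<bullet> (J A B \<boxdot> Idn C (TO D)) \<bullet> J (A \<boxtimes> B) D
            = (Idn C (TO A) \<boxdot> J B D) \<bullet> J A (B \<boxtimes> D) \<bullet> TA (Assoc C A B D)"
    and e_iso: "is_iso C (TO (Unit C)) (Unit C) e"
    and J_LUnit: "A \<in> Obj C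
          \<Longrightarrow> LUnit C (TO A) \<bullet> (e \<boxdot> Idn C (TO A)) \<bullet> J (Unit C) A = TA (LUnit C A)"
    and J_RUnit: "A \<in> Obj C
          \<Longrightarrow> RUnit C (TO A) \<bullet> (Idn C (TO A) \<boxdot> e) \<bullet> J A (Unit C) = TA (RUnit C A)"

text \<open>
  For \<open>x, y\<close> in the acting group: \<open>ActO T x\<close> and \<open>ActA T x\<close> are the functor \<open>T\<^sup>x\<close> on objects and
  morphisms, \<open>ActTens T x M N : T\<^sup>x (M \<boxtimes> N) \<rightarrow> T\<^sup>x M \<boxtimes> T\<^sup>x N\<close>, \<open>ActUnit T x : T\<^sup>x Unit \<rightarrow> Unit\<close> and
  \<open>ActComp T x y M : T\<^sup>x (T\<^sup>y M) \<rightarrow> T\<^sup>x\<^sup>y M\<close>.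
\<close>

record ('f, 'o, 'm) action_data =
  ActO :: "'f \<Rightarrow> 'o \<Rightarrow> 'o"
  ActA :: "'f \<Rightarrow> 'm \<Rightarrow> 'm"
  ActTens :: "'f \<Rightarrow> 'o \<Rightarrow> 'o \<Rightarrow> 'm"
  ActUnit :: "'f \<Rightarrow> 'm"
  ActComp :: "'f \<Rightarrow> 'f \<Rightarrow> 'o \<Rightarrow> 'm"

text \<open>
  \<open>ActComp_tensor\<close> and \<open>ActComp_unit\<close> say that \<open>ActComp T x y\<close> is an isomorphism of tensor
  functors from the composite of \<open>T\<^sup>x\<close> and \<open>T\<^sup>y\<close>, with its composite tensor structure, to \<open>T\<^sup>x\<^sup>y\<close>.
\<close>

locale tensor_action = linear_monoidal_category C + F: group F
  for C :: "('o, 'm, 'k::field, 'z) moncat_scheme" (structure)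
    and F :: "('f, 'x) monoid_scheme"
    and T :: "('f, 'o, 'm) action_data" +
  assumes Act_tensor_autoequivalence: "x \<in> carrier F
          \<Longrightarrow> tensor_autoequivalence C (ActO T x) (ActA T x) (ActTens T x) (ActUnit T x)"
    and ActComp_natural_iso: "\<lbrakk>x \<in> carrier F; y \<in> carrier F\<rbrakk>
          \<Longrightarrow> natural_iso C (\<lambda>M. ActO T x (ActO T y M)) (\<lambda>f. ActA T x (ActA T y f))
                (ActO T (x \<otimes>\<^bsub>F\<^esub> y)) (ActA T (x \<otimes>\<^bsub>F\<^esub> y)) (ActComp T x y)"
    and ActComp_tensor: "\<lbrakk>x \<in> carrier F; y \<in> carrier F; M \<in> Obj C; N \<in> Obj C\<rbrakk>
          \<Longrightarrow> (ActComp T x y M \<boxdot> ActComp T x y N)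
                \<bullet> ActTens T x (ActO T y M) (ActO T y N) \<bullet> ActA T x (ActTens T y M N)
            = ActTens T (x \<otimes>\<^bsub>F\<^esub> y) M N \<bullet> ActComp T x y (M \<boxtimes> N)"
    and ActComp_unit: "\<lbrakk>x \<in> carrier F; y \<in> carrier F\<rbrakk>
          \<Longrightarrow> ActUnit T (x \<otimes>\<^bsub>F\<^esub> y) \<bullet> ActComp T x y (Unit C)
            = ActUnit T x \<bullet> ActA T x (ActUnit T y)"
    and ActComp_cocycle: "\<lbrakk>x \<in> carrier F; y \<in> carrier F; z \<in> carrier F; M \<in> Obj C\<rbrakk>
          \<Longrightarrow> ActComp T (x \<otimes>\<^bsub>F\<^esub> y) z M \<bullet> ActComp T x y (ActO T z M)
            = ActComp T x (y \<otimes>\<^bsub>F\<^esub> z) M \<bullet> ActA T x (ActComp T y z M)"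
    and ActO_one: "M \<in> Obj C \<Longrightarrow> ActO T \<one>\<^bsub>F\<^esub> M = M"
    and ActA_one: "\<lbrakk>M \<in> Obj C; N \<in> Obj C; f \<in> Arr C M N\<rbrakk> \<Longrightarrow> ActA T \<one>\<^bsub>F\<^esub> f = f"
    and ActComp_one_right: "\<lbrakk>x \<in> carrier F; M \<in> Obj C\<rbrakk>
          \<Longrightarrow> ActComp T x \<one>\<^bsub>F\<^esub> M = Idn C (ActO T x M)"
    and ActComp_one_left: "\<lbrakk>x \<in> carrier F; M \<in> Obj C\<rbrakk>
          \<Longrightarrow> ActComp T \<one>\<^bsub>F\<^esub> x M = Idn C (ActO T x M)"

text \<open>\<open>\<rho> x g\<close> is \<open>\<^sup>xg\<close>.\<close>

locale coherent_action =
  graded_fusion_category C G Cg + tensor_action C F T + group_hom F "AutoGroup G" \<rho>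
  for C :: "('o, 'm, 'k::field, 'z) moncat_scheme" (structure)
    and F :: "('f, 'x) monoid_scheme" and G :: "('g, 'y) monoid_scheme"
    and \<rho> :: "'f \<Rightarrow> 'g \<Rightarrow> 'g" and Cg :: "'g \<Rightarrow> 'o set"
    and T :: "('f, 'o, 'm) action_data" +
  assumes finite_F: "finite (carrier F)"
    and finite_G: "finite (carrier G)"
    and Act_Cg: "\<lbrakk>x \<in> carrier F; g \<in> carrier G; M \<in> Cg g\<rbrakk> \<Longrightarrow> ActO T x M \<in> Cg (\<rho> x g)"


section \<open>Equivariantization, restriction, induction\<close>

text \<open>
  \<open>equivariantization C F T D H\<close> is \<open>D\<^sup>H\<close>. Its monoidal structure is meaningful if \<open>D\<close> is closed
  under tensor products and contains the unit object; \<open>TensO\<close> does not depend on \<open>D\<close>.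
\<close>

definition equivariant_objects ::
  "('o, 'm, 'k) moncat \<Rightarrow> ('f, 'x) monoid_scheme \<Rightarrow> ('f, 'o, 'm) action_data \<Rightarrow> 'o set \<Rightarrow> 'f set
    \<Rightarrow> ('o \<times> ('f \<Rightarrow> 'm)) set" where
  "equivariant_objects C F T D H = {(M, \<mu>). M \<in> D \<and> \<mu> \<in> extensional H \<and>
     (\<forall>h\<in>H. is_iso C (ActO T h M) M (\<mu> h)) \<and>
     (\<forall>h\<in>H. \<forall>h'\<in>H. \<mu> h \<bullet>\<^bsub>C\<^esub> ActA T h (\<mu> h') = \<mu> (h \<otimes>\<^bsub>F\<^esub> h') \<bullet>\<^bsub>C\<^esub> ActComp T h h' M) \<and>
     \<mu> \<one>\<^bsub>F\<^esub> = Idn C M}"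

definition equivariantization ::
  "('o, 'm, 'k) moncat \<Rightarrow> ('f, 'x) monoid_scheme \<Rightarrow> ('f, 'o, 'm) action_data \<Rightarrow> 'o set \<Rightarrow> 'f set
    \<Rightarrow> ('o \<times> ('f \<Rightarrow> 'm), 'm, 'k) moncat" where
  "equivariantization C F T D H =
     \<lparr>Obj = equivariant_objects C F T D H,
      Hom = (\<lambda>(M, \<mu>) (N, \<nu>). (Hom C M N)
               \<lparr>carrier := {f \<in> Arr C M N. \<forall>h\<in>H. f \<bullet>\<^bsub>C\<^esub> \<mu> h = \<nu> h \<bullet>\<^bsub>C\<^esub> ActA T h f}\<rparr>),
      Comp = Comp C,
      Idn = (\<lambda>(M, \<mu>). Idn C M),
      TensO = (\<lambda>(M, \<mu>) (N, \<nu>). (M \<boxtimes>\<^bsub>C\<^esub> N, \<lambda>h\<in>H. (\<mu> h \<boxdot>\<^bsub>C\<^esub> \<nu> h) \<bullet>\<^bsub>C\<^esub> ActTens T h M N)),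
      TensA = TensA C,
      Unit = (Unit C, \<lambda>h\<in>H. ActUnit T h),
      Assoc = (\<lambda>(M, \<mu>) (N, \<nu>) (P, \<pi>). Assoc C M N P),
      LUnit = (\<lambda>(M, \<mu>). LUnit C M),
      RUnit = (\<lambda>(M, \<mu>). RUnit C M)\<rparr>"

definition Res :: "'f set \<Rightarrow> 'o \<times> ('f \<Rightarrow> 'm) \<Rightarrow> 'o \<times> ('f \<Rightarrow> 'm)" where
  "Res B X = (fst X, restrict (snd X) B)"

definition conj_object ::
  "('o, 'm, 'k) moncat \<Rightarrow> ('f, 'x) monoid_scheme \<Rightarrow> ('f, 'o, 'm) action_data \<Rightarrow> 'f set \<Rightarrow> 'f
    \<Rightarrow> 'o \<times> ('f \<Rightarrow> 'm) \<Rightarrow> 'o \<times> ('f \<Rightarrow> 'm)" where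
  "conj_object C F T H x = (\<lambda>(V, \<mu>). (ActO T x V,
     \<lambda>y \<in> (\<lambda>h. x \<otimes>\<^bsub>F\<^esub> h \<otimes>\<^bsub>F\<^esub> inv\<^bsub>F\<^esub> x) ` H.
       (let h = inv\<^bsub>F\<^esub> x \<otimes>\<^bsub>F\<^esub> y \<otimes>\<^bsub>F\<^esub> x in
         ActA T x (\<mu> h)
         \<bullet>\<^bsub>C\<^esub> inv_arr C (ActO T x (ActO T h V)) (ActO T (x \<otimes>\<^bsub>F\<^esub> h) V) (ActComp T x h V)
         \<bullet>\<^bsub>C\<^esub> ActComp T y x V)))"

definition left_transversal :: "('f, 'x) monoid_scheme \<Rightarrow> 'f set \<Rightarrow> 'f set \<Rightarrow> 'f set \<Rightarrow> bool" where
  "left_transversal F A B R \<longleftrightarrow> R \<subseteq> A \<and> (\<forall>a\<in>A. \<exists>!t. t \<in> R \<and> (\<exists>b\<in>B. a = t \<otimes>\<^bsub>F\<^esub> b))"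

definition transversal_choice :: "('f, 'x) monoid_scheme \<Rightarrow> ('f set \<Rightarrow> 'f set \<Rightarrow> 'f set) \<Rightarrow> bool" where
  "transversal_choice F tr \<longleftrightarrow>
     (\<forall>A B. subgroup A F \<and> subgroup B F \<and> B \<subseteq> A \<longrightarrow> left_transversal F A B (tr A B))"

text \<open>
  The direct sum in the definition of an induced object is a chosen biproduct, so induction is
  first described as a relation: \<open>(W, \<nu>)\<close> in \<open>D\<^sup>A\<close> is induced from \<open>(V, \<mu>)\<close> along the transversal
  \<open>R\<close> of \<open>A / B\<close>. The last clause describes \<open>\<nu> a\<close> on the summand \<open>T\<^sup>a (T\<^sup>t V)\<close> of \<open>T\<^sup>a W\<close>.
\<close>

definition is_induced ::
  "('o, 'm, 'k) moncat \<Rightarrow> ('f, 'x) monoid_scheme \<Rightarrow> ('f, 'o, 'm) action_data \<Rightarrow> 'o set \<Rightarrow> 'f set \<Rightarrow> 'f set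
    \<Rightarrow> 'f set \<Rightarrow> 'o \<times> ('f \<Rightarrow> 'm) \<Rightarrow> 'o \<times> ('f \<Rightarrow> 'm) \<Rightarrow> bool" where
  "is_induced C F T D A B R = (\<lambda>(V, \<mu>) (W, \<nu>). (W, \<nu>) \<in> equivariant_objects C F T D A \<and>
     (\<exists>\<iota> \<pi>. is_biproduct C R (\<lambda>t. ActO T t V) W \<iota> \<pi> \<and>
        (\<forall>a\<in>A. \<forall>t\<in>R. \<forall>s\<in>R. \<forall>b\<in>B. a \<otimes>\<^bsub>F\<^esub> t = s \<otimes>\<^bsub>F\<^esub> b \<longrightarrow>
           \<nu> a \<bullet>\<^bsub>C\<^esub> ActA T a (\<iota> t) =
           \<iota> s \<bullet>\<^bsub>C\<^esub> ActA T s (\<mu> b)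
             \<bullet>\<^bsub>C\<^esub> inv_arr C (ActO T s (ActO T b V)) (ActO T (s \<otimes>\<^bsub>F\<^esub> b) V) (ActComp T s b V)
             \<bullet>\<^bsub>C\<^esub> ActComp T a t V)))"

definition Ind ::
  "('o, 'm, 'k) moncat \<Rightarrow> ('f, 'x) monoid_scheme \<Rightarrow> ('f, 'o, 'm) action_data \<Rightarrow> 'o set \<Rightarrow> 'f set \<Rightarrow> 'f set
    \<Rightarrow> 'f set \<Rightarrow> 'o \<times> ('f \<Rightarrow> 'm) \<Rightarrow> 'o \<times> ('f \<Rightarrow> 'm)" where
  "Ind C F T D A B R X = (SOME Y. is_induced C F T D A B R X Y)"


section \<open>Grothendieck groups and rings\<close>

text \<open>
  \<open>K0 C\<close> is the Grothendieck group with coefficients in a commutative ring: the free module on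
  the objects modulo the relations \<open>[B] = [A] + [D]\<close> for all short exact sequences
  \<open>0 \<rightarrow> A \<rightarrow> B \<rightarrow> D \<rightarrow> 0\<close>. With integer coefficients this is the Grothendieck group itself, with
  coefficients in a field its extension of scalars to a vector space. The \<open>mult\<close> and \<open>one\<close>
  fields of \<open>K0 C\<close> are not used; \<open>K0_ring\<close> fills them in for a monoidal category.
\<close>

definition free_module :: "'o set \<Rightarrow> ('r::comm_ring_1, 'o \<Rightarrow>\<^sub>0 'r) module" where
  "free_module S = \<lparr>carrier = {x. Poly_Mapping.keys x \<subseteq> S}, mult = undefined, one = undefined,
     zero = 0, add = (+), smult = (\<lambda>r. Poly_Mapping.map ((*) r))\<rparr>"

definition K0_relations :: "('o, 'm, 'k, 'z) lincat_scheme \<Rightarrow> ('o \<Rightarrow>\<^sub>0 'r::comm_ring_1) set" where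
  "K0_relations C =
     {Poly_Mapping.single B 1 - Poly_Mapping.single A 1 - Poly_Mapping.single D 1 | A B D.
        A \<in> Obj C \<and> B \<in> Obj C \<and> D \<in> Obj C \<and> (\<exists>i p. short_exact C A B D i p)}"

definition K0_null :: "('o, 'm, 'k, 'z) lincat_scheme \<Rightarrow> ('o \<Rightarrow>\<^sub>0 'r::comm_ring_1) set" where
  "K0_null C = \<Inter>{N. submodule N scalars (free_module (Obj C)) \<and> K0_relations C \<subseteq> N}"

definition K0_coset :: "('o, 'm, 'k, 'z) lincat_scheme \<Rightarrow> ('o \<Rightarrow>\<^sub>0 'r::comm_ring_1) \<Rightarrow> ('o \<Rightarrow>\<^sub>0 'r) set" where
  "K0_coset C x = K0_null C +>\<^bsub>free_module (Obj C)\<^esub> x"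

definition K0 :: "('o, 'm, 'k, 'z) lincat_scheme \<Rightarrow> ('r::comm_ring_1, ('o \<Rightarrow>\<^sub>0 'r) set) module" where
  "K0 C = \<lparr>carrier = a_rcosets\<^bsub>free_module (Obj C)\<^esub> (K0_null C), mult = undefined, one = undefined,
     zero = K0_null C, add = set_add (free_module (Obj C)),
     smult = (\<lambda>r X. \<Union>x\<in>X. K0_coset C (r \<odot>\<^bsub>free_module (Obj C)\<^esub> x))\<rparr>"

definition K0_class :: "('o, 'm, 'k, 'z) lincat_scheme \<Rightarrow> 'o \<Rightarrow> ('o \<Rightarrow>\<^sub>0 'r::comm_ring_1) set" where
  "K0_class C M = K0_coset C (Poly_Mapping.single M 1)"

text \<open>
  \<open>K0_map E f\<close> and \<open>K0_map2 E f\<close> are the maps into \<open>K0 E\<close> induced by the (bi)linear extension of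
  a map \<open>f\<close> on objects. They are well defined if \<open>f\<close> respects the relations in each argument.
\<close>

definition K0_map ::
  "('p, 'n, 'k, 'z) lincat_scheme \<Rightarrow> ('o \<Rightarrow> 'p) \<Rightarrow> ('o \<Rightarrow>\<^sub>0 'r::comm_ring_1) set \<Rightarrow> ('p \<Rightarrow>\<^sub>0 'r) set" where
  "K0_map E f X = (\<Union>x\<in>X. K0_coset E
     (\<Sum>M\<in>Poly_Mapping.keys x. Poly_Mapping.single (f M) (Poly_Mapping.lookup x M)))"

definition K0_map2 ::
  "('p, 'n, 'k, 'z) lincat_scheme \<Rightarrow> ('o \<Rightarrow> 'q \<Rightarrow> 'p)
    \<Rightarrow> ('o \<Rightarrow>\<^sub>0 'r::comm_ring_1) set \<Rightarrow> ('q \<Rightarrow>\<^sub>0 'r) set \<Rightarrow> ('p \<Rightarrow>\<^sub>0 'r) set" where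
  "K0_map2 E f X Y = (\<Union>x\<in>X. \<Union>y\<in>Y. K0_coset E
     (\<Sum>M\<in>Poly_Mapping.keys x. \<Sum>N\<in>Poly_Mapping.keys y.
        Poly_Mapping.single (f M N) (Poly_Mapping.lookup x M * Poly_Mapping.lookup y N)))"

definition K0_ring ::
  "('o, 'm, 'k, 'z) moncat_scheme \<Rightarrow> ('r::comm_ring_1, ('o \<Rightarrow>\<^sub>0 'r) set) module" where
  "K0_ring C = (K0 C)\<lparr>mult := K0_map2 C (TensO C), one := K0_class C (Unit C)\<rparr>"


section \<open>The multiplicative structure on the invariants of a graded module\<close>

definition linear_map_on :: "('r, 'a, 'z) module_scheme \<Rightarrow> ('r, 'b, 'y) module_scheme \<Rightarrow> ('a \<Rightarrow> 'b) \<Rightarrow> bool" where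
  "linear_map_on A B f \<longleftrightarrow> f \<in> carrier A \<rightarrow> carrier B \<and>
     (\<forall>a\<in>carrier A. \<forall>b\<in>carrier A. f (a \<oplus>\<^bsub>A\<^esub> b) = f a \<oplus>\<^bsub>B\<^esub> f b) \<and>
     (\<forall>r. \<forall>a\<in>carrier A. f (r \<odot>\<^bsub>A\<^esub> a) = r \<odot>\<^bsub>B\<^esub> f a)"

definition graded_space :: "('g, 'y) monoid_scheme \<Rightarrow> ('g \<Rightarrow> ('r, 'a) module) \<Rightarrow> ('g \<Rightarrow> 'a) set" where
  "graded_space G A = (\<Pi>\<^sub>E g\<in>carrier G. carrier (A g))"

definition total_map ::
  "('f, 'x) monoid_scheme \<Rightarrow> ('g, 'y) monoid_scheme \<Rightarrow> ('f \<Rightarrow> 'g \<Rightarrow> 'g) \<Rightarrow> ('f \<Rightarrow> 'g \<Rightarrow> 'a \<Rightarrow> 'a)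
    \<Rightarrow> 'f \<Rightarrow> ('g \<Rightarrow> 'a) \<Rightarrow> ('g \<Rightarrow> 'a)" where
  "total_map F G \<rho> c x \<alpha> = (\<lambda>g\<in>carrier G. c x (\<rho> (inv\<^bsub>F\<^esub> x) g) (\<alpha> (\<rho> (inv\<^bsub>F\<^esub> x) g)))"

definition graded_invariants ::
  "('f, 'x) monoid_scheme \<Rightarrow> ('g, 'y) monoid_scheme \<Rightarrow> ('f \<Rightarrow> 'g \<Rightarrow> 'g) \<Rightarrow> ('g \<Rightarrow> ('r, 'a) module)
    \<Rightarrow> ('f \<Rightarrow> 'g \<Rightarrow> 'a \<Rightarrow> 'a) \<Rightarrow> ('g \<Rightarrow> 'a) set" where
  "graded_invariants F G \<rho> A c =
     {\<alpha> \<in> graded_space G A. \<forall>x\<in>carrier F. total_map F G \<rho> c x \<alpha> = \<alpha>}"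

locale graded_structure_maps = F: group F + G: group G + group_hom F "AutoGroup G" \<rho>
  for F :: "('f, 'x) monoid_scheme" and G :: "('g, 'y) monoid_scheme" and \<rho> :: "'f \<Rightarrow> 'g \<Rightarrow> 'g"
    and A :: "'g \<Rightarrow> ('r::comm_ring_1, 'a) module" and m :: "'g \<Rightarrow> 'g \<Rightarrow> 'a \<Rightarrow> 'a \<Rightarrow> 'a"
    and c :: "'f \<Rightarrow> 'g \<Rightarrow> 'a \<Rightarrow> 'a" and u :: 'a +
  assumes A_module: "g \<in> carrier G \<Longrightarrow> module scalars (A g)"
    and m_linear_left: "\<lbrakk>g \<in> carrier G; h \<in> carrier G; b \<in> carrier (A h)\<rbrakk>
          \<Longrightarrow> linear_map_on (A g) (A (g \<otimes>\<^bsub>G\<^esub> h)) (\<lambda>a. m g h a b)"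
    and m_linear_right: "\<lbrakk>g \<in> carrier G; h \<in> carrier G; a \<in> carrier (A g)\<rbrakk>
          \<Longrightarrow> linear_map_on (A h) (A (g \<otimes>\<^bsub>G\<^esub> h)) (\<lambda>b. m g h a b)"
    and c_linear: "\<lbrakk>x \<in> carrier F; g \<in> carrier G\<rbrakk> \<Longrightarrow> linear_map_on (A g) (A (\<rho> x g)) (c x g)"
    and c_one: "\<alpha> \<in> graded_space G A \<Longrightarrow> total_map F G \<rho> c \<one>\<^bsub>F\<^esub> \<alpha> = \<alpha>"
    and c_mult: "\<lbrakk>x \<in> carrier F; y \<in> carrier F; \<alpha> \<in> graded_space G A\<rbrakk>
          \<Longrightarrow> total_map F G \<rho> c (x \<otimes>\<^bsub>F\<^esub> y) \<alpha> = total_map F G \<rho> c x (total_map F G \<rho> c y \<alpha>)"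
    and c_stabilizer: "\<lbrakk>g \<in> carrier G; x \<in> stabilizer F \<rho> g; a \<in> carrier (A g)\<rbrakk> \<Longrightarrow> c x g a = a"
    and c_m: "\<lbrakk>x \<in> carrier F; g \<in> carrier G; h \<in> carrier G; a \<in> carrier (A g); b \<in> carrier (A h)\<rbrakk>
          \<Longrightarrow> c x (g \<otimes>\<^bsub>G\<^esub> h) (m g h a b) = m (\<rho> x g) (\<rho> x h) (c x g a) (c x h b)"
    and unit_closed: "u \<in> carrier (A \<one>\<^bsub>G\<^esub>)"
    and c_unit: "x \<in> carrier F \<Longrightarrow> c x \<one>\<^bsub>G\<^esub> u = u"
    and m_unit_left: "\<lbrakk>g \<in> carrier G; a \<in> carrier (A g)\<rbrakk> \<Longrightarrow> m \<one>\<^bsub>G\<^esub> g u a = a"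
    and m_unit_right: "\<lbrakk>g \<in> carrier G; a \<in> carrier (A g)\<rbrakk> \<Longrightarrow> m g \<one>\<^bsub>G\<^esub> a u = a"

definition orbit_representatives ::
  "('f, 'x) monoid_scheme \<Rightarrow> ('g, 'y) monoid_scheme \<Rightarrow> ('f \<Rightarrow> 'g \<Rightarrow> 'g) \<Rightarrow> 'g \<Rightarrow> ('g \<times> 'g) set \<Rightarrow> bool" where
  "orbit_representatives F G \<rho> g R \<longleftrightarrow>
     R \<subseteq> {(h, k) \<in> carrier G \<times> carrier G. h \<otimes>\<^bsub>G\<^esub> k = g} \<and>
     (\<forall>h\<in>carrier G. \<forall>k\<in>carrier G. h \<otimes>\<^bsub>G\<^esub> k = g \<longrightarrow>
        (\<exists>!p. p \<in> R \<and> (\<exists>x\<in>stabilizer F \<rho> g. p = (\<rho> x h, \<rho> x k))))"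

text \<open>
  The ring of invariants with multiplication
  \<open>(\<alpha> \<beta>)\<^sub>g = \<Sum>(h, k)\<in>reps g. m h k (\<alpha> h) (\<beta> k)\<close>. Its associativity is not part of
  \<open>graded_structure_maps\<close>; it has to be stated separately, as part of the ring axioms.
\<close>

definition invariant_ring ::
  "('f, 'x) monoid_scheme \<Rightarrow> ('g, 'y) monoid_scheme \<Rightarrow> ('f \<Rightarrow> 'g \<Rightarrow> 'g) \<Rightarrow> ('g \<Rightarrow> ('r, 'a) module)
    \<Rightarrow> ('g \<Rightarrow> 'g \<Rightarrow> 'a \<Rightarrow> 'a \<Rightarrow> 'a) \<Rightarrow> ('f \<Rightarrow> 'g \<Rightarrow> 'a \<Rightarrow> 'a) \<Rightarrow> 'a \<Rightarrow> ('g \<Rightarrow> ('g \<times> 'g) set)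
    \<Rightarrow> ('r, 'g \<Rightarrow> 'a) module" where
  "invariant_ring F G \<rho> A m c u reps =
     \<lparr>carrier = graded_invariants F G \<rho> A c,
      mult = (\<lambda>\<alpha> \<beta>. \<lambda>g\<in>carrier G. finsum (A g) (\<lambda>(h, k). m h k (\<alpha> h) (\<beta> k)) (reps g)),
      one = (\<lambda>g\<in>carrier G. if g = \<one>\<^bsub>G\<^esub> then u else \<zero>\<^bsub>A g\<^esub>),
      zero = (\<lambda>g\<in>carrier G. \<zero>\<^bsub>A g\<^esub>),
      add = (\<lambda>\<alpha> \<beta>. \<lambda>g\<in>carrier G. \<alpha> g \<oplus>\<^bsub>A g\<^esub> \<beta> g),
      smult = (\<lambda>r \<alpha>. \<lambda>g\<in>carrier G. r \<odot>\<^bsub>A g\<^esub> \<alpha> g)\<rparr>"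


section \<open>The data attached to a coherent action\<close>

abbreviation component ::
  "('o, 'm, 'k) moncat \<Rightarrow> ('f, 'x) monoid_scheme \<Rightarrow> ('f \<Rightarrow> 'g \<Rightarrow> 'g) \<Rightarrow> ('g \<Rightarrow> 'o set)
    \<Rightarrow> ('f, 'o, 'm) action_data \<Rightarrow> 'g \<Rightarrow> ('o \<times> ('f \<Rightarrow> 'm), 'm, 'k) moncat" where
  "component C F \<rho> Cg T g \<equiv> equivariantization C F T (Cg g) (stabilizer F \<rho> g)"

definition res_tensor ::
  "('o, 'm, 'k) moncat \<Rightarrow> ('f, 'x) monoid_scheme \<Rightarrow> ('f \<Rightarrow> 'g \<Rightarrow> 'g) \<Rightarrow> ('f, 'o, 'm) action_data
    \<Rightarrow> 'g \<Rightarrow> 'g \<Rightarrow> 'o \<times> ('f \<Rightarrow> 'm) \<Rightarrow> 'o \<times> ('f \<Rightarrow> 'm) \<Rightarrow> 'o \<times> ('f \<Rightarrow> 'm)" where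
  "res_tensor C F \<rho> T g h M N =
     (let B = stabilizer F \<rho> g \<inter> stabilizer F \<rho> h
      in Res B M \<boxtimes>\<^bsub>equivariantization C F T (Obj C) B\<^esub> Res B N)"

definition c_map ::
  "('o, 'm, 'k) moncat \<Rightarrow> ('f, 'x) monoid_scheme \<Rightarrow> ('f \<Rightarrow> 'g \<Rightarrow> 'g) \<Rightarrow> ('g \<Rightarrow> 'o set)
    \<Rightarrow> ('f, 'o, 'm) action_data \<Rightarrow> 'f \<Rightarrow> 'g
    \<Rightarrow> (('o \<times> ('f \<Rightarrow> 'm)) \<Rightarrow>\<^sub>0 'r::comm_ring_1) set \<Rightarrow> (('o \<times> ('f \<Rightarrow> 'm)) \<Rightarrow>\<^sub>0 'r) set" where
  "c_map C F \<rho> Cg T x g =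
     K0_map (component C F \<rho> Cg T (\<rho> x g)) (conj_object C F T (stabilizer F \<rho> g) x)"

definition m_map ::
  "('o, 'm, 'k) moncat \<Rightarrow> ('f, 'x) monoid_scheme \<Rightarrow> ('g, 'y) monoid_scheme \<Rightarrow> ('f \<Rightarrow> 'g \<Rightarrow> 'g)
    \<Rightarrow> ('g \<Rightarrow> 'o set) \<Rightarrow> ('f, 'o, 'm) action_data \<Rightarrow> ('f set \<Rightarrow> 'f set \<Rightarrow> 'f set) \<Rightarrow> 'g \<Rightarrow> 'g
    \<Rightarrow> (('o \<times> ('f \<Rightarrow> 'm)) \<Rightarrow>\<^sub>0 'r::comm_ring_1) set \<Rightarrow> (('o \<times> ('f \<Rightarrow> 'm)) \<Rightarrow>\<^sub>0 'r) set
    \<Rightarrow> (('o \<times> ('f \<Rightarrow> 'm)) \<Rightarrow>\<^sub>0 'r) set" where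
  "m_map C F G \<rho> Cg T tr g h =
     (let A = stabilizer F \<rho> (g \<otimes>\<^bsub>G\<^esub> h); B = stabilizer F \<rho> g \<inter> stabilizer F \<rho> h
      in K0_map2 (component C F \<rho> Cg T (g \<otimes>\<^bsub>G\<^esub> h))
           (\<lambda>M N. Ind C F T (Cg (g \<otimes>\<^bsub>G\<^esub> h)) A B (tr A B) (res_tensor C F \<rho> T g h M N)))"

end

theory Submission
  imports Defs
begin

text \<open>
  Since \<open>C\<close> is semisimple, a sequence of equivariant objects is short exact if and only if the
  underlying sequence splits in \<open>C\<close>; the splitting need not be equivariant, because the
  characteristic may divide the order of \<open>F\<close>. Restriction, conjugation, tensor products and
  induction clearly preserve such sequences, so the structure maps are well defined on classes.

  All identities compare classes of summands of a single object \<open>M\<close> of \<open>C\<^sup>F\<close>. The projections \<open>gr g M\<close>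
  of \<open>M\<close> onto its homogeneous parts are orthogonal idempotents permuted by \<open>F\<close>, and two objects that
  split the same idempotent have the same class. Every object of the component of degree \<open>g\<close> is the
  part of degree \<open>g\<close> of an object of \<open>C\<^sup>F\<close>, namely of the object induced from it. Hence sending \<open>[M]\<close>
  to the family of the classes of its homogeneous parts is bijective onto the invariants; the
  inverse sums the induced objects over representatives of the \<open>F\<close>-orbits on \<open>G\<close>. In \<open>M \<boxtimes> N\<close> the part of
  degree \<open>g\<close> decomposes along the orbits of the stabilizer of \<open>g\<close> on the pairs \<open>(h, k)\<close> with \<open>h k = g\<close>,
  and the summand of an orbit is induced from the tensor product of the parts of degrees \<open>h\<close> and \<open>k\<close>
  by imprimitivity. This is the multiplication (M); its associativity is transported from \<open>C\<^sup>F\<close>.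
\<close>

section \<open>Grothendieck groups\<close>

text \<open>What makes the claim on short exact sequences delicate is that a kernel or cokernel in
  an equivariantization is tested on equivariant objects only, so it is not at once one in
  \<open>C\<close>. Semisimplicity enters as von Neumann regularity: every arrow \<open>p\<close>
  has some \<open>p'\<close> with \<open>p p' p = p\<close>. The images of the idempotents
  \<open>1 - p' p\<close> and \<open>p' p\<close> inherit equivariant structures, one as a subobject
  and one as a quotient, and comparing them with the given kernel and cokernel produces the
  splitting. Because these splittings are mere arrows of \<open>C\<close>, tensor products,
  conjugation, induction and passage to homogeneous parts are applied to arbitrary arrows, and
  equivariance is checked separately. The components \<open>Cg g\<close> need not be closed under
  isomorphism. Objects of prescribed degree are therefore obtained by splitting idempotents inside
  the given set of objects, which is possible because each \<open>Cg g\<close> has kernels. Working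
  in an ambient object over \<open>F\<close> (a host) also saves coherence computations: that
  conjugates are equivariant objects, that conjugations compose and that they respect products is
  read off from idempotents of the host.\<close>

definition scale :: "'r::comm_ring_1 \<Rightarrow> ('o \<Rightarrow>\<^sub>0 'r) \<Rightarrow> ('o \<Rightarrow>\<^sub>0 'r)" where
  "scale r = Poly_Mapping.map ((*) r)"

lemma lookup_scale [simp]: "Poly_Mapping.lookup (scale r x) k = r * Poly_Mapping.lookup x k"
  by (simp add: scale_def Poly_Mapping.map.rep_eq when_def)

lemma keys_scale: "Poly_Mapping.keys (scale r x) \<subseteq> Poly_Mapping.keys x"
  by (auto simp: in_keys_iff)

lemma scale_zero [simp]: "scale r 0 = 0" "scale 0 x = 0"
  by (auto intro!: poly_mapping_eqI)

lemma scale_one [simp]: "scale 1 x = x"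
  by (auto intro!: poly_mapping_eqI)

lemma scale_add: "scale r (x + y) = scale r x + scale r y" "scale (r + s) x = scale r x + scale s x"
  by (auto intro!: poly_mapping_eqI simp: lookup_add algebra_simps)

lemma scale_diff: "scale r (x - y) = scale r x - scale r y"
  by (rule poly_mapping_eqI) (simp add: lookup_minus right_diff_distrib)

lemma scale_scale: "scale r (scale s x) = scale (r * s) x"
  by (auto intro!: poly_mapping_eqI simp: algebra_simps)

lemma scale_minus_one: "scale (-1) x = - x"
  by (auto intro!: poly_mapping_eqI)

lemma scale_single [simp]: "scale r (Poly_Mapping.single M a) = Poly_Mapping.single M (r * a)"
  by (auto intro!: poly_mapping_eqI simp: lookup_single when_def)

lemma scale_sum: "scale r (\<Sum>i\<in>I. f i) = (\<Sum>i\<in>I. scale r (f i))"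
  by (auto intro!: poly_mapping_eqI simp: lookup_sum sum_distrib_left)

lemma keys_sum_subset: "(\<And>i. i \<in> I \<Longrightarrow> Poly_Mapping.keys (f i) \<subseteq> S) \<Longrightarrow> Poly_Mapping.keys (\<Sum>i\<in>I. f i) \<subseteq> S"
  by (induction I rule: infinite_finite_induct) (auto dest!: subsetD[OF Poly_Mapping.keys_add])

lemma cring_scalars: "cring scalars"
  by (rule cringI, rule abelian_groupI, unfold scalars_def)
     (auto intro!: comm_monoidI exI[of _ "- _"] simp: algebra_simps)

lemma free_module_simps [simp]:
  "carrier (free_module S) = {x. Poly_Mapping.keys x \<subseteq> S}" "zero (free_module S) = 0"
  "add (free_module S) = (+)" "smult (free_module S) = scale"
  by (auto simp: free_module_def scale_def fun_eq_iff)

lemma module_free_module: "module scalars (free_module S)"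
proof (rule moduleI[OF cring_scalars])
  show "abelian_group (free_module S)"
  proof (rule abelian_groupI)
    fix x assume "x \<in> carrier (free_module S)"
    then show "\<exists>y\<in>carrier (free_module S). y \<oplus>\<^bsub>free_module S\<^esub> x = \<zero>\<^bsub>free_module S\<^esub>"
      by (intro bexI[of _ "- x"]) auto
  qed (auto simp: add.assoc add.commute dest!: subsetD[OF Poly_Mapping.keys_add])
qed (auto simp: scalars_def scale_add scale_scale dest!: subsetD[OF keys_scale])

lemma a_inv_free_module: "Poly_Mapping.keys x \<subseteq> S \<Longrightarrow> \<ominus>\<^bsub>free_module S\<^esub> x = - x"
  by (rule abelian_group.minus_equality[OF module.axioms(2)[OF module_free_module]]) auto

text \<open>Negation is scaling by \<open>-1\<close>, so being a submodule reduces to closure under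
  sums and multiples.\<close>

lemma submodule_free_module_iff:
  "submodule N scalars (free_module S) \<longleftrightarrow> (\<forall>x\<in>N. Poly_Mapping.keys x \<subseteq> S) \<and> 0 \<in> N \<and>
     (\<forall>x\<in>N. \<forall>y\<in>N. x + y \<in> N) \<and> (\<forall>r. \<forall>x\<in>N. scale r x \<in> N)" (is "_ \<longleftrightarrow> ?R")
proof
  assume N: "submodule N scalars (free_module S)"
  show ?R
    using module.submoduleE[OF module_free_module N] subgroup.one_closed[OF submodule.axioms(1)[OF N]]
    by (auto simp: scalars_def)
next
  assume R: ?R
  show "submodule N scalars (free_module S)"
  proof (rule module.submoduleI[OF module_free_module])
    fix x assume "x \<in> N"
    then show "\<ominus>\<^bsub>free_module S\<^esub> x \<in> N"
      using R a_inv_free_module[of x S] scale_minus_one[of x] by metis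
  qed (use R in auto)
qed

lemma K0_relations_subset: "x \<in> K0_relations C \<Longrightarrow> Poly_Mapping.keys x \<subseteq> Obj C"
  by (force simp: K0_relations_def in_keys_iff lookup_minus lookup_single when_def split: if_splits)

lemma K0_nullI:
  "x \<in> K0_null C" if "\<And>N. submodule N scalars (free_module (Obj C)) \<Longrightarrow> K0_relations C \<subseteq> N \<Longrightarrow> x \<in> N"
  using that by (auto simp: K0_null_def)

text \<open>The elements supported on objects form a submodule that contains all relations. It is
  one of the submodules intersected, so null elements are themselves supported on objects.\<close>

lemma submodule_K0_null: "submodule (K0_null C) scalars (free_module (Obj C))"
proof -
  have "submodule {x. Poly_Mapping.keys x \<subseteq> Obj C} scalars (free_module (Obj C))"
    by (auto simp: submodule_free_module_iff dest!: subsetD[OF keys_scale] subsetD[OF Poly_Mapping.keys_add])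
  then have "K0_null C \<subseteq> {x. Poly_Mapping.keys x \<subseteq> Obj C}"
    using K0_relations_subset[of _ C] by (fastforce simp: K0_null_def)
  then show ?thesis
    unfolding submodule_free_module_iff
    by (auto simp: K0_null_def submodule_free_module_iff)
qed

lemma
  shows K0_null_keys: "x \<in> K0_null C \<Longrightarrow> Poly_Mapping.keys x \<subseteq> Obj C"
    and K0_null_zero: "0 \<in> K0_null C"
    and K0_null_add: "x \<in> K0_null C \<Longrightarrow> y \<in> K0_null C \<Longrightarrow> x + y \<in> K0_null C"
    and K0_null_scale: "x \<in> K0_null C \<Longrightarrow> scale r x \<in> K0_null C"
  using submodule_K0_null[of C] by (auto simp: submodule_free_module_iff)

lemma K0_null_uminus: "x \<in> K0_null C \<Longrightarrow> - x \<in> K0_null C"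
  using K0_null_scale[of x C "-1"] by (simp add: scale_minus_one)

lemma K0_null_diff: "x \<in> K0_null C \<Longrightarrow> y \<in> K0_null C \<Longrightarrow> x - y \<in> K0_null C"
  using K0_null_add[of x C "- y"] by (simp add: K0_null_uminus)

lemma K0_null_relation:
  "A \<in> Obj C \<Longrightarrow> B \<in> Obj C \<Longrightarrow> D \<in> Obj C \<Longrightarrow> short_exact C A B D i p \<Longrightarrow>
   Poly_Mapping.single B 1 - Poly_Mapping.single A 1 - Poly_Mapping.single D 1 \<in> K0_null C"
  by (rule K0_nullI, erule subsetD, unfold K0_relations_def) blast

text \<open>The elements that are supported on objects and satisfy \<open>P\<close> form one of the
  submodules in the intersection defining \<open>K0_null\<close>.\<close>

lemma K0_null_induct [consumes 1, case_names zero add scale relation]: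
  assumes "x \<in> K0_null C" "P 0" "\<And>x y. P x \<Longrightarrow> P y \<Longrightarrow> P (x + y)" "\<And>r x. P x \<Longrightarrow> P (scale r x)"
    and "\<And>A B D i p. \<lbrakk>A \<in> Obj C; B \<in> Obj C; D \<in> Obj C; short_exact C A B D i p\<rbrakk>
      \<Longrightarrow> P (Poly_Mapping.single B 1 - Poly_Mapping.single A 1 - Poly_Mapping.single D 1)"
  shows "P x"
proof -
  let ?N = "{x. Poly_Mapping.keys x \<subseteq> Obj C \<and> P x}"
  have "submodule ?N scalars (free_module (Obj C))"
    using assms(2-4) by (auto simp: submodule_free_module_iff dest!: subsetD[OF keys_scale] subsetD[OF Poly_Mapping.keys_add])
  moreover have "K0_relations C \<subseteq> ?N"
    using assms(5) K0_relations_subset[of _ C] unfolding K0_relations_def by blast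
  ultimately show ?thesis
    using assms(1) by (auto simp: K0_null_def)
qed

lemma mem_K0_coset: "z \<in> K0_coset C x \<longleftrightarrow> z - x \<in> K0_null C"
  unfolding K0_coset_def a_r_coset_def r_coset_def by (auto intro: bexI[of _ "z - x"])

lemma K0_coset_eq_iff: "K0_coset C x = K0_coset C y \<longleftrightarrow> x - y \<in> K0_null C"
proof
  assume "K0_coset C x = K0_coset C y"
  then show "x - y \<in> K0_null C"
    using K0_null_zero[of C] by (metis diff_self mem_K0_coset)
next
  assume xy: "x - y \<in> K0_null C"
  have "z - x \<in> K0_null C \<longleftrightarrow> z - y \<in> K0_null C" for z
    using K0_null_add[OF _ xy, of "z - x"] K0_null_diff[OF _ xy, of "z - y"] by auto
  then show "K0_coset C x = K0_coset C y"
    by (auto simp: mem_K0_coset)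
qed

lemma K0_coset_self: "x \<in> K0_coset C x"
  by (simp add: mem_K0_coset K0_null_zero)

lemma K0_carrier: "carrier (K0 C) = K0_coset C ` {x. Poly_Mapping.keys x \<subseteq> Obj C}"
  by (auto simp: K0_def A_RCOSETS_def RCOSETS_def K0_coset_def a_r_coset_def)

lemma K0_zero: "zero (K0 C) = K0_coset C 0"
  by (auto simp: K0_def mem_K0_coset)

text \<open>Maps on \<open>K0\<close> are defined as unions over all representatives of a coset. The
  union collapses to a single coset as soon as the map on representatives respects null elements,
  which is all that well-definedness asks for.\<close>

lemma UN_K0_coset:
  assumes "\<And>z. z - x \<in> K0_null C \<Longrightarrow> f z - f x \<in> K0_null E"
  shows "(\<Union>z\<in>K0_coset C x. K0_coset E (f z)) = K0_coset E (f x)"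
proof -
  have "K0_coset E (f z) = K0_coset E (f x)" if "z \<in> K0_coset C x" for z
    using that assms by (simp add: K0_coset_eq_iff mem_K0_coset)
  then show ?thesis using K0_coset_self[of x C] by blast
qed

lemma K0_add_set: "add (K0 C) X Y = (\<Union>a\<in>X. \<Union>b\<in>Y. {a + b})"
  by (simp add: K0_def set_add_def set_mult_def)

lemma K0_add: "add (K0 C) (K0_coset C x) (K0_coset C y) = K0_coset C (x + y)"
proof (rule Set.set_eqI, rule iffI)
  fix z assume "z \<in> add (K0 C) (K0_coset C x) (K0_coset C y)"
  then obtain a b where "a - x \<in> K0_null C" "b - y \<in> K0_null C" "z = a + b"
    by (auto simp: K0_add_set mem_K0_coset)
  then show "z \<in> K0_coset C (x + y)"
    using K0_null_add[of "a - x" C "b - y"] by (simp add: mem_K0_coset algebra_simps)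
next
  fix z assume "z \<in> K0_coset C (x + y)"
  then have "z - y - x \<in> K0_null C" "z = (z - y) + y"
    by (simp_all add: mem_K0_coset algebra_simps)
  then show "z \<in> add (K0 C) (K0_coset C x) (K0_coset C y)"
    using K0_coset_self[of y C] unfolding mem_K0_coset[of "z - y" C x, symmetric] K0_add_set by blast
qed

lemma K0_smult: "smult (K0 C) r (K0_coset C x) = K0_coset C (scale r x)"
  unfolding K0_def by (simp add: UN_K0_coset K0_null_scale flip: scale_diff)

lemma module_K0:
  fixes C :: "('o, 'm, 'k, 'z) lincat_scheme"
  shows "module scalars (K0 C :: ('r::comm_ring_1, _) module)"
proof (rule moduleI[OF cring_scalars])
  show "abelian_group (K0 C :: ('r, _) module)"
  proof (rule abelian_groupI)
    fix X :: "('o \<Rightarrow>\<^sub>0 'r) set" assume "X \<in> carrier (K0 C)"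
    then obtain x where "X = K0_coset C x" "Poly_Mapping.keys x \<subseteq> Obj C" by (auto simp: K0_carrier)
    then show "\<exists>Y\<in>carrier (K0 C). Y \<oplus>\<^bsub>K0 C\<^esub> X = \<zero>\<^bsub>K0 C\<^esub>"
      by (intro bexI[of _ "K0_coset C (- x)"]) (auto simp: K0_add K0_zero K0_carrier)
  next
    fix X Y :: "('o \<Rightarrow>\<^sub>0 'r) set" assume "X \<in> carrier (K0 C)" "Y \<in> carrier (K0 C)"
    then obtain x y where xy: "X = K0_coset C x" "Poly_Mapping.keys x \<subseteq> Obj C"
      "Y = K0_coset C y" "Poly_Mapping.keys y \<subseteq> Obj C" by (auto simp: K0_carrier)
    then have "Poly_Mapping.keys (x + y) \<subseteq> Obj C"
      by (auto dest!: subsetD[OF Poly_Mapping.keys_add])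
    then show "X \<oplus>\<^bsub>K0 C\<^esub> Y \<in> carrier (K0 C)"
      using xy by (auto simp: K0_add K0_carrier)
  qed (auto simp: K0_carrier K0_add K0_zero ac_simps)
next
  fix r and X :: "('o \<Rightarrow>\<^sub>0 'r) set" assume "X \<in> carrier (K0 C)"
  then obtain x where x: "X = K0_coset C x" "Poly_Mapping.keys x \<subseteq> Obj C" by (auto simp: K0_carrier)
  then have "Poly_Mapping.keys (scale r x) \<subseteq> Obj C"
    using keys_scale[of r x] by blast
  then show "r \<odot>\<^bsub>K0 C\<^esub> X \<in> carrier (K0 C)"
    using x by (auto simp: K0_carrier K0_smult)
qed (auto simp: K0_carrier K0_add K0_smult scalars_def scale_add scale_scale)

lemma K0_class_closed [simp, intro]: "M \<in> Obj C \<Longrightarrow> K0_class C M \<in> carrier (K0 C)"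
  unfolding K0_class_def K0_carrier by (intro imageI) auto

lemma K0_class_short_exact:
  assumes "A \<in> Obj C" "B \<in> Obj C" "D \<in> Obj C" "short_exact C A B D i p"
  shows "K0_class C B = K0_class C A \<oplus>\<^bsub>K0 C\<^esub> K0_class C D"
  using K0_null_relation[OF assms] by (simp add: K0_class_def K0_add K0_coset_eq_iff algebra_simps)

lemma poly_mapping_decomp: "x = (\<Sum>M\<in>Poly_Mapping.keys x. scale (Poly_Mapping.lookup x M) (Poly_Mapping.single M 1))"
  by (auto intro!: poly_mapping_eqI simp: lookup_sum lookup_single when_def in_keys_iff)

text \<open>Classes of objects span the Grothendieck group, because every element of the free module
  is a finite combination of objects. Identities between linear maps are thereby reduced to
  classes.\<close>

lemma K0_induct [consumes 1, case_names zero cls add smult]: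
  fixes C :: "('o, 'm, 'k, 'z) lincat_scheme" and X :: "('o \<Rightarrow>\<^sub>0 'r::comm_ring_1) set"
  assumes "X \<in> carrier (K0 C)" "P (zero (K0 C))" "\<And>M. M \<in> Obj C \<Longrightarrow> P (K0_class C M)"
    and "\<And>X Y. X \<in> carrier (K0 C) \<Longrightarrow> Y \<in> carrier (K0 C) \<Longrightarrow> P X \<Longrightarrow> P Y \<Longrightarrow> P (X \<oplus>\<^bsub>K0 C\<^esub> Y)"
    and "\<And>r X. X \<in> carrier (K0 C) \<Longrightarrow> P X \<Longrightarrow> P (r \<odot>\<^bsub>K0 C\<^esub> X)"
  shows "P X"
proof -
  interpret module scalars "K0 C :: ('r, _) module" by (rule module_K0)
  have *: "P (K0_coset C (\<Sum>M\<in>I. scale (r M) (Poly_Mapping.single M 1))) \<and>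
      K0_coset C (\<Sum>M\<in>I. scale (r M) (Poly_Mapping.single M 1)) \<in> carrier (K0 C)"
    if "finite I" "I \<subseteq> Obj C" for I and r :: "'o \<Rightarrow> 'r"
    using that
  proof induction
    case empty
    then show ?case using assms(2) zero_closed by (simp add: K0_zero)
  next
    case (insert M I)
    have "P (r M \<odot>\<^bsub>K0 C\<^esub> K0_class C M)" "r M \<odot>\<^bsub>K0 C\<^esub> K0_class C M \<in> carrier (K0 C)"
      using assms(3,5) insert(4) by (auto simp: scalars_def intro!: smult_closed)
    moreover have "K0_coset C (\<Sum>M\<in>insert M I. scale (r M) (Poly_Mapping.single M 1)) =
      r M \<odot>\<^bsub>K0 C\<^esub> K0_class C M \<oplus>\<^bsub>K0 C\<^esub> K0_coset C (\<Sum>M\<in>I. scale (r M) (Poly_Mapping.single M 1))"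
      using insert(1,2) by (simp add: K0_class_def K0_smult K0_add)
    ultimately show ?case
      using insert assms(4) by auto
  qed
  obtain x where x: "X = K0_coset C x" "Poly_Mapping.keys x \<subseteq> Obj C"
    using assms(1) by (auto simp: K0_carrier)
  then show ?thesis
    using *[of "Poly_Mapping.keys x" "Poly_Mapping.lookup x"] poly_mapping_decomp[of x] by simp
qed

section \<open>Linear and bilinear maps out of Grothendieck groups\<close>

lemma linear_map_on_zero:
  assumes "module scalars A" "module scalars B" "linear_map_on A B f"
  shows "f (zero A) = zero B"
proof -
  interpret A: module scalars A by fact
  interpret B: module scalars B by fact
  have "f (zero A \<oplus>\<^bsub>A\<^esub> zero A) = f (zero A) \<oplus>\<^bsub>B\<^esub> f (zero A)"
    using assms(3) unfolding linear_map_on_def by blast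
  then have "f (zero A) \<oplus>\<^bsub>B\<^esub> f (zero A) = f (zero A)" by simp
  moreover have "f (zero A) \<in> carrier B" using assms(3) unfolding linear_map_on_def by auto
  ultimately show ?thesis by (metis B.add.r_cancel_one')
qed

lemma linear_map_on_eqI:
  assumes "linear_map_on (K0 C) B f" "linear_map_on (K0 C) B g" "module scalars B"
    and "\<And>M. M \<in> Obj C \<Longrightarrow> f (K0_class C M) = g (K0_class C M)" "X \<in> carrier (K0 C)"
  shows "f X = g X"
  using assms(5)
proof (induction rule: K0_induct)
  case zero
  show ?case
    using linear_map_on_zero[OF module_K0 assms(3,1)] linear_map_on_zero[OF module_K0 assms(3,2)] by simp
next
  case (cls M)
  then show ?case by (rule assms(4))
next
  case (add X Y)
  then show ?case using assms(1,2) by (simp add: linear_map_on_def)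
next
  case (smult r X)
  then show ?case using assms(1,2) by (simp add: linear_map_on_def)
qed

lemma linear_map_on_compose:
  "linear_map_on A B f \<Longrightarrow> linear_map_on B D g \<Longrightarrow> linear_map_on A D (\<lambda>x. g (f x))"
  by (auto simp: linear_map_on_def Pi_iff)

text \<open>The linear extension of \<open>\<phi>\<close> from objects to the free module. The sum
  in \<open>K0_map\<close> is the case of values that are single objects, and the sum in
  \<open>K0_map2\<close> arises by iteration.\<close>

definition lift_free :: "('o \<Rightarrow> ('p \<Rightarrow>\<^sub>0 'r)) \<Rightarrow> ('o \<Rightarrow>\<^sub>0 'r) \<Rightarrow> ('p \<Rightarrow>\<^sub>0 'r::comm_ring_1)" where
  "lift_free \<phi> x = (\<Sum>M\<in>Poly_Mapping.keys x. scale (Poly_Mapping.lookup x M) (\<phi> M))"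

lemma lift_free_zero [simp]: "lift_free \<phi> 0 = 0"
  by (simp add: lift_free_def)

lemma lift_free_add: "lift_free \<phi> (x + y) = lift_free \<phi> x + lift_free \<phi> y"
  unfolding lift_free_def by (rule setsum_keys_plus_distrib) (auto simp: scale_add)

lemma lift_free_superset:
  "finite I \<Longrightarrow> Poly_Mapping.keys x \<subseteq> I \<Longrightarrow> lift_free \<phi> x = (\<Sum>M\<in>I. scale (Poly_Mapping.lookup x M) (\<phi> M))"
  unfolding lift_free_def by (rule sum.mono_neutral_left) (auto simp: in_keys_iff)

lemma lift_free_scale: "lift_free \<phi> (scale r x) = scale r (lift_free \<phi> x)"
  by (subst lift_free_superset[OF _ keys_scale]) (auto simp: lift_free_def scale_sum scale_scale)

lemma lift_free_uminus: "lift_free \<phi> (- x) = - lift_free \<phi> x"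
  using lift_free_scale[of \<phi> "-1" x] by (simp add: scale_minus_one)

lemma lift_free_diff: "lift_free \<phi> (x - y) = lift_free \<phi> x - lift_free \<phi> y"
  using lift_free_add[of \<phi> x "- y"] by (simp add: lift_free_uminus)

lemma lift_free_single [simp]: "lift_free \<phi> (Poly_Mapping.single M r) = scale r (\<phi> M)"
  by (simp add: lift_free_def)

lemma keys_lift_free:
  "(\<And>M. M \<in> Poly_Mapping.keys x \<Longrightarrow> Poly_Mapping.keys (\<phi> M) \<subseteq> S) \<Longrightarrow> Poly_Mapping.keys (lift_free \<phi> x) \<subseteq> S"
  unfolding lift_free_def by (intro keys_sum_subset order.trans[OF keys_scale])

lemma lift_free_null:
  assumes "x \<in> K0_null C"
    and "\<And>A B D i p. \<lbrakk>A \<in> Obj C; B \<in> Obj C; D \<in> Obj C; short_exact C A B D i p\<rbrakk> \<Longrightarrow> \<phi> B - \<phi> A - \<phi> D \<in> K0_null E"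
  shows "lift_free \<phi> x \<in> K0_null E"
  using assms(1)
  by (induction rule: K0_null_induct)
     (simp_all add: K0_null_zero lift_free_add K0_null_add lift_free_scale K0_null_scale lift_free_diff assms(2))

text \<open>The condition under which a function on objects factors linearly through
  \<open>K0 C\<close>. The arrows of the sequence are quantified inside, since the values depend on
  the objects alone.\<close>

definition K0_additive :: "('o, 'm, 'k, 'z) lincat_scheme \<Rightarrow> ('o \<Rightarrow> 'a) \<Rightarrow> ('r, 'a, 'y) module_scheme \<Rightarrow> bool" where
  "K0_additive C f B \<longleftrightarrow> f \<in> Obj C \<rightarrow> carrier B \<and>
     (\<forall>X\<in>Obj C. \<forall>Y\<in>Obj C. \<forall>Z\<in>Obj C.
        (\<exists>i p. short_exact C X Y Z i p) \<longrightarrow> f Y = f X \<oplus>\<^bsub>B\<^esub> f Z)"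

lemma K0_additive_diff:
  assumes "K0_additive C (\<lambda>M. K0_coset E (\<phi> M)) (K0 E)"
    and "A \<in> Obj C" "B \<in> Obj C" "D \<in> Obj C" "short_exact C A B D i p"
  shows "\<phi> B - \<phi> A - \<phi> D \<in> K0_null E"
proof -
  have "K0_coset E (\<phi> B) = K0_coset E (\<phi> A + \<phi> D)"
    using assms unfolding K0_additive_def K0_add[symmetric] by blast
  then show ?thesis by (simp add: K0_coset_eq_iff algebra_simps)
qed

lemma K0_map_eq: "K0_map E f X = (\<Union>x\<in>X. K0_coset E (lift_free (\<lambda>M. Poly_Mapping.single (f M) 1) x))"
  by (simp add: K0_map_def lift_free_def)

lemma K0_map_coset:
  fixes C :: "('o, 'm, 'k, 'z) lincat_scheme" and x :: "'o \<Rightarrow>\<^sub>0 'r::comm_ring_1"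
  assumes "K0_additive C (\<lambda>M. K0_class E (f M)) (K0 E :: ('r, _) module)"
  shows "K0_map E f (K0_coset C x) = K0_coset E (lift_free (\<lambda>M. Poly_Mapping.single (f M) 1) x)"
  unfolding K0_map_eq
  by (rule UN_K0_coset, subst lift_free_diff[symmetric], erule lift_free_null,
      rule K0_additive_diff[OF assms[unfolded K0_class_def]])

lemma K0_map_class:
  assumes "K0_additive C (\<lambda>M. K0_class E (f M)) (K0 E :: ('r::comm_ring_1, _) module)"
  shows "K0_map E f (K0_class C M) = (K0_class E (f M) :: (_ \<Rightarrow>\<^sub>0 'r) set)"
  unfolding K0_class_def[of C] K0_map_coset[OF assms] by (simp add: K0_class_def)

lemma K0_map_linear:
  fixes C :: "('o, 'm, 'k, 'z) lincat_scheme" and E :: "('p, 'n, 'l, 'y) lincat_scheme"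
  assumes "K0_additive C (\<lambda>M. K0_class E (f M)) (K0 E :: ('r::comm_ring_1, _) module)" "f \<in> Obj C \<rightarrow> Obj E"
  shows "linear_map_on (K0 C :: ('r, _) module) (K0 E) (K0_map E f)"
proof -
  have "Poly_Mapping.keys (lift_free (\<lambda>M. Poly_Mapping.single (f M) 1) x) \<subseteq> Obj E"
    if "Poly_Mapping.keys x \<subseteq> Obj C" for x :: "'o \<Rightarrow>\<^sub>0 'r"
    using that assms(2) by (intro keys_lift_free) auto
  then show ?thesis
    unfolding linear_map_on_def K0_carrier
    by (auto simp: K0_map_coset[OF assms(1)] K0_add K0_smult lift_free_add lift_free_scale)
qed

lemma K0_map2_eq: "K0_map2 E f X Y = (\<Union>x\<in>X. \<Union>y\<in>Y. K0_coset E
    (lift_free (\<lambda>M. lift_free (\<lambda>N. Poly_Mapping.single (f M N) 1) y) x))"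
  by (simp add: K0_map2_def lift_free_def scale_sum)

text \<open>Exchanging the two variables turns a null element in the second argument into one in the
  first, so that a single lemma on null elements covers both.\<close>

lemma lift_free_swap:
  "lift_free (\<lambda>M. lift_free (\<lambda>N. \<phi> M N) y) x = lift_free (\<lambda>N. lift_free (\<lambda>M. \<phi> M N) x) y"
  unfolding lift_free_def scale_sum scale_scale
  by (subst sum.swap) (simp add: mult.commute)

lemma K0_null_sum: "(\<And>i. i \<in> I \<Longrightarrow> x i \<in> K0_null C) \<Longrightarrow> (\<Sum>i\<in>I. x i) \<in> K0_null C"
  by (induction I rule: infinite_finite_induct) (simp_all add: K0_null_zero K0_null_add)

lemma lift_free_closed:
  assumes "\<And>M. M \<in> Poly_Mapping.keys x \<Longrightarrow> \<phi> M \<in> K0_null E"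
  shows "lift_free \<phi> x \<in> K0_null E"
  unfolding lift_free_def by (intro K0_null_sum K0_null_scale assms)

lemma lift_free_fun_diff: "lift_free (\<lambda>M. \<phi> M - \<psi> M) x = lift_free \<phi> x - lift_free \<psi> x"
  by (simp add: lift_free_def scale_diff sum_subtractf)

lemma lift_free_fun_add: "lift_free (\<lambda>M. \<phi> M + \<psi> M) x = lift_free \<phi> x + lift_free \<psi> x"
  by (simp add: lift_free_def scale_add sum.distrib)

lemma lift_free_fun_scale: "lift_free (\<lambda>M. scale r (\<phi> M)) x = scale r (lift_free \<phi> x)"
  by (simp add: lift_free_def scale_sum scale_scale mult.commute)

lemma lift_free2_null:
  assumes "x \<in> K0_null C"
    and "\<And>N. N \<in> Poly_Mapping.keys y \<Longrightarrow> K0_additive C (\<lambda>M. K0_coset E (\<phi> M N)) (K0 E)"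
  shows "lift_free (\<lambda>M. lift_free (\<phi> M) y) x \<in> K0_null E"
  using assms(1)
proof (rule lift_free_null)
  fix A B G i p assume *: "A \<in> Obj C" "B \<in> Obj C" "G \<in> Obj C" "short_exact C A B G i p"
  have "lift_free (\<lambda>N. \<phi> B N - \<phi> A N - \<phi> G N) y \<in> K0_null E"
    by (rule lift_free_closed) (rule K0_additive_diff[OF assms(2) *])
  then show "lift_free (\<phi> B) y - lift_free (\<phi> A) y - lift_free (\<phi> G) y \<in> K0_null E"
    by (simp only: lift_free_fun_diff)
qed

text \<open>Additivity in each variable, with an object fixed in the other, is enough:
  representatives are changed in one variable at a time, and an element of the fixed variable is a
  combination of objects.\<close>

lemma
  fixes C :: "('o, 'm, 'k, 'z) lincat_scheme" and D :: "('q, 'n, 'k, 'y) lincat_scheme"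
    and E :: "('p, 'l, 'k, 'w) lincat_scheme" and f :: "'o \<Rightarrow> 'q \<Rightarrow> 'p"
  assumes left: "\<And>N. N \<in> Obj D \<Longrightarrow> K0_additive C (\<lambda>M. K0_class E (f M N)) (K0 E :: ('r::comm_ring_1, _) module)"
    and right: "\<And>M. M \<in> Obj C \<Longrightarrow> K0_additive D (\<lambda>N. K0_class E (f M N)) (K0 E :: ('r, _) module)"
    and closed: "\<And>M N. M \<in> Obj C \<Longrightarrow> N \<in> Obj D \<Longrightarrow> f M N \<in> Obj E"
  shows K0_map2_class: "\<lbrakk>M \<in> Obj C; N \<in> Obj D\<rbrakk> \<Longrightarrow>
      K0_map2 E f (K0_class C M) (K0_class D N) = (K0_class E (f M N) :: ('p \<Rightarrow>\<^sub>0 'r) set)"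
    and K0_map2_linear_left: "Y \<in> carrier (K0 D) \<Longrightarrow>
      linear_map_on (K0 C :: ('r, _) module) (K0 E) (\<lambda>X. K0_map2 E f X Y)"
    and K0_map2_linear_right: "X \<in> carrier (K0 C) \<Longrightarrow>
      linear_map_on (K0 D :: ('r, _) module) (K0 E) (\<lambda>Y. K0_map2 E f X Y)"
proof -
  let ?s = "\<lambda>M N. Poly_Mapping.single (f M N) (1::'r)"
  let ?l = "\<lambda>x y. lift_free (\<lambda>M. lift_free (?s M) y) x"
  have null_left: "?l x y \<in> K0_null E" if x: "x \<in> K0_null C" and y: "Poly_Mapping.keys y \<subseteq> Obj D" for x y
    using x by (rule lift_free2_null) (use y left[unfolded K0_class_def] in blast)
  have null_right: "?l x y \<in> K0_null E" if y: "y \<in> K0_null D" and x: "Poly_Mapping.keys x \<subseteq> Obj C" for x y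
    unfolding lift_free_swap[of ?s]
    using y by (rule lift_free2_null) (use x right[unfolded K0_class_def] in blast)
  have eq: "K0_map2 E f (K0_coset C x) (K0_coset D y) = K0_coset E (?l x y)"
    if x: "Poly_Mapping.keys x \<subseteq> Obj C" and y: "Poly_Mapping.keys y \<subseteq> Obj D" for x y
  proof -
    have "K0_coset E (?l x' y') = K0_coset E (?l x y)"
      if "x' \<in> K0_coset C x" "y' \<in> K0_coset D y" for x' y'
    proof -
      have xn: "x' - x \<in> K0_null C" and yn: "y' - y \<in> K0_null D" using that by (simp_all add: mem_K0_coset)
      have "x' = (x' - x) + x" by simp
      then have x': "Poly_Mapping.keys x' \<subseteq> Obj C"
        using x K0_null_keys[OF xn] Poly_Mapping.keys_add[of "x' - x" x] by auto
      \<comment> \<open>The telescoping of a bilinear difference. One of the two terms involves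
        \<open>x'\<close> instead of \<open>x\<close>, which is why \<open>x'\<close> had to be
        shown to be supported on objects.\<close>
      have "?l x' y' - ?l x y = ?l x' (y' - y) + ?l (x' - x) y"
        by (simp add: lift_free_diff lift_free_fun_diff)
      also have "\<dots> \<in> K0_null E"
        using null_left[OF xn y] null_right[OF yn x'] by (intro K0_null_add)
      finally show ?thesis by (simp add: K0_coset_eq_iff)
    qed
    then have "(\<Union>y'\<in>K0_coset D y. K0_coset E (?l x' y')) = K0_coset E (?l x y)" if "x' \<in> K0_coset C x" for x'
      using that K0_coset_self[of y D] by auto
    then show ?thesis unfolding K0_map2_eq using K0_coset_self[of x C] by auto
  qed
  show "K0_map2 E f (K0_class C M) (K0_class D N) = (K0_class E (f M N) :: ('p \<Rightarrow>\<^sub>0 'r) set)"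
    if "M \<in> Obj C" "N \<in> Obj D"
    using that by (simp add: K0_class_def eq)
  have keys: "Poly_Mapping.keys (?l x y) \<subseteq> Obj E"
    if "Poly_Mapping.keys x \<subseteq> Obj C" "Poly_Mapping.keys y \<subseteq> Obj D" for x y
    using that closed by (intro keys_lift_free) auto
  have add: "Poly_Mapping.keys (x + y) \<subseteq> S" if "Poly_Mapping.keys x \<subseteq> S" "Poly_Mapping.keys y \<subseteq> S"
    for x y :: "'s \<Rightarrow>\<^sub>0 'r" and S
    using that Poly_Mapping.keys_add[of x y] by blast
  have scale: "Poly_Mapping.keys (scale r x) \<subseteq> S" if "Poly_Mapping.keys x \<subseteq> S"
    for x :: "'s \<Rightarrow>\<^sub>0 'r" and r S
    using that keys_scale[of r x] by blast
  show "linear_map_on (K0 C :: ('r, _) module) (K0 E) (\<lambda>X. K0_map2 E f X Y)" if "Y \<in> carrier (K0 D)"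
  proof -
    obtain y where y: "Y = K0_coset D y" "Poly_Mapping.keys y \<subseteq> Obj D"
      using \<open>Y \<in> carrier (K0 D)\<close> by (auto simp: K0_carrier)
    show ?thesis
      unfolding linear_map_on_def K0_carrier y(1)
    proof (intro conjI ballI allI funcsetI; elim imageE CollectE; clarify)
      fix x :: "'o \<Rightarrow>\<^sub>0 'r" assume x: "Poly_Mapping.keys x \<subseteq> Obj C"
      show "K0_map2 E f (K0_coset C x) (K0_coset D y) \<in> K0_coset E ` {x. Poly_Mapping.keys x \<subseteq> Obj E}"
        using eq[OF x y(2)] keys[OF x y(2)] by blast
      fix x' :: "'o \<Rightarrow>\<^sub>0 'r" assume x': "Poly_Mapping.keys x' \<subseteq> Obj C"
      show "K0_map2 E f (K0_coset C x \<oplus>\<^bsub>K0 C\<^esub> K0_coset C x') (K0_coset D y) =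
        K0_map2 E f (K0_coset C x) (K0_coset D y) \<oplus>\<^bsub>K0 E\<^esub> K0_map2 E f (K0_coset C x') (K0_coset D y)"
        unfolding K0_add eq[OF add[OF x x'] y(2)] eq[OF x y(2)] eq[OF x' y(2)] lift_free_add ..
    next
      fix r and x :: "'o \<Rightarrow>\<^sub>0 'r" assume x: "Poly_Mapping.keys x \<subseteq> Obj C"
      show "K0_map2 E f (r \<odot>\<^bsub>K0 C\<^esub> K0_coset C x) (K0_coset D y) =
        r \<odot>\<^bsub>K0 E\<^esub> K0_map2 E f (K0_coset C x) (K0_coset D y)"
        unfolding K0_smult eq[OF scale[OF x] y(2)] eq[OF x y(2)] lift_free_scale ..
    qed
  qed
  show "linear_map_on (K0 D :: ('r, _) module) (K0 E) (\<lambda>Y. K0_map2 E f X Y)" if "X \<in> carrier (K0 C)"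
  proof -
    obtain x where x: "X = K0_coset C x" "Poly_Mapping.keys x \<subseteq> Obj C"
      using \<open>X \<in> carrier (K0 C)\<close> by (auto simp: K0_carrier)
    show ?thesis
      unfolding linear_map_on_def K0_carrier x(1)
    proof (intro conjI ballI allI funcsetI; elim imageE CollectE; clarify)
      fix y :: "'q \<Rightarrow>\<^sub>0 'r" assume y: "Poly_Mapping.keys y \<subseteq> Obj D"
      show "K0_map2 E f (K0_coset C x) (K0_coset D y) \<in> K0_coset E ` {x. Poly_Mapping.keys x \<subseteq> Obj E}"
        using eq[OF x(2) y] keys[OF x(2) y] by blast
      fix y' :: "'q \<Rightarrow>\<^sub>0 'r" assume y': "Poly_Mapping.keys y' \<subseteq> Obj D"
      show "K0_map2 E f (K0_coset C x) (K0_coset D y \<oplus>\<^bsub>K0 D\<^esub> K0_coset D y') =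
        K0_map2 E f (K0_coset C x) (K0_coset D y) \<oplus>\<^bsub>K0 E\<^esub> K0_map2 E f (K0_coset C x) (K0_coset D y')"
        unfolding K0_add eq[OF x(2) add[OF y y']] eq[OF x(2) y] eq[OF x(2) y']
          lift_free_add lift_free_fun_add ..
    next
      fix r and y :: "'q \<Rightarrow>\<^sub>0 'r" assume y: "Poly_Mapping.keys y \<subseteq> Obj D"
      show "K0_map2 E f (K0_coset C x) (r \<odot>\<^bsub>K0 D\<^esub> K0_coset D y) =
        r \<odot>\<^bsub>K0 E\<^esub> K0_map2 E f (K0_coset C x) (K0_coset D y)"
        unfolding K0_smult eq[OF x(2) scale[OF y]] eq[OF x(2) y]
          lift_free_scale lift_free_fun_scale ..
    qed
  qed
qed

section \<open>Arrows with source and target\<close>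

text \<open>
  Hom sets for different objects may overlap, and sums of morphisms depend on the hom set; arrows
  therefore carry their source and target.
\<close>

datatype ('o, 'm) arrow = Arrow (src: 'o) (mor: 'm) (tgt: 'o)

context linear_category
begin

definition arr :: "('o, 'm) arrow \<Rightarrow> bool" where
  "arr f \<longleftrightarrow> src f \<in> Obj C \<and> tgt f \<in> Obj C \<and> mor f \<in> Arr C (src f) (tgt f)"

abbreviation typed ("_ \<Colon> _ \<leadsto> _" [51, 51, 51] 50) where
  "f \<Colon> A \<leadsto> B \<equiv> arr f \<and> src f = A \<and> tgt f = B"

definition cmp (infixr "\<cdot>" 72) where
  "g \<cdot> f = Arrow (src f) (mor g \<bullet> mor f) (tgt g)"

definition ide where "ide A = Arrow A (Idn C A) A"

definition zer where "zer A B = Arrow A \<zero>\<^bsub>Hom C A B\<^esub> B"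

definition plus (infixl "\<boxplus>" 65) where
  "f \<boxplus> g = Arrow (src f) (mor f \<oplus>\<^bsub>Hom C (src f) (tgt f)\<^esub> mor g) (tgt f)"

definition sub (infixl "\<boxminus>" 65) where
  "f \<boxminus> g = Arrow (src f) (mor f \<ominus>\<^bsub>Hom C (src f) (tgt f)\<^esub> mor g) (tgt f)"

text \<open>The ends \<open>A\<close> and \<open>B\<close> are arguments because an empty sum cannot
  supply them.\<close>

definition asum where
  "asum A B f I = Arrow A (finsum (Hom C A B) (\<lambda>i. mor (f i)) I) B"

lemma src_tgt_simps [simp]:
  "src (g \<cdot> f) = src f" "tgt (g \<cdot> f) = tgt g" "src (ide A) = A" "tgt (ide A) = A"
  "src (zer A B) = A" "tgt (zer A B) = B" "src (f \<boxplus> g) = src f" "tgt (f \<boxplus> g) = tgt f"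
  "src (f \<boxminus> g) = src f" "tgt (f \<boxminus> g) = tgt f" "src (asum A B F I) = A" "tgt (asum A B F I) = B"
  by (simp_all add: cmp_def ide_def zer_def plus_def sub_def asum_def)

lemma mor_cmp: "mor (g \<cdot> f) = mor g \<bullet> mor f"
  by (simp add: cmp_def)

lemma Hom_abelian: "A \<in> Obj C \<Longrightarrow> B \<in> Obj C \<Longrightarrow> abelian_group (Hom C A B)"
  using Hom_module module.axioms(2) by blast

lemma Hom_monoid: "A \<in> Obj C \<Longrightarrow> B \<in> Obj C \<Longrightarrow> abelian_monoid (Hom C A B)"
  using Hom_abelian abelian_group.axioms(1) by blast

lemma arr_obj [simp]: "arr f \<Longrightarrow> src f \<in> Obj C" "arr f \<Longrightarrow> tgt f \<in> Obj C"
  by (simp_all add: arr_def)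

lemma arr_cmp [simp, intro]: "arr g \<Longrightarrow> arr f \<Longrightarrow> src g = tgt f \<Longrightarrow> arr (g \<cdot> f)"
  unfolding arr_def cmp_def by (auto intro: Comp_closed)

lemma arr_ide [simp]: "arr (ide A) \<longleftrightarrow> A \<in> Obj C"
  by (auto simp del: arr_obj simp: arr_def ide_def Idn_closed)

lemma arr_zer [simp]: "arr (zer A B) \<longleftrightarrow> A \<in> Obj C \<and> B \<in> Obj C"
  by (auto simp del: arr_obj simp: arr_def zer_def abelian_monoid.zero_closed[OF Hom_monoid])

lemma arr_plus [simp, intro]: "arr f \<Longrightarrow> arr g \<Longrightarrow> src g = src f \<Longrightarrow> tgt g = tgt f \<Longrightarrow> arr (f \<boxplus> g)"
  unfolding arr_def plus_def by (simp del: arr_obj add: abelian_monoid.a_closed[OF Hom_monoid])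

lemma arr_sub [simp, intro]: "arr f \<Longrightarrow> arr g \<Longrightarrow> src g = src f \<Longrightarrow> tgt g = tgt f \<Longrightarrow> arr (f \<boxminus> g)"
  unfolding arr_def sub_def by (simp del: arr_obj add: abelian_group.minus_closed[OF Hom_abelian])

lemma arr_asum [intro]:
  assumes "A \<in> Obj C" "B \<in> Obj C" "\<And>i. i \<in> I \<Longrightarrow> F i \<Colon> A \<leadsto> B"
  shows "arr (asum A B F I)"
proof -
  have "(\<lambda>i. mor (F i)) \<in> I \<rightarrow> Arr C A B" using assms(3) by (force simp del: arr_obj simp: arr_def)
  then show ?thesis
    using assms(1,2) by (simp del: arr_obj add: arr_def asum_def abelian_monoid.finsum_closed[OF Hom_monoid])
qed

lemma cmp_assoc [simp]:
  "\<lbrakk>arr f; arr g; arr h; src g = tgt f; src h = tgt g\<rbrakk> \<Longrightarrow> (h \<cdot> g) \<cdot> f = h \<cdot> (g \<cdot> f)"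
  unfolding arr_def cmp_def
  by (auto intro: Comp_assoc[of "src f" "tgt f" "tgt g" "tgt h"])

lemma ide_cmp [simp]: "arr f \<Longrightarrow> B = tgt f \<Longrightarrow> ide B \<cdot> f = f"
  by (cases f) (auto simp del: arr_obj simp: arr_def cmp_def ide_def Comp_Idn_left)

lemma cmp_ide [simp]: "arr f \<Longrightarrow> A = src f \<Longrightarrow> f \<cdot> ide A = f"
  by (cases f) (auto simp del: arr_obj simp: arr_def cmp_def ide_def Comp_Idn_right)

text \<open>Composites are kept nested to the right by \<open>cmp_assoc\<close>, so an equation for
  \<open>g \<cdot> f\<close> does not match where the composite continues. This is the form of the
  equation with a tail.\<close>

lemma cmp_rewrite:
  "\<lbrakk>g \<cdot> f = h; arr g; arr f; src g = tgt f; arr k; src f = tgt k\<rbrakk> \<Longrightarrow> g \<cdot> (f \<cdot> k) = h \<cdot> k"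
  by (metis cmp_assoc)

lemma plus_assoc:
  "\<lbrakk>arr f; arr g; arr h; src g = src f; src h = src f; tgt g = tgt f; tgt h = tgt f\<rbrakk>
   \<Longrightarrow> (f \<boxplus> g) \<boxplus> h = f \<boxplus> (g \<boxplus> h)"
  by (auto simp del: arr_obj simp: arr_def plus_def abelian_monoid.a_assoc[OF Hom_monoid])

lemma plus_comm:
  "\<lbrakk>arr f; arr g; src g = src f; tgt g = tgt f\<rbrakk> \<Longrightarrow> f \<boxplus> g = g \<boxplus> f"
  by (auto simp del: arr_obj simp: arr_def plus_def abelian_monoid.a_comm[OF Hom_monoid])

lemma plus_zer [simp]: "arr f \<Longrightarrow> A = src f \<Longrightarrow> B = tgt f \<Longrightarrow> f \<boxplus> zer A B = f"
  "arr f \<Longrightarrow> A = src f \<Longrightarrow> B = tgt f \<Longrightarrow> zer A B \<boxplus> f = f"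
  by (cases f; auto simp del: arr_obj simp: arr_def plus_def zer_def abelian_monoid.r_zero[OF Hom_monoid] abelian_monoid.l_zero[OF Hom_monoid])+

lemma sub_plus:
  assumes "arr f" "arr g" "src g = src f" "tgt g = tgt f" shows "(f \<boxminus> g) \<boxplus> g = f"
proof -
  interpret abelian_group "Hom C (src f) (tgt f)" using assms by (simp add: Hom_abelian)
  have "mor f \<in> Arr C (src f) (tgt f)" "mor g \<in> Arr C (src f) (tgt f)"
    using assms by (auto simp del: arr_obj simp: arr_def)
  then have "(mor f \<ominus>\<^bsub>Hom C (src f) (tgt f)\<^esub> mor g) \<oplus>\<^bsub>Hom C (src f) (tgt f)\<^esub> mor g = mor f"
    by (simp add: a_minus_def a_assoc l_neg)
  then show ?thesis by (simp add: plus_def sub_def)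
qed

lemma plus_cancel:
  assumes "f \<boxplus> g = f' \<boxplus> g" "arr f" "arr f'" "arr g" "src f' = src f" "src g = src f" "tgt f' = tgt f" "tgt g = tgt f"
  shows "f = f'"
proof -
  interpret abelian_group "Hom C (src f) (tgt f)" using assms by (simp add: Hom_abelian)
  have "mor f \<in> Arr C (src f) (tgt f)" "mor f' \<in> Arr C (src f) (tgt f)" "mor g \<in> Arr C (src f) (tgt f)"
    using assms by (auto simp del: arr_obj simp: arr_def)
  then have "mor f = mor f'" using assms(1,5,7) by (simp add: plus_def)
  then show ?thesis using assms(5,7) by (auto intro: arrow.expand)
qed

text \<open>A difference is determined by what results from adding the subtrahend back; the rules
  for subtraction are derived from those for sums in this way.\<close>

lemma sub_eqI:
  "\<lbrakk>h \<boxplus> g = f; arr f; arr g; arr h; src g = src f; src h = src f; tgt g = tgt f; tgt h = tgt f\<rbrakk> \<Longrightarrow> f \<boxminus> g = h"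
  by (rule plus_cancel[of _ g]) (auto simp: sub_plus)

lemma sub_self: "arr f \<Longrightarrow> f \<boxminus> f = zer (src f) (tgt f)"
  by (rule sub_eqI) auto

lemma sub_zer: "arr f \<Longrightarrow> f \<boxminus> zer (src f) (tgt f) = f"
  by (rule sub_eqI) auto

lemma sub_eq_zerD:
  assumes "f \<boxminus> g = zer (src f) (tgt f)" "arr f" "arr g" "src g = src f" "tgt g = tgt f"
  shows "f = g"
  using sub_plus[of f g] assms by simp

lemma cmp_plus_left:
  "\<lbrakk>arr f; arr g; arr h; src g = src f; tgt g = tgt f; src f = tgt h\<rbrakk> \<Longrightarrow> (f \<boxplus> g) \<cdot> h = f \<cdot> h \<boxplus> g \<cdot> h"
  by (auto simp del: arr_obj simp: arr_def plus_def cmp_def Comp_add_left)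

lemma cmp_plus_right:
  "\<lbrakk>arr f; arr g; arr h; src g = src f; tgt g = tgt f; src h = tgt f\<rbrakk> \<Longrightarrow> h \<cdot> (f \<boxplus> g) = h \<cdot> f \<boxplus> h \<cdot> g"
  by (auto simp del: arr_obj simp: arr_def plus_def cmp_def Comp_add_right)

lemma cmp_sub_left:
  "\<lbrakk>arr f; arr g; arr h; src g = src f; tgt g = tgt f; src f = tgt h\<rbrakk> \<Longrightarrow> (f \<boxminus> g) \<cdot> h = f \<cdot> h \<boxminus> g \<cdot> h"
  by (rule sub_eqI[symmetric]) (auto simp: cmp_plus_left[symmetric] sub_plus)

lemma cmp_sub_right:
  "\<lbrakk>arr f; arr g; arr h; src g = src f; tgt g = tgt f; src h = tgt f\<rbrakk> \<Longrightarrow> h \<cdot> (f \<boxminus> g) = h \<cdot> f \<boxminus> h \<cdot> g"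
  by (rule sub_eqI[symmetric]) (auto simp: cmp_plus_right[symmetric] sub_plus)

text \<open>Serves to show that additive operations preserve zero: the image \<open>f\<close> of a
  zero arrow satisfies \<open>f \<boxplus> f = f\<close>.\<close>

lemma plus_idem_zer:
  assumes "f \<boxplus> f = f" "arr f" shows "f = zer (src f) (tgt f)"
  by (rule plus_cancel[of _ f]) (use assms in auto)

lemma zer_cmp [simp]: "arr f \<Longrightarrow> A = tgt f \<Longrightarrow> B \<in> Obj C \<Longrightarrow> zer A B \<cdot> f = zer (src f) B"
  using plus_idem_zer[of "zer A B \<cdot> f"] by (simp add: cmp_plus_left[symmetric])

lemma cmp_zer [simp]: "arr f \<Longrightarrow> B = src f \<Longrightarrow> A \<in> Obj C \<Longrightarrow> f \<cdot> zer A B = zer A (tgt f)"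
  using plus_idem_zer[of "f \<cdot> zer A B"] by (simp add: cmp_plus_right[symmetric])

lemma asum_empty [simp]: "A \<in> Obj C \<Longrightarrow> B \<in> Obj C \<Longrightarrow> asum A B F {} = zer A B"
  by (simp add: asum_def zer_def abelian_monoid.finsum_empty[OF Hom_monoid])

lemma asum_insert:
  assumes "finite I" "i \<notin> I" "F i \<Colon> A \<leadsto> B" "\<And>j. j \<in> I \<Longrightarrow> F j \<Colon> A \<leadsto> B"
  shows "asum A B F (insert i I) = F i \<boxplus> asum A B F I"
proof -
  interpret abelian_group "Hom C A B" using assms(3) by (auto simp: Hom_abelian)
  have "(\<lambda>i. mor (F i)) \<in> I \<rightarrow> Arr C A B" "mor (F i) \<in> Arr C A B"
    using assms by (force simp del: arr_obj simp: arr_def)+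
  then show ?thesis using assms(1,2,3)
    by (auto simp: asum_def plus_def finsum_insert)
qed

lemma arr_asum' [simp]:
  "A \<in> Obj C \<Longrightarrow> B \<in> Obj C \<Longrightarrow> \<forall>i\<in>I. F i \<Colon> A \<leadsto> B \<Longrightarrow> arr (asum A B F I)"
  by (rule arr_asum) auto

lemma asum_cong:
  assumes "\<And>i. i \<in> I \<Longrightarrow> F i = F' i" "\<And>i. i \<in> I \<Longrightarrow> F i \<Colon> A \<leadsto> B" "A \<in> Obj C" "B \<in> Obj C"
  shows "asum A B F I = asum A B F' I"
proof -
  interpret abelian_group "Hom C A B" using assms by (auto simp: Hom_abelian)
  have "(\<lambda>i. mor (F' i)) \<in> I \<rightarrow> Arr C A B" using assms by (force simp del: arr_obj simp: arr_def)
  then show ?thesis using assms(1) unfolding asum_def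
    by (auto intro!: finsum_cong')
qed

text \<open>Composition on either side, tensoring with an arrow and the functors of the action are
  instances, which is why the ends of the arrows may change under \<open>\<phi>\<close>.\<close>

lemma asum_linear:
  assumes "finite I" "A \<in> Obj C" "B \<in> Obj C" "\<And>i. i \<in> I \<Longrightarrow> F i \<Colon> A \<leadsto> B"
    and "\<And>f. f \<Colon> A \<leadsto> B \<Longrightarrow> \<phi> f \<Colon> A' \<leadsto> B'" "\<And>f g. f \<Colon> A \<leadsto> B \<Longrightarrow> g \<Colon> A \<leadsto> B \<Longrightarrow> \<phi> (f \<boxplus> g) = \<phi> f \<boxplus> \<phi> g"
  shows "\<phi> (asum A B F I) = asum A' B' (\<lambda>i. \<phi> (F i)) I"
  using assms(1,4)
proof induction
  case empty
  have z: "\<phi> (zer A B) \<Colon> A' \<leadsto> B'" using assms(2,3,5) by simp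
  moreover have "\<phi> (zer A B) \<boxplus> \<phi> (zer A B) = \<phi> (zer A B)"
    using assms(2,3) assms(6)[of "zer A B" "zer A B"] by simp
  ultimately have "\<phi> (zer A B) = zer A' B'" using plus_idem_zer by metis
  moreover have "A' \<in> Obj C" "B' \<in> Obj C" using z by auto
  ultimately show ?case using assms(2,3) by simp
next
  case (insert i I)
  then show ?case
    using assms(2,3,5,6) by (simp add: asum_insert arr_asum)
qed

lemma cmp_asum_right:
  assumes "finite I" "\<And>i. i \<in> I \<Longrightarrow> F i \<Colon> A \<leadsto> B" "g \<Colon> B \<leadsto> D" "A \<in> Obj C"
  shows "g \<cdot> asum A B F I = asum A D (\<lambda>i. g \<cdot> F i) I"
proof -
  have "B \<in> Obj C" using assms(3) by auto
  then show ?thesis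
    using assms by (intro asum_linear) (auto simp: cmp_plus_right)
qed

lemma cmp_asum_left:
  assumes "finite I" "\<And>i. i \<in> I \<Longrightarrow> F i \<Colon> A \<leadsto> B" "g \<Colon> D \<leadsto> A" "B \<in> Obj C"
  shows "asum A B F I \<cdot> g = asum D B (\<lambda>i. F i \<cdot> g) I"
proof -
  have "A \<in> Obj C" using assms(3) by auto
  then show ?thesis
    using assms by (intro asum_linear[where \<phi> = "\<lambda>f. f \<cdot> g"]) (auto simp: cmp_plus_left)
qed

lemma asum_zer: "finite I \<Longrightarrow> A \<in> Obj C \<Longrightarrow> B \<in> Obj C \<Longrightarrow> asum A B (\<lambda>i. zer A B) I = zer A B"
  by (induction rule: finite_induct) (simp_all add: asum_insert)

lemma asum_neutral:
  assumes "finite I" "J \<subseteq> I" "A \<in> Obj C" "B \<in> Obj C"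
    and "\<And>i. i \<in> J \<Longrightarrow> F i \<Colon> A \<leadsto> B" "\<And>i. i \<in> I - J \<Longrightarrow> F i = zer A B"
  shows "asum A B F I = asum A B F J"
proof -
  have "finite J" using assms(1,2) by (rule finite_subset[rotated])
  have "asum A B F (J \<union> K) = asum A B F J" if "finite K" "K \<subseteq> I - J" for K
    using that
  proof induction
    case (insert i K)
    have "asum A B F (insert i (J \<union> K)) = F i \<boxplus> asum A B F (J \<union> K)"
      using insert assms \<open>finite J\<close> by (intro asum_insert) auto
    also have "\<dots> = asum A B F J"
      using insert assms by (auto simp: arr_asum)
    finally show ?case by simp
  qed simp
  moreover have "I = J \<union> (I - J)" using assms(2) by auto
  ultimately show ?thesis using assms(1) by (metis finite_Diff order_refl)
qed

lemma asum_singleton: "F i \<Colon> A \<leadsto> B \<Longrightarrow> asum A B F {i} = F i"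
  by (subst asum_insert) auto

lemma asum_single:
  assumes "finite I" "j \<in> I" "F j \<Colon> A \<leadsto> B" "\<And>i. i \<in> I \<Longrightarrow> i \<noteq> j \<Longrightarrow> F i = zer A B"
  shows "asum A B F I = F j"
proof -
  have "A \<in> Obj C" "B \<in> Obj C" using assms(3) by auto
  then show ?thesis
    using assms asum_neutral[of I "{j}" A B F] asum_singleton[of F j A B] by auto
qed

lemma asum_Un:
  assumes "finite I" "finite J" "I \<inter> J = {}" "A \<in> Obj C" "B \<in> Obj C" "\<And>i. i \<in> I \<union> J \<Longrightarrow> F i \<Colon> A \<leadsto> B"
  shows "asum A B F (I \<union> J) = asum A B F I \<boxplus> asum A B F J"
  using assms(1,3,6)
proof (induction)
  case empty
  then show ?case using assms by (auto simp: arr_asum)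
next
  case (insert i I)
  have "asum A B F (insert i (I \<union> J)) = F i \<boxplus> asum A B F (I \<union> J)"
    using insert.hyps insert.prems assms(2) by (intro asum_insert) auto
  also have "\<dots> = (F i \<boxplus> asum A B F I) \<boxplus> asum A B F J"
    using insert assms by (simp add: plus_assoc)
  also have "F i \<boxplus> asum A B F I = asum A B F (insert i I)"
    using insert.hyps insert.prems by (intro asum_insert[symmetric]) auto
  finally show ?case by simp
qed

lemma asum_UN:
  fixes J :: "'i \<Rightarrow> 'j set"
  assumes "finite I" "\<And>i. i \<in> I \<Longrightarrow> finite (J i)" "\<And>i j. i \<in> I \<Longrightarrow> j \<in> I \<Longrightarrow> i \<noteq> j \<Longrightarrow> J i \<inter> J j = {}"
    "A \<in> Obj C" "B \<in> Obj C" "\<And>i j. i \<in> I \<Longrightarrow> j \<in> J i \<Longrightarrow> F j \<Colon> A \<leadsto> B"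
  shows "asum A B F (\<Union>i\<in>I. J i) = asum A B (\<lambda>i. asum A B F (J i)) I"
  using assms(1,2,3,6)
proof induction
  case empty
  then show ?case using assms by simp
next
  case (insert i I)
  have "J i \<inter> (\<Union>i\<in>I. J i) = {}" using insert(2,5) by fastforce
  then have "asum A B F (J i \<union> (\<Union>i\<in>I. J i)) = asum A B F (J i) \<boxplus> asum A B F (\<Union>i\<in>I. J i)"
  proof (intro asum_Un)
    show "F j \<Colon> A \<leadsto> B" if "j \<in> J i \<union> (\<Union>i\<in>I. J i)" for j
      using that insert(6) by blast
  qed (use insert(1,4) assms(4,5) in auto)
  also have "asum A B F (\<Union>i\<in>I. J i) = asum A B (\<lambda>i. asum A B F (J i)) I"
    by (rule insert(3)) (use insert(4-6) in blast)+
  also have "asum A B F (J i) \<boxplus> asum A B (\<lambda>i. asum A B F (J i)) I = asum A B (\<lambda>i. asum A B F (J i)) (insert i I)"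
  proof (rule asum_insert[symmetric])
    have "arr (asum A B F (J k))" if "k \<in> insert i I" for k
      using insert(6) that assms(4,5) by (intro arr_asum) blast+
    then show "asum A B F (J i) \<Colon> A \<leadsto> B" "\<And>k. k \<in> I \<Longrightarrow> asum A B F (J k) \<Colon> A \<leadsto> B" by auto
  qed (use insert(1,2) in auto)
  finally show ?case by simp
qed

lemma asum_reindex:
  assumes "inj_on h I" "\<And>i. i \<in> I \<Longrightarrow> F (h i) \<Colon> A \<leadsto> B" "A \<in> Obj C" "B \<in> Obj C"
  shows "asum A B F (h ` I) = asum A B (\<lambda>i. F (h i)) I"
proof -
  interpret abelian_group "Hom C A B" using assms by (auto simp: Hom_abelian)
  have "(\<lambda>i. mor (F i)) \<in> h ` I \<rightarrow> Arr C A B" using assms by (force simp del: arr_obj simp: arr_def)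
  then show ?thesis using finsum_reindex[of "\<lambda>i. mor (F i)" h I] assms(1) by (simp add: asum_def)
qed

lemma cmp_Arrow: "Arrow B' g D \<cdot> Arrow A f B = Arrow A (g \<bullet> f) D"
  by (simp add: cmp_def)

section \<open>Isomorphisms, zero objects and kernels\<close>

lemma is_iso_iff:
  "A \<in> Obj C \<Longrightarrow> B \<in> Obj C \<Longrightarrow> is_iso C A B f \<longleftrightarrow>
   arr (Arrow A f B) \<and> (\<exists>g. g \<Colon> B \<leadsto> A \<and> g \<cdot> Arrow A f B = ide A \<and> Arrow A f B \<cdot> g = ide B)"
  unfolding is_iso_def inverse_arrows_def
  by (auto simp del: arr_obj simp: arr_def cmp_def ide_def) (metis arrow.sel)

definition aiso where "aiso f \<longleftrightarrow> arr f \<and> (\<exists>g. g \<Colon> tgt f \<leadsto> src f \<and> g \<cdot> f = ide (src f) \<and> f \<cdot> g = ide (tgt f))"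

definition ainv where "ainv f = Arrow (tgt f) (inv_arr C (src f) (tgt f) (mor f)) (src f)"

lemma is_iso_aiso: "A \<in> Obj C \<Longrightarrow> B \<in> Obj C \<Longrightarrow> is_iso C A B f \<longleftrightarrow> aiso (Arrow A f B)"
  by (simp add: is_iso_iff aiso_def)

lemma aiso_arr [simp]: "aiso f \<Longrightarrow> arr f" by (simp add: aiso_def)

lemma aisoI: "arr f \<Longrightarrow> g \<Colon> tgt f \<leadsto> src f \<Longrightarrow> g \<cdot> f = ide (src f) \<Longrightarrow> f \<cdot> g = ide (tgt f) \<Longrightarrow> aiso f"
  unfolding aiso_def by blast

text \<open>\<open>inv_arr\<close> is a definite description. Once it is identified here, only the
  equations of an inverse are used.\<close>

lemma ainv_unique:
  assumes "arr f" "g \<Colon> tgt f \<leadsto> src f" "g \<cdot> f = ide (src f)" "f \<cdot> g = ide (tgt f)"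
  shows "ainv f = g"
proof -
  have "inv_arr C (src f) (tgt f) (mor f) = mor g"
    unfolding inv_arr_def
  proof (rule the_equality)
    show "inverse_arrows C (src f) (tgt f) (mor f) (mor g)"
      using assms unfolding inverse_arrows_def by (auto simp del: arr_obj simp: arr_def cmp_def ide_def)
  next
    fix g' assume g': "inverse_arrows C (src f) (tgt f) (mor f) g'"
    let ?g' = "Arrow (tgt f) g' (src f)"
    have "?g' \<Colon> tgt f \<leadsto> src f" "?g' \<cdot> f = ide (src f)"
      using g' assms(1) unfolding inverse_arrows_def by (auto simp del: arr_obj simp: arr_def cmp_def ide_def)
    then have "?g' \<cdot> (f \<cdot> g) = ide (src f) \<cdot> g"
      using assms by (intro cmp_rewrite) auto
    then have "?g' = g" using assms \<open>?g' \<Colon> tgt f \<leadsto> src f\<close> by simp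
    then show "g' = mor g" by (metis arrow.sel(2))
  qed
  then show ?thesis using assms(2) by (cases g) (auto simp: ainv_def)
qed

lemma
  assumes "aiso f"
  shows arr_ainv [simp]: "arr (ainv f)" and ainv_cmp: "ainv f \<cdot> f = ide (src f)" and cmp_ainv: "f \<cdot> ainv f = ide (tgt f)"
proof -
  obtain g where "g \<Colon> tgt f \<leadsto> src f" "g \<cdot> f = ide (src f)" "f \<cdot> g = ide (tgt f)"
    using assms unfolding aiso_def by blast
  then show "arr (ainv f)" "ainv f \<cdot> f = ide (src f)" "f \<cdot> ainv f = ide (tgt f)"
    using ainv_unique[of f g] assms by simp_all
qed

lemma src_ainv [simp]: "src (ainv f) = tgt f" "tgt (ainv f) = src f"
  by (simp_all add: ainv_def)

lemma cmp_ainv_cancel [simp]: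
  "aiso f \<Longrightarrow> arr k \<Longrightarrow> tgt k = src f \<Longrightarrow> ainv f \<cdot> (f \<cdot> k) = k"
  "aiso f \<Longrightarrow> arr k \<Longrightarrow> tgt k = tgt f \<Longrightarrow> f \<cdot> (ainv f \<cdot> k) = k"
  by (subst cmp_rewrite[OF ainv_cmp]; simp) (subst cmp_rewrite[OF cmp_ainv]; simp)

lemma aiso_ainv [simp]: "aiso f \<Longrightarrow> aiso (ainv f)"
  by (rule aisoI[of _ f]) (auto simp: ainv_cmp cmp_ainv)

text \<open>A left and a right inverse coincide. The lemma is meant for situations in which the two
  come from different constructions.\<close>

lemma aiso_split:
  assumes "arr f" "g \<Colon> tgt f \<leadsto> src f" "g' \<Colon> tgt f \<leadsto> src f" "g \<cdot> f = ide (src f)" "f \<cdot> g' = ide (tgt f)"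
  shows "aiso f"
proof -
  have "g \<cdot> (f \<cdot> g') = ide (src f) \<cdot> g'"
    using assms by (intro cmp_rewrite) auto
  then have "g = g'" using assms by simp
  then show ?thesis using assms by (auto intro: aisoI)
qed

lemma cmp_cancel_right:
  assumes "f \<cdot> k = g \<cdot> k" "aiso k" "arr f" "arr g" "src f = tgt k" "src g = tgt k"
  shows "f = g"
proof -
  have "(f \<cdot> k) \<cdot> ainv k = (g \<cdot> k) \<cdot> ainv k" by (simp add: assms(1))
  then show ?thesis using assms(2-) by (simp add: cmp_ainv)
qed

lemma cmp_cancel_left:
  assumes "k \<cdot> f = k \<cdot> g" "aiso k" "arr f" "arr g" "tgt f = src k" "tgt g = src k"
  shows "f = g"
proof -
  have "ainv k \<cdot> (k \<cdot> f) = ainv k \<cdot> (k \<cdot> g)" by (simp add: assms(1))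
  then show ?thesis using assms(2-) by simp
qed

text \<open>If the identity vanishes, so does every arrow into or out of the object. The equational
  form also makes sense for full subcategories and equivariantizations, which share identities and
  zero arrows with \<open>C\<close>.\<close>

lemma zero_object_iff: "zero_object C Z \<longleftrightarrow> Z \<in> Obj C \<and> ide Z = zer Z Z"
proof
  assume Z: "zero_object C Z"
  then have "\<exists>!f. f \<in> Arr C Z Z" unfolding zero_object_def by blast
  then show "Z \<in> Obj C \<and> ide Z = zer Z Z"
    using Z Idn_closed arr_zer[of Z Z] by (auto simp del: arr_obj simp: zero_object_def ide_def zer_def arr_def)
next
  assume Z: "Z \<in> Obj C \<and> ide Z = zer Z Z"
  have 1: "f \<in> Arr C A Z \<longleftrightarrow> f = \<zero>\<^bsub>Hom C A Z\<^esub>" if "A \<in> Obj C" for A f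
  proof
    assume "f \<in> Arr C A Z"
    then have "ide Z \<cdot> Arrow A f Z = Arrow A f Z" using Z that by (intro ide_cmp) (auto simp del: arr_obj simp: arr_def)
    moreover have "zer Z Z \<cdot> Arrow A f Z = zer A Z" using Z that \<open>f \<in> _\<close> by (subst zer_cmp) (auto simp del: arr_obj simp: arr_def)
    ultimately show "f = \<zero>\<^bsub>Hom C A Z\<^esub>" using Z by (simp add: zer_def)
  qed (use arr_zer[of A Z] that Z in \<open>auto simp del: arr_obj simp: arr_def zer_def\<close>)
  have 2: "f \<in> Arr C Z A \<longleftrightarrow> f = \<zero>\<^bsub>Hom C Z A\<^esub>" if "A \<in> Obj C" for A f
  proof
    assume "f \<in> Arr C Z A"
    then have "Arrow Z f A \<cdot> ide Z = Arrow Z f A" using Z that by (intro cmp_ide) (auto simp del: arr_obj simp: arr_def)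
    moreover have "Arrow Z f A \<cdot> zer Z Z = zer Z A" using Z that \<open>f \<in> _\<close> by (subst cmp_zer) (auto simp del: arr_obj simp: arr_def)
    ultimately show "f = \<zero>\<^bsub>Hom C Z A\<^esub>" using Z by (simp add: zer_def)
  qed (use arr_zer[of Z A] that Z in \<open>auto simp del: arr_obj simp: arr_def zer_def\<close>)
  show "zero_object C Z" unfolding zero_object_def using Z 1 2 by auto
qed

text \<open>Uniqueness in the universal property becomes cancellability of the kernel arrow: two
  arrows with the same composite are both factorizations of that composite, which \<open>f\<close>
  kills.\<close>

lemma is_kernelD:
  assumes "is_kernel C A B f K i" "A \<in> Obj C" "B \<in> Obj C"
  shows "Arrow A f B \<Colon> A \<leadsto> B" "Arrow K i A \<Colon> K \<leadsto> A" "Arrow A f B \<cdot> Arrow K i A = zer K B"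
    and "\<And>g. arr g \<Longrightarrow> tgt g = A \<Longrightarrow> Arrow A f B \<cdot> g = zer (src g) B \<Longrightarrow> \<exists>h. h \<Colon> src g \<leadsto> K \<and> Arrow K i A \<cdot> h = g"
    and "\<And>h h'. arr h \<Longrightarrow> arr h' \<Longrightarrow> tgt h = K \<Longrightarrow> tgt h' = K \<Longrightarrow> src h = src h' \<Longrightarrow>
      Arrow K i A \<cdot> h = Arrow K i A \<cdot> h' \<Longrightarrow> h = h'"
proof -
  note k = assms(1)[unfolded is_kernel_def]
  show 0: "Arrow A f B \<Colon> A \<leadsto> B" "Arrow K i A \<Colon> K \<leadsto> A" "Arrow A f B \<cdot> Arrow K i A = zer K B"
    using k assms(2,3) by (auto simp del: arr_obj simp: arr_def cmp_def zer_def)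
  show "\<exists>h. h \<Colon> src g \<leadsto> K \<and> Arrow K i A \<cdot> h = g" if "arr g" "tgt g = A" "Arrow A f B \<cdot> g = zer (src g) B" for g
  proof -
    have "src g \<in> Obj C" "mor g \<in> Arr C (src g) A" "f \<bullet> mor g = \<zero>\<^bsub>Hom C (src g) B\<^esub>"
      using that by (auto simp del: arr_obj simp: arr_def cmp_def zer_def)
    then obtain h where "h \<in> Arr C (src g) K" "i \<bullet> h = mor g" using k by blast
    then show ?thesis using that k by (intro exI[of _ "Arrow (src g) h K"], cases g) (auto simp del: arr_obj simp: arr_def cmp_def)
  qed
  show "h = h'" if h: "arr h" "arr h'" "tgt h = K" "tgt h' = K" "src h = src h'" "Arrow K i A \<cdot> h = Arrow K i A \<cdot> h'" for h h'
  proof -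
    have a: "arr (Arrow K i A \<cdot> h')" using 0 h by auto
    have "Arrow A f B \<cdot> (Arrow K i A \<cdot> h') = zer (src h') B"
      using 0 h assms(3) by (subst cmp_rewrite[OF 0(3)]) auto
    then have "src h \<in> Obj C" "mor (Arrow K i A \<cdot> h') \<in> Arr C (src h) A"
      "f \<bullet> mor (Arrow K i A \<cdot> h') = \<zero>\<^bsub>Hom C (src h) B\<^esub>"
      using a h unfolding cmp_def zer_def arr_def by auto
    moreover have "mor h \<in> Arr C (src h) K" "mor h' \<in> Arr C (src h) K"
       "i \<bullet> mor h = mor (Arrow K i A \<cdot> h')" "i \<bullet> mor h' = mor (Arrow K i A \<cdot> h')"
      using h by (auto simp del: arr_obj simp: arr_def cmp_def)
    ultimately have "mor h = mor h'" using k by blast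
    then show ?thesis using h by (cases h; cases h') auto
  qed
qed

end

section \<open>Semisimplicity and splitting\<close>

context linear_category
begin

lemma is_biproductD:
  assumes "is_biproduct C I X P \<iota> \<pi>"
  defines "j \<equiv> \<lambda>i. Arrow (X i) (\<iota> i) P" and "p \<equiv> \<lambda>i. Arrow P (\<pi> i) (X i)"
  shows "finite I" "P \<in> Obj C" "\<And>i. i \<in> I \<Longrightarrow> X i \<in> Obj C" "\<And>i. i \<in> I \<Longrightarrow> j i \<Colon> X i \<leadsto> P" "\<And>i. i \<in> I \<Longrightarrow> p i \<Colon> P \<leadsto> X i"
    "\<And>i k. i \<in> I \<Longrightarrow> k \<in> I \<Longrightarrow> p k \<cdot> j i = (if i = k then ide (X i) else zer (X i) (X k))"
    "asum P P (\<lambda>i. j i \<cdot> p i) I = ide P"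
  using assms(1) unfolding is_biproduct_def
  by (auto simp del: arr_obj simp: j_def p_def arr_def cmp_def ide_def zer_def asum_def)

lemma is_biproductI:
  assumes "finite I" "P \<in> Obj C" "\<And>i. i \<in> I \<Longrightarrow> j i \<Colon> X i \<leadsto> P" "\<And>i. i \<in> I \<Longrightarrow> p i \<Colon> P \<leadsto> X i"
    "\<And>i k. i \<in> I \<Longrightarrow> k \<in> I \<Longrightarrow> p k \<cdot> j i = (if i = k then ide (X i) else zer (X i) (X k))"
    "asum P P (\<lambda>i. j i \<cdot> p i) I = ide P"
  shows "is_biproduct C I X P (\<lambda>i. mor (j i)) (\<lambda>i. mor (p i))"
proof -
  have "mor (j i) \<in> Arr C (X i) P \<and> mor (p i) \<in> Arr C P (X i) \<and> X i \<in> Obj C" if "i \<in> I" for i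
    using assms(3,4)[OF that] by (auto simp del: arr_obj simp: arr_def)
  moreover have "mor (p k) \<bullet> mor (j i) = (if i = k then Idn C (X i) else \<zero>\<^bsub>Hom C (X i) (X k)\<^esub>)" if "i \<in> I" "k \<in> I" for i k
    using arg_cong[OF assms(5)[OF that], of mor] by (auto simp: cmp_def ide_def zer_def)
  moreover have "finsum (Hom C P P) (\<lambda>i. mor (j i) \<bullet> mor (p i)) I = Idn C P"
    using arg_cong[OF assms(6), of mor] by (auto simp: cmp_def ide_def asum_def)
  ultimately show ?thesis unfolding is_biproduct_def using assms(1,2) by auto
qed

lemma is_biproductE:
  assumes "is_biproduct C I X P \<iota> \<pi>"
  obtains j p where "\<iota> = (\<lambda>i. mor (j i))" "\<pi> = (\<lambda>i. mor (p i))" "finite I" "P \<in> Obj C"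
    "\<And>i. i \<in> I \<Longrightarrow> X i \<in> Obj C" "\<And>i. i \<in> I \<Longrightarrow> j i \<Colon> X i \<leadsto> P" "\<And>i. i \<in> I \<Longrightarrow> p i \<Colon> P \<leadsto> X i"
    "\<And>i k. i \<in> I \<Longrightarrow> k \<in> I \<Longrightarrow> p k \<cdot> j i = (if i = k then ide (X i) else zer (X i) (X k))"
    "asum P P (\<lambda>i. j i \<cdot> p i) I = ide P"
  using that[OF _ _ is_biproductD[OF assms]] by auto

lemma is_mono_iff:
  "A \<in> Obj C \<Longrightarrow> B \<in> Obj C \<Longrightarrow> is_mono C A B f \<longleftrightarrow> arr (Arrow A f B) \<and>
    (\<forall>g h. arr g \<and> arr h \<and> tgt g = A \<and> tgt h = A \<and> src g = src h \<and> Arrow A f B \<cdot> g = Arrow A f B \<cdot> h \<longrightarrow> g = h)"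
  (is "_ \<Longrightarrow> _ \<Longrightarrow> ?L \<longleftrightarrow> ?R")
proof
  assume AB: "A \<in> Obj C" "B \<in> Obj C"
  {
    assume ?L
    then show ?R unfolding is_mono_def using AB by (auto simp del: arr_obj simp: arr_def cmp_def intro: arrow.expand)
  next
    assume R: ?R
    have "g = h" if "X \<in> Obj C" "g \<in> Arr C X A" "h \<in> Arr C X A" "f \<bullet> g = f \<bullet> h" for X g h
      using R[THEN conjunct2, rule_format, of "Arrow X g A" "Arrow X h A"] that AB by (simp del: arr_obj add: arr_def cmp_def)
    then show ?L unfolding is_mono_def using R by (auto simp del: arr_obj simp: arr_def)
  }
qed

end

context abelian_category
begin

lemma ex_kernel_arrow:
  assumes "arr f"
  obtains i where "arr i" "tgt i = src f" "f \<cdot> i = zer (src i) (tgt f)"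
    "\<And>g. arr g \<Longrightarrow> tgt g = src f \<Longrightarrow> f \<cdot> g = zer (src g) (tgt f) \<Longrightarrow> \<exists>h. h \<Colon> src g \<leadsto> src i \<and> i \<cdot> h = g"
    "\<And>h h'. \<lbrakk>arr h; arr h'; tgt h = src i; tgt h' = src i; src h = src h'; i \<cdot> h = i \<cdot> h'\<rbrakk> \<Longrightarrow> h = h'"
proof -
  obtain K i where i: "is_kernel C (src f) (tgt f) (mor f) K i"
    using ex_kernel[of "src f" "tgt f" "mor f"] assms by (auto simp del: arr_obj simp: arr_def)
  have o: "src f \<in> Obj C" "tgt f \<in> Obj C" using assms by auto
  have "f = Arrow (src f) (mor f) (tgt f)" by simp
  with is_kernelD[OF i o] show ?thesis
    by (intro that[of "Arrow K i (src f)"]) auto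
qed

text \<open>The kernel of a nonzero arrow is not the whole of the simple source, hence is zero. The
  arrow is then mono, and a mono with nonzero source into a simple object is an isomorphism.\<close>

lemma Schur:
  assumes S: "simple_object C S" "simple_object C S'" and f: "f \<Colon> S \<leadsto> S'" "f \<noteq> zer S S'"
  shows "aiso f"
proof -
  obtain i where i: "arr i" "tgt i = src f" "f \<cdot> i = zer (src i) (tgt f)"
    "\<And>g. arr g \<Longrightarrow> tgt g = src f \<Longrightarrow> f \<cdot> g = zer (src g) (tgt f) \<Longrightarrow> \<exists>h. h \<Colon> src g \<leadsto> src i \<and> i \<cdot> h = g"
    "\<And>h h'. \<lbrakk>arr h; arr h'; tgt h = src i; tgt h' = src i; src h = src h'; i \<cdot> h = i \<cdot> h'\<rbrakk> \<Longrightarrow> h = h'"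
    using f(1) by (blast elim: ex_kernel_arrow)
  have Si: "S \<in> Obj C" "S' \<in> Obj C" "src i \<in> Obj C" using f(1) i(1) by auto
  have ii: "Arrow (src i) (mor i) S = i" using i(2) f(1) by (cases i) auto
  have ff: "Arrow S (mor f) S' = f" using f(1) by (cases f) auto
  have "is_mono C (src i) S (mor i)"
    using i(1,2,5) f(1) Si by (auto simp: is_mono_iff ii)
  then have "zero_object C (src i) \<or> is_iso C (src i) S (mor i)"
    using S(1) Si unfolding simple_object_def by blast
  moreover have "\<not> is_iso C (src i) S (mor i)"
  proof
    assume "is_iso C (src i) S (mor i)"
    then have iso: "aiso i" using is_iso_aiso[of "src i" S "mor i"] Si ii by simp
    have "f \<cdot> (i \<cdot> ainv i) = zer (src i) (tgt f) \<cdot> ainv i"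
      using i f(1) iso by (intro cmp_rewrite) auto
    then show False using f i(2) iso Si by (auto simp: cmp_ainv)
  qed
  ultimately have K: "ide (src i) = zer (src i) (src i)" by (simp add: zero_object_iff)
  have "is_mono C S S' (mor f)"
    unfolding is_mono_iff[OF Si(1,2)] ff
  proof (intro conjI allI impI)
    fix g h assume gh: "arr g \<and> arr h \<and> tgt g = S \<and> tgt h = S \<and> src g = src h \<and> f \<cdot> g = f \<cdot> h"
    \<comment> \<open>Two arrows that become equal after \<open>f\<close> have a difference that
      factors through the kernel, which is a zero object.\<close>
    have "f \<cdot> (g \<boxminus> h) = zer (src g) (tgt f)"
      using gh f(1) by (simp add: cmp_sub_right sub_self)
    then obtain k where k: "k \<Colon> src g \<leadsto> src i" "i \<cdot> k = g \<boxminus> h"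
      using i(4)[of "g \<boxminus> h"] gh f(1) by auto
    have "k = zer (src g) (src i)" using k(1) K zer_cmp[of k "src i" "src i"] ide_cmp[of k "src i"] Si by auto
    with k(2) have "g \<boxminus> h = i \<cdot> zer (src g) (src i)" by simp
    also have "\<dots> = zer (src g) (tgt i)" using gh i(1) by (intro trans[OF cmp_zer]) auto
    finally have "g \<boxminus> h = zer (src g) S" using i(2) f(1) by simp
    then have "g \<boxminus> h = zer (src g) (tgt g)" using gh by metis
    moreover have "arr g" "arr h" "src h = src g" "tgt h = tgt g" using gh by metis+
    ultimately show "g = h" by (rule sub_eq_zerD)
  qed (use f in auto)
  then have "zero_object C S \<or> is_iso C S S' (mor f)"
    using S(2) Si unfolding simple_object_def by blast
  then show ?thesis using S(1) is_iso_aiso[OF Si(1,2), of "mor f"] ff by (auto simp: simple_object_def)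
qed

end

context semisimple_category
begin

text \<open>Gaussian elimination: each step removes one simple summand of the source on which \<open>f\<close> does not vanish.\<close>

lemma von_Neumann_regular:
  assumes "f \<Colon> A \<leadsto> B"
  shows "\<exists>g. g \<Colon> B \<leadsto> A \<and> f \<cdot> g \<cdot> f = f"
proof -
  have AB: "A \<in> Obj C" "B \<in> Obj C" using assms by auto
  obtain n :: nat and S \<iota> \<pi> where S: "\<forall>i<n. simple_object C (S i)" "is_biproduct C {..<n} S A \<iota> \<pi>"
    using semisimple[OF AB(1)] by blast
  obtain m :: nat and S' \<iota>' \<pi>' where S': "\<forall>i<m. simple_object C (S' i)" "is_biproduct C {..<m} S' B \<iota>' \<pi>'"
    using semisimple[OF AB(2)] by blast
  from S(2) obtain j p where j: "\<And>i. i < n \<Longrightarrow> S i \<in> Obj C" "\<And>i. i < n \<Longrightarrow> j i \<Colon> S i \<leadsto> A" "\<And>i. i < n \<Longrightarrow> p i \<Colon> A \<leadsto> S i"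
    "asum A A (\<lambda>i. j i \<cdot> p i) {..<n} = ide A" by (rule is_biproductE) (auto simp: lessThan_iff)
  from S'(2) obtain j' p' where j': "\<And>i. i < m \<Longrightarrow> S' i \<in> Obj C" "\<And>i. i < m \<Longrightarrow> j' i \<Colon> S' i \<leadsto> B" "\<And>i. i < m \<Longrightarrow> p' i \<Colon> B \<leadsto> S' i"
    "asum B B (\<lambda>i. j' i \<cdot> p' i) {..<m} = ide B" by (rule is_biproductE) (auto simp: lessThan_iff)
  show ?thesis using assms
  proof (induction "card {i. i < n \<and> f \<cdot> j i \<noteq> zer (S i) B}" arbitrary: f rule: less_induct)
    case (less f)
    show ?case
    proof (cases "\<exists>i<n. f \<cdot> j i \<noteq> zer (S i) B")
      case False
      have "f = f \<cdot> asum A A (\<lambda>i. j i \<cdot> p i) {..<n}" using less(2) j(4) by simp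
      also have "\<dots> = asum A B (\<lambda>i. f \<cdot> (j i \<cdot> p i)) {..<n}"
        using j less(2) AB by (intro cmp_asum_right) auto
      also have "\<dots> = asum A B (\<lambda>i. zer A B) {..<n}"
      proof (rule asum_cong)
        fix i assume "i \<in> {..<n}"
        then show "f \<cdot> (j i \<cdot> p i) = zer A B"
          using False j less(2) AB by (subst cmp_rewrite[of f "j i" "zer (S i) B"]) auto
      qed (use j less(2) AB in auto)
      also have "\<dots> = zer A B" using AB by (simp add: asum_zer)
      finally show ?thesis using AB by (intro exI[of _ "zer B A"]) simp
    next
      case True
      then obtain i where i: "i < n" "f \<cdot> j i \<noteq> zer (S i) B" by blast
      note ji = j(1-3)[OF i(1)]
      have "\<exists>k<m. p' k \<cdot> (f \<cdot> j i) \<noteq> zer (S i) (S' k)"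
      proof (rule ccontr)
        assume k: "\<not> (\<exists>k<m. p' k \<cdot> (f \<cdot> j i) \<noteq> zer (S i) (S' k))"
        then have z: "p' k \<cdot> (f \<cdot> j i) = zer (S i) (S' k)" if "k < m" for k using that k by blast
        have "f \<cdot> j i = asum B B (\<lambda>i. j' i \<cdot> p' i) {..<m} \<cdot> (f \<cdot> j i)" using less(2) j'(4) ji by simp
        also have "\<dots> = asum (S i) B (\<lambda>k. (j' k \<cdot> p' k) \<cdot> (f \<cdot> j i)) {..<m}"
          using j' less(2) AB ji by (intro cmp_asum_left) auto
        also have "\<dots> = asum (S i) B (\<lambda>i'. zer (S i) B) {..<m}"
        proof (rule asum_cong)
          fix k assume "k \<in> {..<m}"
          then show "(j' k \<cdot> p' k) \<cdot> (f \<cdot> j i) = zer (S i) B"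
            using z[of k] j'(1-3)[of k] less(2) ji by simp
        qed (use j' less(2) AB ji in auto)
        also have "\<dots> = zer (S i) B" using AB ji by (simp add: asum_zer)
        finally show False using i by simp
      qed
      then obtain k where k: "k < m" "p' k \<cdot> (f \<cdot> j i) \<noteq> zer (S i) (S' k)" by blast
      note jk = j'(1-3)[OF k(1)]
      \<comment> \<open>The pivot: a nonzero entry of the matrix of \<open>f\<close> with respect to
        the two decompositions, invertible by Schur's lemma. \<open>g0\<close> will be a partial
        inverse built from it.\<close>
      define u where "u = p' k \<cdot> f \<cdot> j i"
      have u: "u \<Colon> S i \<leadsto> S' k" using less(2) ji jk by (auto simp: u_def)
      have iso: "aiso u" by (rule Schur[of "S i" "S' k"]) (use S S' i k u in \<open>auto simp: u_def\<close>)
      define g0 where "g0 = j i \<cdot> ainv u \<cdot> p' k"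
      have g0: "g0 \<Colon> B \<leadsto> A" using iso u ji jk by (auto simp: g0_def)
      have g0u: "g0 \<cdot> f \<cdot> j i = j i"
        using iso u ji jk less(2) by (simp add: g0_def u_def[symmetric] ainv_cmp)
      \<comment> \<open>Subtraction kills the column of the pivot and leaves the columns that were
        already zero untouched, so the number of nonzero columns drops.\<close>
      define f1 where "f1 = f \<boxminus> f \<cdot> g0 \<cdot> f"
      have f1: "f1 \<Colon> A \<leadsto> B" using g0 less(2) by (auto simp: f1_def)
      have f1j: "f1 \<cdot> j l = f \<cdot> j l \<boxminus> f \<cdot> g0 \<cdot> f \<cdot> j l" if "l < n" for l
        using g0 less(2) j(1-3)[OF that] by (simp add: f1_def cmp_sub_left)
      have z1: "f1 \<cdot> j l = zer (S l) B" if "l < n" "f \<cdot> j l = zer (S l) B \<or> l = i" for l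
        using that f1j[OF that(1)] g0 less(2) j(1-3)[OF that(1)] AB g0u
          sub_self[of "f \<cdot> j l"] sub_self[of "zer (S l) B"] by auto
      have "card {i. i < n \<and> f1 \<cdot> j i \<noteq> zer (S i) B} < card {i. i < n \<and> f \<cdot> j i \<noteq> zer (S i) B}"
        using i z1 by (intro psubset_card_mono) auto
      then obtain y where y: "y \<Colon> B \<leadsto> A" "f1 \<cdot> y \<cdot> f1 = f1" using less(1) f1 by blast
      \<comment> \<open>Since \<open>f1\<close> equals both \<open>f \<cdot> a\<close> and
        \<open>b \<cdot> f\<close>, a generalized inverse \<open>y\<close> of \<open>f1\<close>
        yields one of \<open>f\<close>: conjugate \<open>y\<close> by \<open>a\<close> and
        \<open>b\<close> and add back \<open>g0\<close>, which accounts for the subtracted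
        part.\<close>
      define a where "a = ide A \<boxminus> g0 \<cdot> f"
      define b where "b = ide B \<boxminus> f \<cdot> g0"
      have ab: "a \<Colon> A \<leadsto> A" "b \<Colon> B \<leadsto> B" using AB g0 less(2) by (auto simp: a_def b_def)
      have fa: "f1 = f \<cdot> a" "f1 = b \<cdot> f"
        using AB g0 less(2) by (simp_all add: f1_def a_def b_def cmp_sub_left cmp_sub_right)
      have "f \<cdot> (a \<cdot> y \<cdot> b \<boxplus> g0) \<cdot> f = (f \<cdot> a) \<cdot> y \<cdot> (b \<cdot> f) \<boxplus> f \<cdot> g0 \<cdot> f"
        using ab g0 y less(2) by (simp add: cmp_plus_left cmp_plus_right)
      also have "\<dots> = f1 \<boxplus> f \<cdot> g0 \<cdot> f" unfolding fa[symmetric] y(2) ..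
      also have "\<dots> = f" using g0 less(2) by (simp add: f1_def sub_plus)
      finally show ?thesis using ab g0 y by (intro exI[of _ "a \<cdot> y \<cdot> b \<boxplus> g0"]) auto
    qed
  qed
qed

end

section \<open>Sets of objects in which idempotents split\<close>

context linear_category
begin

text \<open>The property common to \<open>Obj C\<close> and to the sets \<open>Cg g\<close> on which
  the later arguments rest. The splitting object is required to lie in \<open>D\<close> itself,
  since \<open>D\<close> need not contain all isomorphic objects.\<close>

definition idem_complete :: "'o set \<Rightarrow> bool" where
  "idem_complete D \<longleftrightarrow> D \<subseteq> Obj C \<and> (\<exists>Z\<in>D. ide Z = zer Z Z) \<and>
     (\<forall>e. arr e \<and> src e \<in> D \<and> tgt e = src e \<and> e \<cdot> e = e \<longrightarrow>
        (\<exists>i p. src i \<in> D \<and> i \<Colon> src i \<leadsto> src e \<and> p \<Colon> src e \<leadsto> src i \<and> p \<cdot> i = ide (src i) \<and> i \<cdot> p = e))"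

text \<open>The image of \<open>e\<close> is the kernel of \<open>1 - e\<close>. This kernel is
  taken in the full subcategory and has its universal property only for objects of \<open>D\<close>;
  it is applied to the kernel object and to the source of \<open>e\<close>, which both lie in
  \<open>D\<close>.\<close>

lemma idem_complete_full_subcategory:
  assumes ab: "abelian_category (full_subcategory C D)" and D: "D \<subseteq> Obj C"
  shows "idem_complete D"
  unfolding idem_complete_def
proof (intro conjI allI impI D)
  interpret D: abelian_category "full_subcategory C D" by fact
  obtain Z where "zero_object (full_subcategory C D) Z" using D.ex_zero_object by blast
  then have Z: "Z \<in> D" "\<exists>!f. f \<in> Arr C Z Z" by (auto simp: zero_object_def)
  then have "ide Z = zer Z Z"
    using D Idn_closed[of Z] arr_zer[of Z Z] by (auto simp del: arr_obj simp: ide_def zer_def arr_def)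
  with Z show "\<exists>Z\<in>D. ide Z = zer Z Z" by blast
  fix e assume e: "arr e \<and> src e \<in> D \<and> tgt e = src e \<and> e \<cdot> e = e"
  define f where "f = ide (src e) \<boxminus> e"
  have f: "f \<Colon> src e \<leadsto> src e" using e by (auto simp: f_def)
  have fe: "f \<cdot> e = zer (src e) (src e)" using e sub_self[of e] by (simp add: f_def cmp_sub_left)
  obtain K i where i: "is_kernel (full_subcategory C D) (src e) (src e) (mor f) K i"
    using D.ex_kernel[of "src e" "src e" "mor f"] e f by (auto simp del: arr_obj simp: arr_def)
  then have K: "K \<in> D" "i \<in> Arr C K (src e)" "mor f \<bullet> i = \<zero>\<^bsub>Hom C K (src e)\<^esub>"
    and u: "\<And>X g. X \<in> D \<Longrightarrow> g \<in> Arr C X (src e) \<Longrightarrow> mor f \<bullet> g = \<zero>\<^bsub>Hom C X (src e)\<^esub> \<Longrightarrow> \<exists>!h. h \<in> Arr C X K \<and> i \<bullet> h = g"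
    by (auto simp: is_kernel_def)
  have inj: "h = h'" if "h \<in> Arr C K K" "h' \<in> Arr C K K" "i \<bullet> h = i" "i \<bullet> h' = i" for h h'
    using u[OF K] that by blast
  define i' where "i' = Arrow K i (src e)"
  have i': "i' \<Colon> K \<leadsto> src e" "K \<in> Obj C" using K D e by (auto simp del: arr_obj simp: arr_def i'_def)
  have "f \<cdot> i' = zer K (src e)" using K f by (auto simp: i'_def cmp_def zer_def)
  then have "i' \<boxminus> e \<cdot> i' = zer (src i') (tgt i')" using e i' by (simp add: f_def cmp_sub_left)
  then have ei: "e \<cdot> i' = i'" using e i' sub_eq_zerD[of i' "e \<cdot> i'"] by simp
  have "mor f \<bullet> mor e = \<zero>\<^bsub>Hom C (src e) (src e)\<^esub>"
    using arg_cong[OF fe, of mor] by (simp add: cmp_def zer_def)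
  moreover have "mor e \<in> Arr C (src e) (src e)" using e by (auto simp del: arr_obj simp: arr_def)
  ultimately obtain p where p: "p \<in> Arr C (src e) K" "i \<bullet> p = mor e" using u e by blast
  define p' where "p' = Arrow (src e) p K"
  have p': "p' \<Colon> src e \<leadsto> K" "i' \<cdot> p' = e" using p e i' by (cases e; auto simp del: arr_obj simp: arr_def p'_def i'_def cmp_def)+
  have "i' \<cdot> (p' \<cdot> i') = i' \<cdot> ide K" using p' i' ei by (subst cmp_rewrite[OF p'(2)]) auto
  also have "\<dots> = i'" using i' by simp
  finally have "mor (i' \<cdot> (p' \<cdot> i')) = mor i'" "mor (i' \<cdot> ide K) = mor i'" using i' by simp_all
  then have "i \<bullet> mor (p' \<cdot> i') = i" "i \<bullet> mor (ide K) = i"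
    unfolding mor_cmp[of i'] by (simp_all add: i'_def)
  note 1 = this
  have 2: "mor (p' \<cdot> i') \<in> Arr C K K" "mor (ide K) \<in> Arr C K K"
    using arr_cmp[of p' i'] arr_ide[of K] p'(1) i' by (auto simp del: arr_obj simp: arr_def)
  have "mor (p' \<cdot> i') = mor (ide K)"
    by (rule inj) (rule 1 2)+
  then have "p' \<cdot> i' = ide K" using p'(1) i' by (intro arrow.expand) simp
  then show "\<exists>i p. src i \<in> D \<and> i \<Colon> src i \<leadsto> src e \<and> p \<Colon> src e \<leadsto> src i \<and> p \<cdot> i = ide (src i) \<and> i \<cdot> p = e"
    using p' i' K(1) by (intro exI[of _ i'] exI[of _ p']) auto
qed

lemma idem_completeE:
  assumes "idem_complete D" "e \<Colon> A \<leadsto> A" "e \<cdot> e = e" "A \<in> D"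
  obtains V i p where "V \<in> D" "i \<Colon> V \<leadsto> A" "p \<Colon> A \<leadsto> V" "p \<cdot> i = ide V" "i \<cdot> p = e"
  using assms unfolding idem_complete_def by metis

end

lemma (in abelian_category) idem_complete_Obj: "idem_complete (Obj C)"
  by (rule idem_complete_full_subcategory) (simp_all add: abelian_category_axioms)

section \<open>Equivariant objects and their exact sequences\<close>

lemma (in linear_category) natural_isoD:
  assumes "natural_iso C SO SA TO TA \<eta>" "\<And>A. A \<in> Obj C \<Longrightarrow> SO A \<in> Obj C" "\<And>A. A \<in> Obj C \<Longrightarrow> TO A \<in> Obj C"
  shows "A \<in> Obj C \<Longrightarrow> aiso (Arrow (SO A) (\<eta> A) (TO A))"
    and "arr f \<Longrightarrow> TA (mor f) \<bullet> \<eta> (src f) = \<eta> (tgt f) \<bullet> SA (mor f)"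
  using assms by (auto simp: natural_iso_def is_iso_aiso simp del: arr_obj simp: arr_def)

text \<open>The part of the setting that does not involve the grading. The record type of
  \<open>C\<close> is exactly \<open>moncat\<close>, as the definition of an equivariantization
  requires.\<close>

locale action = tensor_action C F T + semisimple_category C
  for C :: "('o, 'm, 'k::field) moncat" (structure)
    and F :: "('f, 'x) monoid_scheme"
    and T :: "('f, 'o, 'm) action_data"
begin

definition act :: "'f \<Rightarrow> ('o, 'm) arrow \<Rightarrow> ('o, 'm) arrow" where
  "act x f = Arrow (ActO T x (src f)) (ActA T x (mor f)) (ActO T x (tgt f))"

definition cp where "cp x y M = Arrow (ActO T x (ActO T y M)) (ActComp T x y M) (ActO T (x \<otimes>\<^bsub>F\<^esub> y) M)"

definition sact where "sact X h = Arrow (ActO T h (fst X)) (snd X h) (fst X)"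

abbreviation EO where "EO D H \<equiv> equivariant_objects C F T D H"
abbreviation EQ where "EQ D H \<equiv> equivariantization C F T D H"

definition eo where "eo H X \<longleftrightarrow> X \<in> EO (Obj C) H"

text \<open>\<open>X\<close> and \<open>Y\<close> may carry structures over groups larger than
  \<open>H\<close>. Thus an arrow from an object over a stabilizer to an object over
  \<open>F\<close> can be called equivariant without restricting the latter.\<close>

definition eqv where
  "eqv H X Y f \<longleftrightarrow> f \<Colon> fst X \<leadsto> fst Y \<and> (\<forall>h\<in>H. f \<cdot> sact X h = sact Y h \<cdot> act h f)"

lemma act_functor: "x \<in> carrier F \<Longrightarrow> linear_endofunctor C (ActO T x) (ActA T x)"
  by (rule linear_autoequivalence.axioms(1)[OF tensor_autoequivalence.axioms(2)[OF Act_tensor_autoequivalence]])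

lemma src_tgt_act [simp]:
  "src (act x f) = ActO T x (src f)" "tgt (act x f) = ActO T x (tgt f)"
  "src (cp x y M) = ActO T x (ActO T y M)" "tgt (cp x y M) = ActO T (x \<otimes>\<^bsub>F\<^esub> y) M"
  "src (sact X h) = ActO T h (fst X)" "tgt (sact X h) = fst X"
  by (simp_all add: act_def cp_def sact_def)

lemma ActO_closed [simp]: "x \<in> carrier F \<Longrightarrow> M \<in> Obj C \<Longrightarrow> ActO T x M \<in> Obj C"
  by (rule linear_endofunctor.TO_closed[OF act_functor])

lemma arr_act [simp]: "x \<in> carrier F \<Longrightarrow> arr f \<Longrightarrow> arr (act x f)"
  using linear_endofunctor.TA_closed[OF act_functor] by (auto simp del: arr_obj simp: arr_def act_def)

lemma act_cmp [simp]:
  "x \<in> carrier F \<Longrightarrow> arr f \<Longrightarrow> arr g \<Longrightarrow> src g = tgt f \<Longrightarrow> act x (g \<cdot> f) = act x g \<cdot> act x f"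
  using linear_endofunctor.TA_Comp[OF act_functor, of x "src f" "tgt f" "tgt g" "mor f" "mor g"]
  by (simp del: arr_obj add: arr_def act_def cmp_def)

lemma act_ide [simp]: "x \<in> carrier F \<Longrightarrow> A \<in> Obj C \<Longrightarrow> act x (ide A) = ide (ActO T x A)"
  using linear_endofunctor.TA_Idn[OF act_functor] by (simp add: act_def ide_def)

lemma act_plus [simp]:
  "x \<in> carrier F \<Longrightarrow> arr f \<Longrightarrow> arr g \<Longrightarrow> src g = src f \<Longrightarrow> tgt g = tgt f \<Longrightarrow> act x (f \<boxplus> g) = act x f \<boxplus> act x g"
  using linear_endofunctor.TA_add[OF act_functor, of x "src f" "tgt f" "mor f" "mor g"]
  by (simp del: arr_obj add: arr_def act_def plus_def)

lemma act_zer [simp]: "x \<in> carrier F \<Longrightarrow> A \<in> Obj C \<Longrightarrow> B \<in> Obj C \<Longrightarrow> act x (zer A B) = zer (ActO T x A) (ActO T x B)"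
  using plus_idem_zer[of "act x (zer A B)"] by (simp add: act_plus[symmetric])

lemma act_sub [simp]:
  "x \<in> carrier F \<Longrightarrow> arr f \<Longrightarrow> arr g \<Longrightarrow> src g = src f \<Longrightarrow> tgt g = tgt f \<Longrightarrow> act x (f \<boxminus> g) = act x f \<boxminus> act x g"
  by (rule sub_eqI[symmetric]) (auto simp: act_plus[symmetric] sub_plus)

lemma act_asum:
  assumes "x \<in> carrier F" "finite I" "A \<in> Obj C" "B \<in> Obj C" "\<And>i. i \<in> I \<Longrightarrow> F' i \<Colon> A \<leadsto> B"
  shows "act x (asum A B F' I) = asum (ActO T x A) (ActO T x B) (\<lambda>i. act x (F' i)) I"
  using assms by (intro asum_linear) auto

lemma aiso_act: "x \<in> carrier F \<Longrightarrow> aiso f \<Longrightarrow> aiso (act x f)"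
  by (rule aisoI[of _ "act x (ainv f)"]) (auto simp: ainv_cmp cmp_ainv simp flip: act_cmp)

lemma
  assumes "x \<in> carrier F" "y \<in> carrier F"
  shows aiso_cp [simp]: "M \<in> Obj C \<Longrightarrow> aiso (cp x y M)"
    and cp_natural: "arr f \<Longrightarrow> act (x \<otimes>\<^bsub>F\<^esub> y) f \<cdot> cp x y (src f) = cp x y (tgt f) \<cdot> act x (act y f)"
  using natural_isoD[OF ActComp_natural_iso[OF assms]] assms
  by (simp_all add: cp_def act_def cmp_def)

lemma cp_cocycle:
  "\<lbrakk>x \<in> carrier F; y \<in> carrier F; z \<in> carrier F; M \<in> Obj C\<rbrakk>
   \<Longrightarrow> cp (x \<otimes>\<^bsub>F\<^esub> y) z M \<cdot> cp x y (ActO T z M) = cp x (y \<otimes>\<^bsub>F\<^esub> z) M \<cdot> act x (cp y z M)"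
  using ActComp_cocycle[of x y z M] by (simp add: cp_def act_def cmp_def F.m_assoc)

lemma act_one [simp]: "arr f \<Longrightarrow> act \<one>\<^bsub>F\<^esub> f = f"
  using ActA_one[of "src f" "tgt f" "mor f"] by (simp del: arr_obj add: arr_def act_def ActO_one)

lemma ActO_one' [simp]: "M \<in> Obj C \<Longrightarrow> ActO T \<one>\<^bsub>F\<^esub> M = M"
  by (rule ActO_one)

lemma cp_one [simp]:
  "x \<in> carrier F \<Longrightarrow> M \<in> Obj C \<Longrightarrow> cp x \<one>\<^bsub>F\<^esub> M = ide (ActO T x M)"
  "x \<in> carrier F \<Longrightarrow> M \<in> Obj C \<Longrightarrow> cp \<one>\<^bsub>F\<^esub> x M = ide (ActO T x M)"
  by (simp_all add: cp_def ide_def ActComp_one_right ActComp_one_left)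

lemma EO_iff: "D \<subseteq> Obj C \<Longrightarrow> X \<in> EO D H \<longleftrightarrow> eo H X \<and> fst X \<in> D"
  by (auto simp: eo_def equivariant_objects_def)

lemma eo_iff:
  assumes "H \<subseteq> carrier F"
  shows "eo H X \<longleftrightarrow> fst X \<in> Obj C \<and> snd X \<in> extensional H \<and> (\<forall>h\<in>H. aiso (sact X h)) \<and>
     (\<forall>h\<in>H. \<forall>k\<in>H. sact X h \<cdot> act h (sact X k) = sact X (h \<otimes>\<^bsub>F\<^esub> k) \<cdot> cp h k (fst X)) \<and> sact X \<one>\<^bsub>F\<^esub> = ide (fst X)"
proof -
  have "is_iso C (ActO T h (fst X)) (fst X) (snd X h) \<longleftrightarrow> aiso (sact X h)" if "h \<in> H" "fst X \<in> Obj C" for h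
    using that assms by (subst is_iso_aiso) (auto simp: sact_def)
  then show ?thesis
    unfolding eo_def equivariant_objects_def
    by (cases X) (auto simp: sact_def act_def cmp_def cp_def ide_def)
qed

lemma
  assumes "eo H X" "H \<subseteq> carrier F"
  shows eo_obj: "fst X \<in> Obj C" and eo_ext: "snd X \<in> extensional H"
    and eo_aiso: "h \<in> H \<Longrightarrow> aiso (sact X h)" and eo_arr: "h \<in> H \<Longrightarrow> arr (sact X h)"
    and eo_cocycle: "h \<in> H \<Longrightarrow> k \<in> H \<Longrightarrow> sact X h \<cdot> act h (sact X k) = sact X (h \<otimes>\<^bsub>F\<^esub> k) \<cdot> cp h k (fst X)"
    and eo_one: "sact X \<one>\<^bsub>F\<^esub> = ide (fst X)"
  using assms by (simp_all add: eo_iff)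

text \<open>Invertibility of the structure maps is a consequence of the cocycle condition for
  \<open>h\<close> and its inverse, together with the normalization at \<open>1\<close>. The
  constructions below are therefore spared that check.\<close>

lemma eoI:
  assumes H: "subgroup H F" and M: "fst X \<in> Obj C" and "snd X \<in> extensional H"
    and a: "\<And>h. h \<in> H \<Longrightarrow> arr (sact X h)"
    and c: "\<And>h k. h \<in> H \<Longrightarrow> k \<in> H \<Longrightarrow> sact X h \<cdot> act h (sact X k) = sact X (h \<otimes>\<^bsub>F\<^esub> k) \<cdot> cp h k (fst X)"
    and one: "sact X \<one>\<^bsub>F\<^esub> = ide (fst X)"
  shows "eo H X"
proof -
  note [simp] = subgroup.mem_carrier[OF H] subgroup.m_closed[OF H] subgroup.one_closed[OF H] subgroup.m_inv_closed[OF H]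
  have "aiso (sact X h)" if h: "h \<in> H" for h
  proof -
    let ?k = "inv\<^bsub>F\<^esub> h" let ?s = "sact X h" let ?t = "sact X ?k"
    have hk [simp]: "h \<otimes>\<^bsub>F\<^esub> ?k = \<one>\<^bsub>F\<^esub>" "?k \<otimes>\<^bsub>F\<^esub> h = \<one>\<^bsub>F\<^esub>" using h by simp_all
    have [simp]: "?k \<in> H" "h \<in> carrier F" "?k \<in> carrier F" using h by simp_all
    note [simp] = a[OF h] a[of ?k] M
    have 1: "?s \<cdot> act h ?t = cp h ?k (fst X)"
      using c[of h ?k] h aiso_cp[of h ?k "fst X"] by (simp add: one)
    have 2: "?t \<cdot> act ?k ?s = cp ?k h (fst X)"
      using c[of ?k h] h by (simp add: one)
    have A: "aiso (cp h ?k (fst X))" "aiso (cp ?k h (fst X))" by simp_all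
    \<comment> \<open>A right inverse of \<open>?s\<close> is immediate from the relation
      \<open>1\<close>. For a left inverse the relation \<open>2\<close> is carried over by the
      functor \<open>T^h\<close>, and naturality of \<open>cp\<close> leads back from
      \<open>T^h(T^k ?s)\<close> to \<open>?s\<close> itself, where \<open>k\<close> is the inverse
      of \<open>h\<close>.\<close>
    have n: "?s \<cdot> cp h ?k (ActO T h (fst X)) = cp h ?k (fst X) \<cdot> act h (act ?k ?s)"
      using cp_natural[of h ?k ?s] by simp
    have l: "act h ?t \<cdot> act h (act ?k ?s) = act h (cp ?k h (fst X))"
      unfolding 2[symmetric] by simp
    let ?cA = "cp h ?k (ActO T h (fst X))" let ?cB = "cp h ?k (fst X)"
    have i: "aiso ?cA" "aiso (act h (cp ?k h (fst X)))" by (simp_all add: aiso_act)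
    have t: "tgt ?cA = ActO T h (fst X)" "tgt ?cB = fst X" "tgt (cp ?k h (fst X)) = fst X" by simp_all
    let ?L = "?cA \<cdot> ainv (act h (cp ?k h (fst X))) \<cdot> act h ?t \<cdot> ainv ?cB"
    show ?thesis
    proof (rule aiso_split)
      show "?s \<cdot> (act h ?t \<cdot> ainv ?cB) = ide (tgt ?s)"
        using t by (simp add: cmp_rewrite[OF 1] cmp_ainv)
      have "(?L \<cdot> ?s) \<cdot> ?cA = ?L \<cdot> (?cB \<cdot> act h (act ?k ?s))"
        using i t by (simp add: n)
      also have "\<dots> = ?cA"
        using i t by (simp add: l ainv_cmp)
      also have "\<dots> = ide (src ?s) \<cdot> ?cA" using t by simp
      finally show "?L \<cdot> ?s = ide (src ?s)"
        by (rule cmp_cancel_right) (use i t in simp_all)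
    qed (use i t in simp_all)
  qed
  then show ?thesis using assms by (auto simp: eo_iff subgroup.subset)
qed

lemma eqvD:
  assumes "eqv H X Y f"
  shows "f \<Colon> fst X \<leadsto> fst Y" "h \<in> H \<Longrightarrow> f \<cdot> sact X h = sact Y h \<cdot> act h f"
  using assms by (auto simp: eqv_def)

lemma eqv_cmp:
  assumes "H \<subseteq> carrier F" "eo H X" "eo H Y" "eo H Z" "eqv H X Y f" "eqv H Y Z g"
  shows "eqv H X Z (g \<cdot> f)"
  unfolding eqv_def
proof (intro conjI ballI)
  fix h assume h: "h \<in> H"
  have [simp]: "h \<in> carrier F" using h assms(1) by auto
  note [simp] = eqvD(1)[OF assms(5)] eqvD(1)[OF assms(6)]
    eo_arr[OF assms(2,1) h] eo_arr[OF assms(3,1) h] eo_arr[OF assms(4,1) h]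
  show "(g \<cdot> f) \<cdot> sact X h = sact Z h \<cdot> act h (g \<cdot> f)"
    by (simp add: eqvD(2)[OF assms(5) h] cmp_rewrite[OF eqvD(2)[OF assms(6) h]])
qed (use assms(5,6) in \<open>auto simp: eqv_def\<close>)

lemma eqv_ide: "H \<subseteq> carrier F \<Longrightarrow> eo H X \<Longrightarrow> eqv H X X (ide (fst X))"
  using eo_arr[of H X] eo_obj[of H X] by (auto simp: eqv_def subset_iff)

lemma eqv_plus:
  assumes "H \<subseteq> carrier F" "eo H X" "eo H Y" "eqv H X Y f" "eqv H X Y g"
  shows "eqv H X Y (f \<boxplus> g)"
  unfolding eqv_def
proof (intro conjI ballI)
  fix h assume h: "h \<in> H"
  have [simp]: "h \<in> carrier F" using h assms(1) by auto
  note [simp] = eqvD(1)[OF assms(4)] eqvD(1)[OF assms(5)] eo_arr[OF assms(2,1) h] eo_arr[OF assms(3,1) h]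
  show "(f \<boxplus> g) \<cdot> sact X h = sact Y h \<cdot> act h (f \<boxplus> g)"
    by (simp add: cmp_plus_left cmp_plus_right eqvD(2)[OF assms(4) h] eqvD(2)[OF assms(5) h])
qed (use assms(4,5) in \<open>auto simp: eqv_def\<close>)

lemma eqv_mono: "eqv H X Y f \<Longrightarrow> H' \<subseteq> H \<Longrightarrow> eqv H' X Y f"
  by (auto simp: eqv_def)

text \<open>The retraction \<open>r\<close> is an arrow of \<open>C\<close> that serves only to
  cancel \<open>i\<close>. This is what allows splittings that are not equivariant to be
  used.\<close>

lemma eqv_cancel_mono:
  assumes "H \<subseteq> carrier F" "eo H X" "eo H Y" "eo H Z" "eqv H Y Z i" "eqv H X Z (i \<cdot> f)"
    and f: "f \<Colon> fst X \<leadsto> fst Y" and r: "r \<Colon> fst Z \<leadsto> fst Y" "r \<cdot> i = ide (fst Y)"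
  shows "eqv H X Y f"
  unfolding eqv_def
proof (intro conjI ballI)
  fix h assume h: "h \<in> H"
  have [simp]: "h \<in> carrier F" using h assms(1) by auto
  note [simp] = eqvD(1)[OF assms(5)] f r
    eo_arr[OF assms(2,1) h] eo_arr[OF assms(3,1) h] eo_arr[OF assms(4,1) h] cmp_rewrite[OF r(2)]
  have "i \<cdot> (f \<cdot> sact X h) = i \<cdot> (sact Y h \<cdot> act h f)"
    using eqvD(2)[OF assms(6) h] by (simp add: cmp_rewrite[OF eqvD(2)[OF assms(5) h]])
  then have "r \<cdot> (i \<cdot> (f \<cdot> sact X h)) = r \<cdot> (i \<cdot> (sact Y h \<cdot> act h f))" by (rule arg_cong)
  then show "f \<cdot> sact X h = sact Y h \<cdot> act h f" by simp
qed (use f in auto)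

text \<open>Here the arrow to be cancelled is \<open>T^h(p)\<close>; its section is the image of
  \<open>s\<close> under the functor.\<close>

lemma eqv_cancel_epi:
  assumes "H \<subseteq> carrier F" "eo H X" "eo H Y" "eo H Z" "eqv H X Y p" "eqv H X Z (f \<cdot> p)"
    and f: "f \<Colon> fst Y \<leadsto> fst Z" and s: "s \<Colon> fst Y \<leadsto> fst X" "p \<cdot> s = ide (fst Y)"
  shows "eqv H Y Z f"
  unfolding eqv_def
proof (intro conjI ballI)
  fix h assume h: "h \<in> H"
  have [simp]: "h \<in> carrier F" using h assms(1) by auto
  note [simp] = eqvD(1)[OF assms(5)] f s eo_obj[OF assms(3,1)]
    eo_arr[OF assms(2,1) h] eo_arr[OF assms(3,1) h] eo_arr[OF assms(4,1) h]
  have ps: "act h p \<cdot> act h s = ide (ActO T h (fst Y))"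
    by (simp add: act_cmp[symmetric] del: act_cmp)
  have "f \<cdot> sact Y h \<cdot> act h p = sact Z h \<cdot> act h f \<cdot> act h p"
    using eqvD(2)[OF assms(6) h] by (simp add: eqvD(2)[OF assms(5) h])
  then have "(f \<cdot> sact Y h \<cdot> act h p) \<cdot> act h s = (sact Z h \<cdot> act h f \<cdot> act h p) \<cdot> act h s" by simp
  then show "f \<cdot> sact Y h = sact Z h \<cdot> act h f" by (simp add: ps)
qed (use f in auto)

text \<open>The structure of \<open>Y\<close> compressed to a retract: include, act, project. It
  satisfies the cocycle condition only if the retract is well placed; the two cases needed are that
  the image of \<open>j\<close> is stable and that the kernel of \<open>p\<close> is stable.\<close>

definition img where "img H Y j p = (src j, \<lambda>h\<in>H. mor (p \<cdot> sact Y h \<cdot> act h j))"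

lemma fst_img [simp]: "fst (img H Y j p) = src j" by (simp add: img_def)

lemma sact_img: "h \<in> H \<Longrightarrow> tgt p = src j \<Longrightarrow> sact (img H Y j p) h = p \<cdot> sact Y h \<cdot> act h j"
  by (rule arrow.expand) (simp add: sact_def img_def)

context
  fixes H Y j p V
  assumes H: "subgroup H F" and Y: "eo H Y" and j: "j \<Colon> V \<leadsto> fst Y" and p: "p \<Colon> fst Y \<leadsto> V"
    and pj: "p \<cdot> j = ide V"
begin

text \<open>The hypothesis says that the structure maps of \<open>Y\<close> send the image of
  \<open>j\<close> into itself. In a product of two compressed structure maps the inner one then
  absorbs the projection \<open>j \<cdot> p\<close> in the middle.\<close>

lemma img_sub:
  assumes e: "\<And>h. h \<in> H \<Longrightarrow> (j \<cdot> p) \<cdot> sact Y h \<cdot> act h j = sact Y h \<cdot> act h j"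
  shows "eo H (img H Y j p)" "eqv H (img H Y j p) Y j"
proof -
  note Hc = subgroup.subset[OF H]
  have V: "V \<in> Obj C" using j by auto
  note [simp] = subgroup.mem_carrier[OF H] subgroup.m_closed[OF H] subgroup.one_closed[OF H] j p
    eo_arr[OF Y Hc] sact_img eo_obj[OF Y Hc] V
  have e': "j \<cdot> p \<cdot> sact Y h \<cdot> act h j = sact Y h \<cdot> act h j" if "h \<in> H" for h
    using e[OF that] that by simp
  show "eo H (img H Y j p)"
  proof (rule eoI[OF H])
    fix h k assume h: "h \<in> H" and k: "k \<in> H"
    let ?s = "sact (img H Y j p)"
    have "?s h \<cdot> act h (?s k) = p \<cdot> sact Y h \<cdot> act h (j \<cdot> p \<cdot> sact Y k \<cdot> act k j)"
      using h k by simp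
    also have "\<dots> = p \<cdot> (sact Y h \<cdot> act h (sact Y k)) \<cdot> act h (act k j)"
      using h k by (subst e'[OF k]) simp
    also have "\<dots> = p \<cdot> sact Y (h \<otimes>\<^bsub>F\<^esub> k) \<cdot> (cp h k (fst Y) \<cdot> act h (act k j))"
      unfolding eo_cocycle[OF Y Hc h k] using h k by simp
    also have "cp h k (fst Y) \<cdot> act h (act k j) = act (h \<otimes>\<^bsub>F\<^esub> k) j \<cdot> cp h k V"
      using cp_natural[of h k j] h k by simp
    finally show "?s h \<cdot> act h (?s k) = ?s (h \<otimes>\<^bsub>F\<^esub> k) \<cdot> cp h k (fst (img H Y j p))"
      using h k by simp
  next
    show "sact (img H Y j p) \<one>\<^bsub>F\<^esub> = ide (fst (img H Y j p))"
      using pj by (simp add: eo_one[OF Y Hc])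
    show "fst (img H Y j p) \<in> Obj C" by simp
    show "snd (img H Y j p) \<in> extensional H" by (simp add: img_def)
    show "arr (sact (img H Y j p) h)" if "h \<in> H" for h using that by simp
  qed
  show "eqv H (img H Y j p) Y j"
    by (auto simp: eqv_def e')
qed

text \<open>Dual to the case of a stable image: now the kernel of \<open>p\<close> is stable, and
  the projection in the middle is absorbed by the outer structure map.\<close>

lemma img_quo:
  assumes e: "\<And>h. h \<in> H \<Longrightarrow> p \<cdot> sact Y h \<cdot> act h (j \<cdot> p) = p \<cdot> sact Y h"
  shows "eo H (img H Y j p)" "eqv H Y (img H Y j p) p"
proof -
  note Hc = subgroup.subset[OF H]
  have V: "V \<in> Obj C" using j by auto
  note [simp] = subgroup.mem_carrier[OF H] subgroup.m_closed[OF H] subgroup.one_closed[OF H] j p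
    eo_arr[OF Y Hc] sact_img eo_obj[OF Y Hc] V
  have e': "p \<cdot> sact Y h \<cdot> act h j \<cdot> act h p = p \<cdot> sact Y h" if "h \<in> H" for h
    using e[OF that] that by simp
  show "eo H (img H Y j p)"
  proof (rule eoI[OF H])
    fix h k assume h: "h \<in> H" and k: "k \<in> H"
    let ?s = "sact (img H Y j p)"
    have "?s h \<cdot> act h (?s k) = (p \<cdot> sact Y h \<cdot> act h j \<cdot> act h p) \<cdot> act h (sact Y k \<cdot> act k j)"
      using h k by simp
    also have "\<dots> = p \<cdot> (sact Y h \<cdot> act h (sact Y k)) \<cdot> act h (act k j)"
      using h k by (subst e'[OF h]) simp
    also have "\<dots> = p \<cdot> sact Y (h \<otimes>\<^bsub>F\<^esub> k) \<cdot> (cp h k (fst Y) \<cdot> act h (act k j))"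
      unfolding eo_cocycle[OF Y Hc h k] using h k by simp
    also have "cp h k (fst Y) \<cdot> act h (act k j) = act (h \<otimes>\<^bsub>F\<^esub> k) j \<cdot> cp h k V"
      using cp_natural[of h k j] h k by simp
    finally show "?s h \<cdot> act h (?s k) = ?s (h \<otimes>\<^bsub>F\<^esub> k) \<cdot> cp h k (fst (img H Y j p))"
      using h k by simp
  next
    show "sact (img H Y j p) \<one>\<^bsub>F\<^esub> = ide (fst (img H Y j p))"
      using pj by (simp add: eo_one[OF Y Hc])
    show "fst (img H Y j p) \<in> Obj C" by simp
    show "snd (img H Y j p) \<in> extensional H" by (simp add: img_def)
    show "arr (sact (img H Y j p) h)" if "h \<in> H" for h using that by simp
  qed
  show "eqv H Y (img H Y j p) p"
    by (auto simp: eqv_def e')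
qed

lemma img_eqv:
  assumes e: "eqv H Y Y (j \<cdot> p)"
  shows "eo H (img H Y j p)" "eqv H (img H Y j p) Y j" "eqv H Y (img H Y j p) p"
proof -
  note Hc = subgroup.subset[OF H]
  have V: "V \<in> Obj C" using j by auto
  note [simp] = subgroup.mem_carrier[OF H] j p eo_arr[OF Y Hc] V
  have pjk: "p \<cdot> (j \<cdot> k) = k" if "arr k" "tgt k = V" for k
    using that by (subst cmp_rewrite[OF pj]) auto
  have 1: "(j \<cdot> p) \<cdot> sact Y h \<cdot> act h j = sact Y h \<cdot> act h j" if h: "h \<in> H" for h
  proof -
    have "(j \<cdot> p) \<cdot> sact Y h \<cdot> act h j = ((j \<cdot> p) \<cdot> sact Y h) \<cdot> act h j" using h by simp
    also have "\<dots> = sact Y h \<cdot> act h (j \<cdot> (p \<cdot> j))" unfolding eqvD(2)[OF e h] using h by simp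
    finally show ?thesis by (simp add: pj)
  qed
  have 2: "p \<cdot> sact Y h \<cdot> act h (j \<cdot> p) = p \<cdot> sact Y h" if h: "h \<in> H" for h
    unfolding eqvD(2)[OF e h, symmetric] using h by (simp add: pjk)
  show "eo H (img H Y j p)" "eqv H (img H Y j p) Y j" using img_sub[OF 1] by simp_all
  show "eqv H Y (img H Y j p) p" using img_quo[OF 2] by simp
qed

end

section \<open>Kernels, cokernels and exact sequences in an equivariantization\<close>

lemma EQ_simps [simp]:
  "Obj (EQ D H) = EO D H" "Comp (EQ D H) = Comp C" "zero (Hom (EQ D H) X Y) = zero (Hom C (fst X) (fst Y))"
  "Idn (EQ D H) X = Idn C (fst X)"
  by (simp_all add: equivariantization_def split: prod.split)

lemma Arr_EQ:
  assumes "H \<subseteq> carrier F" "eo H X" "eo H Y"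
  shows "f \<in> Arr (EQ D H) X Y \<longleftrightarrow> eqv H X Y (Arrow (fst X) f (fst Y))"
  using eo_obj[OF assms(2,1)] eo_obj[OF assms(3,1)]
  by (auto simp: equivariantization_def eqv_def sact_def act_def cmp_def arr_def split: prod.splits)

text \<open>The universal property is required for equivariant test objects over \<open>D\<close>
  and equivariant arrows only; it is not assumed for arrows of \<open>C\<close>.\<close>

definition ker where
  "ker D H X Y K f i \<longleftrightarrow> eqv H X Y f \<and> K \<in> EO D H \<and> eqv H K X i \<and> f \<cdot> i = zer (fst K) (fst Y) \<and>
     (\<forall>W\<in>EO D H. \<forall>g. eqv H W X g \<and> f \<cdot> g = zer (fst W) (fst Y) \<longrightarrow> (\<exists>!h. eqv H W K h \<and> i \<cdot> h = g))"

definition coker where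
  "coker D H X Y Q f p \<longleftrightarrow> eqv H X Y f \<and> Q \<in> EO D H \<and> eqv H Y Q p \<and> p \<cdot> f = zer (fst X) (fst Q) \<and>
     (\<forall>W\<in>EO D H. \<forall>g. eqv H Y W g \<and> g \<cdot> f = zer (fst X) (fst W) \<longrightarrow> (\<exists>!h. eqv H Q W h \<and> h \<cdot> p = g))"

text \<open>An equivariant arrow has prescribed source and target, so quantifying over such arrows
  amounts to quantifying over their underlying morphisms.\<close>

lemma eqv_arrow_all:
  "(\<forall>g. eqv H X Y g \<and> P g \<longrightarrow> Q g) \<longleftrightarrow>
   (\<forall>g. eqv H X Y (Arrow (fst X) g (fst Y)) \<and> P (Arrow (fst X) g (fst Y)) \<longrightarrow> Q (Arrow (fst X) g (fst Y)))"
proof (intro iffI allI impI)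
  fix g assume *: "\<forall>g. eqv H X Y (Arrow (fst X) g (fst Y)) \<and> P (Arrow (fst X) g (fst Y)) \<longrightarrow> Q (Arrow (fst X) g (fst Y))"
    and g: "eqv H X Y g \<and> P g"
  then have "g = Arrow (fst X) (mor g) (fst Y)" by (cases g) (auto simp: eqv_def)
  with * g show "Q g" by metis
qed blast

lemma eqv_arrow_ex1:
  "(\<exists>!h. eqv H X Y h \<and> P h) \<longleftrightarrow> (\<exists>!h. eqv H X Y (Arrow (fst X) h (fst Y)) \<and> P (Arrow (fst X) h (fst Y)))"
proof -
  have *: "h = Arrow (fst X) (mor h) (fst Y)" if "eqv H X Y h" for h
    using that by (cases h) (auto simp: eqv_def)
  show ?thesis
  proof
    assume "\<exists>!h. eqv H X Y h \<and> P h"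
    then show "\<exists>!h. eqv H X Y (Arrow (fst X) h (fst Y)) \<and> P (Arrow (fst X) h (fst Y))"
      by (elim ex1E) (metis * arrow.sel(2))
  next
    assume "\<exists>!h. eqv H X Y (Arrow (fst X) h (fst Y)) \<and> P (Arrow (fst X) h (fst Y))"
    then show "\<exists>!h. eqv H X Y h \<and> P h"
      by (elim ex1E) (metis *)
  qed
qed

lemma is_kernel_EQ:
  assumes "H \<subseteq> carrier F" "D \<subseteq> Obj C" "X \<in> EO D H" "Y \<in> EO D H"
  shows "is_kernel (EQ D H) X Y f K i \<longleftrightarrow> ker D H X Y K (Arrow (fst X) f (fst Y)) (Arrow (fst K) i (fst X))"
proof -
  have eo: "eo H W" if "W \<in> EO D H" for W using that assms(2) by (simp add: EO_iff)
  have *: "(\<forall>g\<in>Arr (EQ D H) W X. f \<bullet> g = \<zero>\<^bsub>Hom C (fst W) (fst Y)\<^esub> \<longrightarrow>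
        (\<exists>!h. h \<in> Arr (EQ D H) W K \<and> i \<bullet> h = g)) \<longleftrightarrow>
     (\<forall>g. eqv H W X g \<and> Arrow (fst X) f (fst Y) \<cdot> g = zer (fst W) (fst Y) \<longrightarrow>
        (\<exists>!h. eqv H W K h \<and> Arrow (fst K) i (fst X) \<cdot> h = g))" (is "?L \<longleftrightarrow> ?R")
    if W: "W \<in> EO D H" and K: "K \<in> EO D H" for W
  proof -
    show ?thesis
      unfolding eqv_arrow_all[of H W X] eqv_arrow_ex1[of H W K]
      by (simp add: Arr_EQ[OF assms(1) eo[OF W]] eo[OF K] eo[OF assms(3)] cmp_def zer_def Ball_def imp_conjL)
  qed
  show ?thesis
  proof (cases "K \<in> EO D H")
    case True
    note b = ball_cong[OF refl *[OF _ True]]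
    show ?thesis
      by (simp only: is_kernel_def ker_def EQ_simps b)
        (simp only: Arr_EQ[OF assms(1)] eo assms(3,4) True cmp_Arrow, simp add: zer_def)
  qed (simp add: is_kernel_def ker_def)
qed

lemma is_cokernel_EQ:
  assumes "H \<subseteq> carrier F" "D \<subseteq> Obj C" "X \<in> EO D H" "Y \<in> EO D H"
  shows "is_cokernel (EQ D H) X Y f Q p \<longleftrightarrow> coker D H X Y Q (Arrow (fst X) f (fst Y)) (Arrow (fst Y) p (fst Q))"
proof -
  have eo: "eo H W" if "W \<in> EO D H" for W using that assms(2) by (simp add: EO_iff)
  have *: "(\<forall>g\<in>Arr (EQ D H) Y W. g \<bullet> f = \<zero>\<^bsub>Hom C (fst X) (fst W)\<^esub> \<longrightarrow>
        (\<exists>!h. h \<in> Arr (EQ D H) Q W \<and> h \<bullet> p = g)) \<longleftrightarrow>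
     (\<forall>g. eqv H Y W g \<and> g \<cdot> Arrow (fst X) f (fst Y) = zer (fst X) (fst W) \<longrightarrow>
        (\<exists>!h. eqv H Q W h \<and> h \<cdot> Arrow (fst Y) p (fst Q) = g))" (is "?L \<longleftrightarrow> ?R")
    if W: "W \<in> EO D H" and K: "Q \<in> EO D H" for W
  proof -
    show ?thesis
      unfolding eqv_arrow_all[of H Y W] eqv_arrow_ex1[of H Q W]
      by (simp add: Arr_EQ[OF assms(1) _ eo[OF W]] eo[OF K] eo[OF assms(4)] cmp_def zer_def Ball_def imp_conjL)
  qed
  show ?thesis
  proof (cases "Q \<in> EO D H")
    case True
    note b = ball_cong[OF refl *[OF _ True]]
    show ?thesis
      by (simp only: is_cokernel_def coker_def EQ_simps b)
        (simp only: Arr_EQ[OF assms(1)] eo assms(3,4) True cmp_Arrow, simp add: zer_def)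
  qed (simp add: is_cokernel_def coker_def)
qed

definition split_exact where
  "split_exact H X Y Z i p \<longleftrightarrow> eqv H X Y i \<and> eqv H Y Z p \<and> p \<cdot> i = zer (fst X) (fst Z) \<and>
     (\<exists>r s. r \<Colon> fst Y \<leadsto> fst X \<and> s \<Colon> fst Z \<leadsto> fst Y \<and> r \<cdot> i = ide (fst X) \<and> p \<cdot> s = ide (fst Z) \<and>
        i \<cdot> r \<boxplus> s \<cdot> p = ide (fst Y))"

text \<open>The factorizations are found in \<open>C\<close> with the help of \<open>r\<close> and
  \<open>s\<close>; that they are equivariant follows afterwards from the cancellation
  lemmas.\<close>

lemma split_exact_imp:
  assumes H: "H \<subseteq> carrier F" and D: "D \<subseteq> Obj C" and XYZ: "X \<in> EO D H" "Y \<in> EO D H" "Z \<in> EO D H"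
    and se: "split_exact H X Y Z i p"
  shows "ker D H Y Z X p i" "coker D H X Y Z i p"
proof -
  have eo: "eo H W" if "W \<in> EO D H" for W using that D by (simp add: EO_iff)
  from se obtain r s where ip: "eqv H X Y i" "eqv H Y Z p" and pi: "p \<cdot> i = zer (fst X) (fst Z)"
    and rs: "r \<Colon> fst Y \<leadsto> fst X" "s \<Colon> fst Z \<leadsto> fst Y" "r \<cdot> i = ide (fst X)" "p \<cdot> s = ide (fst Z)"
    "i \<cdot> r \<boxplus> s \<cdot> p = ide (fst Y)" unfolding split_exact_def by blast
  note [simp] = eqvD(1)[OF ip(1)] eqvD(1)[OF ip(2)] rs(1,2)
  show "ker D H Y Z X p i"
    unfolding ker_def
  proof (intro conjI ip XYZ pi ballI allI impI)
    fix W g assume W: "W \<in> EO D H" and g: "eqv H W Y g \<and> p \<cdot> g = zer (fst W) (fst Z)"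
    have [simp]: "g \<Colon> fst W \<leadsto> fst Y" using g by (auto simp: eqv_def)
    have "g = (i \<cdot> r \<boxplus> s \<cdot> p) \<cdot> g" by (simp add: rs)
    also have "\<dots> = i \<cdot> r \<cdot> g \<boxplus> s \<cdot> (p \<cdot> g)" by (simp add: cmp_plus_left)
    also have "\<dots> = i \<cdot> r \<cdot> g" using g eo_obj[OF eo[OF W] H] by simp
    finally have gg: "i \<cdot> (r \<cdot> g) = g" ..
    show "\<exists>!h. eqv H W X h \<and> i \<cdot> h = g"
    proof (rule ex1I[of _ "r \<cdot> g"])
      show "eqv H W X (r \<cdot> g) \<and> i \<cdot> r \<cdot> g = g"
        using gg g by (intro conjI eqv_cancel_mono[OF H eo[OF W] eo[OF XYZ(1)] eo[OF XYZ(2)] ip(1) _ _ rs(1,3)]) auto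
      fix h assume h: "eqv H W X h \<and> i \<cdot> h = g"
      have "h = r \<cdot> i \<cdot> h" using h by (subst cmp_rewrite[OF rs(3)]) (auto simp: eqv_def)
      then show "h = r \<cdot> g" using h by simp
    qed
  qed
  show "coker D H X Y Z i p"
    unfolding coker_def
  proof (intro conjI ip XYZ pi ballI allI impI)
    fix W g assume W: "W \<in> EO D H" and g: "eqv H Y W g \<and> g \<cdot> i = zer (fst X) (fst W)"
    have [simp]: "g \<Colon> fst Y \<leadsto> fst W" using g by (auto simp: eqv_def)
    have "g = g \<cdot> (i \<cdot> r \<boxplus> s \<cdot> p)" by (simp add: rs)
    also have "\<dots> = (g \<cdot> i) \<cdot> r \<boxplus> g \<cdot> s \<cdot> p" by (simp add: cmp_plus_right)
    also have "\<dots> = g \<cdot> s \<cdot> p" using g eo_obj[OF eo[OF W] H] by simp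
    finally have gg: "(g \<cdot> s) \<cdot> p = g" by simp
    show "\<exists>!h. eqv H Z W h \<and> h \<cdot> p = g"
    proof (rule ex1I[of _ "g \<cdot> s"])
      show "eqv H Z W (g \<cdot> s) \<and> (g \<cdot> s) \<cdot> p = g"
        using gg g by (intro conjI eqv_cancel_epi[OF H eo[OF XYZ(2)] eo[OF XYZ(3)] eo[OF W] ip(2) _ _ rs(2,4)]) auto
      fix h assume h: "eqv H Z W h \<and> h \<cdot> p = g"
      have "(h \<cdot> p) \<cdot> s = h" using h by (subst cmp_assoc) (auto simp: eqv_def rs)
      then show "h = g \<cdot> s" using h by simp
    qed
  qed
qed

text \<open>The idempotent \<open>1 - p' p\<close> projects onto the kernel of \<open>p\<close> in
  \<open>C\<close>. Its image is stable under \<open>H\<close> and so becomes an equivariant object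
  over \<open>D\<close> that may be compared with \<open>X\<close>; this shows that \<open>i\<close>
  is its inclusion up to isomorphism. The complementary image is a quotient of \<open>Y\<close> and
  is compared with \<open>Z\<close> in the same manner.\<close>

lemma short_exact_EQ:
  assumes H: "subgroup H F" and D: "idem_complete D" and XYZ: "X \<in> EO D H" "Y \<in> EO D H" "Z \<in> EO D H"
    and k: "ker D H Y Z X p i" and c: "coker D H X Y Z i p"
  shows "split_exact H X Y Z i p"
proof -
  note Hc = subgroup.subset[OF H]
  have DO: "D \<subseteq> Obj C" using D by (simp add: idem_complete_def)
  have eo: "eo H W" if "W \<in> EO D H" for W using that DO by (simp add: EO_iff)
  note eX = eo[OF XYZ(1)] and eY = eo[OF XYZ(2)] and eZ = eo[OF XYZ(3)]
  have ip: "eqv H X Y i" "eqv H Y Z p" and pi: "p \<cdot> i = zer (fst X) (fst Z)"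
    using k unfolding ker_def by blast+
  note o = eo_obj[OF eX Hc] eo_obj[OF eY Hc] eo_obj[OF eZ Hc]
  note [simp] = eqvD(1)[OF ip(1)] eqvD(1)[OF ip(2)] o subgroup.mem_carrier[OF H]
    eo_arr[OF eX Hc] eo_arr[OF eY Hc] eo_arr[OF eZ Hc]
  obtain p' where p': "p' \<Colon> fst Z \<leadsto> fst Y" "p \<cdot> p' \<cdot> p = p"
    using von_Neumann_regular[OF eqvD(1)[OF ip(2)]] by blast
  note [simp] = p'
  define e where "e = ide (fst Y) \<boxminus> p' \<cdot> p"
  have e: "e \<Colon> fst Y \<leadsto> fst Y" by (auto simp: e_def)
  have pe: "p \<cdot> e = zer (fst Y) (fst Z)" using sub_self[of p] by (simp add: e_def cmp_sub_right)
  \<comment> \<open>\<open>e\<close> acts as the identity on every arrow that \<open>p\<close>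
    kills, equivariant or not.\<close>
  have ek: "e \<cdot> g = g" if "g \<Colon> W \<leadsto> fst Y" "p \<cdot> g = zer W (fst Z)" for W g
    using that sub_zer[of g] arr_obj[of g] by (auto simp: e_def cmp_sub_left)
  obtain V j q where j: "V \<in> D" "j \<Colon> V \<leadsto> fst Y" "q \<Colon> fst Y \<leadsto> V" "q \<cdot> j = ide V" "j \<cdot> q = e"
    using idem_completeE[OF D e ek[OF e pe]] XYZ DO by (auto simp: EO_iff)
  have V: "V \<in> Obj C" using j by auto
  note [simp] = j(2,3) V
  have "p \<cdot> (j \<cdot> (q \<cdot> j)) = (p \<cdot> e) \<cdot> j" unfolding j(5)[symmetric] by simp
  then have pj: "p \<cdot> j = zer V (fst Z)" by (simp add: j(4) pe)
  let ?K = "img H Y j q"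
  \<comment> \<open>The image of \<open>e\<close> is stable because \<open>p\<close> kills it and is
    equivariant.\<close>
  have "(j \<cdot> q) \<cdot> sact Y h \<cdot> act h j = sact Y h \<cdot> act h j" if h: "h \<in> H" for h
  proof -
    have "p \<cdot> sact Y h \<cdot> act h j = (p \<cdot> sact Y h) \<cdot> act h j" using h by simp
    also have "\<dots> = sact Z h \<cdot> act h (p \<cdot> j)" unfolding eqvD(2)[OF ip(2) h] using h by simp
    also have "\<dots> = zer (ActO T h V) (fst Z)" using h by (simp add: pj del: act_cmp)
    finally show ?thesis
      unfolding j(5) using h by (intro ek[of _ "ActO T h V"]) auto
  qed
  note K = img_sub[OF H eY j(2,3,4) this]
  have KD: "?K \<in> EO D H" using K(1) j DO by (simp add: EO_iff)
  have fK: "fst ?K = V" by simp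
  have ku: "\<exists>!h. eqv H W X h \<and> i \<cdot> h = g" if "W \<in> EO D H" "eqv H W Y g" "p \<cdot> g = zer (fst W) (fst Z)" for W g
    using k that unfolding ker_def by blast
  obtain h where h: "eqv H ?K X h" "i \<cdot> h = j"
    using ku[OF KD K(2)] pj by auto
  have h1: "h \<Colon> V \<leadsto> fst X" using h by (auto simp: eqv_def)
  define \<phi> where "\<phi> = q \<cdot> i"
  have ei: "j \<cdot> \<phi> = i" using ek[of i "fst X"] pi unfolding j(5)[symmetric] \<phi>_def by simp
  have \<phi>: "eqv H X ?K \<phi>"
    by (rule eqv_cancel_mono[OF Hc eX K(1) eY K(2)]) (use ei ip j in \<open>auto simp: \<phi>_def\<close>)
  \<comment> \<open>Both sides are equivariant endomorphisms of \<open>X\<close> with the same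
    composite with \<open>i\<close>, so the uniqueness in the universal property applies.\<close>
  have "h \<cdot> \<phi> = ide (fst X)"
  proof -
    have "eqv H X X (h \<cdot> \<phi>)" "i \<cdot> (h \<cdot> \<phi>) = i"
      using eqv_cmp[OF Hc eX K(1) eX \<phi> h(1)] ei h1 h(2) eqvD(1)[OF \<phi>] by (simp_all add: cmp_rewrite[OF h(2)])
    moreover have "eqv H X X (ide (fst X))" "i \<cdot> ide (fst X) = i" using eqv_ide[OF Hc eX] by simp_all
    ultimately show ?thesis using ku[OF XYZ(1) ip(1) pi] by blast
  qed
  define r where "r = h \<cdot> q"
  have r: "r \<Colon> fst Y \<leadsto> fst X" "r \<cdot> i = ide (fst X)" "i \<cdot> r = e"
    using h1 \<open>h \<cdot> \<phi> = _\<close> j(5) by (auto simp: r_def \<phi>_def cmp_rewrite[OF h(2)])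
  note [simp] = r(1)
  define d where "d = p' \<cdot> p"
  have d: "d \<Colon> fst Y \<leadsto> fst Y" "d \<cdot> d = d" by (auto simp: d_def)
  have dr: "d = ide (fst Y) \<boxminus> i \<cdot> r"
    unfolding r(3) e_def d_def by (rule sub_eqI[symmetric]) (auto simp: sub_plus plus_comm[of "p' \<cdot> p"])
  obtain Q s0 q0 where Q: "Q \<in> D" "s0 \<Colon> Q \<leadsto> fst Y" "q0 \<Colon> fst Y \<leadsto> Q" "q0 \<cdot> s0 = ide Q" "s0 \<cdot> q0 = d"
    using idem_completeE[OF D d] XYZ DO by (auto simp: EO_iff)
  have QO: "Q \<in> Obj C" using Q by auto
  note [simp] = Q(2,3) QO
  have di: "d \<cdot> i = zer (fst X) (fst Y)" by (simp add: d_def pi)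
  have "(q0 \<cdot> s0) \<cdot> (q0 \<cdot> i) = q0 \<cdot> (d \<cdot> i)" unfolding Q(5)[symmetric] by simp
  then have qi: "q0 \<cdot> i = zer (fst X) Q" by (simp add: Q(4) di)
  let ?Q = "img H Y s0 q0"
  \<comment> \<open>The decisive identity is \<open>d = 1 - i r\<close>: the arrow \<open>q0\<close>
    kills \<open>i\<close>, hence by equivariance of \<open>i\<close> it also kills the translates
    of its image.\<close>
  have Qq: "q0 \<cdot> sact Y h \<cdot> act h (s0 \<cdot> q0) = q0 \<cdot> sact Y h" if h: "h \<in> H" for h
  proof -
    have "q0 \<cdot> sact Y h \<cdot> act h i = q0 \<cdot> i \<cdot> sact X h" using h eqvD(2)[OF ip(1) h] by simp
    also have "\<dots> = zer (ActO T h (fst X)) Q" using h by (simp add: cmp_rewrite[OF qi])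
    finally have z: "q0 \<cdot> sact Y h \<cdot> act h i = zer (ActO T h (fst X)) Q" .
    have "q0 \<cdot> sact Y h \<cdot> act h (i \<cdot> r) = (q0 \<cdot> sact Y h \<cdot> act h i) \<cdot> act h r" using h by simp
    also have "\<dots> = zer (ActO T h (fst Y)) Q" unfolding z using h by simp
    finally have "q0 \<cdot> sact Y h \<cdot> act h (i \<cdot> r) = zer (ActO T h (fst Y)) Q" .
    then show ?thesis unfolding Q(5) dr using h sub_zer[of "q0 \<cdot> sact Y h"] by (simp add: cmp_sub_right)
  qed
  have Q': "eo H ?Q" "eqv H Y ?Q q0" using img_quo[OF H eY Q(2,3,4) Qq] by simp_all
  have QD: "?Q \<in> EO D H" using Q'(1) Q DO by (simp add: EO_iff)
  have cu: "\<exists>!h. eqv H Z W h \<and> h \<cdot> p = g" if "W \<in> EO D H" "eqv H Y W g" "g \<cdot> i = zer (fst X) (fst W)" for W g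
    using c that unfolding coker_def by blast
  obtain \<psi> where \<psi>: "eqv H Z ?Q \<psi>" "\<psi> \<cdot> p = q0" using cu[OF QD Q'(2)] qi by auto
  have \<psi>1: "\<psi> \<Colon> fst Z \<leadsto> Q" using \<psi> by (auto simp: eqv_def)
  define \<theta> where "\<theta> = p \<cdot> s0"
  have \<theta>q: "\<theta> \<cdot> q0 = p" by (simp add: \<theta>_def Q(5)) (simp add: d_def)
  have \<theta>: "eqv H ?Q Z \<theta>"
    by (rule eqv_cancel_epi[OF Hc eY Q'(1) eZ Q'(2)]) (use \<theta>q ip Q in \<open>auto simp: \<theta>_def\<close>)
  \<comment> \<open>\<open>p\<close> is not yet known to be epi in \<open>C\<close>; it can be
    cancelled only between equivariant arrows, which is why \<open>\<theta>\<close> and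
    \<open>\<psi>\<close> were shown to be equivariant.\<close>
  have "\<theta> \<cdot> \<psi> = ide (fst Z)"
  proof -
    have "eqv H Z Z (\<theta> \<cdot> \<psi>)" "(\<theta> \<cdot> \<psi>) \<cdot> p = p"
      using eqv_cmp[OF Hc eZ Q'(1) eZ \<psi>(1) \<theta>] \<theta>q \<psi>1 \<psi>(2) eqvD(1)[OF \<theta>] by simp_all
    moreover have "eqv H Z Z (ide (fst Z))" "ide (fst Z) \<cdot> p = p" using eqv_ide[OF Hc eZ] by simp_all
    ultimately show ?thesis using cu[OF XYZ(3) ip(2) pi] by blast
  qed
  then have ps: "p \<cdot> (s0 \<cdot> \<psi>) = ide (fst Z)" using \<psi>1 by (simp add: \<theta>_def)
  have "(s0 \<cdot> \<psi>) \<cdot> p = d" using \<psi>1 \<psi>(2) Q(5) by simp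
  then have "i \<cdot> r \<boxplus> (s0 \<cdot> \<psi>) \<cdot> p = ide (fst Y)" unfolding r(3) e_def d_def[symmetric] by (simp add: sub_plus d)
  then show ?thesis
    unfolding split_exact_def using ip pi r \<psi>1 ps by (intro conjI exI[of _ r] exI[of _ "s0 \<cdot> \<psi>"]) auto
qed

end

section \<open>Classes of summands\<close>

context action
begin

lemma typed_obj: "f \<Colon> A \<leadsto> B \<Longrightarrow> A \<in> Obj C" "f \<Colon> A \<leadsto> B \<Longrightarrow> B \<in> Obj C"
  using arr_obj by blast+

lemma asum_delta:
  assumes "finite I" "f \<Colon> A \<leadsto> B"
  shows "asum A B (\<lambda>l. if l = k then f else zer A B) I = (if k \<in> I then f else zer A B)"
proof (cases "k \<in> I")
  case True
  then show ?thesis using asum_single[OF assms(1) True, of "\<lambda>l. if l = k then f else zer A B" A B] assms(2) by simp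
next
  case False
  then have "asum A B (\<lambda>l. if l = k then f else zer A B) I = asum A B (\<lambda>l. if l = k then f else zer A B) {}"
    by (intro asum_neutral assms(1) typed_obj[OF assms(2)]) auto
  then show ?thesis using False typed_obj[OF assms(2)] by simp
qed

lemma ex_zero_EO:
  assumes H: "subgroup H F" and D: "idem_complete D"
  obtains Z where "Z \<in> EO D H" "ide (fst Z) = zer (fst Z) (fst Z)"
proof -
  obtain Z where Z: "Z \<in> D" "ide Z = zer Z Z" and DO: "D \<subseteq> Obj C" using D by (auto simp: idem_complete_def)
  have [simp]: "Z \<in> Obj C" using Z DO by auto
  let ?Z = "(Z, \<lambda>h\<in>H. mor (zer (ActO T h Z) Z))"
  note [simp] = subgroup.mem_carrier[OF H] subgroup.m_closed[OF H] subgroup.one_closed[OF H]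
  have s: "sact ?Z h = zer (ActO T h Z) Z" if "h \<in> H" for h
    using that by (simp add: sact_def zer_def)
  have "eo H ?Z"
  proof (rule eoI[OF H])
    show "sact ?Z h \<cdot> act h (sact ?Z k) = sact ?Z (h \<otimes>\<^bsub>F\<^esub> k) \<cdot> cp h k (fst ?Z)" if "h \<in> H" "k \<in> H" for h k
      using that by (simp add: s)
  qed (simp_all add: s Z)
  then show ?thesis using that[of ?Z] Z DO by (simp add: EO_iff)
qed

lemma eqv_Arrow: "eqv H X Y f \<Longrightarrow> Arrow (fst X) (mor f) (fst Y) = f"
  by (cases f) (auto simp: eqv_def)

lemma cls_split:
  assumes H: "subgroup H F" and D: "D \<subseteq> Obj C" and XYZ: "X \<in> EO D H" "Y \<in> EO D H" "Z \<in> EO D H"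
    and se: "split_exact H X Y Z i p"
  shows "K0_class (EQ D H) Y = K0_class (EQ D H) X \<oplus>\<^bsub>K0 (EQ D H)\<^esub> K0_class (EQ D H) Z"
proof (rule K0_class_short_exact)
  note Hc = subgroup.subset[OF H]
  have ip: "eqv H X Y i" "eqv H Y Z p" using se by (auto simp: split_exact_def)
  show "short_exact (EQ D H) X Y Z (mor i) (mor p)"
    unfolding short_exact_def is_kernel_EQ[OF Hc D XYZ(2,3)] is_cokernel_EQ[OF Hc D XYZ(1,2)] eqv_Arrow[OF ip(1)] eqv_Arrow[OF ip(2)]
    using split_exact_imp[OF Hc D XYZ se] by blast
qed (simp_all add: XYZ)

text \<open>If the identity of \<open>X\<close> vanishes, then \<open>X\<close>, \<open>X\<close>,
  \<open>X\<close> with identities as arrows is a split sequence, and the class of \<open>X\<close>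
  is twice itself.\<close>

lemma cls_zero:
  assumes H: "subgroup H F" and D: "D \<subseteq> Obj C" and X: "X \<in> EO D H" and z: "ide (fst X) = zer (fst X) (fst X)"
  shows "K0_class (EQ D H) X = \<zero>\<^bsub>K0 (EQ D H) :: ('r::comm_ring_1, _) module\<^esub>"
proof -
  interpret K: module scalars "K0 (EQ D H) :: ('r, _) module" by (rule module_K0)
  have eo: "eo H X" using X D by (simp add: EO_iff)
  note Hc = subgroup.subset[OF H]
  have O: "fst X \<in> Obj C" using eo_obj[OF eo Hc] .
  have "split_exact H X X X (ide (fst X)) (ide (fst X))"
    unfolding split_exact_def using eqv_ide[OF Hc eo] O z
    by (intro conjI exI[of _ "ide (fst X)"]) auto
  have "(K0_class (EQ D H) X :: (_ \<Rightarrow>\<^sub>0 'r) set) = K0_class (EQ D H) X \<oplus>\<^bsub>K0 (EQ D H)\<^esub> K0_class (EQ D H) X"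
    by (rule cls_split[OF H D X X X]) fact
  moreover have "K0_class (EQ D H) X \<in> carrier (K0 (EQ D H) :: ('r, _) module)" using X by simp
  ultimately show ?thesis by (metis K.M.add.r_cancel_one')
qed

text \<open>An isomorphism is completed by a zero object of \<open>EO D H\<close> to a split
  sequence.\<close>

lemma cls_iso:
  assumes H: "subgroup H F" and D: "idem_complete D" and XY: "X \<in> EO D H" "Y \<in> EO D H"
    and f: "eqv H X Y f" and g: "g \<Colon> fst Y \<leadsto> fst X" "g \<cdot> f = ide (fst X)" "f \<cdot> g = ide (fst Y)"
  shows "K0_class (EQ D H) X = (K0_class (EQ D H) Y :: (_ \<Rightarrow>\<^sub>0 'r::comm_ring_1) set)"
proof -
  interpret K: module scalars "K0 (EQ D H) :: ('r, _) module" by (rule module_K0)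
  have DO: "D \<subseteq> Obj C" using D by (simp add: idem_complete_def)
  note Hc = subgroup.subset[OF H]
  obtain Z where Z: "Z \<in> EO D H" "ide (fst Z) = zer (fst Z) (fst Z)" using ex_zero_EO[OF H D] .
  have eo: "eo H X" "eo H Y" "eo H Z" using XY Z DO by (simp_all add: EO_iff)
  have O: "fst X \<in> Obj C" "fst Y \<in> Obj C" "fst Z \<in> Obj C" using eo eo_obj[OF _ Hc] by blast+
  note [simp] = O eqvD(1)[OF f] g(1)
  have "eqv H Y Z (zer (fst Y) (fst Z))"
    using O Hc eo_arr[OF eo(2) Hc] eo_arr[OF eo(3) Hc] by (auto simp: eqv_def subset_iff)
  then have "split_exact H X Y Z f (zer (fst Y) (fst Z))"
    unfolding split_exact_def using f g Z(2)
    by (intro conjI exI[of _ g] exI[of _ "zer (fst Z) (fst Y)"]) auto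
  have "(K0_class (EQ D H) Y :: (_ \<Rightarrow>\<^sub>0 'r) set) = K0_class (EQ D H) X \<oplus>\<^bsub>K0 (EQ D H)\<^esub> K0_class (EQ D H) Z"
    by (rule cls_split[OF H DO XY(1,2) Z(1)]) fact
  then show ?thesis using XY cls_zero[OF H DO Z, where 'r='r] by simp
qed

text \<open>Replaces short exact sequences of the equivariantization by split ones, the form in
  which sequences can be tensored, conjugated and induced.\<close>

lemma K0_additiveI:
  fixes B :: "('r, 'a, 'y) module_scheme"
  assumes H: "subgroup H F" and D: "idem_complete D"
    and "\<And>X. X \<in> EO D H \<Longrightarrow> \<phi> X \<in> carrier B"
    and "\<And>X Y Z i p. \<lbrakk>X \<in> EO D H; Y \<in> EO D H; Z \<in> EO D H; split_exact H X Y Z i p\<rbrakk> \<Longrightarrow> \<phi> Y = \<phi> X \<oplus>\<^bsub>B\<^esub> \<phi> Z"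
  shows "K0_additive (EQ D H) \<phi> B"
  unfolding K0_additive_def
proof (intro conjI ballI impI)
  note Hc = subgroup.subset[OF H]
  have DO: "D \<subseteq> Obj C" using D by (simp add: idem_complete_def)
  show "\<phi> \<in> Obj (EQ D H) \<rightarrow> carrier B" using assms(3) by simp
  fix X Y Z assume "X \<in> Obj (EQ D H)" "Y \<in> Obj (EQ D H)" "Z \<in> Obj (EQ D H)" and "\<exists>i p. short_exact (EQ D H) X Y Z i p"
  then obtain i p where XYZ: "X \<in> EO D H" "Y \<in> EO D H" "Z \<in> EO D H" and "short_exact (EQ D H) X Y Z i p" by auto
  then have "split_exact H X Y Z (Arrow (fst X) i (fst Y)) (Arrow (fst Y) p (fst Z))"
    using is_kernel_EQ[OF Hc DO XYZ(2,3)] is_cokernel_EQ[OF Hc DO XYZ(1,2)]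
    by (intro short_exact_EQ[OF H D XYZ]) (simp_all add: short_exact_def)
  then show "\<phi> Y = \<phi> X \<oplus>\<^bsub>B\<^esub> \<phi> Z" by (rule assms(4)[OF XYZ])
qed

text \<open>\<open>X\<close> splits the idempotent \<open>j \<cdot> p\<close> of \<open>M\<close>, equivariantly for \<open>H\<close>.\<close>

definition smd where
  "smd H X M j p \<longleftrightarrow> eqv H X M j \<and> eqv H M X p \<and> p \<cdot> j = ide (fst X)"

lemma smdD:
  assumes "smd H X M j p"
  shows "j \<Colon> fst X \<leadsto> fst M" "p \<Colon> fst M \<leadsto> fst X" "eqv H X M j" "eqv H M X p" "p \<cdot> j = ide (fst X)"
  using assms by (auto simp: smd_def eqv_def)

lemma smd_cancel:
  assumes "smd H X M j p" "arr k" "tgt k = fst X" shows "p \<cdot> (j \<cdot> k) = k"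
  using smdD[OF assms(1)] assms(2,3) by (subst cmp_rewrite[of p j "ide (fst X)"]) auto

lemma smd_idem:
  assumes "smd H X M j p" shows "(j \<cdot> p) \<cdot> (j \<cdot> p) = j \<cdot> p"
  using smdD[OF assms] smd_cancel[OF assms] by simp

lemma eqv_smd:
  assumes "H \<subseteq> carrier F" "eo H X" "eo H M" "smd H X M j p"
  shows "eqv H M M (j \<cdot> p)"
  by (rule eqv_cmp[OF assms(1,3,2,3)]) (use smdD[OF assms(4)] in auto)

text \<open>Equivalence of idempotents: with \<open>v \<cdot> u = j \<cdot> p\<close> and
  \<open>u \<cdot> v = j' \<cdot> p'\<close>, the arrows \<open>u\<close> and \<open>v\<close>
  restrict to mutually inverse isomorphisms between the two summands.\<close>

lemma cls_smd_eq:
  assumes H: "subgroup H F" and D: "idem_complete D" and XY: "X \<in> EO D H" "Y \<in> EO D H"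
    and MN: "eo H M" "eo H N" and s: "smd H X M j p" and s': "smd H Y N j' p'"
    and u: "eqv H M N u" and v: "eqv H N M v" and vu: "v \<cdot> u = j \<cdot> p" and uv: "u \<cdot> v = j' \<cdot> p'"
  shows "K0_class (EQ D H) X = K0_class (EQ D H) Y"
proof (rule cls_iso[OF H D XY])
  note Hc = subgroup.subset[OF H]
  have DO: "D \<subseteq> Obj C" using D by (simp add: idem_complete_def)
  have eo: "eo H X" "eo H Y" using XY DO by (simp_all add: EO_iff)
  note [simp] = smdD(1,2)[OF s] smdD(1,2)[OF s'] eqvD(1)[OF u] eqvD(1)[OF v]
  have "eqv H X N (u \<cdot> j)" by (rule eqv_cmp[OF Hc eo(1) MN smdD(3)[OF s] u])
  then show "eqv H X Y (p' \<cdot> u \<cdot> j)" by (rule eqv_cmp[OF Hc eo(1) MN(2) eo(2) _ smdD(4)[OF s']])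
  show "p \<cdot> v \<cdot> j' \<Colon> fst Y \<leadsto> fst X" by simp
  have 1: "j' \<cdot> p' \<cdot> k = u \<cdot> v \<cdot> k" if "arr k" "tgt k = fst N" for k
    using that by (subst cmp_rewrite[OF uv[symmetric]]) auto
  have 2: "v \<cdot> u \<cdot> k = j \<cdot> p \<cdot> k" if "arr k" "tgt k = fst M" for k
    using that by (subst cmp_rewrite[OF vu]) auto
  show "(p \<cdot> v \<cdot> j') \<cdot> (p' \<cdot> u \<cdot> j) = ide (fst X)"
    by (simp add: 1 2 smd_cancel[OF s] smdD(5)[OF s])
  show "(p' \<cdot> u \<cdot> j) \<cdot> (p \<cdot> v \<cdot> j') = ide (fst Y)"
    by (simp add: 1[symmetric] 2[symmetric] smd_cancel[OF s'] smdD(5)[OF s'])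
qed

lemma cls_smd_same:
  assumes H: "subgroup H F" and D: "idem_complete D" and XY: "X \<in> EO D H" "Y \<in> EO D H"
    and M: "eo H M" and s: "smd H X M j p" and s': "smd H Y M j' p'" and e: "j \<cdot> p = j' \<cdot> p'"
  shows "K0_class (EQ D H) X = K0_class (EQ D H) Y"
proof (rule cls_smd_eq[OF H D XY M M s s'])
  have "eo H X" using XY D by (auto simp: EO_iff idem_complete_def)
  then show "eqv H M M (j \<cdot> p)" "eqv H M M (j \<cdot> p)"
    using eqv_smd[OF subgroup.subset[OF H] _ M s] by blast+
qed (use smd_idem[OF s] e in auto)

text \<open>The exact sequence \<open>X1\<close>, \<open>X\<close>, \<open>X2\<close> and its
  splitting are cut out of \<open>M\<close> by composing inclusions of one summand with projections
  to another.\<close>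

lemma cls_smd_plus:
  assumes H: "subgroup H F" and D: "D \<subseteq> Obj C" and X: "X \<in> EO D H" "X1 \<in> EO D H" "X2 \<in> EO D H"
    and M: "eo H M" and s: "smd H X M j p" "smd H X1 M j1 p1" "smd H X2 M j2 p2"
    and e: "j \<cdot> p = j1 \<cdot> p1 \<boxplus> j2 \<cdot> p2" and o: "p2 \<cdot> j1 = zer (fst X1) (fst X2)" "p1 \<cdot> j2 = zer (fst X2) (fst X1)"
  shows "K0_class (EQ D H) X = K0_class (EQ D H) X1 \<oplus>\<^bsub>K0 (EQ D H)\<^esub> K0_class (EQ D H) X2"
proof (rule cls_split[OF H D X(2,1,3)])
  note Hc = subgroup.subset[OF H]
  have eo: "eo H X" "eo H X1" "eo H X2" using X D by (simp_all add: EO_iff)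
  note O = eo[THEN eo_obj, OF Hc]
  note [simp] = smdD(1,2)[OF s(1)] smdD(1,2)[OF s(2)] smdD(1,2)[OF s(3)] O smd_cancel[OF s(1)] smd_cancel[OF s(2)] smd_cancel[OF s(3)]
    smdD(5)[OF s(1)] smdD(5)[OF s(2)] smdD(5)[OF s(3)] cmp_rewrite[OF o(1)] cmp_rewrite[OF o(2)]
  have e': "j \<cdot> p \<cdot> k = j1 \<cdot> p1 \<cdot> k \<boxplus> j2 \<cdot> p2 \<cdot> k" if "arr k" "tgt k = fst M" for k
    using that by (subst cmp_rewrite[OF e]) (auto simp: cmp_plus_left)
  show "split_exact H X1 X X2 (p \<cdot> j1) (p2 \<cdot> j)"
    unfolding split_exact_def
  proof (intro conjI exI)
    show "eqv H X1 X (p \<cdot> j1)" by (rule eqv_cmp[OF Hc eo(2) M eo(1) smdD(3)[OF s(2)] smdD(4)[OF s(1)]])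
    show "eqv H X X2 (p2 \<cdot> j)" by (rule eqv_cmp[OF Hc eo(1) M eo(3) smdD(3)[OF s(1)] smdD(4)[OF s(3)]])
    show "(p2 \<cdot> j) \<cdot> (p \<cdot> j1) = zer (fst X1) (fst X2)" by (simp add: e' cmp_plus_right o)
    show "(p1 \<cdot> j) \<cdot> (p \<cdot> j1) = ide (fst X1)" by (simp add: e' cmp_plus_right o)
    show "(p2 \<cdot> j) \<cdot> (p \<cdot> j2) = ide (fst X2)" by (simp add: e' cmp_plus_right o)
    have "(p \<cdot> j1) \<cdot> (p1 \<cdot> j) \<boxplus> (p \<cdot> j2) \<cdot> (p2 \<cdot> j) = p \<cdot> (j1 \<cdot> p1 \<boxplus> j2 \<cdot> p2) \<cdot> j"
      by (simp add: cmp_plus_left cmp_plus_right)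
    also have "\<dots> = ide (fst X)" unfolding e[symmetric] by simp
    finally show "(p \<cdot> j1) \<cdot> (p1 \<cdot> j) \<boxplus> (p \<cdot> j2) \<cdot> (p2 \<cdot> j) = ide (fst X)" .
  qed simp_all
qed

text \<open>The underlying object of \<open>M\<close> need not lie in \<open>D\<close>. It is enough
  that \<open>e\<close> lies below an idempotent \<open>j \<cdot> p\<close> of \<open>C\<close>
  whose image \<open>V\<close> is in \<open>D\<close>.\<close>

lemma smd_ex:
  assumes H: "subgroup H F" and D: "idem_complete D" and M: "eo H M" and e: "eqv H M M e" "e \<cdot> e = e"
    and V: "V \<in> D" "j \<Colon> V \<leadsto> fst M" "p \<Colon> fst M \<leadsto> V" "p \<cdot> j = ide V" "j \<cdot> p \<cdot> e = e" "e \<cdot> j \<cdot> p = e"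
  obtains X j' p' where "X \<in> EO D H" "smd H X M j' p'" "j' \<cdot> p' = e"
proof -
  note Hc = subgroup.subset[OF H]
  have DO: "D \<subseteq> Obj C" using D by (simp add: idem_complete_def)
  note [simp] = eqvD(1)[OF e(1)] V(2,3)
  have ee: "e \<cdot> e \<cdot> k = e \<cdot> k" if "arr k" "tgt k = fst M" for k
    using that by (subst cmp_rewrite[OF e(2)]) auto
  have jpe: "j \<cdot> p \<cdot> e \<cdot> k = e \<cdot> k" if "arr k" "tgt k = fst M" for k
  proof -
    have "(j \<cdot> p \<cdot> e) \<cdot> k = e \<cdot> k" by (simp only: V(5))
    then show ?thesis using that by simp
  qed
  \<comment> \<open>Compressed to \<open>V\<close>, the idempotent \<open>e\<close> becomes an
    idempotent of an object of \<open>D\<close>. It is split there, and the splitting is carried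
    back to \<open>M\<close> along \<open>j\<close> and \<open>p\<close>.\<close>
  have "(p \<cdot> e \<cdot> j) \<cdot> (p \<cdot> e \<cdot> j) = p \<cdot> e \<cdot> j" by (simp add: jpe ee)
  then obtain W a b where W: "W \<in> D" "a \<Colon> W \<leadsto> V" "b \<Colon> V \<leadsto> W" "b \<cdot> a = ide W" "a \<cdot> b = p \<cdot> e \<cdot> j"
    using idem_completeE[OF D, of "p \<cdot> e \<cdot> j" V] V by (metis arr_cmp src_tgt_simps(1,2) eqvD(1)[OF e(1)])
  note [simp] = W(2,3)
  have j': "j \<cdot> a \<Colon> W \<leadsto> fst M" "b \<cdot> p \<Colon> fst M \<leadsto> W" by auto
  have "(b \<cdot> p) \<cdot> (j \<cdot> a) = ide W" using W(4) by (simp add: cmp_rewrite[OF V(4)])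
  moreover have "(j \<cdot> a) \<cdot> (b \<cdot> p) = j \<cdot> (a \<cdot> b) \<cdot> p" by simp
  then have "(j \<cdot> a) \<cdot> (b \<cdot> p) = e" unfolding W(5) using V(5,6) by (simp add: jpe)
  ultimately show ?thesis
    using img_eqv[OF H M j', unfolded smd_def] e W(1) DO
    by (intro that[of "img H M (j \<cdot> a) (b \<cdot> p)" "j \<cdot> a" "b \<cdot> p"]) (auto simp: EO_iff smd_def)
qed

text \<open>The hypotheses are written as implications so that \<open>X\<close>, \<open>j\<close>
  and \<open>p\<close> can vary in the induction: in the step, a new object is made for the sum of
  the remaining idempotents.\<close>

lemma cls_smd_sum:
  assumes H: "subgroup H F" and D: "idem_complete D" and M: "eo H M"
  shows "finite I \<Longrightarrow> X \<in> EO D H \<Longrightarrow> smd H X M j p \<Longrightarrow>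
    (\<And>i. i \<in> I \<Longrightarrow> Xs i \<in> EO D H) \<Longrightarrow> (\<And>i. i \<in> I \<Longrightarrow> smd H (Xs i) M (js i) (ps i)) \<Longrightarrow>
    (\<And>i k. i \<in> I \<Longrightarrow> k \<in> I \<Longrightarrow> i \<noteq> k \<Longrightarrow> ps k \<cdot> js i = zer (fst (Xs i)) (fst (Xs k))) \<Longrightarrow>
    j \<cdot> p = asum (fst M) (fst M) (\<lambda>i. js i \<cdot> ps i) I \<Longrightarrow>
    K0_class (EQ D H) X = finsum (K0 (EQ D H) :: ('r::comm_ring_1, _) module) (\<lambda>i. K0_class (EQ D H) (Xs i)) I"
proof (induction I arbitrary: X j p rule: finite_induct)
  interpret K: module scalars "K0 (EQ D H) :: ('r, _) module" by (rule module_K0)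
  note Hc = subgroup.subset[OF H]
  have DO: "D \<subseteq> Obj C" using D by (simp add: idem_complete_def)
  note MO = eo_obj[OF M Hc]
  {
    case empty
    note s = smdD[OF empty(2)]
    have XO: "fst X \<in> Obj C" using s(1) arr_obj(1) by metis
    have "ide (fst X) = p \<cdot> (j \<cdot> p) \<cdot> j" using s by (simp add: smd_cancel[OF empty(2)])
    also have "\<dots> = zer (fst X) (fst X)" unfolding empty(6) using s MO XO by simp
    finally show ?case using cls_zero[OF H DO empty(1)] by simp
  next
    case (insert i I)
    note si = smdD[OF insert.prems(4)]
    have tI: "js k \<cdot> ps k \<Colon> fst M \<leadsto> fst M" if "k \<in> insert i I" for k using si[OF that] by auto
    define e where "e = asum (fst M) (fst M) (\<lambda>i. js i \<cdot> ps i) I"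
    have e: "e \<Colon> fst M \<leadsto> fst M" unfolding e_def using tI MO by (auto intro!: arr_asum)
    have orth: "(js k \<cdot> ps k) \<cdot> (js l \<cdot> ps l) = (if k = l then js k \<cdot> ps k else zer (fst M) (fst M))"
      if "k \<in> insert i I" "l \<in> insert i I" for k l
    proof (cases "k = l")
      case True
      then show ?thesis using smd_idem[OF insert.prems(4)[OF that(1)]] by simp
    next
      case False
      have "fst (Xs k) \<in> Obj C" "fst (Xs l) \<in> Obj C" using typed_obj(1)[OF si(1)[OF that(1)]] typed_obj(1)[OF si(1)[OF that(2)]] .
      then show ?thesis using False si(1,2)[OF that(1)] si(1,2)[OF that(2)] MO
        by (simp add: cmp_rewrite[OF insert.prems(5)[OF that(2,1)]])
    qed
    have ek: "e \<cdot> (js k \<cdot> ps k) = (if k \<in> I then js k \<cdot> ps k else zer (fst M) (fst M))"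
      and ke: "(js k \<cdot> ps k) \<cdot> e = (if k \<in> I then js k \<cdot> ps k else zer (fst M) (fst M))" if k: "k \<in> insert i I" for k
    proof -
      have "e \<cdot> (js k \<cdot> ps k) = asum (fst M) (fst M) (\<lambda>l. (js l \<cdot> ps l) \<cdot> (js k \<cdot> ps k)) I"
        unfolding e_def using tI k MO insert.hyps by (intro cmp_asum_left) blast+
      also have "\<dots> = asum (fst M) (fst M) (\<lambda>l. if l = k then js k \<cdot> ps k else zer (fst M) (fst M)) I"
        using k orth tI MO by (intro asum_cong) auto
      also have "\<dots> = (if k \<in> I then js k \<cdot> ps k else zer (fst M) (fst M))"
        by (rule asum_delta[OF insert.hyps(1) tI[OF k]])
      finally show "e \<cdot> (js k \<cdot> ps k) = (if k \<in> I then js k \<cdot> ps k else zer (fst M) (fst M))" .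
      have "(js k \<cdot> ps k) \<cdot> e = asum (fst M) (fst M) (\<lambda>l. (js k \<cdot> ps k) \<cdot> (js l \<cdot> ps l)) I"
        unfolding e_def using tI k MO insert.hyps by (intro cmp_asum_right) blast+
      also have "\<dots> = asum (fst M) (fst M) (\<lambda>l. if l = k then js k \<cdot> ps k else zer (fst M) (fst M)) I"
        using k orth tI MO by (intro asum_cong) auto
      also have "\<dots> = (if k \<in> I then js k \<cdot> ps k else zer (fst M) (fst M))"
        by (rule asum_delta[OF insert.hyps(1) tI[OF k]])
      finally show "(js k \<cdot> ps k) \<cdot> e = (if k \<in> I then js k \<cdot> ps k else zer (fst M) (fst M))" .
    qed
    have ee: "e \<cdot> e = e"
    proof -
      have "e \<cdot> e = asum (fst M) (fst M) (\<lambda>l. e \<cdot> (js l \<cdot> ps l)) I"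
        using tI e MO insert.hyps unfolding e_def[of] by (intro cmp_asum_right) blast+
      also have "\<dots> = asum (fst M) (fst M) (\<lambda>i. js i \<cdot> ps i) I"
        by (rule asum_cong) (use ek tI e MO in auto)
      finally show ?thesis by (simp add: e_def)
    qed
    have jp: "j \<cdot> p = js i \<cdot> ps i \<boxplus> e"
      unfolding insert.prems(6) e_def using insert.hyps tI by (intro asum_insert) blast+
    note s = smdD[OF insert.prems(2)]
    note [simp] = e tI[of i, simplified] MO
    have eoXs: "eo H (Xs k)" if "k \<in> insert i I" for k using insert.prems(3)[OF that] DO by (simp add: EO_iff)
    have eqi: "eqv H M M (js k \<cdot> ps k)" if "k \<in> insert i I" for k
      by (rule eqv_smd[OF Hc eoXs[OF that] M insert.prems(4)[OF that]])
    have eqe: "eqv H M M e"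
    proof -
      have "eqv H M M (asum (fst M) (fst M) (\<lambda>i. js i \<cdot> ps i) J)" if "J \<subseteq> I" "finite J" for J
        using that(2,1)
      proof induction
        case empty
        show ?case using MO eo_arr[OF M Hc] Hc by (auto simp: eqv_def subset_iff)
      next
        case (insert k J)
        have "asum (fst M) (fst M) (\<lambda>i. js i \<cdot> ps i) (insert k J) = js k \<cdot> ps k \<boxplus> asum (fst M) (fst M) (\<lambda>i. js i \<cdot> ps i) J"
          using insert(1,2,4) tI by (intro asum_insert) blast+
        then show ?case using insert eqi by (auto intro!: eqv_plus[OF Hc M M])
      qed
      then show ?thesis unfolding e_def using insert.hyps by blast
    qed
    \<comment> \<open>The partial sum \<open>e\<close> lies below \<open>j \<cdot> p\<close>, so it
      can be split inside \<open>fst X\<close>. This keeps the new object over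
      \<open>D\<close>.\<close>
    have V: "fst X \<in> D" using insert.prems(1) DO by (simp add: EO_iff)
    have 1: "(j \<cdot> p) \<cdot> e = e" "e \<cdot> (j \<cdot> p) = e"
      unfolding jp using ek[of i] ke[of i] insert.hyps ee by (simp_all add: cmp_plus_left cmp_plus_right)
    obtain X' j' p' where X': "X' \<in> EO D H" "smd H X' M j' p'" "j' \<cdot> p' = e"
      by (rule smd_ex[OF H D M eqe ee V s(1,2,5)]) (use 1 s in auto)
    note s' = smdD[OF X'(2)]
    have O: "fst X' \<in> Obj C" "fst (Xs i) \<in> Obj C" using typed_obj(1)[OF s'(1)] typed_obj(1)[OF si(1)[of i]] by auto
    note [simp] = s'(1,2) si(1,2)[of i, simplified] O
    have "ps i \<cdot> j' = ps i \<cdot> (js i \<cdot> ps i) \<cdot> (j' \<cdot> p') \<cdot> j'"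
      using s'(5) si(5)[of i] by (simp add: smd_cancel[OF X'(2)] smd_cancel[OF insert.prems(4)])
    also have "\<dots> = ps i \<cdot> ((js i \<cdot> ps i) \<cdot> e) \<cdot> j'" unfolding X'(3) by simp
    also have "\<dots> = zer (fst X') (fst (Xs i))" using ke[of i] insert.hyps by simp
    finally have o1: "ps i \<cdot> j' = zer (fst X') (fst (Xs i))" .
    have "p' \<cdot> js i = p' \<cdot> (j' \<cdot> p') \<cdot> (js i \<cdot> ps i) \<cdot> js i"
      using s'(5) si(5)[of i] by (simp add: smd_cancel[OF X'(2)] smd_cancel[OF insert.prems(4)])
    also have "\<dots> = p' \<cdot> (e \<cdot> (js i \<cdot> ps i)) \<cdot> js i" unfolding X'(3) by simp
    also have "\<dots> = zer (fst (Xs i)) (fst X')" using ek[of i] insert.hyps by simp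
    finally have o2: "p' \<cdot> js i = zer (fst (Xs i)) (fst X')" .
    have "K0_class (EQ D H) X = K0_class (EQ D H) (Xs i) \<oplus>\<^bsub>K0 (EQ D H) :: ('r, _) module\<^esub> K0_class (EQ D H) X'"
      by (rule cls_smd_plus[OF H DO insert.prems(1) insert.prems(3)[of i] X'(1) M insert.prems(2) insert.prems(4)[of i] X'(2)])
        (simp_all add: X'(3) jp o1 o2)
    also have "K0_class (EQ D H) X' = finsum (K0 (EQ D H) :: ('r, _) module) (\<lambda>i. K0_class (EQ D H) (Xs i)) I"
      by (rule insert.IH[OF X'(1,2)]) (use insert.prems in \<open>auto simp: X'(3) e_def\<close>)
    also have "K0_class (EQ D H) (Xs i) \<oplus>\<^bsub>K0 (EQ D H) :: ('r, _) module\<^esub> finsum (K0 (EQ D H)) (\<lambda>i. K0_class (EQ D H) (Xs i)) I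
      = finsum (K0 (EQ D H)) (\<lambda>i. K0_class (EQ D H) (Xs i)) (insert i I)"
      using insert.hyps insert.prems(3) by (intro K.M.finsum_insert[symmetric]) auto
    finally show ?case .
  }
qed

section \<open>Induction\<close>

definition bip where
  "bip I X P j p \<longleftrightarrow> finite I \<and> P \<in> Obj C \<and> (\<forall>i\<in>I. X i \<in> Obj C \<and> j i \<Colon> X i \<leadsto> P \<and> p i \<Colon> P \<leadsto> X i) \<and>
     (\<forall>i\<in>I. \<forall>k\<in>I. p k \<cdot> j i = (if i = k then ide (X i) else zer (X i) (X k))) \<and>
     asum P P (\<lambda>i. j i \<cdot> p i) I = ide P"

lemma bipD:
  assumes "bip I X P j p"
  shows "finite I" "P \<in> Obj C" "i \<in> I \<Longrightarrow> X i \<in> Obj C" "i \<in> I \<Longrightarrow> j i \<Colon> X i \<leadsto> P" "i \<in> I \<Longrightarrow> p i \<Colon> P \<leadsto> X i"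
    "i \<in> I \<Longrightarrow> p i \<cdot> j i = ide (X i)" "i \<in> I \<Longrightarrow> k \<in> I \<Longrightarrow> i \<noteq> k \<Longrightarrow> p k \<cdot> j i = zer (X i) (X k)"
    "asum P P (\<lambda>i. j i \<cdot> p i) I = ide P"
  using assms unfolding bip_def by auto

text \<open>Arrows out of a biproduct are determined by their restrictions to the summands.
  Identities about induced objects are checked summand by summand in this way.\<close>

lemma bip_ext:
  assumes b: "bip I X P j p" and f: "f \<Colon> P \<leadsto> Q" "g \<Colon> P \<leadsto> Q" and fg: "\<And>i. i \<in> I \<Longrightarrow> f \<cdot> j i = g \<cdot> j i"
  shows "f = g"
proof -
  note d = bipD[OF b]
  have Q: "Q \<in> Obj C" using f by auto
  have *: "h = asum P Q (\<lambda>i. (h \<cdot> j i) \<cdot> p i) I" if h: "h \<Colon> P \<leadsto> Q" for h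
  proof -
    have "h = h \<cdot> asum P P (\<lambda>i. j i \<cdot> p i) I" using h d(8) by simp
    also have "\<dots> = asum P Q (\<lambda>i. h \<cdot> (j i \<cdot> p i)) I" using h d by (intro cmp_asum_right) auto
    also have "\<dots> = asum P Q (\<lambda>i. (h \<cdot> j i) \<cdot> p i) I" using h d Q by (intro asum_cong) auto
    finally show ?thesis .
  qed
  have "asum P Q (\<lambda>i. (f \<cdot> j i) \<cdot> p i) I = asum P Q (\<lambda>i. (g \<cdot> j i) \<cdot> p i) I"
    using f d Q fg by (intro asum_cong) auto
  then show ?thesis using *[OF f(1)] *[OF f(2)] by simp
qed

lemma bip_act:
  assumes b: "bip I X P j p" and a: "a \<in> carrier F"
  shows "bip I (\<lambda>i. ActO T a (X i)) (ActO T a P) (\<lambda>i. act a (j i)) (\<lambda>i. act a (p i))"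
proof -
  note d = bipD[OF b]
  have "act a (p k) \<cdot> act a (j i) = (if i = k then ide (ActO T a (X i)) else zer (ActO T a (X i)) (ActO T a (X k)))"
    if "i \<in> I" "k \<in> I" for i k
  proof -
    have "act a (p k) \<cdot> act a (j i) = act a (p k \<cdot> j i)" using d that a by simp
    also have "\<dots> = (if i = k then ide (ActO T a (X i)) else zer (ActO T a (X i)) (ActO T a (X k)))"
      using d that a by (cases "i = k") (simp_all del: act_cmp)
    finally show ?thesis .
  qed
  moreover have "asum (ActO T a P) (ActO T a P) (\<lambda>i. act a (j i) \<cdot> act a (p i)) I = ide (ActO T a P)"
  proof -
    have "asum (ActO T a P) (ActO T a P) (\<lambda>i. act a (j i) \<cdot> act a (p i)) I = asum (ActO T a P) (ActO T a P) (\<lambda>i. act a (j i \<cdot> p i)) I"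
      using d a by (intro asum_cong) auto
    also have "\<dots> = act a (asum P P (\<lambda>i. j i \<cdot> p i) I)" using d a by (intro act_asum[symmetric]) auto
    finally show ?thesis using d a by simp
  qed
  ultimately show ?thesis using d a unfolding bip_def by auto
qed

lemma is_biproduct_bip: "is_biproduct C I X P \<iota> \<pi> \<Longrightarrow>
  bip I X P (\<lambda>i. Arrow (X i) (\<iota> i) P) (\<lambda>i. Arrow P (\<pi> i) (X i))"
  using is_biproductD[of I X P \<iota> \<pi>] unfolding bip_def by auto

lemma bip_is_biproduct: "bip I X P j p \<Longrightarrow> is_biproduct C I X P (\<lambda>i. mor (j i)) (\<lambda>i. mor (p i))"
  by (rule is_biproductI) (auto simp: bip_def)

lemma ex_bip: "finite I \<Longrightarrow> (\<And>i. i \<in> I \<Longrightarrow> X i \<in> Obj C) \<Longrightarrow> \<exists>P j p. bip I X P j p"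
proof (induction I rule: finite_induct)
  case empty
  obtain Z where Z: "zero_object C Z" using ex_zero_object by blast
  then show ?case unfolding bip_def zero_object_iff by (intro exI[of _ Z]) auto
next
  case (insert i I)
  then obtain Q j p where b: "bip I X Q j p" by blast
  note d = bipD[OF b]
  obtain P \<iota> \<pi> where "is_biproduct C UNIV (\<lambda>b. if b then X i else Q) P \<iota> \<pi>"
    using ex_biproduct[of "X i" Q] insert.prems d by auto
  note b' = is_biproduct_bip[OF this]
  define u where "u b = Arrow (if b then X i else Q) (\<iota> b) P" for b
  define v where "v b = Arrow P (\<pi> b) (if b then X i else Q)" for b
  have b'': "bip UNIV (\<lambda>b. if b then X i else Q) P u v" using b' by (simp add: u_def[abs_def] v_def[abs_def])
  have [simp]: "u True \<Colon> X i \<leadsto> P" "u False \<Colon> Q \<leadsto> P" "v True \<Colon> P \<leadsto> X i" "v False \<Colon> P \<leadsto> Q" "P \<in> Obj C" "Q \<in> Obj C"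
    using bipD(4,5)[OF b'', of True] bipD(4,5)[OF b'', of False] bipD(2)[OF b''] d(2) by simp_all
  have vu: "v True \<cdot> u True = ide (X i)" "v False \<cdot> u False = ide Q" "v True \<cdot> u False = zer Q (X i)" "v False \<cdot> u True = zer (X i) Q"
    using bipD(6)[OF b'', of True] bipD(6)[OF b'', of False] bipD(7)[OF b'', of True False] bipD(7)[OF b'', of False True] by simp_all
  note [simp] = vu cmp_rewrite[OF vu(1)] cmp_rewrite[OF vu(2)] cmp_rewrite[OF vu(3)] cmp_rewrite[OF vu(4)]
  have uv: "u True \<cdot> v True \<boxplus> u False \<cdot> v False = ide P"
  proof -
    have "asum P P (\<lambda>b. u b \<cdot> v b) (insert True {False}) = u True \<cdot> v True \<boxplus> asum P P (\<lambda>b. u b \<cdot> v b) {False}"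
      by (rule asum_insert) auto
    moreover have "insert True {False} = UNIV" by auto
    moreover have "asum P P (\<lambda>b. u b \<cdot> v b) {False} = u False \<cdot> v False" by (rule asum_singleton) auto
    ultimately show ?thesis using bipD(8)[OF b''] by simp
  qed
  let ?j = "\<lambda>k. if k = i then u True else u False \<cdot> j k" let ?p = "\<lambda>k. if k = i then v True else p k \<cdot> v False"
  have dI: "k \<noteq> i" "X k \<in> Obj C" "j k \<Colon> X k \<leadsto> Q" "p k \<Colon> Q \<leadsto> X k" if "k \<in> I" for k
    using that d insert.hyps by auto
  have "bip (insert i I) X P ?j ?p"
    unfolding bip_def
  proof (intro conjI ballI)
    fix k l assume kl: "k \<in> insert i I" "l \<in> insert i I"
    show "?p l \<cdot> ?j k = (if k = l then ide (X k) else zer (X k) (X l))"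
    proof (cases "k = i"; cases "l = i")
      assume "k = i" "l \<noteq> i"
      then show ?thesis using kl dI[of l] insert.prems[of i] by auto
    next
      assume "k \<noteq> i" "l = i"
      then show ?thesis using kl dI[of k] insert.prems[of i] by auto
    next
      assume "k \<noteq> i" "l \<noteq> i"
      then show ?thesis using kl dI[of k] dI[of l] d(6,7) by auto
    qed auto
  next
    have "asum P P (\<lambda>k. ?j k \<cdot> ?p k) (insert i I) = ?j i \<cdot> ?p i \<boxplus> asum P P (\<lambda>k. ?j k \<cdot> ?p k) I"
      using insert.hyps dI by (intro asum_insert) (auto split: if_splits)
    also have "asum P P (\<lambda>k. ?j k \<cdot> ?p k) I = asum P P (\<lambda>k. u False \<cdot> (j k \<cdot> p k) \<cdot> v False) I"
      using dI by (intro asum_cong) auto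
    also have "\<dots> = u False \<cdot> asum Q Q (\<lambda>k. j k \<cdot> p k) I \<cdot> v False"
    proof -
      have "asum Q Q (\<lambda>k. j k \<cdot> p k) I \<cdot> v False = asum P Q (\<lambda>k. (j k \<cdot> p k) \<cdot> v False) I"
        using insert.hyps dI by (intro cmp_asum_left) auto
      moreover have "u False \<cdot> asum P Q (\<lambda>k. (j k \<cdot> p k) \<cdot> v False) I = asum P P (\<lambda>k. u False \<cdot> (j k \<cdot> p k) \<cdot> v False) I"
        using insert.hyps dI by (intro cmp_asum_right) auto
      ultimately show ?thesis by simp
    qed
    also have "\<dots> = u False \<cdot> v False" using d(8) by simp
    finally show "asum P P (\<lambda>k. ?j k \<cdot> ?p k) (insert i I) = ide P" using uv by simp
  qed (use insert dI in auto)
  then show ?case by blast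
qed

text \<open>The part of \<open>is_induced\<close> that concerns the biproduct, with its inclusions
  and projections as parameters: the functor on arrows is written in terms of them.\<close>

definition ind_data where
  "ind_data A B R V Y j p \<longleftrightarrow> bip R (\<lambda>t. ActO T t (fst V)) (fst Y) j p \<and>
     (\<forall>a\<in>A. \<forall>t\<in>R. \<forall>s\<in>R. \<forall>b\<in>B. a \<otimes>\<^bsub>F\<^esub> t = s \<otimes>\<^bsub>F\<^esub> b \<longrightarrow>
        sact Y a \<cdot> act a (j t) = j s \<cdot> act s (sact V b) \<cdot> ainv (cp s b (fst V)) \<cdot> cp a t (fst V))"

lemma is_induced_iff:
  assumes "D \<subseteq> Obj C"
  shows "is_induced C F T D A B R V Y \<longleftrightarrow> Y \<in> EO D A \<and> (\<exists>j p. ind_data A B R V Y j p)"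
proof -
  obtain V' \<mu> W \<nu> where VY: "V = (V', \<mu>)" "Y = (W, \<nu>)" by (cases V; cases Y)
  have eq: "(\<nu> a \<bullet> ActA T a (\<iota> t) = \<iota> s \<bullet> ActA T s (\<mu> b)
      \<bullet> inv_arr C (ActO T s (ActO T b V')) (ActO T (s \<otimes>\<^bsub>F\<^esub> b) V') (ActComp T s b V') \<bullet> ActComp T a t V') \<longleftrightarrow>
     (sact Y a \<cdot> act a (Arrow (ActO T t V') (\<iota> t) W) = Arrow (ActO T s V') (\<iota> s) W \<cdot> act s (sact V b) \<cdot> ainv (cp s b (fst V)) \<cdot> cp a t (fst V))"
    for a t s b \<iota>
    by (simp add: VY sact_def act_def cmp_def cp_def ainv_def)
  show ?thesis
  proof
    assume "is_induced C F T D A B R V Y"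
    then show "Y \<in> EO D A \<and> (\<exists>j p. ind_data A B R V Y j p)"
      unfolding is_induced_def VY prod.case eq[unfolded VY] ind_data_def
      using is_biproduct_bip[of R "\<lambda>t. ActO T t V'" W] by auto
  next
    assume "Y \<in> EO D A \<and> (\<exists>j p. ind_data A B R V Y j p)"
    then obtain j p where Y: "Y \<in> EO D A" and d: "ind_data A B R V Y j p" by blast
    then have b: "bip R (\<lambda>t. ActO T t V') W j p" by (simp add: ind_data_def VY)
    have "Arrow (ActO T t V') (mor (j t)) W = j t" if "t \<in> R" for t
      using bipD(4)[OF b that] by (metis arrow.collapse)
    then have "\<forall>a\<in>A. \<forall>t\<in>R. \<forall>s\<in>R. \<forall>b\<in>B. a \<otimes>\<^bsub>F\<^esub> t = s \<otimes>\<^bsub>F\<^esub> b \<longrightarrow>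
        sact Y a \<cdot> act a (Arrow (ActO T t V') (mor (j t)) W) = Arrow (ActO T s V') (mor (j s)) W \<cdot> act s (sact V b) \<cdot> ainv (cp s b (fst V)) \<cdot> cp a t (fst V)"
      using d by (auto simp: ind_data_def)
    then show "is_induced C F T D A B R V Y"
      using Y bip_is_biproduct[OF b]
      unfolding is_induced_def VY prod.case eq[unfolded VY]
      by (intro conjI exI[of _ "\<lambda>t. mor (j t)"] exI[of _ "\<lambda>t. mor (p t)"]) auto
  qed
qed

end

section \<open>Functoriality and existence of induced objects\<close>

context action
begin

lemma ainv_natural:
  assumes "g \<cdot> k = k' \<cdot> f" "aiso k" "aiso k'" "arr f" "arr g" "src f = src k" "tgt f = src k'" "src g = tgt k" "tgt g = tgt k'"
  shows "ainv k' \<cdot> g = f \<cdot> ainv k"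
proof -
  have "ainv k' \<cdot> (g \<cdot> k) \<cdot> ainv k = ainv k' \<cdot> (k' \<cdot> f) \<cdot> ainv k" by (simp only: assms(1))
  then show ?thesis using assms(2-) by (simp add: cmp_ainv)
qed

lemma ainv_ide [simp]: "A \<in> Obj C \<Longrightarrow> ainv (ide A) = ide A"
  by (rule ainv_unique) auto

text \<open>The arrow from \<open>T^a(T^t V)\<close> to \<open>T^s V\<close> in the definition of
  induced objects is natural in \<open>V\<close>. For \<open>t = s\<close> it is the structure map
  of a conjugate, so the lemma serves both constructions.\<close>

lemma theta_natural:
  assumes [simp]: "a \<in> carrier F" "t \<in> carrier F" "s \<in> carrier F" "b \<in> carrier F" and ab: "a \<otimes>\<^bsub>F\<^esub> t = s \<otimes>\<^bsub>F\<^esub> b"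
    and f [simp]: "f \<Colon> fst V \<leadsto> fst V'" and fb: "f \<cdot> sact V b = sact V' b \<cdot> act b f"
    and [simp]: "arr (sact V b)" "arr (sact V' b)"
  shows "act s f \<cdot> act s (sact V b) \<cdot> ainv (cp s b (fst V)) \<cdot> cp a t (fst V) =
    act s (sact V' b) \<cdot> ainv (cp s b (fst V')) \<cdot> cp a t (fst V') \<cdot> act a (act t f)"
proof -
  have [simp]: "fst V \<in> Obj C" "fst V' \<in> Obj C" using typed_obj[OF f] .
  have n: "act (s \<otimes>\<^bsub>F\<^esub> b) f \<cdot> cp s b (fst V) = cp s b (fst V') \<cdot> act s (act b f)" using cp_natural[of s b f] by simp
  have 1: "ainv (cp s b (fst V')) \<cdot> act (s \<otimes>\<^bsub>F\<^esub> b) f = act s (act b f) \<cdot> ainv (cp s b (fst V))"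
    by (rule ainv_natural[OF n]) simp_all
  have 2: "cp a t (fst V') \<cdot> act a (act t f) = act (a \<otimes>\<^bsub>F\<^esub> t) f \<cdot> cp a t (fst V)" using cp_natural[of a t f] by simp
  have 3: "act s f \<cdot> act s (sact V b) = act s (sact V' b) \<cdot> act s (act b f)"
    using arg_cong[OF fb, of "act s"] by simp
  have "act s f \<cdot> act s (sact V b) \<cdot> ainv (cp s b (fst V)) \<cdot> cp a t (fst V)
     = act s (sact V' b) \<cdot> (act s (act b f) \<cdot> ainv (cp s b (fst V))) \<cdot> cp a t (fst V)"
    using ab by (simp add: cmp_rewrite[OF 3])
  also have "\<dots> = act s (sact V' b) \<cdot> ainv (cp s b (fst V')) \<cdot> cp a t (fst V') \<cdot> act a (act t f)"
    unfolding 1[symmetric] 2 using ab by simp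
  finally show ?thesis .
qed

text \<open>Induction on arrows: the diagonal matrix with entries \<open>T^t f\<close> between
  chosen biproducts. It is defined for every arrow of \<open>C\<close>, so that the non-equivariant
  halves of a splitting can be induced too.\<close>

definition ifun where
  "ifun R Y Y' j' p f = asum (fst Y) (fst Y') (\<lambda>t. j' t \<cdot> act t f \<cdot> p t) R"

lemma ifun_j:
  assumes b: "bip R (\<lambda>t. ActO T t V) (fst Y) j p" and b': "bip R (\<lambda>t. ActO T t V') (fst Y') j' p'"
    and R: "R \<subseteq> carrier F" and f: "f \<Colon> V \<leadsto> V'"
  shows "ifun R Y Y' j' p f \<Colon> fst Y \<leadsto> fst Y'" "t \<in> R \<Longrightarrow> ifun R Y Y' j' p f \<cdot> j t = j' t \<cdot> act t f"
proof -
  note d = bipD[OF b] and d' = bipD[OF b']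
  have ty: "j' t \<cdot> act t f \<cdot> p t \<Colon> fst Y \<leadsto> fst Y'" if "t \<in> R" for t
    using d(5)[OF that] d'(4)[OF that] f that R by (auto simp: subset_iff)
  then show "ifun R Y Y' j' p f \<Colon> fst Y \<leadsto> fst Y'"
    unfolding ifun_def using d(2) d'(2) by (auto intro!: arr_asum)
  assume t: "t \<in> R"
  note tt = d(3,4)[OF t] d'(3,4)[OF t]
  have tF: "t \<in> carrier F" using t R by auto
  have c: "(j' s \<cdot> act s f \<cdot> p s) \<cdot> j t = (if s = t then j' t \<cdot> act t f else zer (ActO T t V) (fst Y'))" if s: "s \<in> R" for s
  proof -
    have sF: "s \<in> carrier F" using s R by auto
    have "(j' s \<cdot> act s f \<cdot> p s) \<cdot> j t = j' s \<cdot> act s f \<cdot> (p s \<cdot> j t)"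
      using d(4)[OF t] d(5)[OF s] d'(4)[OF s] f sF by simp
    then show ?thesis
      using d(6)[OF t] d(7)[OF t s] tt d'(2,3,4) f sF s typed_obj[OF f] by (cases "s = t") auto
  qed
  have "ifun R Y Y' j' p f \<cdot> j t = asum (ActO T t V) (fst Y') (\<lambda>s. (j' s \<cdot> act s f \<cdot> p s) \<cdot> j t) R"
    unfolding ifun_def by (rule cmp_asum_left[OF d(1) ty tt(2) d'(2)])
  also have "\<dots> = asum (ActO T t V) (fst Y') (\<lambda>s. if s = t then j' t \<cdot> act t f else zer (ActO T t V) (fst Y')) R"
    using c tt d'(2) f tF by (intro asum_cong) auto
  also have "\<dots> = j' t \<cdot> act t f"
    using asum_single[OF d(1) t, of "\<lambda>s. if s = t then j' t \<cdot> act t f else zer (ActO T t V) (fst Y')" "ActO T t V" "fst Y'"] tt f tF by auto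
  finally show "ifun R Y Y' j' p f \<cdot> j t = j' t \<cdot> act t f" .
qed

lemma left_transversalE:
  assumes "left_transversal F A B R" "subgroup A F" "a \<in> A" "t \<in> R"
  obtains s b where "s \<in> R" "b \<in> B" "a \<otimes>\<^bsub>F\<^esub> t = s \<otimes>\<^bsub>F\<^esub> b"
proof -
  have "a \<otimes>\<^bsub>F\<^esub> t \<in> A" using assms by (auto simp: left_transversal_def intro!: subgroup.m_closed)
  then show ?thesis using assms(1) that unfolding left_transversal_def by blast
qed

text \<open>Both sides are compared on the summands \<open>T^a(T^t V)\<close>. For
  \<open>a t = s c\<close> they agree by naturality of the transition arrow to
  \<open>T^s V\<close>.\<close>

lemma eqv_ifun:
  assumes A: "subgroup A F" and B: "subgroup B F" and R: "left_transversal F A B R"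
    and V: "eo B V" "eo B V'" and Y: "eo A Y" "eo A Y'"
    and i: "ind_data A B R V Y j p" "ind_data A B R V' Y' j' p'" and f: "eqv B V V' f"
  shows "eqv A Y Y' (ifun R Y Y' j' p f)"
  unfolding eqv_def
proof (intro conjI ballI)
  note Ac = subgroup.subset[OF A] and Bc = subgroup.subset[OF B]
  have RA: "R \<subseteq> A" using R by (simp add: left_transversal_def)
  then have RF: "R \<subseteq> carrier F" using Ac by auto
  have b: "bip R (\<lambda>t. ActO T t (fst V)) (fst Y) j p" "bip R (\<lambda>t. ActO T t (fst V')) (fst Y') j' p'"
    using i by (auto simp: ind_data_def)
  note fD = eqvD[OF f]
  note I = ifun_j[OF b RF fD(1)]
  show "arr (ifun R Y Y' j' p f)" "src (ifun R Y Y' j' p f) = fst Y" "tgt (ifun R Y Y' j' p f) = fst Y'" using I(1) by auto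
  fix a assume a: "a \<in> A"
  have aF: "a \<in> carrier F" using a Ac by auto
  let ?I = "ifun R Y Y' j' p f"
  note [simp] = I(1) aF eo_arr[OF Y(1) Ac a] eo_arr[OF Y(2) Ac a]
  show "?I \<cdot> sact Y a = sact Y' a \<cdot> act a ?I"
  proof (rule bip_ext[OF bip_act[OF b(1) aF]])
    fix t assume t: "t \<in> R"
    obtain s c where s: "s \<in> R" and c: "c \<in> B" and at: "a \<otimes>\<^bsub>F\<^esub> t = s \<otimes>\<^bsub>F\<^esub> c"
      by (rule left_transversalE[OF R A a t])
    have F: "t \<in> carrier F" "s \<in> carrier F" "c \<in> carrier F" using t s c RF Bc by auto
    note [simp] = F bipD(4)[OF b(1) t] bipD(4)[OF b(1) s] bipD(4)[OF b(2) t] bipD(4)[OF b(2) s] eo_obj[OF V(1) Bc] eo_obj[OF V(2) Bc]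
      eo_arr[OF V(1) Bc c] eo_arr[OF V(2) Bc c] fD(1)
    have r: "sact Y a \<cdot> act a (j t) = j s \<cdot> act s (sact V c) \<cdot> ainv (cp s c (fst V)) \<cdot> cp a t (fst V)"
      "sact Y' a \<cdot> act a (j' t) = j' s \<cdot> act s (sact V' c) \<cdot> ainv (cp s c (fst V')) \<cdot> cp a t (fst V')"
      using i a t s c at unfolding ind_data_def by blast+
    note th = theta_natural[OF aF F at fD(1) fD(2)[OF c] eo_arr[OF V(1) Bc c] eo_arr[OF V(2) Bc c]]
    have "(?I \<cdot> sact Y a) \<cdot> act a (j t) = ?I \<cdot> j s \<cdot> act s (sact V c) \<cdot> ainv (cp s c (fst V)) \<cdot> cp a t (fst V)"
      by (simp add: r(1) del: act_cmp)
    also have "\<dots> = j' s \<cdot> (act s f \<cdot> act s (sact V c) \<cdot> ainv (cp s c (fst V)) \<cdot> cp a t (fst V))"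
      using at by (simp add: cmp_rewrite[OF I(2)[OF s]])
    also have "\<dots> = (sact Y' a \<cdot> act a (j' t)) \<cdot> act a (act t f)"
      unfolding th r(2) using at by simp
    also have "\<dots> = sact Y' a \<cdot> act a (?I \<cdot> j t)"
      unfolding I(2)[OF t] by simp
    also have "\<dots> = (sact Y' a \<cdot> act a ?I) \<cdot> act a (j t)" by simp
    finally show "(?I \<cdot> sact Y a) \<cdot> act a (j t) = (sact Y' a \<cdot> act a ?I) \<cdot> act a (j t)" .
  qed simp_all
qed

lemma ifun_functor:
  assumes b: "bip R (\<lambda>t. ActO T t V1) (fst Y1) j1 p1" "bip R (\<lambda>t. ActO T t V2) (fst Y2) j2 p2"
    "bip R (\<lambda>t. ActO T t V3) (fst Y3) j3 p3" and R: "R \<subseteq> carrier F"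
    and f: "f \<Colon> V1 \<leadsto> V2" "g \<Colon> V2 \<leadsto> V3"
  shows "ifun R Y2 Y3 j3 p2 g \<cdot> ifun R Y1 Y2 j2 p1 f = ifun R Y1 Y3 j3 p1 (g \<cdot> f)"
proof (rule bip_ext[OF b(1)])
  note F = ifun_j[OF b(1,2) R f(1)] and G = ifun_j[OF b(2,3) R f(2)]
  have gf: "g \<cdot> f \<Colon> V1 \<leadsto> V3" using f by auto
  note GF = ifun_j[OF b(1,3) R gf]
  show "ifun R Y2 Y3 j3 p2 g \<cdot> ifun R Y1 Y2 j2 p1 f \<Colon> fst Y1 \<leadsto> fst Y3" "ifun R Y1 Y3 j3 p1 (g \<cdot> f) \<Colon> fst Y1 \<leadsto> fst Y3"
    using F(1) G(1) GF(1) by auto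
  fix t assume t: "t \<in> R"
  have tF: "t \<in> carrier F" using t R by auto
  show "(ifun R Y2 Y3 j3 p2 g \<cdot> ifun R Y1 Y2 j2 p1 f) \<cdot> j1 t = ifun R Y1 Y3 j3 p1 (g \<cdot> f) \<cdot> j1 t"
    using F(1) G(1) f tF bipD(4)[OF b(1) t] bipD(4)[OF b(2) t] bipD(4)[OF b(3) t]
    by (simp add: GF(2)[OF t] F(2)[OF t] cmp_rewrite[OF G(2)[OF t]])
qed

lemma ifun_ide:
  assumes b: "bip R (\<lambda>t. ActO T t V) (fst Y) j p" and R: "R \<subseteq> carrier F" and V: "V \<in> Obj C"
  shows "ifun R Y Y j p (ide V) = ide (fst Y)"
proof (rule bip_ext[OF b])
  have i: "ide V \<Colon> V \<leadsto> V" using V by simp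
  note I = ifun_j[OF b b R i]
  show "ifun R Y Y j p (ide V) \<Colon> fst Y \<leadsto> fst Y" "ide (fst Y) \<Colon> fst Y \<leadsto> fst Y" using I(1) bipD(2)[OF b] by auto
  fix t assume t: "t \<in> R"
  have tF: "t \<in> carrier F" using t R by auto
  show "ifun R Y Y j p (ide V) \<cdot> j t = ide (fst Y) \<cdot> j t"
    using bipD(4)[OF b t] tF V by (simp add: I(2)[OF t])
qed

lemma ifun_plus:
  assumes b: "bip R (\<lambda>t. ActO T t V) (fst Y) j p" "bip R (\<lambda>t. ActO T t V') (fst Y') j' p'" and R: "R \<subseteq> carrier F"
    and f: "f \<Colon> V \<leadsto> V'" "g \<Colon> V \<leadsto> V'"
  shows "ifun R Y Y' j' p (f \<boxplus> g) = ifun R Y Y' j' p f \<boxplus> ifun R Y Y' j' p g"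
proof (rule bip_ext[OF b(1)])
  have fg: "f \<boxplus> g \<Colon> V \<leadsto> V'" using f by auto
  note F = ifun_j[OF b R f(1)] and G = ifun_j[OF b R f(2)] and H = ifun_j[OF b R fg]
  show "ifun R Y Y' j' p (f \<boxplus> g) \<Colon> fst Y \<leadsto> fst Y'" "ifun R Y Y' j' p f \<boxplus> ifun R Y Y' j' p g \<Colon> fst Y \<leadsto> fst Y'" using F(1) G(1) H(1) by auto
  fix t assume t: "t \<in> R"
  have tF: "t \<in> carrier F" using t R by auto
  show "ifun R Y Y' j' p (f \<boxplus> g) \<cdot> j t = (ifun R Y Y' j' p f \<boxplus> ifun R Y Y' j' p g) \<cdot> j t"
    using F(1) G(1) f tF bipD(4)[OF b(1) t] bipD(4)[OF b(2) t]
    by (simp add: H(2)[OF t] F(2)[OF t] G(2)[OF t] cmp_plus_left cmp_plus_right)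
qed

lemma ifun_zer:
  assumes b: "bip R (\<lambda>t. ActO T t V) (fst Y) j p" "bip R (\<lambda>t. ActO T t V') (fst Y') j' p'" and R: "R \<subseteq> carrier F"
    and V: "V \<in> Obj C" "V' \<in> Obj C"
  shows "ifun R Y Y' j' p (zer V V') = zer (fst Y) (fst Y')"
proof -
  have z: "zer V V' \<Colon> V \<leadsto> V'" using V by simp
  have "ifun R Y Y' j' p (zer V V') \<boxplus> ifun R Y Y' j' p (zer V V') = ifun R Y Y' j' p (zer V V')"
    using ifun_plus[OF b R z z] V by simp
  then show ?thesis using plus_idem_zer ifun_j(1)[OF b R z] by metis
qed

text \<open>All identities of a splitting are preserved, since \<open>ifun\<close> respects
  composites, identities, sums and zero. Equivariance is needed only for \<open>f\<close> and
  \<open>g\<close>.\<close>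

lemma ind_split_exact:
  assumes A: "subgroup A F" and B: "subgroup B F" and R: "left_transversal F A B R"
    and V: "eo B V1" "eo B V2" "eo B V3" and Y: "eo A Y1" "eo A Y2" "eo A Y3"
    and i: "ind_data A B R V1 Y1 j1 p1" "ind_data A B R V2 Y2 j2 p2" "ind_data A B R V3 Y3 j3 p3"
    and se: "split_exact B V1 V2 V3 f g"
  shows "split_exact A Y1 Y2 Y3 (ifun R Y1 Y2 j2 p1 f) (ifun R Y2 Y3 j3 p2 g)"
proof -
  note Ac = subgroup.subset[OF A] and Bc = subgroup.subset[OF B]
  have RF: "R \<subseteq> carrier F" using R Ac by (auto simp: left_transversal_def)
  have b: "bip R (\<lambda>t. ActO T t (fst V1)) (fst Y1) j1 p1" "bip R (\<lambda>t. ActO T t (fst V2)) (fst Y2) j2 p2"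
     "bip R (\<lambda>t. ActO T t (fst V3)) (fst Y3) j3 p3" using i by (auto simp: ind_data_def)
  from se obtain r s where fg: "eqv B V1 V2 f" "eqv B V2 V3 g" and z: "g \<cdot> f = zer (fst V1) (fst V3)"
    and rs: "r \<Colon> fst V2 \<leadsto> fst V1" "s \<Colon> fst V3 \<leadsto> fst V2" "r \<cdot> f = ide (fst V1)" "g \<cdot> s = ide (fst V3)"
    "f \<cdot> r \<boxplus> s \<cdot> g = ide (fst V2)" unfolding split_exact_def by blast
  note t = eqvD(1)[OF fg(1)] eqvD(1)[OF fg(2)]
  note o = eo_obj[OF V(1) Bc] eo_obj[OF V(2) Bc] eo_obj[OF V(3) Bc]
  show ?thesis
    unfolding split_exact_def
  proof (intro conjI exI)
    show "eqv A Y1 Y2 (ifun R Y1 Y2 j2 p1 f)" by (rule eqv_ifun[OF A B R V(1,2) Y(1,2) i(1,2) fg(1)])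
    show "eqv A Y2 Y3 (ifun R Y2 Y3 j3 p2 g)" by (rule eqv_ifun[OF A B R V(2,3) Y(2,3) i(2,3) fg(2)])
    show "ifun R Y2 Y3 j3 p2 g \<cdot> ifun R Y1 Y2 j2 p1 f = zer (fst Y1) (fst Y3)"
      unfolding ifun_functor[OF b RF t] z by (rule ifun_zer[OF b(1,3) RF o(1,3)])
    show "ifun R Y2 Y1 j1 p2 r \<cdot> ifun R Y1 Y2 j2 p1 f = ide (fst Y1)"
      unfolding ifun_functor[OF b(1,2,1) RF t(1) rs(1)] rs(3) by (rule ifun_ide[OF b(1) RF o(1)])
    show "ifun R Y2 Y3 j3 p2 g \<cdot> ifun R Y3 Y2 j2 p3 s = ide (fst Y3)"
      unfolding ifun_functor[OF b(3,2,3) RF rs(2) t(2)] rs(4) by (rule ifun_ide[OF b(3) RF o(3)])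
    have "f \<cdot> r \<Colon> fst V2 \<leadsto> fst V2" "s \<cdot> g \<Colon> fst V2 \<leadsto> fst V2" using rs t by auto
    then show "ifun R Y1 Y2 j2 p1 f \<cdot> ifun R Y2 Y1 j1 p2 r \<boxplus> ifun R Y3 Y2 j2 p3 s \<cdot> ifun R Y2 Y3 j3 p2 g = ide (fst Y2)"
      unfolding ifun_functor[OF b(2,1,2) RF rs(1) t(1)] ifun_functor[OF b(2,3,2) RF t(2) rs(2)]
      by (subst ifun_plus[OF b(2,2) RF, symmetric]) (simp_all add: rs(5) ifun_ide[OF b(2) RF o(2)])
    show "arr (ifun R Y2 Y1 j1 p2 r)" "src (ifun R Y2 Y1 j1 p2 r) = fst Y2" "tgt (ifun R Y2 Y1 j1 p2 r) = fst Y1"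
      "arr (ifun R Y3 Y2 j2 p3 s)" "src (ifun R Y3 Y2 j2 p3 s) = fst Y3" "tgt (ifun R Y3 Y2 j2 p3 s) = fst Y2"
      using ifun_j(1)[OF b(2,1) RF rs(1)] ifun_j(1)[OF b(3,2) RF rs(2)] by auto
  qed
qed

text \<open>The identity of \<open>V\<close> induces an isomorphism between any two objects induced
  along the same transversal. The choice hidden in \<open>Ind\<close> is thus invisible in the
  Grothendieck group.\<close>

lemma ind_unique:
  assumes A: "subgroup A F" and B: "subgroup B F" and R: "left_transversal F A B R" and D: "idem_complete D"
    and V: "eo B V" and Y: "Y \<in> EO D A" "Y' \<in> EO D A" and i: "ind_data A B R V Y j p" "ind_data A B R V Y' j' p'"
  shows "K0_class (EQ D A) Y = K0_class (EQ D A) Y'"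
proof -
  note Ac = subgroup.subset[OF A] and Bc = subgroup.subset[OF B]
  have eo: "eo A Y" "eo A Y'" using Y D by (auto simp: EO_iff idem_complete_def)
  have RF: "R \<subseteq> carrier F" using R Ac by (auto simp: left_transversal_def)
  have b: "bip R (\<lambda>t. ActO T t (fst V)) (fst Y) j p" "bip R (\<lambda>t. ActO T t (fst V)) (fst Y') j' p'"
    using i by (auto simp: ind_data_def)
  have o: "ide (fst V) \<Colon> fst V \<leadsto> fst V" using eo_obj[OF V Bc] by simp
  show ?thesis
  proof (rule cls_iso[OF A D Y])
    show "eqv A Y Y' (ifun R Y Y' j' p (ide (fst V)))" by (rule eqv_ifun[OF A B R V V eo i eqv_ide[OF Bc V]])
    show "ifun R Y' Y j p' (ide (fst V)) \<Colon> fst Y' \<leadsto> fst Y" by (rule ifun_j(1)[OF b(2,1) RF o])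
    have "ide (fst V) \<cdot> ide (fst V) = ide (fst V)" using o by simp
    then show "ifun R Y' Y j p' (ide (fst V)) \<cdot> ifun R Y Y' j' p (ide (fst V)) = ide (fst Y)"
      "ifun R Y Y' j' p (ide (fst V)) \<cdot> ifun R Y' Y j p' (ide (fst V)) = ide (fst Y')"
      using ifun_functor[OF b(1,2,1) RF o o] ifun_functor[OF b(2,1,2) RF o o] ifun_ide[OF b(1) RF] ifun_ide[OF b(2) RF] o by auto
  qed
qed

text \<open>The family \<open>e\<close> of translates of \<open>j \<cdot> p\<close> is a system of imprimitivity.\<close>

lemma ind_data_imprimitivity:
  assumes A: "subgroup A F" and B: "subgroup B F" "B \<subseteq> A" and R: "R \<subseteq> A" "finite R"
    and M: "eo A M" and V: "eo B V" "smd B V M j p" and W: "eo A W" "smd A W M J P"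
    and e: "\<And>t. t \<in> R \<Longrightarrow> e t \<Colon> fst M \<leadsto> fst M" "\<And>t. t \<in> R \<Longrightarrow> sact M t \<cdot> act t (j \<cdot> p) = e t \<cdot> sact M t"
    and o: "\<And>s t. s \<in> R \<Longrightarrow> t \<in> R \<Longrightarrow> s \<noteq> t \<Longrightarrow> e s \<cdot> e t = zer (fst M) (fst M)"
    and E: "J \<cdot> P = asum (fst M) (fst M) e R"
  shows "\<exists>j p. ind_data A B R V W j p"
proof -
  note Ac = subgroup.subset[OF A] and Bc = subgroup.subset[OF B(1)]
  have RF: "R \<subseteq> carrier F" using R Ac by auto
  note v = smdD[OF V(2)] and w = smdD[OF W(2)]
  note MO = eo_obj[OF M Ac] and VO = eo_obj[OF V(1) Bc] and WO = eo_obj[OF W(1) Ac]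
  note [simp] = v(1,2) w(1,2) MO VO WO smd_cancel[OF V(2)] smd_cancel[OF W(2)] v(5) w(5)
  have RA: "t \<in> A" "t \<in> carrier F" "arr (sact M t)" "aiso (sact M t)" if "t \<in> R" for t
    using that R RF eo_arr[OF M Ac] eo_aiso[OF M Ac] by auto
  \<comment> \<open>\<open>u t\<close> embeds \<open>T^t V\<close> into \<open>M\<close> as the
    translate by \<open>t\<close> of the summand \<open>V\<close>; its image is that of
    \<open>e t\<close>, and \<open>v' t\<close> is the corresponding projection.\<close>
  define u where "u t = sact M t \<cdot> act t j" for t
  define v' where "v' t = act t p \<cdot> ainv (sact M t)" for t
  have u: "u t \<Colon> ActO T t (fst V) \<leadsto> fst M" "v' t \<Colon> fst M \<leadsto> ActO T t (fst V)" if "t \<in> R" for t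
    using RA[OF that] by (auto simp: u_def v'_def)
  have vu: "v' t \<cdot> u t = ide (ActO T t (fst V))" if "t \<in> R" for t
  proof -
    have "v' t \<cdot> u t = act t (p \<cdot> j)" using RA[OF that] by (simp add: u_def v'_def del: v(5))
    then show ?thesis using RA[OF that] by (simp del: act_cmp)
  qed
  have uv: "u t \<cdot> v' t = e t" if "t \<in> R" for t
  proof -
    have "u t \<cdot> v' t = (sact M t \<cdot> act t (j \<cdot> p)) \<cdot> ainv (sact M t)" using RA[OF that] by (simp add: u_def v'_def)
    then show ?thesis unfolding e(2)[OF that] using RA[OF that] e(1)[OF that] by (simp add: cmp_ainv)
  qed
  have vus: "v' s \<cdot> u t = zer (ActO T t (fst V)) (ActO T s (fst V))" if st: "s \<in> R" "t \<in> R" "s \<noteq> t" for s t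
  proof -
    note [simp] = u[OF st(1)] u[OF st(2)] RA[OF st(1)] RA[OF st(2)]
    have "v' s \<cdot> u t = v' s \<cdot> (u s \<cdot> v' s) \<cdot> (u t \<cdot> v' t) \<cdot> u t"
      by (simp add: vu st cmp_rewrite[OF vu[OF st(1)]])
    also have "\<dots> = v' s \<cdot> (e s \<cdot> e t) \<cdot> u t" unfolding uv[OF st(1)] uv[OF st(2)] using e(1)[OF st(1)] e(1)[OF st(2)] by simp
    finally show ?thesis by (simp add: o[OF st])
  qed
  \<comment> \<open>The idempotent of \<open>W\<close> is the sum of all \<open>e s\<close>. By
    orthogonality only \<open>e t\<close> acts on the translate by \<open>t\<close>, and it acts as
    the identity.\<close>
  have Eu: "(J \<cdot> P) \<cdot> u t = u t" if t: "t \<in> R" for t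
  proof -
    note [simp] = u[OF t] RA[OF t]
    have "(J \<cdot> P) \<cdot> u t = asum (ActO T t (fst V)) (fst M) (\<lambda>s. e s \<cdot> u t) R"
      unfolding E by (rule cmp_asum_left[OF R(2) e(1)]) auto
    also have "\<dots> = e t \<cdot> u t"
    proof (rule asum_single[OF R(2) t])
      show "e t \<cdot> u t \<Colon> ActO T t (fst V) \<leadsto> fst M" using e(1)[OF t] by auto
      fix s assume s: "s \<in> R" "s \<noteq> t"
      show "e s \<cdot> u t = zer (ActO T t (fst V)) (fst M)"
        using u[OF s(1)] RA[OF s(1)] vus[OF s(1) t s(2)] by (simp add: uv[OF s(1), symmetric])
    qed
    also have "\<dots> = u t" by (simp add: uv[OF t, symmetric] vu[OF t])
    finally show ?thesis .
  qed
  have JPu: "J \<cdot> (P \<cdot> u t) = u t" if "t \<in> R" for t using Eu[OF that] u[OF that] by simp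
  let ?j = "\<lambda>t. P \<cdot> u t" and ?p = "\<lambda>t. v' t \<cdot> J"
  have "bip R (\<lambda>t. ActO T t (fst V)) (fst W) ?j ?p"
    unfolding bip_def
  proof (intro conjI ballI)
    fix s t assume s: "s \<in> R" and t: "t \<in> R"
    have "?p t \<cdot> ?j s = v' t \<cdot> u s" using u[OF s] u[OF t] JPu[OF s] by simp
    then show "?p t \<cdot> ?j s = (if s = t then ide (ActO T s (fst V)) else zer (ActO T s (fst V)) (ActO T t (fst V)))"
      using vu vus[OF t s] s by auto
  next
    have "asum (fst W) (fst W) (\<lambda>t. ?j t \<cdot> ?p t) R = asum (fst W) (fst W) (\<lambda>t. P \<cdot> e t \<cdot> J) R"
    proof (rule asum_cong)
      fix t assume t: "t \<in> R"
      show "?j t \<cdot> ?p t = P \<cdot> e t \<cdot> J" using u[OF t] by (simp add: uv[OF t, symmetric])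
    qed (use u in auto)
    also have "\<dots> = P \<cdot> asum (fst M) (fst M) e R \<cdot> J"
    proof -
      have "asum (fst M) (fst M) e R \<cdot> J = asum (fst W) (fst M) (\<lambda>t. e t \<cdot> J) R"
        by (rule cmp_asum_left[OF R(2) e(1)]) auto
      moreover have "P \<cdot> asum (fst W) (fst M) (\<lambda>t. e t \<cdot> J) R = asum (fst W) (fst W) (\<lambda>t. P \<cdot> e t \<cdot> J) R"
        by (rule cmp_asum_right[OF R(2)]) (use e(1) in auto)
      ultimately show ?thesis by simp
    qed
    also have "\<dots> = ide (fst W)" unfolding E[symmetric] by simp
    finally show "asum (fst W) (fst W) (\<lambda>t. ?j t \<cdot> ?p t) R = ide (fst W)" .
  qed (use u RA R in auto)
  moreover have "sact W a \<cdot> act a (?j t) = ?j s \<cdot> act s (sact V b) \<cdot> ainv (cp s b (fst V)) \<cdot> cp a t (fst V)"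
    if a: "a \<in> A" and t: "t \<in> R" and s: "s \<in> R" and b: "b \<in> B" and at: "a \<otimes>\<^bsub>F\<^esub> t = s \<otimes>\<^bsub>F\<^esub> b" for a t s b
  proof -
    have F: "a \<in> carrier F" "b \<in> carrier F" "b \<in> A" using a b Ac B by auto
    have sb: "s \<otimes>\<^bsub>F\<^esub> b \<in> A" using RA(1)[OF s] F(3) subgroup.m_closed[OF A] by blast
    note [simp] = F RA[OF t] RA[OF s] u[OF t] u[OF s] eo_arr[OF M Ac a] eo_arr[OF W(1) Ac a] eo_arr[OF V(1) Bc b] eo_arr[OF M Ac F(3)] eo_arr[OF M Ac sb]
    have atM: "sact M (a \<otimes>\<^bsub>F\<^esub> t) = sact M (s \<otimes>\<^bsub>F\<^esub> b)" by (simp add: at)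
    \<comment> \<open>The structure of \<open>W\<close> is that of \<open>M\<close>, compressed. The
      transition formula thereby becomes a statement about \<open>M\<close>, where the
      factorizations \<open>a t\<close> and \<open>s b\<close> name the same structure map.\<close>
    have Wa: "sact W a \<cdot> act a k = P \<cdot> sact M a \<cdot> act a (J \<cdot> k)" if "arr k" "tgt k = fst W" for k
      using that by (simp add: cmp_rewrite[OF eqvD(2)[OF w(3) a, symmetric]])
    have n1: "cp a t (fst M) \<cdot> act a (act t j) = act (s \<otimes>\<^bsub>F\<^esub> b) j \<cdot> cp a t (fst V)"
      using cp_natural[of a t j] at by simp
    have n2: "act (s \<otimes>\<^bsub>F\<^esub> b) j \<cdot> cp s b (fst V) = cp s b (fst M) \<cdot> act s (act b j)"
      using cp_natural[of s b j] by simp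
    have n3: "act s (sact M b) \<cdot> act s (act b j) = act s j \<cdot> act s (sact V b)"
      using arg_cong[OF eqvD(2)[OF v(3) b], of "act s"] by simp
    have "sact W a \<cdot> act a (?j t) = P \<cdot> (sact M a \<cdot> act a (sact M t)) \<cdot> act a (act t j)"
      by (subst Wa) (simp_all add: JPu[OF t] del: act_cmp, simp_all add: u_def)
    also have "\<dots> = P \<cdot> sact M (s \<otimes>\<^bsub>F\<^esub> b) \<cdot> cp a t (fst M) \<cdot> act a (act t j)"
      unfolding eo_cocycle[OF M Ac a RA(1)[OF t]] using at by simp
    also have "\<dots> = P \<cdot> sact M (s \<otimes>\<^bsub>F\<^esub> b) \<cdot> act (s \<otimes>\<^bsub>F\<^esub> b) j \<cdot> cp a t (fst V)" unfolding n1 ..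
    also have "act (s \<otimes>\<^bsub>F\<^esub> b) j \<cdot> cp a t (fst V) = (act (s \<otimes>\<^bsub>F\<^esub> b) j \<cdot> cp s b (fst V)) \<cdot> ainv (cp s b (fst V)) \<cdot> cp a t (fst V)"
      using at by simp
    also have "P \<cdot> sact M (s \<otimes>\<^bsub>F\<^esub> b) \<cdot> \<dots> = P \<cdot> (sact M (s \<otimes>\<^bsub>F\<^esub> b) \<cdot> cp s b (fst M)) \<cdot> act s (act b j) \<cdot> ainv (cp s b (fst V)) \<cdot> cp a t (fst V)"
      unfolding n2 using at by simp
    also have "\<dots> = P \<cdot> sact M s \<cdot> (act s (sact M b) \<cdot> act s (act b j)) \<cdot> ainv (cp s b (fst V)) \<cdot> cp a t (fst V)"
      unfolding eo_cocycle[OF M Ac RA(1)[OF s] F(3), symmetric] using at by simp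
    also have "\<dots> = ?j s \<cdot> act s (sact V b) \<cdot> ainv (cp s b (fst V)) \<cdot> cp a t (fst V)"
      unfolding n3 using at by (simp add: u_def)
    finally show ?thesis .
  qed
  ultimately show ?thesis unfolding ind_data_def by blast
qed

text \<open>The difficulty is the cocycle condition on the biproduct. Instead of handling equations
  \<open>a t = s b\<close>, every \<open>x\<close> in \<open>A\<close> is factored as
  \<open>rep x\<close> times \<open>cof x\<close>; the condition then follows from two
  compatibilities of the arrows \<open>th x\<close>, one with \<open>B\<close> on the right and one
  with \<open>A\<close> on the left.\<close>

lemma ind_exists:
  assumes A: "subgroup A F" and B: "subgroup B F" "B \<subseteq> A" and R: "left_transversal F A B R" "finite R" and V: "eo B V"
  shows "\<exists>Y j p. eo A Y \<and> ind_data A B R V Y j p"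
proof -
  note Ac = subgroup.subset[OF A] and Bc = subgroup.subset[OF B(1)]
  have RA: "R \<subseteq> A" using R by (simp add: left_transversal_def)
  have VO: "fst V \<in> Obj C" by (rule eo_obj[OF V Bc])
  define rep where "rep a = (THE t. t \<in> R \<and> (\<exists>b\<in>B. a = t \<otimes>\<^bsub>F\<^esub> b))" for a
  define cof where "cof a = inv\<^bsub>F\<^esub> (rep a) \<otimes>\<^bsub>F\<^esub> a" for a
  have inA [simp]: "a \<in> carrier F" if "a \<in> A" for a using that Ac by auto
  have inB [simp]: "b \<in> A" if "b \<in> B" for b using that B by auto
  have inR [simp]: "t \<in> A" if "t \<in> R" for t using that RA by auto
  note [simp] = subgroup.m_closed[OF A] subgroup.m_closed[OF B(1)] subgroup.one_closed[OF A] subgroup.one_closed[OF B(1)]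
    eo_arr[OF V Bc] VO
  have ex1: "\<exists>!t. t \<in> R \<and> (\<exists>b\<in>B. a = t \<otimes>\<^bsub>F\<^esub> b)" if "a \<in> A" for a
    using R that by (auto simp: left_transversal_def)
  have rep_R: "rep a \<in> R" "\<exists>b\<in>B. a = rep a \<otimes>\<^bsub>F\<^esub> b" if "a \<in> A" for a
    using theI'[OF ex1[OF that]] unfolding rep_def by auto
  have rep_eq: "rep (s \<otimes>\<^bsub>F\<^esub> b) = s" "cof (s \<otimes>\<^bsub>F\<^esub> b) = b" if "s \<in> R" "b \<in> B" for s b
  proof -
    have "s \<otimes>\<^bsub>F\<^esub> b \<in> A" using that by simp
    from the1_equality[OF ex1[OF this], of s] that show r: "rep (s \<otimes>\<^bsub>F\<^esub> b) = s" unfolding rep_def by blast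
    show "cof (s \<otimes>\<^bsub>F\<^esub> b) = b" unfolding cof_def r using that by (simp add: F.m_assoc[symmetric])
  qed
  have cof: "cof a \<in> B" "rep a \<otimes>\<^bsub>F\<^esub> cof a = a" if a: "a \<in> A" for a
  proof -
    obtain b where b: "b \<in> B" "a = rep a \<otimes>\<^bsub>F\<^esub> b" using rep_R(2)[OF a] by blast
    then have "cof a = b" using rep_eq(2)[OF rep_R(1)[OF a] b(1)] by simp
    then show "cof a \<in> B" "rep a \<otimes>\<^bsub>F\<^esub> cof a = a" using b by simp_all
  qed
  note [simp] = rep_R(1) cof
  have rep_mult: "rep (y \<otimes>\<^bsub>F\<^esub> b) = rep y" "cof (y \<otimes>\<^bsub>F\<^esub> b) = cof y \<otimes>\<^bsub>F\<^esub> b" if "y \<in> A" "b \<in> B" for y b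
  proof -
    have "y \<otimes>\<^bsub>F\<^esub> b = rep y \<otimes>\<^bsub>F\<^esub> (cof y \<otimes>\<^bsub>F\<^esub> b)" using that by (simp add: F.m_assoc[symmetric])
    then show "rep (y \<otimes>\<^bsub>F\<^esub> b) = rep y" "cof (y \<otimes>\<^bsub>F\<^esub> b) = cof y \<otimes>\<^bsub>F\<^esub> b"
      using rep_eq[of "rep y" "cof y \<otimes>\<^bsub>F\<^esub> b"] that by simp_all
  qed
  have rep_id: "rep t = t" "cof t = \<one>\<^bsub>F\<^esub>" if "t \<in> R" for t
    using rep_eq[OF that subgroup.one_closed[OF B(1)]] that by simp_all
  \<comment> \<open>Identifies \<open>T^x V\<close> with the summand \<open>T^(rep x) V\<close> for
    every \<open>x\<close> in \<open>A\<close>, by means of the structure of \<open>V\<close> at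
    \<open>cof x\<close>.\<close>
  define th where "th x = act (rep x) (sact V (cof x)) \<cdot> ainv (cp (rep x) (cof x) (fst V))" for x
  have th [simp]: "arr (th x)" "src (th x) = ActO T x (fst V)" "tgt (th x) = ActO T (rep x) (fst V)" if "x \<in> A" for x
    using that by (auto simp: th_def)
  have th_cp: "th x \<cdot> cp (rep x) (cof x) (fst V) = act (rep x) (sact V (cof x))" if "x \<in> A" for x
    using that by (simp add: th_def ainv_cmp)
  \<comment> \<open>This is the cocycle condition of \<open>V\<close>, carried over by
    \<open>T^(rep y)\<close>. It is proved after composition with an isomorphism \<open>cp\<close>,
    which removes the inverse from \<open>th\<close>.\<close>
  have th_b: "th y \<cdot> act y (sact V b) = th (y \<otimes>\<^bsub>F\<^esub> b) \<cdot> cp y b (fst V)" if y: "y \<in> A" and b: "b \<in> B" for y b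
  proof (rule cmp_cancel_right)
    note [simp] = y b rep_mult[OF y b]
    let ?k = "cp (rep y) (cof y) (ActO T b (fst V))"
    have n: "act y (sact V b) \<cdot> ?k = cp (rep y) (cof y) (fst V) \<cdot> act (rep y) (act (cof y) (sact V b))"
      using cp_natural[of "rep y" "cof y" "sact V b"] by simp
    have cc: "cp y b (fst V) \<cdot> ?k = cp (rep y) (cof y \<otimes>\<^bsub>F\<^esub> b) (fst V) \<cdot> act (rep y) (cp (cof y) b (fst V))"
      using cp_cocycle[of "rep y" "cof y" b "fst V"] by simp
    have e: "act (rep y) (sact V (cof y)) \<cdot> act (rep y) (act (cof y) (sact V b)) =
      act (rep y) (sact V (cof y \<otimes>\<^bsub>F\<^esub> b)) \<cdot> act (rep y) (cp (cof y) b (fst V))"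
      using arg_cong[OF eo_cocycle[OF V Bc cof(1)[OF y] b], of "act (rep y)"] by simp
    have t2: "th (y \<otimes>\<^bsub>F\<^esub> b) \<cdot> cp (rep y) (cof y \<otimes>\<^bsub>F\<^esub> b) (fst V) = act (rep y) (sact V (cof y \<otimes>\<^bsub>F\<^esub> b))"
      using th_cp[of "y \<otimes>\<^bsub>F\<^esub> b"] by simp
    have [simp]: "rep y \<otimes>\<^bsub>F\<^esub> (cof y \<otimes>\<^bsub>F\<^esub> b) = y \<otimes>\<^bsub>F\<^esub> b" by (simp add: F.m_assoc[symmetric])
    show "(th y \<cdot> act y (sact V b)) \<cdot> ?k = (th (y \<otimes>\<^bsub>F\<^esub> b) \<cdot> cp y b (fst V)) \<cdot> ?k"
      by (simp add: n cc e cmp_rewrite[OF th_cp[OF y]] cmp_rewrite[OF t2])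
  qed (use y b in \<open>simp_all\<close>)
  \<comment> \<open>The compatibility with translation by \<open>a\<close> on the left. It is the
    form of associativity that the structure maps of the induced object need, and it follows from
    \<open>th_b\<close> and the cocycle condition of \<open>cp\<close>.\<close>
  have th_a: "th (a \<otimes>\<^bsub>F\<^esub> rep x) \<cdot> cp a (rep x) (fst V) \<cdot> act a (th x) = th (a \<otimes>\<^bsub>F\<^esub> x) \<cdot> cp a x (fst V)"
    if a: "a \<in> A" and x: "x \<in> A" for a x
  proof (rule cmp_cancel_right)
    note [simp] = a x
    let ?s = "rep x" let ?b = "cof x" let ?k = "act a (cp ?s ?b (fst V))"
    have assoc: "a \<otimes>\<^bsub>F\<^esub> ?s \<otimes>\<^bsub>F\<^esub> ?b = a \<otimes>\<^bsub>F\<^esub> x" by (simp add: F.m_assoc)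
    have rep2: "rep (a \<otimes>\<^bsub>F\<^esub> ?s) = rep (a \<otimes>\<^bsub>F\<^esub> x)" using rep_mult(1)[of "a \<otimes>\<^bsub>F\<^esub> ?s" ?b] assoc by simp
    have 1: "act a (th x) \<cdot> ?k = act a (act ?s (sact V ?b))"
      using arg_cong[OF th_cp[OF x], of "act a"] by simp
    have 2: "cp a ?s (fst V) \<cdot> act a (act ?s (sact V ?b)) = act (a \<otimes>\<^bsub>F\<^esub> ?s) (sact V ?b) \<cdot> cp a ?s (ActO T ?b (fst V))"
      using cp_natural[of a ?s "sact V ?b"] by simp
    have 3: "th (a \<otimes>\<^bsub>F\<^esub> ?s) \<cdot> act (a \<otimes>\<^bsub>F\<^esub> ?s) (sact V ?b) = th (a \<otimes>\<^bsub>F\<^esub> x) \<cdot> cp (a \<otimes>\<^bsub>F\<^esub> ?s) ?b (fst V)"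
      using th_b[of "a \<otimes>\<^bsub>F\<^esub> ?s" ?b] assoc by simp
    have 4: "cp (a \<otimes>\<^bsub>F\<^esub> ?s) ?b (fst V) \<cdot> cp a ?s (ActO T ?b (fst V)) = cp a x (fst V) \<cdot> ?k"
      using cp_cocycle[of a ?s ?b "fst V"] by simp
    show "(th (a \<otimes>\<^bsub>F\<^esub> ?s) \<cdot> cp a ?s (fst V) \<cdot> act a (th x)) \<cdot> ?k = (th (a \<otimes>\<^bsub>F\<^esub> x) \<cdot> cp a x (fst V)) \<cdot> ?k"
      using assoc rep2 by (simp add: 1 2 4 cmp_rewrite[OF 3])
    show "aiso ?k" by (simp add: aiso_act)
  qed (use a x in \<open>simp_all add: F.m_assoc\<close>)
  obtain W j p where b: "bip R (\<lambda>t. ActO T t (fst V)) W j p" using ex_bip[OF R(2), of "\<lambda>t. ActO T t (fst V)"] by auto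
  note d = bipD[OF b]
  have [simp]: "W \<in> Obj C" by (rule d(2))
  have jp [simp]: "arr (j t)" "src (j t) = ActO T t (fst V)" "tgt (j t) = W" "arr (p t)" "src (p t) = W" "tgt (p t) = ActO T t (fst V)"
    if "t \<in> R" for t using d(4,5)[OF that] by auto
  \<comment> \<open>On the summand \<open>T^a(T^t V)\<close>: pass to \<open>T^(a t) V\<close>, then
    by \<open>th\<close> to the summand of its representative.\<close>
  define N where "N a = asum (ActO T a W) W (\<lambda>t. j (rep (a \<otimes>\<^bsub>F\<^esub> t)) \<cdot> th (a \<otimes>\<^bsub>F\<^esub> t) \<cdot> cp a t (fst V) \<cdot> act a (p t)) R" for a
  have N [simp]: "arr (N a)" "src (N a) = ActO T a W" "tgt (N a) = W" if "a \<in> A" for a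
    using that unfolding N_def by (auto intro!: arr_asum)
  have Nj: "N a \<cdot> act a (j t) = j (rep (a \<otimes>\<^bsub>F\<^esub> t)) \<cdot> th (a \<otimes>\<^bsub>F\<^esub> t) \<cdot> cp a t (fst V)" if a: "a \<in> A" and t: "t \<in> R" for a t
  proof -
    let ?f = "\<lambda>t. j (rep (a \<otimes>\<^bsub>F\<^esub> t)) \<cdot> th (a \<otimes>\<^bsub>F\<^esub> t) \<cdot> cp a t (fst V)"
    let ?A = "ActO T a (ActO T t (fst V))"
    note da = bipD[OF bip_act[OF b inA[OF a]]]
    have "N a \<cdot> act a (j t) = asum ?A W (\<lambda>s. (j (rep (a \<otimes>\<^bsub>F\<^esub> s)) \<cdot> th (a \<otimes>\<^bsub>F\<^esub> s) \<cdot> cp a s (fst V) \<cdot> act a (p s)) \<cdot> act a (j t)) R"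
      unfolding N_def using a t by (intro cmp_asum_left R(2)) auto
    also have "\<dots> = asum ?A W (\<lambda>s. if s = t then ?f t else zer ?A W) R"
    proof (rule asum_cong)
      fix s assume s: "s \<in> R"
      show "(j (rep (a \<otimes>\<^bsub>F\<^esub> s)) \<cdot> th (a \<otimes>\<^bsub>F\<^esub> s) \<cdot> cp a s (fst V) \<cdot> act a (p s)) \<cdot> act a (j t) = (if s = t then ?f t else zer ?A W)"
        using a s t da(6)[OF t] da(7)[OF t s] by (cases "s = t") auto
    qed (use a t in auto)
    also have "\<dots> = ?f t"
      using asum_single[OF R(2) t, of "\<lambda>s. if s = t then ?f t else zer ?A W" ?A W] a t by auto
    finally show ?thesis .
  qed
  let ?Y = "(W, \<lambda>a\<in>A. mor (N a))"
  have sY: "sact ?Y a = N a" if "a \<in> A" for a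
    using that by (intro arrow.expand) (simp add: sact_def)
  have "eo A ?Y"
  proof (rule eoI[OF A])
    fix h k assume h: "h \<in> A" and k: "k \<in> A"
    note [simp] = h k
    have "N h \<cdot> act h (N k) = N (h \<otimes>\<^bsub>F\<^esub> k) \<cdot> cp h k W"
    proof (rule bip_ext[OF bip_act[OF bip_act[OF b, of k], of h]])
      fix t assume t: "t \<in> R"
      note [simp] = t
      let ?x = "k \<otimes>\<^bsub>F\<^esub> t"
      \<comment> \<open>The elements \<open>h (rep ?x)\<close> and \<open>h ?x\<close> differ by
        \<open>cof ?x\<close> on the right, hence lie in the same coset.\<close>
      have r: "rep (h \<otimes>\<^bsub>F\<^esub> rep ?x) = rep (h \<otimes>\<^bsub>F\<^esub> ?x)"
        using rep_mult(1)[of "h \<otimes>\<^bsub>F\<^esub> rep ?x" "cof ?x"] by (simp add: F.m_assoc)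
      have "act h (N k) \<cdot> act h (act k (j t)) = act h (j (rep ?x)) \<cdot> act h (th ?x) \<cdot> act h (cp k t (fst V))"
        using arg_cong[OF Nj[OF k t], of "act h"] by simp
      then have "(N h \<cdot> act h (N k)) \<cdot> act h (act k (j t)) = (N h \<cdot> act h (j (rep ?x))) \<cdot> act h (th ?x) \<cdot> act h (cp k t (fst V))" by simp
      also have "\<dots> = j (rep (h \<otimes>\<^bsub>F\<^esub> ?x)) \<cdot> (th (h \<otimes>\<^bsub>F\<^esub> rep ?x) \<cdot> cp h (rep ?x) (fst V) \<cdot> act h (th ?x)) \<cdot> act h (cp k t (fst V))"
        by (subst Nj) (simp_all add: r)
      also have "\<dots> = j (rep (h \<otimes>\<^bsub>F\<^esub> ?x)) \<cdot> th (h \<otimes>\<^bsub>F\<^esub> ?x) \<cdot> cp h ?x (fst V) \<cdot> act h (cp k t (fst V))"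
        by (subst th_a) simp_all
      also have "\<dots> = j (rep (h \<otimes>\<^bsub>F\<^esub> ?x)) \<cdot> th (h \<otimes>\<^bsub>F\<^esub> ?x) \<cdot> cp (h \<otimes>\<^bsub>F\<^esub> k) t (fst V) \<cdot> cp h k (ActO T t (fst V))"
        by (simp add: cp_cocycle)
      also have "\<dots> = (N (h \<otimes>\<^bsub>F\<^esub> k) \<cdot> act (h \<otimes>\<^bsub>F\<^esub> k) (j t)) \<cdot> cp h k (ActO T t (fst V))"
        by (subst Nj) (simp_all add: F.m_assoc)
      also have "\<dots> = (N (h \<otimes>\<^bsub>F\<^esub> k) \<cdot> cp h k W) \<cdot> act h (act k (j t))"
        using cp_natural[of h k "j t"] by simp
      finally show "(N h \<cdot> act h (N k)) \<cdot> act h (act k (j t)) = (N (h \<otimes>\<^bsub>F\<^esub> k) \<cdot> cp h k W) \<cdot> act h (act k (j t))" .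
    qed simp_all
    then show "sact ?Y h \<cdot> act h (sact ?Y k) = sact ?Y (h \<otimes>\<^bsub>F\<^esub> k) \<cdot> cp h k (fst ?Y)" by (simp add: sY)
  next
    have "N \<one>\<^bsub>F\<^esub> = ide W"
    proof (rule bip_ext[OF b])
      fix t assume t: "t \<in> R"
      have "N \<one>\<^bsub>F\<^esub> \<cdot> act \<one>\<^bsub>F\<^esub> (j t) = j t \<cdot> th t" using t by (subst Nj) (simp_all add: rep_id)
      also have "th t = ide (ActO T t (fst V))" using t eo_one[OF V Bc] by (simp add: th_def rep_id)
      finally show "N \<one>\<^bsub>F\<^esub> \<cdot> j t = ide W \<cdot> j t" using t by simp
    qed simp_all
    then show "sact ?Y \<one>\<^bsub>F\<^esub> = ide (fst ?Y)" by (simp add: sY)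
  qed (simp_all add: sY)
  moreover have "ind_data A B R V ?Y j p"
    unfolding ind_data_def
  proof (intro conjI ballI impI)
    fix a t s c assume a: "a \<in> A" and t: "t \<in> R" and s: "s \<in> R" and c: "c \<in> B" and at: "a \<otimes>\<^bsub>F\<^esub> t = s \<otimes>\<^bsub>F\<^esub> c"
    have r: "rep (a \<otimes>\<^bsub>F\<^esub> t) = s" "cof (a \<otimes>\<^bsub>F\<^esub> t) = c" unfolding at using rep_eq[OF s c] by simp_all
    have "sact ?Y a \<cdot> act a (j t) = j s \<cdot> th (a \<otimes>\<^bsub>F\<^esub> t) \<cdot> cp a t (fst V)" using a t by (simp add: sY Nj r)
    also have "\<dots> = j s \<cdot> act s (sact V c) \<cdot> ainv (cp s c (fst V)) \<cdot> cp a t (fst V)"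
      unfolding th_def r using a t s c at by simp
    finally show "sact ?Y a \<cdot> act a (j t) = j s \<cdot> act s (sact V c) \<cdot> ainv (cp s c (fst V)) \<cdot> cp a t (fst V)" .
  qed (use b in simp)
  ultimately show ?thesis by blast
qed

section \<open>Conjugation\<close>

context
  fixes H K x
  assumes H: "subgroup H F" and K: "subgroup K F" and x: "x \<in> carrier F" and KH: "K = (\<lambda>h. x \<otimes>\<^bsub>F\<^esub> h \<otimes>\<^bsub>F\<^esub> inv\<^bsub>F\<^esub> x) ` H"
begin

lemma conjugate:
  assumes "y \<in> K"
  obtains h where "h \<in> H" "inv\<^bsub>F\<^esub> x \<otimes>\<^bsub>F\<^esub> y \<otimes>\<^bsub>F\<^esub> x = h" "x \<otimes>\<^bsub>F\<^esub> h = y \<otimes>\<^bsub>F\<^esub> x" "y \<in> carrier F" "h \<in> carrier F"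
proof -
  obtain h where h: "h \<in> H" "y = x \<otimes>\<^bsub>F\<^esub> h \<otimes>\<^bsub>F\<^esub> inv\<^bsub>F\<^esub> x" using assms KH by auto
  have hF: "h \<in> carrier F" using subgroup.mem_carrier[OF H h(1)] .
  have yF: "y \<in> carrier F" using subgroup.mem_carrier[OF K assms] .
  have "y \<otimes>\<^bsub>F\<^esub> x = x \<otimes>\<^bsub>F\<^esub> h" using h(2) hF x by (simp add: F.m_assoc)
  moreover from this have "inv\<^bsub>F\<^esub> x \<otimes>\<^bsub>F\<^esub> y \<otimes>\<^bsub>F\<^esub> x = inv\<^bsub>F\<^esub> x \<otimes>\<^bsub>F\<^esub> (x \<otimes>\<^bsub>F\<^esub> h)" using yF x by (simp add: F.m_assoc)
  then have "inv\<^bsub>F\<^esub> x \<otimes>\<^bsub>F\<^esub> y \<otimes>\<^bsub>F\<^esub> x = h" using hF x by (simp add: F.m_assoc[symmetric])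
  ultimately show ?thesis using that h(1) hF yF by simp
qed

lemma fst_conj_object [simp]: "fst (conj_object C F T H x V) = ActO T x (fst V)"
  by (simp add: conj_object_def split: prod.split)

lemma snd_conj_object: "snd (conj_object C F T H x V) \<in> extensional K"
  by (auto simp: conj_object_def KH split: prod.split)

lemma sact_conj:
  assumes "y \<in> K" "inv\<^bsub>F\<^esub> x \<otimes>\<^bsub>F\<^esub> y \<otimes>\<^bsub>F\<^esub> x = h"
  shows "sact (conj_object C F T H x V) y = act x (sact V h) \<cdot> ainv (cp x h (fst V)) \<cdot> cp y x (fst V)"
  using assms by (auto simp: KH conj_object_def sact_def act_def cmp_def cp_def ainv_def Let_def split: prod.split)

lemma eqv_conj:
  assumes V: "eo H V" "eo H V'" and f: "eqv H V V' f"
  shows "eqv K (conj_object C F T H x V) (conj_object C F T H x V') (act x f)"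
  unfolding eqv_def
proof (intro conjI ballI)
  note Hc = subgroup.subset[OF H]
  note f1 = eqvD(1)[OF f]
  fix y assume y: "y \<in> K"
  then obtain h where h: "h \<in> H" "inv\<^bsub>F\<^esub> x \<otimes>\<^bsub>F\<^esub> y \<otimes>\<^bsub>F\<^esub> x = h" "x \<otimes>\<^bsub>F\<^esub> h = y \<otimes>\<^bsub>F\<^esub> x" "y \<in> carrier F" "h \<in> carrier F"
    by (rule conjugate)
  show "act x f \<cdot> sact (conj_object C F T H x V) y = sact (conj_object C F T H x V') y \<cdot> act y (act x f)"
    unfolding sact_conj[OF y h(2)]
    using theta_natural[OF h(4) x x h(5) h(3)[symmetric] f1 eqvD(2)[OF f h(1)] eo_arr[OF V(1) Hc h(1)] eo_arr[OF V(2) Hc h(1)]]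
      f1 x h eo_arr[OF V(2) Hc h(1)] typed_obj[OF f1] by simp
qed (use x eqvD(1)[OF f] in auto)

lemma conj_split_exact:
  assumes V: "eo H V1" "eo H V2" "eo H V3" and se: "split_exact H V1 V2 V3 f g"
  shows "split_exact K (conj_object C F T H x V1) (conj_object C F T H x V2) (conj_object C F T H x V3) (act x f) (act x g)"
proof -
  note Hc = subgroup.subset[OF H]
  from se obtain r s where fg: "eqv H V1 V2 f" "eqv H V2 V3 g" and z: "g \<cdot> f = zer (fst V1) (fst V3)"
    and rs: "r \<Colon> fst V2 \<leadsto> fst V1" "s \<Colon> fst V3 \<leadsto> fst V2" "r \<cdot> f = ide (fst V1)" "g \<cdot> s = ide (fst V3)"
    "f \<cdot> r \<boxplus> s \<cdot> g = ide (fst V2)" unfolding split_exact_def by blast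
  note t = eqvD(1)[OF fg(1)] eqvD(1)[OF fg(2)]
  note o = eo_obj[OF V(1) Hc] eo_obj[OF V(2) Hc] eo_obj[OF V(3) Hc]
  note a = arg_cong[OF z, of "act x"] arg_cong[OF rs(3), of "act x"] arg_cong[OF rs(4), of "act x"] arg_cong[OF rs(5), of "act x"]
  show ?thesis
    unfolding split_exact_def using eqv_conj[OF V(1,2) fg(1)] eqv_conj[OF V(2,3) fg(2)] a x o t rs(1,2)
    by (intro conjI exI[of _ "act x r"] exI[of _ "act x s"]) simp_all
qed

text \<open>If \<open>V\<close> is a summand of an \<open>F\<close>-object \<open>M\<close>, the
  structure map of \<open>M\<close> at \<open>x\<close> identifies \<open>T^x V\<close> with another
  summand of \<open>M\<close>, and the conjugate structure is the one compressed from
  \<open>M\<close>. The axioms of an equivariant object for the conjugate can thus be taken from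
  \<open>img\<close>.\<close>

lemma conj_img:
  assumes M: "eo (carrier F) M" and V: "eo H V" "smd H V M j p"
  shows "conj_object C F T H x V = img K M (sact M x \<cdot> act x j) (act x p \<cdot> ainv (sact M x))" (is "?L = ?R")
proof -
  note Hc = subgroup.subset[OF H]
  note v = smdD[OF V(2)]
  note MO = eo_obj[OF M order_refl] and Ma = eo_arr[OF M order_refl] eo_aiso[OF M order_refl]
  note [simp] = v(1,2) x MO Ma eo_obj[OF V(1) Hc]
  have "snd ?L y = snd ?R y" if y: "y \<in> K" for y
  proof -
    obtain h where h: "h \<in> H" "inv\<^bsub>F\<^esub> x \<otimes>\<^bsub>F\<^esub> y \<otimes>\<^bsub>F\<^esub> x = h" "x \<otimes>\<^bsub>F\<^esub> h = y \<otimes>\<^bsub>F\<^esub> x" "y \<in> carrier F" "h \<in> carrier F"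
      using y by (rule conjugate)
    note [simp] = h(4,5) h(3)[symmetric] eo_arr[OF V(1) Hc h(1)]
    have n1: "cp y x (fst M) \<cdot> act y (act x j) = act (x \<otimes>\<^bsub>F\<^esub> h) j \<cdot> cp y x (fst V)"
      using cp_natural[of y x j] by simp
    have n2: "act (x \<otimes>\<^bsub>F\<^esub> h) j \<cdot> cp x h (fst V) = cp x h (fst M) \<cdot> act x (act h j)"
      using cp_natural[of x h j] by simp
    have n3: "act x (sact M h) \<cdot> act x (act h j) = act x j \<cdot> act x (sact V h)"
      using arg_cong[OF eqvD(2)[OF v(3) h(1)], of "act x"] by simp
    have n4: "act x p \<cdot> (act x j \<cdot> k) = k" if "arr k" "tgt k = ActO T x (fst V)" for k
    proof -
      have "act x p \<cdot> act x j = ide (ActO T x (fst V))" using arg_cong[OF v(5), of "act x"] by simp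
      then show ?thesis using that by (subst cmp_rewrite) auto
    qed
    have "sact ?R y = (act x p \<cdot> ainv (sact M x)) \<cdot> sact M y \<cdot> act y (sact M x \<cdot> act x j)"
      using y by (subst sact_img) simp_all
    also have "\<dots> = act x p \<cdot> ainv (sact M x) \<cdot> (sact M y \<cdot> act y (sact M x)) \<cdot> act y (act x j)" by simp
    also have "\<dots> = act x p \<cdot> ainv (sact M x) \<cdot> sact M (x \<otimes>\<^bsub>F\<^esub> h) \<cdot> cp y x (fst M) \<cdot> act y (act x j)"
      unfolding eo_cocycle[OF M order_refl h(4) x] by simp
    also have "\<dots> = act x p \<cdot> ainv (sact M x) \<cdot> sact M (x \<otimes>\<^bsub>F\<^esub> h) \<cdot> act (x \<otimes>\<^bsub>F\<^esub> h) j \<cdot> cp y x (fst V)" unfolding n1 ..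
    also have "act (x \<otimes>\<^bsub>F\<^esub> h) j \<cdot> cp y x (fst V) = (act (x \<otimes>\<^bsub>F\<^esub> h) j \<cdot> cp x h (fst V)) \<cdot> ainv (cp x h (fst V)) \<cdot> cp y x (fst V)"
      by simp
    also have "act x p \<cdot> ainv (sact M x) \<cdot> sact M (x \<otimes>\<^bsub>F\<^esub> h) \<cdot> \<dots> =
      act x p \<cdot> ainv (sact M x) \<cdot> (sact M (x \<otimes>\<^bsub>F\<^esub> h) \<cdot> cp x h (fst M)) \<cdot> act x (act h j) \<cdot> ainv (cp x h (fst V)) \<cdot> cp y x (fst V)"
      unfolding n2 by simp
    also have "\<dots> = act x p \<cdot> (act x (sact M h) \<cdot> act x (act h j)) \<cdot> ainv (cp x h (fst V)) \<cdot> cp y x (fst V)"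
      unfolding eo_cocycle[OF M order_refl x h(5), symmetric] by simp
    also have "\<dots> = sact ?L y"
      unfolding n3 sact_conj[OF y h(2)] by (simp add: n4)
    finally show ?thesis by (simp add: sact_def)
  qed
  moreover have "snd ?R \<in> extensional K" by (simp add: img_def)
  ultimately have "snd ?L = snd ?R" using snd_conj_object by (intro extensionalityI[of _ K]) auto
  then show ?thesis by (intro prod_eqI) simp_all
qed

text \<open>\<open>e\<close> is the translate by \<open>x\<close> of the idempotent of
  \<open>V\<close>. Since it commutes with \<open>K\<close>, compression along it yields an
  equivariant object.\<close>

lemma conj_smd:
  assumes M: "eo (carrier F) M" and V: "eo H V" "smd H V M j p"
    and e: "eqv K M M e" "sact M x \<cdot> act x (j \<cdot> p) = e \<cdot> sact M x"
  defines "j' \<equiv> sact M x \<cdot> act x j" and "p' \<equiv> act x p \<cdot> ainv (sact M x)"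
  shows "eo K (conj_object C F T H x V)" "smd K (conj_object C F T H x V) M j' p'" "j' \<cdot> p' = e"
proof -
  note Hc = subgroup.subset[OF H] and Kc = subgroup.subset[OF K]
  note v = smdD[OF V(2)]
  note MO = eo_obj[OF M order_refl] and Ma = eo_arr[OF M order_refl] eo_aiso[OF M order_refl]
  note [simp] = v(1,2) x MO Ma eqvD(1)[OF e(1)]
  have VO: "fst V \<in> Obj C" by (rule eo_obj[OF V(1) Hc])
  have MK: "eo K M' \<longleftrightarrow> eo K M'" for M' ..
  have j': "j' \<Colon> ActO T x (fst V) \<leadsto> fst M" "p' \<Colon> fst M \<leadsto> ActO T x (fst V)" by (auto simp: j'_def p'_def)
  have pj: "p' \<cdot> j' = ide (ActO T x (fst V))" using arg_cong[OF v(5), of "act x"] VO by (simp add: j'_def p'_def)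
  have "j' \<cdot> p' = (sact M x \<cdot> act x (j \<cdot> p)) \<cdot> ainv (sact M x)" by (simp add: j'_def p'_def)
  then show e': "j' \<cdot> p' = e" unfolding e(2) by (simp add: cmp_ainv)
  \<comment> \<open>The lemmas on compressed structures ask for an object over exactly
    \<open>K\<close>, whereas \<open>M\<close> is an object over \<open>F\<close>.\<close>
  let ?M = "Res K M"
  have sR: "sact ?M k = sact M k" if "k \<in> K" for k using that by (simp add: sact_def Res_def)
  have fR [simp]: "fst ?M = fst M" by (simp add: Res_def)
  have eoR: "eo K ?M"
  proof (rule eoI[OF K])
    note [simp] = subgroup.mem_carrier[OF K] subgroup.m_closed[OF K] subgroup.one_closed[OF K]
    show "sact ?M h \<cdot> act h (sact ?M k) = sact ?M (h \<otimes>\<^bsub>F\<^esub> k) \<cdot> cp h k (fst ?M)" if "h \<in> K" "k \<in> K" for h k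
      using that eo_cocycle[OF M order_refl, of h k] by (simp add: sR)
    show "sact ?M \<one>\<^bsub>F\<^esub> = ide (fst ?M)" using eo_one[OF M order_refl] by (simp add: sR)
    show "arr (sact ?M h)" if "h \<in> K" for h using that by (simp add: sR)
  qed (simp_all add: Res_def)
  have eqR: "eqv K ?M Y f \<longleftrightarrow> eqv K M Y f" "eqv K Y ?M f \<longleftrightarrow> eqv K Y M f" for Y f by (auto simp: eqv_def sR)
  have im: "img K ?M j' p' = conj_object C F T H x V"
    unfolding conj_img[OF M V] j'_def[symmetric] p'_def[symmetric] by (simp add: img_def sR cong: restrict_cong)
  have "eqv K ?M ?M (j' \<cdot> p')" unfolding e' by (auto simp: eqR eqv_def sR intro: eqvD[OF e(1)])
  from img_eqv[OF K eoR _ _ pj this]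
  show "eo K (conj_object C F T H x V)" "smd K (conj_object C F T H x V) M j' p'"
    using j' pj unfolding im smd_def by (auto simp: eqR)
qed

end

end

section \<open>Tensor products of equivariant objects\<close>

context action
begin

definition ten (infixr "\<star>" 76) where
  "f \<star> g = Arrow (src f \<boxtimes> src g) (mor f \<boxdot> mor g) (tgt f \<boxtimes> tgt g)"

definition jt where "jt x M N = Arrow (ActO T x (M \<boxtimes> N)) (ActTens T x M N) (ActO T x M \<boxtimes> ActO T x N)"

definition asc where "asc A B D = Arrow ((A \<boxtimes> B) \<boxtimes> D) (Assoc C A B D) (A \<boxtimes> (B \<boxtimes> D))"

definition lun where "lun A = Arrow (Unit C \<boxtimes> A) (LUnit C A) A"

definition run where "run A = Arrow (A \<boxtimes> Unit C) (RUnit C A) A"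

definition uu where "uu x = Arrow (ActO T x (Unit C)) (ActUnit T x) (Unit C)"

lemma src_tgt_ten [simp]:
  "src (f \<star> g) = src f \<boxtimes> src g" "tgt (f \<star> g) = tgt f \<boxtimes> tgt g"
  "src (jt x M N) = ActO T x (M \<boxtimes> N)" "tgt (jt x M N) = ActO T x M \<boxtimes> ActO T x N"
  "src (asc A B D) = (A \<boxtimes> B) \<boxtimes> D" "tgt (asc A B D) = A \<boxtimes> (B \<boxtimes> D)"
  "src (lun A) = Unit C \<boxtimes> A" "tgt (lun A) = A" "src (run A) = A \<boxtimes> Unit C" "tgt (run A) = A"
  "src (uu x) = ActO T x (Unit C)" "tgt (uu x) = Unit C"
  by (simp_all add: ten_def jt_def asc_def lun_def run_def uu_def)

lemmas [simp] = TensO_closed Unit_closed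

lemma arr_ten [simp, intro]: "arr f \<Longrightarrow> arr g \<Longrightarrow> arr (f \<star> g)"
  unfolding ten_def arr_def by (auto simp del: arr_obj intro: TensA_closed)

lemma ten_cmp: "\<lbrakk>arr f; arr f'; arr g; arr g'; src f' = tgt f; src g' = tgt g\<rbrakk> \<Longrightarrow>
  (f' \<cdot> f) \<star> (g' \<cdot> g) = (f' \<star> g') \<cdot> (f \<star> g)"
  using TensA_Comp[of "src f" "tgt f" "tgt f'" "src g" "tgt g" "tgt g'" "mor f" "mor f'" "mor g" "mor g'"]
  by (simp del: arr_obj add: arr_def ten_def cmp_def)

text \<open>Oriented so that composites of tensor products are merged into one; the second form is
  the one with a tail, for composites nested to the right.\<close>

lemma ten_merge [simp]:
  assumes "arr f" "arr f'" "arr g" "arr g'" "src f' = tgt f" "src g' = tgt g"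
  shows "(f' \<star> g') \<cdot> (f \<star> g) = (f' \<cdot> f) \<star> (g' \<cdot> g)"
    and "arr k \<Longrightarrow> tgt k = src f \<boxtimes> src g \<Longrightarrow> (f' \<star> g') \<cdot> ((f \<star> g) \<cdot> k) = ((f' \<cdot> f) \<star> (g' \<cdot> g)) \<cdot> k"
  using ten_cmp[OF assms] cmp_rewrite[OF ten_cmp[OF assms, symmetric], of k] assms by simp_all

lemma ten_ide [simp]: "A \<in> Obj C \<Longrightarrow> B \<in> Obj C \<Longrightarrow> ide A \<star> ide B = ide (A \<boxtimes> B)"
  by (simp add: ten_def ide_def TensA_Idn)

lemma ten_plus_left: "\<lbrakk>arr f; arr f'; arr g; src f' = src f; tgt f' = tgt f\<rbrakk> \<Longrightarrow> (f \<boxplus> f') \<star> g = f \<star> g \<boxplus> f' \<star> g"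
  using TensA_add_left[of "src f" "src g" "tgt f" "tgt g" "mor f" "mor f'" "mor g"]
  by (simp del: arr_obj add: arr_def ten_def plus_def)

lemma ten_plus_right: "\<lbrakk>arr f; arr f'; arr g; src f' = src f; tgt f' = tgt f\<rbrakk> \<Longrightarrow> g \<star> (f \<boxplus> f') = g \<star> f \<boxplus> g \<star> f'"
  using TensA_add_right[of "src g" "src f" "tgt g" "tgt f" "mor g" "mor f" "mor f'"]
  by (simp del: arr_obj add: arr_def ten_def plus_def)

lemma ten_zer_left [simp]:
  assumes "A \<in> Obj C" "B \<in> Obj C" "arr g" shows "zer A B \<star> g = zer (A \<boxtimes> src g) (B \<boxtimes> tgt g)"
proof -
  have "zer A B \<star> g \<boxplus> zer A B \<star> g = zer A B \<star> g"
    using ten_plus_left[of "zer A B" "zer A B" g] assms by simp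
  then show ?thesis using plus_idem_zer[of "zer A B \<star> g"] assms by simp
qed

lemma ten_zer_right [simp]:
  assumes "A \<in> Obj C" "B \<in> Obj C" "arr g" shows "g \<star> zer A B = zer (src g \<boxtimes> A) (tgt g \<boxtimes> B)"
proof -
  have "g \<star> zer A B \<boxplus> g \<star> zer A B = g \<star> zer A B"
    using ten_plus_right[of "zer A B" "zer A B" g] assms by simp
  then show ?thesis using plus_idem_zer[of "g \<star> zer A B"] assms by simp
qed

lemma act_tensor: "x \<in> carrier F \<Longrightarrow> tensor_autoequivalence C (ActO T x) (ActA T x) (ActTens T x) (ActUnit T x)"
  by (rule Act_tensor_autoequivalence)

lemma aiso_jt [simp]: "x \<in> carrier F \<Longrightarrow> M \<in> Obj C \<Longrightarrow> N \<in> Obj C \<Longrightarrow> aiso (jt x M N)"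
  using tensor_autoequivalence.J_iso[OF act_tensor, of x M N] by (simp add: is_iso_aiso jt_def)

lemma jt_natural: "\<lbrakk>x \<in> carrier F; arr f; arr g\<rbrakk> \<Longrightarrow>
  (act x f \<star> act x g) \<cdot> jt x (src f) (src g) = jt x (tgt f) (tgt g) \<cdot> act x (f \<star> g)"
  using tensor_autoequivalence.J_natural[OF act_tensor, of x "src f" "src g" "tgt f" "tgt g" "mor f" "mor g"]
  by (simp del: arr_obj add: arr_def ten_def jt_def act_def cmp_def)

lemma jt_assoc: "\<lbrakk>x \<in> carrier F; A \<in> Obj C; B \<in> Obj C; D \<in> Obj C\<rbrakk> \<Longrightarrow>
  asc (ActO T x A) (ActO T x B) (ActO T x D) \<cdot> (jt x A B \<star> ide (ActO T x D)) \<cdot> jt x (A \<boxtimes> B) D =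
  (ide (ActO T x A) \<star> jt x B D) \<cdot> jt x A (B \<boxtimes> D) \<cdot> act x (asc A B D)"
  using tensor_autoequivalence.J_assoc[OF act_tensor, of x A B D]
  by (simp add: ten_def jt_def act_def cmp_def asc_def ide_def)

lemma aiso_uu [simp]: "x \<in> carrier F \<Longrightarrow> aiso (uu x)"
  using tensor_autoequivalence.e_iso[OF act_tensor, of x] by (simp add: is_iso_aiso uu_def)

lemma jt_lun: "x \<in> carrier F \<Longrightarrow> A \<in> Obj C \<Longrightarrow>
   lun (ActO T x A) \<cdot> (uu x \<star> ide (ActO T x A)) \<cdot> jt x (Unit C) A = act x (lun A)"
  using tensor_autoequivalence.J_LUnit[OF act_tensor, of x A]
  by (simp add: ten_def jt_def act_def cmp_def lun_def ide_def uu_def)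

lemma jt_run: "x \<in> carrier F \<Longrightarrow> A \<in> Obj C \<Longrightarrow>
   run (ActO T x A) \<cdot> (ide (ActO T x A) \<star> uu x) \<cdot> jt x A (Unit C) = act x (run A)"
  using tensor_autoequivalence.J_RUnit[OF act_tensor, of x A]
  by (simp add: ten_def jt_def act_def cmp_def run_def ide_def uu_def)

lemma jt_cp: "\<lbrakk>x \<in> carrier F; y \<in> carrier F; M \<in> Obj C; N \<in> Obj C\<rbrakk> \<Longrightarrow>
  (cp x y M \<star> cp x y N) \<cdot> jt x (ActO T y M) (ActO T y N) \<cdot> act x (jt y M N) = jt (x \<otimes>\<^bsub>F\<^esub> y) M N \<cdot> cp x y (M \<boxtimes> N)"
  using ActComp_tensor[of x y M N] by (simp add: ten_def jt_def act_def cmp_def cp_def)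

lemma uu_cp: "x \<in> carrier F \<Longrightarrow> y \<in> carrier F \<Longrightarrow> uu (x \<otimes>\<^bsub>F\<^esub> y) \<cdot> cp x y (Unit C) = uu x \<cdot> act x (uu y)"
  using ActComp_unit[of x y] by (simp add: act_def cmp_def cp_def uu_def)

text \<open>The normalization is assumed for the functor \<open>T^1\<close> and for
  \<open>T_2\<close>, not for the tensor structure of \<open>T^1\<close>. Compatibility with
  \<open>T_2\<close> at the pair \<open>1\<close>, \<open>1\<close> makes that structure an
  idempotent isomorphism.\<close>

lemma jt_one [simp]:
  assumes [simp]: "M \<in> Obj C" "N \<in> Obj C" shows "jt \<one>\<^bsub>F\<^esub> M N = ide (M \<boxtimes> N)"
proof -
  have "jt \<one>\<^bsub>F\<^esub> M N \<cdot> jt \<one>\<^bsub>F\<^esub> M N = jt \<one>\<^bsub>F\<^esub> M N \<cdot> ide (M \<boxtimes> N)"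
    using jt_cp[of "\<one>\<^bsub>F\<^esub>" "\<one>\<^bsub>F\<^esub>" M N] by simp
  then show ?thesis by (rule cmp_cancel_left) simp_all
qed

lemma uu_one [simp]: "uu \<one>\<^bsub>F\<^esub> = ide (Unit C)"
proof -
  have "uu \<one>\<^bsub>F\<^esub> \<cdot> uu \<one>\<^bsub>F\<^esub> = uu \<one>\<^bsub>F\<^esub> \<cdot> ide (Unit C)"
    using uu_cp[of "\<one>\<^bsub>F\<^esub>" "\<one>\<^bsub>F\<^esub>"] by simp
  then show ?thesis by (rule cmp_cancel_left) simp_all
qed

lemma aiso_asc [simp]: "A \<in> Obj C \<Longrightarrow> B \<in> Obj C \<Longrightarrow> D \<in> Obj C \<Longrightarrow> aiso (asc A B D)"
  using Assoc_iso[of A B D] by (simp add: is_iso_aiso asc_def)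

lemma aiso_lun [simp]: "A \<in> Obj C \<Longrightarrow> aiso (lun A)" and aiso_run [simp]: "A \<in> Obj C \<Longrightarrow> aiso (run A)"
  using LUnit_iso[of A] RUnit_iso[of A] by (simp_all add: is_iso_aiso lun_def run_def)

lemma asc_natural: "\<lbrakk>arr f; arr g; arr h\<rbrakk> \<Longrightarrow>
  asc (tgt f) (tgt g) (tgt h) \<cdot> ((f \<star> g) \<star> h) = (f \<star> (g \<star> h)) \<cdot> asc (src f) (src g) (src h)"
  using Assoc_natural[of "src f" "src g" "src h" "tgt f" "tgt g" "tgt h" "mor f" "mor g" "mor h"]
  by (simp del: arr_obj add: arr_def ten_def cmp_def asc_def)

lemma lun_natural: "arr f \<Longrightarrow> lun (tgt f) \<cdot> (ide (Unit C) \<star> f) = f \<cdot> lun (src f)"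
  using LUnit_natural[of "src f" "tgt f" "mor f"]
  by (simp del: arr_obj add: arr_def ten_def cmp_def lun_def ide_def)

lemma run_natural: "arr f \<Longrightarrow> run (tgt f) \<cdot> (f \<star> ide (Unit C)) = f \<cdot> run (src f)"
  using RUnit_natural[of "src f" "tgt f" "mor f"]
  by (simp del: arr_obj add: arr_def ten_def cmp_def run_def ide_def)

text \<open>The group \<open>H\<close> is given apart from the objects, which may carry structures
  over larger groups; only their values on \<open>H\<close> enter.\<close>

definition tob where
  "tob H X Y = (fst X \<boxtimes> fst Y, \<lambda>h\<in>H. mor ((sact X h \<star> sact Y h) \<cdot> jt h (fst X) (fst Y)))"

definition unob where "unob H = (Unit C, \<lambda>h\<in>H. ActUnit T h)"

lemma TensO_EQ: "TensO (EQ D H) X Y = tob H X Y"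
  by (auto simp: equivariantization_def tob_def ten_def sact_def jt_def cmp_def split: prod.split)

lemma Unit_EQ: "Unit (EQ D H) = unob H"
  by (simp add: equivariantization_def unob_def)

lemma fst_tob [simp]: "fst (tob H X Y) = fst X \<boxtimes> fst Y" "fst (unob H) = Unit C"
  by (simp_all add: tob_def unob_def)

lemma sact_tob: "h \<in> H \<Longrightarrow> sact (tob H X Y) h = (sact X h \<star> sact Y h) \<cdot> jt h (fst X) (fst Y)"
  by (rule arrow.expand) (simp add: sact_def tob_def)

lemma sact_unob: "h \<in> H \<Longrightarrow> sact (unob H) h = uu h"
  by (simp add: sact_def unob_def uu_def)

lemma eo_unob: "subgroup H F \<Longrightarrow> eo H (unob H)"
proof (rule eoI)
  assume H: "subgroup H F"
  note [simp] = subgroup.mem_carrier[OF H] subgroup.m_closed[OF H] subgroup.one_closed[OF H] sact_unob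
  show "sact (unob H) h \<cdot> act h (sact (unob H) k) = sact (unob H) (h \<otimes>\<^bsub>F\<^esub> k) \<cdot> cp h k (fst (unob H))"
    if "h \<in> H" "k \<in> H" for h k using that by (simp add: uu_cp)
  show "sact (unob H) \<one>\<^bsub>F\<^esub> = ide (fst (unob H))" by simp
  show "arr (sact (unob H) h)" if "h \<in> H" for h using that by simp
qed (simp_all add: unob_def)

text \<open>The cocycle condition for the product is the compatibility of \<open>T_2\<close> with
  the tensor structures, after naturality has moved the structure maps of the factors
  together.\<close>

lemma eo_tob:
  assumes H: "subgroup H F" and X: "eo H X" "eo H Y"
  shows "eo H (tob H X Y)"
proof (rule eoI[OF H])
  note Hc = subgroup.subset[OF H]
  note [simp] = subgroup.mem_carrier[OF H] subgroup.m_closed[OF H] subgroup.one_closed[OF H] sact_tob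
    eo_obj[OF X(1) Hc] eo_obj[OF X(2) Hc] eo_arr[OF X(1) Hc] eo_arr[OF X(2) Hc]
  show "sact (tob H X Y) h \<cdot> act h (sact (tob H X Y) k) = sact (tob H X Y) (h \<otimes>\<^bsub>F\<^esub> k) \<cdot> cp h k (fst (tob H X Y))"
    if h: "h \<in> H" and k: "k \<in> H" for h k
  proof -
    note [simp] = h k
    have n: "jt h (fst X) (fst Y) \<cdot> act h (sact X k \<star> sact Y k) =
      (act h (sact X k) \<star> act h (sact Y k)) \<cdot> jt h (ActO T k (fst X)) (ActO T k (fst Y))"
      using jt_natural[of h "sact X k" "sact Y k"] by simp
    have "sact (tob H X Y) h \<cdot> act h (sact (tob H X Y) k) =
      (sact X h \<star> sact Y h) \<cdot> (jt h (fst X) (fst Y) \<cdot> act h (sact X k \<star> sact Y k)) \<cdot> act h (jt k (fst X) (fst Y))" by simp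
    also have "\<dots> = ((sact X h \<cdot> act h (sact X k)) \<star> (sact Y h \<cdot> act h (sact Y k))) \<cdot>
        jt h (ActO T k (fst X)) (ActO T k (fst Y)) \<cdot> act h (jt k (fst X) (fst Y))" unfolding n by simp
    also have "\<dots> = (sact X (h \<otimes>\<^bsub>F\<^esub> k) \<star> sact Y (h \<otimes>\<^bsub>F\<^esub> k)) \<cdot> ((cp h k (fst X) \<star> cp h k (fst Y)) \<cdot>
        jt h (ActO T k (fst X)) (ActO T k (fst Y)) \<cdot> act h (jt k (fst X) (fst Y)))"
      unfolding eo_cocycle[OF X(1) Hc h k] eo_cocycle[OF X(2) Hc h k] by simp
    also have "\<dots> = sact (tob H X Y) (h \<otimes>\<^bsub>F\<^esub> k) \<cdot> cp h k (fst (tob H X Y))"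
      by (subst jt_cp) simp_all
    finally show ?thesis .
  qed
  show "sact (tob H X Y) \<one>\<^bsub>F\<^esub> = ide (fst (tob H X Y))"
    by (simp add: eo_one[OF X(1) Hc] eo_one[OF X(2) Hc])
  show "arr (sact (tob H X Y) h)" if "h \<in> H" for h using that by simp
  show "fst (tob H X Y) \<in> Obj C" by simp
  show "snd (tob H X Y) \<in> extensional H" by (simp add: tob_def)
qed

text \<open>Three groups occur because a tensor product over an intersection of stabilizers is
  compared with one over \<open>F\<close>, and equivariance is asserted for the
  intersection.\<close>

lemma eqv_ten:
  assumes H: "H \<subseteq> carrier F" "H \<subseteq> H1" "H \<subseteq> H2" and X: "\<And>h. h \<in> H \<Longrightarrow> arr (sact X h)" "\<And>h. h \<in> H \<Longrightarrow> arr (sact Y h)"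
    "\<And>h. h \<in> H \<Longrightarrow> arr (sact X' h)" "\<And>h. h \<in> H \<Longrightarrow> arr (sact Y' h)"
    and f: "eqv H X X' f" "eqv H Y Y' g"
  shows "eqv H (tob H1 X Y) (tob H2 X' Y') (f \<star> g)"
  unfolding eqv_def
proof (intro conjI ballI)
  note fD = eqvD(1)[OF f(1)] eqvD(1)[OF f(2)]
  show "arr (f \<star> g)" "src (f \<star> g) = fst (tob H1 X Y)" "tgt (f \<star> g) = fst (tob H2 X' Y')" using fD by auto
  fix h assume h: "h \<in> H"
  have [simp]: "h \<in> carrier F" "h \<in> H1" "h \<in> H2" using h H by auto
  note O = typed_obj[OF fD(1)] typed_obj[OF fD(2)]
  note [simp] = fD X(1)[OF h] X(2)[OF h] X(3)[OF h] X(4)[OF h] O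
  have n: "jt h (fst X') (fst Y') \<cdot> act h (f \<star> g) = (act h f \<star> act h g) \<cdot> jt h (fst X) (fst Y)"
    using jt_natural[of h f g] by simp
  show "(f \<star> g) \<cdot> sact (tob H1 X Y) h = sact (tob H2 X' Y') h \<cdot> act h (f \<star> g)"
    by (simp add: sact_tob n eqvD(2)[OF f(1) h] eqvD(2)[OF f(2) h])
qed

text \<open>Follows from naturality of the associator and from its compatibility with the tensor
  structure of \<open>T^h\<close>. The two unit constraints are treated in the same way.\<close>

lemma eqv_asc:
  assumes H: "subgroup H F" and X: "eo H X" "eo H Y" "eo H Z"
  shows "eqv H (tob H (tob H X Y) Z) (tob H X (tob H Y Z)) (asc (fst X) (fst Y) (fst Z))"
  unfolding eqv_def
proof (intro conjI ballI)
  note Hc = subgroup.subset[OF H]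
  note [simp] = eo_obj[OF X(1) Hc] eo_obj[OF X(2) Hc] eo_obj[OF X(3) Hc]
  fix h assume h: "h \<in> H"
  note [simp] = h subgroup.mem_carrier[OF H h] eo_arr[OF X(1) Hc h] eo_arr[OF X(2) Hc h] eo_arr[OF X(3) Hc h] sact_tob[OF h]
  let ?s = "sact X h" and ?t = "sact Y h" and ?u = "sact Z h"
  let ?A = "fst X" and ?B = "fst Y" and ?D = "fst Z"
  have n: "asc ?A ?B ?D \<cdot> ((?s \<star> ?t) \<star> ?u) = (?s \<star> (?t \<star> ?u)) \<cdot> asc (ActO T h ?A) (ActO T h ?B) (ActO T h ?D)"
    using asc_natural[of ?s ?t ?u] by simp
  have "asc ?A ?B ?D \<cdot> sact (tob H (tob H X Y) Z) h =
    (asc ?A ?B ?D \<cdot> ((?s \<star> ?t) \<star> ?u)) \<cdot> (jt h ?A ?B \<star> ide (ActO T h ?D)) \<cdot> jt h (?A \<boxtimes> ?B) ?D" by simp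
  also have "\<dots> = (?s \<star> (?t \<star> ?u)) \<cdot> (asc (ActO T h ?A) (ActO T h ?B) (ActO T h ?D) \<cdot> (jt h ?A ?B \<star> ide (ActO T h ?D)) \<cdot> jt h (?A \<boxtimes> ?B) ?D)"
    unfolding n by simp
  also have "\<dots> = sact (tob H X (tob H Y Z)) h \<cdot> act h (asc ?A ?B ?D)"
    by (subst jt_assoc) simp_all
  finally show "asc ?A ?B ?D \<cdot> sact (tob H (tob H X Y) Z) h = sact (tob H X (tob H Y Z)) h \<cdot> act h (asc ?A ?B ?D)" .
qed (use eo_obj[OF X(1) subgroup.subset[OF H]] eo_obj[OF X(2) subgroup.subset[OF H]] eo_obj[OF X(3) subgroup.subset[OF H]] in auto)

lemma eqv_lun:
  assumes H: "subgroup H F" and X: "eo H X"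
  shows "eqv H (tob H (unob H) X) X (lun (fst X))"
  unfolding eqv_def
proof (intro conjI ballI)
  note Hc = subgroup.subset[OF H]
  note [simp] = eo_obj[OF X Hc]
  fix h assume h: "h \<in> H"
  note [simp] = h subgroup.mem_carrier[OF H h] eo_arr[OF X Hc h] sact_tob[OF h] sact_unob[OF h]
  have n: "lun (fst X) \<cdot> (ide (Unit C) \<star> sact X h) = sact X h \<cdot> lun (ActO T h (fst X))"
    using lun_natural[of "sact X h"] by simp
  have "lun (fst X) \<cdot> sact (tob H (unob H) X) h =
    (lun (fst X) \<cdot> (ide (Unit C) \<star> sact X h)) \<cdot> (uu h \<star> ide (ActO T h (fst X))) \<cdot> jt h (Unit C) (fst X)" by simp
  also have "\<dots> = sact X h \<cdot> (lun (ActO T h (fst X)) \<cdot> (uu h \<star> ide (ActO T h (fst X))) \<cdot> jt h (Unit C) (fst X))"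
    unfolding n by simp
  also have "\<dots> = sact X h \<cdot> act h (lun (fst X))" by (subst jt_lun) simp_all
  finally show "lun (fst X) \<cdot> sact (tob H (unob H) X) h = sact X h \<cdot> act h (lun (fst X))" .
qed (use eo_obj[OF X subgroup.subset[OF H]] in auto)

lemma eqv_run:
  assumes H: "subgroup H F" and X: "eo H X"
  shows "eqv H (tob H X (unob H)) X (run (fst X))"
  unfolding eqv_def
proof (intro conjI ballI)
  note Hc = subgroup.subset[OF H]
  note [simp] = eo_obj[OF X Hc]
  fix h assume h: "h \<in> H"
  note [simp] = h subgroup.mem_carrier[OF H h] eo_arr[OF X Hc h] sact_tob[OF h] sact_unob[OF h]
  have n: "run (fst X) \<cdot> (sact X h \<star> ide (Unit C)) = sact X h \<cdot> run (ActO T h (fst X))"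
    using run_natural[of "sact X h"] by simp
  have "run (fst X) \<cdot> sact (tob H X (unob H)) h =
    (run (fst X) \<cdot> (sact X h \<star> ide (Unit C))) \<cdot> (ide (ActO T h (fst X)) \<star> uu h) \<cdot> jt h (fst X) (Unit C)" by simp
  also have "\<dots> = sact X h \<cdot> (run (ActO T h (fst X)) \<cdot> (ide (ActO T h (fst X)) \<star> uu h) \<cdot> jt h (fst X) (Unit C))"
    unfolding n by simp
  also have "\<dots> = sact X h \<cdot> act h (run (fst X))" by (subst jt_run) simp_all
  finally show "run (fst X) \<cdot> sact (tob H X (unob H)) h = sact X h \<cdot> act h (run (fst X))" .
qed (use eo_obj[OF X subgroup.subset[OF H]] in auto)

text \<open>The arrows \<open>r\<close> and \<open>s\<close> are tensored with an identity as arrows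
  of \<open>C\<close>.\<close>

lemma tob_split_exact:
  assumes H: "subgroup H F" and X: "eo H X" "eo H Y" "eo H Z" "eo H W" and se: "split_exact H X Y Z i p"
  shows "split_exact H (tob H X W) (tob H Y W) (tob H Z W) (i \<star> ide (fst W)) (p \<star> ide (fst W))"
    and "split_exact H (tob H W X) (tob H W Y) (tob H W Z) (ide (fst W) \<star> i) (ide (fst W) \<star> p)"
proof -
  note Hc = subgroup.subset[OF H]
  from se obtain r s where fg: "eqv H X Y i" "eqv H Y Z p" and z: "p \<cdot> i = zer (fst X) (fst Z)"
    and rs: "r \<Colon> fst Y \<leadsto> fst X" "s \<Colon> fst Z \<leadsto> fst Y" "r \<cdot> i = ide (fst X)" "p \<cdot> s = ide (fst Z)"
    "i \<cdot> r \<boxplus> s \<cdot> p = ide (fst Y)" unfolding split_exact_def by blast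
  note t = eqvD(1)[OF fg(1)] eqvD(1)[OF fg(2)]
  note [simp] = eo_obj[OF X(1) Hc] eo_obj[OF X(2) Hc] eo_obj[OF X(3) Hc] eo_obj[OF X(4) Hc] rs(1,2) t
  note a = eo_arr[OF X(1) Hc] eo_arr[OF X(2) Hc] eo_arr[OF X(3) Hc] eo_arr[OF X(4) Hc]
  note w = eqv_ide[OF Hc X(4)]
  have "(i \<cdot> r) \<star> ide (fst W) \<boxplus> (s \<cdot> p) \<star> ide (fst W) = ide (fst Y \<boxtimes> fst W)"
    by (subst ten_plus_left[symmetric]) (simp_all add: rs(5))
  then show "split_exact H (tob H X W) (tob H Y W) (tob H Z W) (i \<star> ide (fst W)) (p \<star> ide (fst W))"
    unfolding split_exact_def using eqv_ten[OF Hc order_refl order_refl a(1,4,2,4) fg(1) w] eqv_ten[OF Hc order_refl order_refl a(2,4,3,4) fg(2) w]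
    by (intro conjI exI[of _ "r \<star> ide (fst W)"] exI[of _ "s \<star> ide (fst W)"]) (simp_all add: z rs(3,4))
  have "ide (fst W) \<star> (i \<cdot> r) \<boxplus> ide (fst W) \<star> (s \<cdot> p) = ide (fst W \<boxtimes> fst Y)"
    by (subst ten_plus_right[symmetric]) (simp_all add: rs(5))
  then show "split_exact H (tob H W X) (tob H W Y) (tob H W Z) (ide (fst W) \<star> i) (ide (fst W) \<star> p)"
    unfolding split_exact_def using eqv_ten[OF Hc order_refl order_refl a(4,1,4,2) w fg(1)] eqv_ten[OF Hc order_refl order_refl a(4,2,4,3) w fg(2)]
    by (intro conjI exI[of _ "ide (fst W) \<star> r"] exI[of _ "ide (fst W) \<star> s"]) (simp_all add: z rs(3,4))
qed

section \<open>The Grothendieck ring of an equivariantization\<close>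

lemma EO_Obj: "X \<in> EO (Obj C) H \<longleftrightarrow> eo H X"
  by (simp add: eo_def)

context
  fixes H and K :: "('r::comm_ring_1, (('o \<times> ('f \<Rightarrow> 'm)) \<Rightarrow>\<^sub>0 'r) set) module"
  assumes H: "subgroup H F" and K_def: "K = K0_ring (EQ (Obj C) H)"
begin

abbreviation (input) "cK \<equiv> \<lambda>X. (K0_class (EQ (Obj C) H) X :: (('o \<times> ('f \<Rightarrow> 'm)) \<Rightarrow>\<^sub>0 'r) set)"
abbreviation (input) "KK \<equiv> K0 (EQ (Obj C) H) :: ('r, (('o \<times> ('f \<Rightarrow> 'm)) \<Rightarrow>\<^sub>0 'r) set) module"

lemma K_simps: "carrier K = carrier KK" "add K = add KK" "zero K = zero KK" "smult K = smult KK"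
  "mult K = K0_map2 (EQ (Obj C) H) (tob H)" "one K = cK (unob H)"
proof -
  have "TensO (EQ (Obj C) H) = tob H" by (intro ext) (rule TensO_EQ)
  then show "mult K = K0_map2 (EQ (Obj C) H) (tob H)" by (simp add: K_def K0_ring_def)
qed (simp_all add: K_def K0_ring_def Unit_EQ)

lemma
  shows K_mult_class: "eo H M \<Longrightarrow> eo H N \<Longrightarrow> cK M \<otimes>\<^bsub>K\<^esub> cK N = cK (tob H M N)"
    and K_linear_left: "Y \<in> carrier K \<Longrightarrow> linear_map_on KK KK (\<lambda>X. X \<otimes>\<^bsub>K\<^esub> Y)"
    and K_linear_right: "X \<in> carrier K \<Longrightarrow> linear_map_on KK KK (\<lambda>Y. X \<otimes>\<^bsub>K\<^esub> Y)"
proof -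
  have l: "K0_additive (EQ (Obj C) H) (\<lambda>M. cK (tob H M N)) KK" if "N \<in> Obj (EQ (Obj C) H)" for N
  proof (rule K0_additiveI[OF H idem_complete_Obj])
    have N: "eo H N" using that by (simp add: EO_Obj)
    show "cK (tob H X N) \<in> carrier KK" if "X \<in> EO (Obj C) H" for X
      using that N eo_tob[OF H] by (intro K0_class_closed) (simp add: EO_Obj)
    fix X Y Z i p assume "X \<in> EO (Obj C) H" "Y \<in> EO (Obj C) H" "Z \<in> EO (Obj C) H" "split_exact H X Y Z i p"
    then show "cK (tob H Y N) = cK (tob H X N) \<oplus>\<^bsub>KK\<^esub> cK (tob H Z N)"
      using N eo_tob[OF H] by (intro cls_split[OF H order_refl _ _ _ tob_split_exact(1)[OF H]]) (auto simp: EO_Obj)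
  qed
  have r: "K0_additive (EQ (Obj C) H) (\<lambda>M. cK (tob H N M)) KK" if "N \<in> Obj (EQ (Obj C) H)" for N
  proof (rule K0_additiveI[OF H idem_complete_Obj])
    have N: "eo H N" using that by (simp add: EO_Obj)
    show "cK (tob H N X) \<in> carrier KK" if "X \<in> EO (Obj C) H" for X
      using that N eo_tob[OF H] by (intro K0_class_closed) (simp add: EO_Obj)
    fix X Y Z i p assume "X \<in> EO (Obj C) H" "Y \<in> EO (Obj C) H" "Z \<in> EO (Obj C) H" "split_exact H X Y Z i p"
    then show "cK (tob H N Y) = cK (tob H N X) \<oplus>\<^bsub>KK\<^esub> cK (tob H N Z)"
      using N eo_tob[OF H] by (intro cls_split[OF H order_refl _ _ _ tob_split_exact(2)[OF H]]) (auto simp: EO_Obj)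
  qed
  have c: "tob H M N \<in> Obj (EQ (Obj C) H)" if "M \<in> Obj (EQ (Obj C) H)" "N \<in> Obj (EQ (Obj C) H)" for M N
    using that eo_tob[OF H] by (simp add: EO_Obj)
  show "eo H M \<Longrightarrow> eo H N \<Longrightarrow> cK M \<otimes>\<^bsub>K\<^esub> cK N = cK (tob H M N)"
    unfolding K_simps by (rule K0_map2_class[OF l r c]) (simp_all add: EO_Obj)
  show "Y \<in> carrier K \<Longrightarrow> linear_map_on KK KK (\<lambda>X. X \<otimes>\<^bsub>K\<^esub> Y)"
    unfolding K_simps by (rule K0_map2_linear_left[OF l r c])
  show "X \<in> carrier K \<Longrightarrow> linear_map_on KK KK (\<lambda>Y. X \<otimes>\<^bsub>K\<^esub> Y)"
    unfolding K_simps by (rule K0_map2_linear_right[OF l r c])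
qed

lemma K_closed: "X \<in> carrier KK \<Longrightarrow> Y \<in> carrier KK \<Longrightarrow> X \<otimes>\<^bsub>K\<^esub> Y \<in> carrier KK"
  using K_linear_left[of Y] by (auto simp: linear_map_on_def K_simps)

lemma module_K: "module scalars K"
proof -
  interpret m: module scalars KK by (rule module_K0)
  have ex: "\<exists>y\<in>carrier KK. y \<oplus>\<^bsub>KK\<^esub> x = \<zero>\<^bsub>KK\<^esub>" if "x \<in> carrier KK" for x
    using m.M.l_neg[OF that] m.M.a_inv_closed[OF that] by blast
  have "abelian_group K"
    by (rule abelian_groupI; unfold K_simps)
      (assumption | rule m.M.a_closed m.M.zero_closed m.M.a_assoc m.M.a_comm m.M.l_zero ex)+
  then show ?thesis
    by (intro moduleI cring_scalars) (auto simp: K_simps m.smult_l_distr m.smult_r_distr m.smult_assoc1)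
qed

text \<open>On classes of objects the axioms hold because the associator and the unit constraints
  are equivariant isomorphisms.\<close>

lemma ring_K: "ring K"
proof -
  interpret m: module scalars KK by (rule module_K0)
  interpret mK: module scalars K by (rule module_K)
  have eocl: "M \<in> Obj (EQ (Obj C) H) \<longleftrightarrow> eo H M" for M by (simp add: EO_Obj)
  have assoc_class: "(cK X \<otimes>\<^bsub>K\<^esub> cK Y) \<otimes>\<^bsub>K\<^esub> cK Z = cK X \<otimes>\<^bsub>K\<^esub> (cK Y \<otimes>\<^bsub>K\<^esub> cK Z)" if "eo H X" "eo H Y" "eo H Z" for X Y Z
  proof -
    have o: "fst X \<in> Obj C" "fst Y \<in> Obj C" "fst Z \<in> Obj C" using that eo_obj[OF _ subgroup.subset[OF H]] by blast+
    have "cK (tob H (tob H X Y) Z) = cK (tob H X (tob H Y Z))"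
      by (rule cls_iso[OF H idem_complete_Obj _ _ eqv_asc[OF H that], where g = "ainv (asc (fst X) (fst Y) (fst Z))"])
        (use that o eo_tob[OF H] in \<open>auto simp: EO_Obj ainv_cmp cmp_ainv\<close>)
    then show ?thesis using that eo_tob[OF H] by (simp add: K_mult_class)
  qed
  have lc: "cK (unob H) \<otimes>\<^bsub>K\<^esub> cK X = cK X" "cK X \<otimes>\<^bsub>K\<^esub> cK (unob H) = cK X" if "eo H X" for X
  proof -
    have o: "fst X \<in> Obj C" using that eo_obj[OF _ subgroup.subset[OF H]] by blast
    have "cK (tob H (unob H) X) = cK X"
      by (rule cls_iso[OF H idem_complete_Obj _ _ eqv_lun[OF H that], where g = "ainv (lun (fst X))"])
        (use that o eo_tob[OF H] eo_unob[OF H] in \<open>auto simp: EO_Obj ainv_cmp cmp_ainv\<close>)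
    moreover have "cK (tob H X (unob H)) = cK X"
      by (rule cls_iso[OF H idem_complete_Obj _ _ eqv_run[OF H that], where g = "ainv (run (fst X))"])
        (use that o eo_tob[OF H] eo_unob[OF H] in \<open>auto simp: EO_Obj ainv_cmp cmp_ainv\<close>)
    ultimately show "cK (unob H) \<otimes>\<^bsub>K\<^esub> cK X = cK X" "cK X \<otimes>\<^bsub>K\<^esub> cK (unob H) = cK X"
      using that eo_unob[OF H] by (simp_all add: K_mult_class)
  qed
  have id: "linear_map_on KK KK (\<lambda>X. X)" by (simp add: linear_map_on_def)
  have uc: "cK (unob H) \<in> carrier KK" using eo_unob[OF H] by (intro K0_class_closed) (simp add: EO_Obj)
  have KL: "linear_map_on KK KK (\<lambda>X. X \<otimes>\<^bsub>K\<^esub> Y)" "linear_map_on KK KK (\<lambda>X. Y \<otimes>\<^bsub>K\<^esub> X)" if "Y \<in> carrier KK" for Y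
    using K_linear_left[of Y] K_linear_right[of Y] that by (simp_all add: K_simps)
  have cc: "cK M \<in> carrier KK" if "eo H M" for M using that by (intro K0_class_closed) (simp add: EO_Obj)
  \<comment> \<open>Associativity is linear in each variable, so classes are replaced by arbitrary
    elements one variable at a time in \<open>a1\<close>, \<open>a2\<close> and
    \<open>a3\<close>.\<close>
  have a1: "(X \<otimes>\<^bsub>K\<^esub> cK M) \<otimes>\<^bsub>K\<^esub> cK N = X \<otimes>\<^bsub>K\<^esub> (cK M \<otimes>\<^bsub>K\<^esub> cK N)" if "X \<in> carrier KK" "eo H M" "eo H N" for X M N
  proof (rule linear_map_on_eqI[where C = "EQ (Obj C) H" and B = KK and X = X])
    show "linear_map_on KK KK (\<lambda>X. (X \<otimes>\<^bsub>K\<^esub> cK M) \<otimes>\<^bsub>K\<^esub> cK N)"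
      by (rule linear_map_on_compose[OF KL(1)[OF cc[OF that(2)]] KL(1)[OF cc[OF that(3)]]])
    show "linear_map_on KK KK (\<lambda>X. X \<otimes>\<^bsub>K\<^esub> (cK M \<otimes>\<^bsub>K\<^esub> cK N))"
      by (rule KL(1)) (use that cc K_closed in blast)
  qed (use that module_K0 assoc_class in \<open>auto simp: EO_Obj\<close>)
  have a2: "(X \<otimes>\<^bsub>K\<^esub> Y) \<otimes>\<^bsub>K\<^esub> cK N = X \<otimes>\<^bsub>K\<^esub> (Y \<otimes>\<^bsub>K\<^esub> cK N)" if "X \<in> carrier KK" "Y \<in> carrier KK" "eo H N" for X Y N
  proof (rule linear_map_on_eqI[where C = "EQ (Obj C) H" and B = KK and X = Y])
    show "linear_map_on KK KK (\<lambda>Y. (X \<otimes>\<^bsub>K\<^esub> Y) \<otimes>\<^bsub>K\<^esub> cK N)"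
      by (rule linear_map_on_compose[OF KL(2)[OF that(1)] KL(1)[OF cc[OF that(3)]]])
    show "linear_map_on KK KK (\<lambda>Y. X \<otimes>\<^bsub>K\<^esub> (Y \<otimes>\<^bsub>K\<^esub> cK N))"
      by (rule linear_map_on_compose[OF KL(1)[OF cc[OF that(3)]] KL(2)[OF that(1)]])
  qed (use that module_K0 a1 in \<open>auto simp: EO_Obj\<close>)
  have a3: "(X \<otimes>\<^bsub>K\<^esub> Y) \<otimes>\<^bsub>K\<^esub> Z = X \<otimes>\<^bsub>K\<^esub> (Y \<otimes>\<^bsub>K\<^esub> Z)" if "X \<in> carrier KK" "Y \<in> carrier KK" "Z \<in> carrier KK" for X Y Z
  proof (rule linear_map_on_eqI[where C = "EQ (Obj C) H" and B = KK and X = Z])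
    show "linear_map_on KK KK (\<lambda>Z. (X \<otimes>\<^bsub>K\<^esub> Y) \<otimes>\<^bsub>K\<^esub> Z)"
      by (rule KL(2)) (use that K_closed in blast)
    show "linear_map_on KK KK (\<lambda>Z. X \<otimes>\<^bsub>K\<^esub> (Y \<otimes>\<^bsub>K\<^esub> Z))"
      by (rule linear_map_on_compose[OF KL(2)[OF that(2)] KL(2)[OF that(1)]])
  qed (use that module_K0 a2 in \<open>auto simp: EO_Obj\<close>)
  have l1: "cK (unob H) \<otimes>\<^bsub>K\<^esub> X = X" if "X \<in> carrier KK" for X
    by (rule linear_map_on_eqI[OF KL(2)[OF uc] id module_K0 _ that]) (use lc in \<open>auto simp: EO_Obj\<close>)
  have r1: "X \<otimes>\<^bsub>K\<^esub> cK (unob H) = X" if "X \<in> carrier KK" for X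
    by (rule linear_map_on_eqI[OF KL(1)[OF uc] id module_K0 _ that]) (use lc in \<open>auto simp: EO_Obj\<close>)
  show ?thesis
  proof (rule ringI)
    show "abelian_group K" by (rule mK.M.abelian_group_axioms)
    have K1: "carrier K = carrier KK" "add K = add KK" "\<one>\<^bsub>K\<^esub> = cK (unob H)" by (simp_all only: K_simps)
    show "monoid K"
      by (rule monoidI) (use a3 l1 r1 uc K_closed K1 in auto)
    show "(x \<oplus>\<^bsub>K\<^esub> y) \<otimes>\<^bsub>K\<^esub> z = x \<otimes>\<^bsub>K\<^esub> z \<oplus>\<^bsub>K\<^esub> y \<otimes>\<^bsub>K\<^esub> z" if "x \<in> carrier K" "y \<in> carrier K" "z \<in> carrier K" for x y z
      using KL(1)[of z] that unfolding K1 linear_map_on_def by blast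
    show "z \<otimes>\<^bsub>K\<^esub> (x \<oplus>\<^bsub>K\<^esub> y) = z \<otimes>\<^bsub>K\<^esub> x \<oplus>\<^bsub>K\<^esub> z \<otimes>\<^bsub>K\<^esub> y" if "x \<in> carrier K" "y \<in> carrier K" "z \<in> carrier K" for x y z
      using KL(2)[of z] that unfolding K1 linear_map_on_def by blast
  qed
qed

end

end

section \<open>The grading idempotents\<close>

locale gaction = coherent_action C F G \<rho> Cg T + action C F T
  for C :: "('o, 'm, 'k::field) moncat" (structure)
    and F :: "('f, 'x) monoid_scheme" and G :: "('g, 'y) monoid_scheme"
    and \<rho> :: "'f \<Rightarrow> 'g \<Rightarrow> 'g" and Cg :: "'g \<Rightarrow> 'o set" and T :: "('f, 'o, 'm) action_data"
begin

lemma group_F: "group F" and group_G: "group G" and hom_rho: "group_hom F (AutoGroup G) \<rho>"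
  using coherent_action_axioms unfolding coherent_action_def graded_fusion_category_def tensor_action_def by blast+

declare hom_one [simp del] hom_mult [simp del] hom_inv [simp del]

lemma rho_auto: "x \<in> carrier F \<Longrightarrow> \<rho> x \<in> auto G"
  using group_hom.hom_closed[OF hom_rho, of x] by (simp add: AutoGroup_def)

lemma rho_closed [simp]: "x \<in> carrier F \<Longrightarrow> g \<in> carrier G \<Longrightarrow> \<rho> x g \<in> carrier G"
  using rho_auto[of x] by (auto simp: auto_def hom_def)

lemma rho_mult: "x \<in> carrier F \<Longrightarrow> g \<in> carrier G \<Longrightarrow> h \<in> carrier G \<Longrightarrow> \<rho> x (g \<otimes>\<^bsub>G\<^esub> h) = \<rho> x g \<otimes>\<^bsub>G\<^esub> \<rho> x h"
  using rho_auto[of x] by (auto simp: auto_def hom_def)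

lemma rho_eq_iff [simp]: "x \<in> carrier F \<Longrightarrow> g \<in> carrier G \<Longrightarrow> h \<in> carrier G \<Longrightarrow> \<rho> x g = \<rho> x h \<longleftrightarrow> g = h"
  using rho_auto[of x] by (auto simp: auto_def Bij_def bij_betw_def dest: inj_onD)

lemma rho_comp: "x \<in> carrier F \<Longrightarrow> y \<in> carrier F \<Longrightarrow> g \<in> carrier G \<Longrightarrow> \<rho> (x \<otimes>\<^bsub>F\<^esub> y) g = \<rho> x (\<rho> y g)"
  using group_hom.hom_mult[OF hom_rho, of x y] rho_auto[of x] rho_auto[of y]
  by (auto simp: AutoGroup_def BijGroup_def auto_def compose_def)

lemmas F_simps [simp] = group.is_monoid[OF group_F, THEN monoid.m_closed] group.is_monoid[OF group_F, THEN monoid.one_closed]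
  group.inv_closed[OF group_F] group.l_inv[OF group_F] group.r_inv[OF group_F]
  group.is_monoid[OF group_F, THEN monoid.l_one] group.is_monoid[OF group_F, THEN monoid.r_one]

lemmas F_assoc = group.is_monoid[OF group_F, THEN monoid.m_assoc]

lemmas G_simps [simp] = group.is_monoid[OF group_G, THEN monoid.m_closed] group.is_monoid[OF group_G, THEN monoid.one_closed]
  group.inv_closed[OF group_G] group.l_inv[OF group_G] group.r_inv[OF group_G]
  group.is_monoid[OF group_G, THEN monoid.l_one] group.is_monoid[OF group_G, THEN monoid.r_one]

lemma rho_one [simp]: "g \<in> carrier G \<Longrightarrow> \<rho> \<one>\<^bsub>F\<^esub> g = g"
  using rho_comp[of "\<one>\<^bsub>F\<^esub>" "\<one>\<^bsub>F\<^esub>" g] by simp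

lemma rho_inv [simp]: "x \<in> carrier F \<Longrightarrow> g \<in> carrier G \<Longrightarrow> \<rho> (inv\<^bsub>F\<^esub> x) (\<rho> x g) = g"
  "x \<in> carrier F \<Longrightarrow> g \<in> carrier G \<Longrightarrow> \<rho> x (\<rho> (inv\<^bsub>F\<^esub> x) g) = g"
  using rho_comp[of "inv\<^bsub>F\<^esub> x" x g] rho_comp[of x "inv\<^bsub>F\<^esub> x" g] by simp_all

lemma G_idem: "g \<in> carrier G \<Longrightarrow> g \<otimes>\<^bsub>G\<^esub> g = g \<Longrightarrow> g = \<one>\<^bsub>G\<^esub>"
proof -
  assume g: "g \<in> carrier G" "g \<otimes>\<^bsub>G\<^esub> g = g"
  have "g = (inv\<^bsub>G\<^esub> g \<otimes>\<^bsub>G\<^esub> g) \<otimes>\<^bsub>G\<^esub> g" using g(1) by simp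
  also have "\<dots> = inv\<^bsub>G\<^esub> g \<otimes>\<^bsub>G\<^esub> (g \<otimes>\<^bsub>G\<^esub> g)" using g(1) by (intro monoid.m_assoc[OF group.is_monoid[OF group_G]]) simp_all
  also have "\<dots> = \<one>\<^bsub>G\<^esub>" unfolding g(2) using g(1) by simp
  finally show ?thesis .
qed

lemma rho_oneG [simp]: "x \<in> carrier F \<Longrightarrow> \<rho> x \<one>\<^bsub>G\<^esub> = \<one>\<^bsub>G\<^esub>"
  using rho_mult[of x "\<one>\<^bsub>G\<^esub>" "\<one>\<^bsub>G\<^esub>"] by (intro G_idem) simp_all

abbreviation St where "St g \<equiv> stabilizer F \<rho> g"

lemma St_iff: "x \<in> St g \<longleftrightarrow> x \<in> carrier F \<and> \<rho> x g = g"
  by (simp add: stabilizer_def)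

lemma subgroup_F: "subgroup (carrier F) F"
  by (rule group.subgroup_self[OF group_F])

lemma subgroup_St: "g \<in> carrier G \<Longrightarrow> subgroup (St g) F"
proof (rule group.subgroupI[OF group_F])
  assume g: "g \<in> carrier G"
  show "St g \<subseteq> carrier F" by (auto simp: St_iff)
  have "\<one>\<^bsub>F\<^esub> \<in> St g" using g by (simp add: St_iff)
  then show "St g \<noteq> {}" by blast
  show "inv\<^bsub>F\<^esub> a \<in> St g" if "a \<in> St g" for a using that g rho_inv(1)[of a g] by (simp add: St_iff)
  show "a \<otimes>\<^bsub>F\<^esub> b \<in> St g" if "a \<in> St g" "b \<in> St g" for a b using that g by (simp add: St_iff rho_comp)
qed

text \<open>The structure of a conjugate is indexed by the set on the right, a component by the
  stabilizer on the left.\<close>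

lemma St_rho:
  assumes "x \<in> carrier F" "g \<in> carrier G"
  shows "St (\<rho> x g) = (\<lambda>h. x \<otimes>\<^bsub>F\<^esub> h \<otimes>\<^bsub>F\<^esub> inv\<^bsub>F\<^esub> x) ` St g"
proof
  show "St (\<rho> x g) \<subseteq> (\<lambda>h. x \<otimes>\<^bsub>F\<^esub> h \<otimes>\<^bsub>F\<^esub> inv\<^bsub>F\<^esub> x) ` St g"
  proof
    fix y assume y: "y \<in> St (\<rho> x g)"
    then have "inv\<^bsub>F\<^esub> x \<otimes>\<^bsub>F\<^esub> y \<otimes>\<^bsub>F\<^esub> x \<in> St g" using assms by (simp add: St_iff rho_comp)
    moreover have "y = x \<otimes>\<^bsub>F\<^esub> (inv\<^bsub>F\<^esub> x \<otimes>\<^bsub>F\<^esub> y \<otimes>\<^bsub>F\<^esub> x) \<otimes>\<^bsub>F\<^esub> inv\<^bsub>F\<^esub> x"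
      using y assms by (simp add: St_iff F_assoc) (simp add: F_assoc[symmetric])
    ultimately show "y \<in> (\<lambda>h. x \<otimes>\<^bsub>F\<^esub> h \<otimes>\<^bsub>F\<^esub> inv\<^bsub>F\<^esub> x) ` St g" by blast
  qed
  show "(\<lambda>h. x \<otimes>\<^bsub>F\<^esub> h \<otimes>\<^bsub>F\<^esub> inv\<^bsub>F\<^esub> x) ` St g \<subseteq> St (\<rho> x g)"
    using assms by (auto simp: St_iff rho_comp)
qed

lemma idem_complete_Cg: "g \<in> carrier G \<Longrightarrow> idem_complete (Cg g)"
  by (rule idem_complete_full_subcategory[OF Cg_abelian Cg_subset])

lemma Cg_obj: "g \<in> carrier G \<Longrightarrow> V \<in> Cg g \<Longrightarrow> V \<in> Obj C"
  using Cg_subset by blast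

lemma Cg_zer:
  assumes "g \<in> carrier G" "h \<in> carrier G" "g \<noteq> h" "A \<in> Cg g" "B \<in> Cg h" "f \<Colon> A \<leadsto> B"
  shows "f = zer A B"
  using Cg_orthogonal[OF assms(1-5)] assms(6) by (cases f) (auto simp del: arr_obj simp: arr_def zer_def)

text \<open>One decomposition is chosen for each object, and only its idempotents are kept; they
  turn out to be natural.\<close>

definition gdec where
  "gdec M = (SOME (X, j, p). (\<forall>g\<in>carrier G. X g \<in> Cg g) \<and> bip (carrier G) X M j p)"

text \<open>The idempotent of \<open>M\<close> projecting onto its part of degree \<open>g\<close>.\<close>

definition gr where "gr g M = (case gdec M of (X, j, p) \<Rightarrow> j g \<cdot> p g)"

lemma gr_ex:
  assumes "M \<in> Obj C"
  shows "\<exists>X j p. (\<forall>g\<in>carrier G. X g \<in> Cg g) \<and> bip (carrier G) X M j p \<and> (\<forall>g. gr g M = j g \<cdot> p g)"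
proof -
  obtain X \<iota> \<pi> where X: "\<forall>g\<in>carrier G. X g \<in> Cg g" "is_biproduct C (carrier G) X M \<iota> \<pi>"
    using grading_decomp[OF assms] by blast
  define P where "P = (\<lambda>(X, j, p). (\<forall>g\<in>carrier G. X g \<in> Cg g) \<and> bip (carrier G) X M j p)"
  have "P (X, \<lambda>i. Arrow (X i) (\<iota> i) M, \<lambda>i. Arrow M (\<pi> i) (X i))"
    using X is_biproduct_bip by (simp add: P_def)
  then have "P (gdec M)" unfolding gdec_def P_def by (rule someI)
  then show ?thesis unfolding gr_def P_def by (cases "gdec M") auto
qed

lemma
  assumes M: "M \<in> Obj C"
  shows gr_typed: "g \<in> carrier G \<Longrightarrow> gr g M \<Colon> M \<leadsto> M"
    and gr_cmp: "g \<in> carrier G \<Longrightarrow> h \<in> carrier G \<Longrightarrow> gr g M \<cdot> gr h M = (if g = h then gr g M else zer M M)"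
    and gr_sum: "asum M M (\<lambda>g. gr g M) (carrier G) = ide M"
    and gr_factor: "g \<in> carrier G \<Longrightarrow> \<exists>V j p. V \<in> Cg g \<and> j \<Colon> V \<leadsto> M \<and> p \<Colon> M \<leadsto> V \<and> p \<cdot> j = ide V \<and> j \<cdot> p = gr g M"
proof -
  obtain X j p where X: "\<And>g. g \<in> carrier G \<Longrightarrow> X g \<in> Cg g" and b: "bip (carrier G) X M j p" and gr: "\<And>g. gr g M = j g \<cdot> p g"
    using gr_ex[OF M] by blast
  note d = bipD[OF b]
  show t: "gr g M \<Colon> M \<leadsto> M" if "g \<in> carrier G" for g using d(4,5)[OF that] by (auto simp: gr)
  show "asum M M (\<lambda>g. gr g M) (carrier G) = ide M" using d(8) by (simp add: gr[abs_def])
  show "gr g M \<cdot> gr h M = (if g = h then gr g M else zer M M)" if g: "g \<in> carrier G" and h: "h \<in> carrier G" for g h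
  proof (cases "g = h")
    case True
    show ?thesis unfolding True[symmetric] using d(3,4,5)[OF g] by (simp add: gr cmp_rewrite[OF d(6)[OF g]])
  next
    case False
    then have "h \<noteq> g" by simp
    then show ?thesis using False M d(3,4,5)[OF g] d(3,4,5)[OF h] by (simp add: gr cmp_rewrite[OF d(7)[OF h g \<open>h \<noteq> g\<close>]])
  qed
  show "\<exists>V j p. V \<in> Cg g \<and> j \<Colon> V \<leadsto> M \<and> p \<Colon> M \<leadsto> V \<and> p \<cdot> j = ide V \<and> j \<cdot> p = gr g M" if "g \<in> carrier G" for g
    using d(4,5,6)[OF that] X[OF that] gr[of g]
    by (intro exI[of _ "X g"] exI[of _ "j g"] exI[of _ "p g"]) simp
qed

lemma gr_obj [simp]: "M \<in> Obj C \<Longrightarrow> g \<in> carrier G \<Longrightarrow> arr (gr g M)"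
  "M \<in> Obj C \<Longrightarrow> g \<in> carrier G \<Longrightarrow> src (gr g M) = M" "M \<in> Obj C \<Longrightarrow> g \<in> carrier G \<Longrightarrow> tgt (gr g M) = M"
  using gr_typed by blast+

text \<open>The composite factors through an arrow between objects of two different degrees, which
  is zero.\<close>

lemma gr_between:
  assumes "g \<in> carrier G" "h \<in> carrier G" "g \<noteq> h" "f \<Colon> M \<leadsto> N"
  shows "gr h N \<cdot> f \<cdot> gr g M = zer M N"
proof -
  note O = typed_obj[OF assms(4)]
  obtain V j p where V: "V \<in> Cg g" "j \<Colon> V \<leadsto> M" "p \<Colon> M \<leadsto> V" "j \<cdot> p = gr g M" using gr_factor[OF O(1) assms(1)] by blast
  obtain W i q where W: "W \<in> Cg h" "i \<Colon> W \<leadsto> N" "q \<Colon> N \<leadsto> W" "i \<cdot> q = gr h N" using gr_factor[OF O(2) assms(2)] by blast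
  have z: "q \<cdot> f \<cdot> j = zer V W" by (rule Cg_zer[OF assms(1-3) V(1) W(1)]) (use V W assms(4) in auto)
  have "gr h N \<cdot> f \<cdot> gr g M = i \<cdot> (q \<cdot> f \<cdot> j) \<cdot> p" unfolding V(4)[symmetric] W(4)[symmetric] using V(2,3) W(2,3) assms(4) by simp
  then show ?thesis unfolding z using V(2,3) W(2,3) O typed_obj[OF V(2)] typed_obj[OF W(2)] by simp
qed

text \<open>Inserting the decomposition of the identity on either side reduces both composites to
  \<open>gr g N \<cdot> f \<cdot> gr g M\<close>, since the mixed terms vanish.\<close>

lemma gr_natural:
  assumes g: "g \<in> carrier G" and f: "f \<Colon> M \<leadsto> N"
  shows "gr g N \<cdot> f = f \<cdot> gr g M"
proof -
  note O = typed_obj[OF f]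
  note [simp] = O f
  have "gr g N \<cdot> f = (gr g N \<cdot> f) \<cdot> asum M M (\<lambda>h. gr h M) (carrier G)" using g by (simp add: gr_sum)
  also have "\<dots> = asum M N (\<lambda>h. (gr g N \<cdot> f) \<cdot> gr h M) (carrier G)"
    by (rule cmp_asum_right[OF finite_G]) (use g in auto)
  also have "\<dots> = (gr g N \<cdot> f) \<cdot> gr g M"
    by (rule asum_single[OF finite_G g]) (use g gr_between[OF _ g _ f] in auto)
  finally have 1: "gr g N \<cdot> f = gr g N \<cdot> f \<cdot> gr g M" using g by simp
  have "f \<cdot> gr g M = asum N N (\<lambda>h. gr h N) (carrier G) \<cdot> (f \<cdot> gr g M)" using g by (simp add: gr_sum)
  also have "\<dots> = asum M N (\<lambda>h. gr h N \<cdot> (f \<cdot> gr g M)) (carrier G)"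
    by (rule cmp_asum_left[OF finite_G]) (use g in auto)
  also have "\<dots> = gr g N \<cdot> (f \<cdot> gr g M)"
    by (rule asum_single[OF finite_G g]) (use g gr_between[OF g _ _ f] in auto)
  finally show ?thesis using 1 by simp
qed

lemma gr_Cg_zer:
  assumes g: "g \<in> carrier G" and V: "V \<in> Cg g" and h: "h \<in> carrier G" "h \<noteq> g"
  shows "gr h V = zer V V"
proof -
  have O: "V \<in> Obj C" using Cg_obj[OF g V] .
  obtain W j p where W: "W \<in> Cg h" "j \<Colon> W \<leadsto> V" "p \<Colon> V \<leadsto> W" "j \<cdot> p = gr h V" using gr_factor[OF O h(1)] by blast
  have "p = zer V W" by (rule Cg_zer[OF g h(1) _ V W(1,3)]) (use h in simp)
  then have "j \<cdot> p = zer V V" using W O by simp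
  then show ?thesis unfolding W(4) .
qed

lemma gr_Cg:
  assumes g: "g \<in> carrier G" and V: "V \<in> Cg g"
  shows "gr g V = ide V"
proof -
  have O: "V \<in> Obj C" using Cg_obj[OF g V] .
  have "asum V V (\<lambda>h. gr h V) (carrier G) = gr g V"
    by (rule asum_single[OF finite_G g]) (use O g gr_Cg_zer[OF g V] in auto)
  then show ?thesis using gr_sum[OF O] by simp
qed

lemma gr_of:
  assumes g: "g \<in> carrier G" and V: "V \<in> Cg g" and j: "j \<Colon> V \<leadsto> M" and h: "h \<in> carrier G"
  shows "gr h M \<cdot> j = (if h = g then j else zer V M)"
  using gr_natural[OF h j] gr_Cg[OF g V] gr_Cg_zer[OF g V h] j typed_obj[OF j] by auto

text \<open>\<open>T^x\<close> sends the image of \<open>gr h M\<close> to an object of degree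
  \<open>\<rho> x h\<close>. Hence, of the translated summands of \<open>M\<close>, only that of
  degree \<open>g\<close> survives the projection to degree \<open>\<rho> x g\<close>.\<close>

lemma gr_act:
  assumes g: "g \<in> carrier G" and x: "x \<in> carrier F" and M: "M \<in> Obj C"
  shows "act x (gr g M) = gr (\<rho> x g) (ActO T x M)"
proof -
  note [simp] = x M
  let ?N = "ActO T x M"
  have *: "gr k ?N \<cdot> act x (gr h M) = (if k = \<rho> x h then act x (gr h M) else zer ?N ?N)"
    if h: "h \<in> carrier G" and k: "k \<in> carrier G" for h k
  proof -
    obtain V j p where V: "V \<in> Cg h" "j \<Colon> V \<leadsto> M" "p \<Colon> M \<leadsto> V" "j \<cdot> p = gr h M" using gr_factor[OF M h] by blast
    have VO: "V \<in> Obj C" using typed_obj(1)[OF V(2)] .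
    have "gr k ?N \<cdot> act x (gr h M) = (gr k ?N \<cdot> act x j) \<cdot> act x p" unfolding V(4)[symmetric] using V(2,3) k by simp
    also have "\<dots> = (if k = \<rho> x h then act x j else zer (ActO T x V) ?N) \<cdot> act x p"
      using gr_of[OF rho_closed[OF x h] Act_Cg[OF x h V(1)], of "act x j" ?N k] V(2) k by simp
    finally show ?thesis unfolding V(4)[symmetric] using V(2,3) VO by auto
  qed
  have rg: "\<rho> x g \<in> carrier G" using g by simp
  have "gr (\<rho> x g) ?N = gr (\<rho> x g) ?N \<cdot> act x (asum M M (\<lambda>h. gr h M) (carrier G))" using rg by (simp add: gr_sum)
  also have "act x (asum M M (\<lambda>h. gr h M) (carrier G)) = asum ?N ?N (\<lambda>h. act x (gr h M)) (carrier G)"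
    by (rule act_asum[OF x finite_G M M]) simp
  also have "gr (\<rho> x g) ?N \<cdot> \<dots> = asum ?N ?N (\<lambda>h. gr (\<rho> x g) ?N \<cdot> act x (gr h M)) (carrier G)"
    by (rule cmp_asum_right[OF finite_G]) (use rg in auto)
  also have "\<dots> = gr (\<rho> x g) ?N \<cdot> act x (gr g M)"
    by (rule asum_single[OF finite_G g]) (use * rg g in auto)
  also have "\<dots> = act x (gr g M)" using *[OF g rg] by simp
  finally show ?thesis ..
qed

text \<open>The structure maps permute the homogeneous parts. For \<open>h\<close> in the stabilizer
  of \<open>g\<close> this is the equivariance of \<open>gr g\<close>.\<close>

lemma gr_sact:
  assumes H: "H \<subseteq> carrier F" and X: "eo H X" and h: "h \<in> H" and g: "g \<in> carrier G"
  shows "sact X h \<cdot> act h (gr g (fst X)) = gr (\<rho> h g) (fst X) \<cdot> sact X h"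
  using gr_natural[of "\<rho> h g" "sact X h" "ActO T h (fst X)" "fst X"] gr_act[OF g, of h "fst X"]
    eo_obj[OF X H] eo_arr[OF X H h] H h g by auto

lemma gr_eqv:
  assumes H: "H \<subseteq> carrier F" and X: "eo H X" and H': "H' \<subseteq> H" "H' \<subseteq> St g" and g: "g \<in> carrier G"
  shows "eqv H' X X (gr g (fst X))"
  unfolding eqv_def
proof (intro conjI ballI)
  fix h assume "h \<in> H'"
  then have "h \<in> H" "\<rho> h g = g" using H' by (auto simp: St_iff)
  then show "gr g (fst X) \<cdot> sact X h = sact X h \<cdot> act h (gr g (fst X))" using gr_sact[OF H X _ g, of h] by simp
qed (use gr_typed[OF eo_obj[OF X H] g] in auto)

text \<open>Sums over subsets of an orthogonal family multiply like intersections. Applied to the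
  degrees of one object and to the pairs of degrees of a tensor product.\<close>

lemma orth_asum_cmp:
  assumes fin: "finite P" "finite Q" and X: "X \<in> Obj C" and ty: "\<And>p. p \<in> P \<union> Q \<Longrightarrow> t p \<Colon> X \<leadsto> X"
    and tt: "\<And>p q. p \<in> P \<Longrightarrow> q \<in> Q \<Longrightarrow> t p \<cdot> t q = (if p = q then t p else zer X X)"
  shows "asum X X t P \<cdot> asum X X t Q = asum X X t (P \<inter> Q)"
proof -
  have tP: "t p \<Colon> X \<leadsto> X" if "p \<in> P" for p using ty[of p] that by simp
  have tQ: "t p \<Colon> X \<leadsto> X" if "p \<in> Q" for p using ty[of p] that by simp
  have aP: "asum X X t P \<Colon> X \<leadsto> X" using tP X by (auto intro!: arr_asum)
  have *: "asum X X t P \<cdot> t q = (if q \<in> P then t q else zer X X)" if q: "q \<in> Q" for q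
  proof -
    have "asum X X t P \<cdot> t q = asum X X (\<lambda>p. t p \<cdot> t q) P"
      by (rule cmp_asum_left[OF fin(1) tP tQ[OF q] X])
    also have "\<dots> = asum X X (\<lambda>p. if p = q then t q else zer X X) P"
      by (rule asum_cong) (use tt q tP tQ[OF q] X in auto)
    also have "\<dots> = (if q \<in> P then t q else zer X X)"
      by (rule asum_delta[OF fin(1) tQ[OF q]])
    finally show ?thesis .
  qed
  have "asum X X t P \<cdot> asum X X t Q = asum X X (\<lambda>q. asum X X t P \<cdot> t q) Q"
    by (rule cmp_asum_right[OF fin(2) tQ aP X])
  also have "\<dots> = asum X X (\<lambda>q. if q \<in> P then t q else zer X X) Q"
    by (rule asum_cong) (use * tQ X aP in auto)
  also have "\<dots> = asum X X (\<lambda>q. if q \<in> P then t q else zer X X) (P \<inter> Q)"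
    by (rule asum_neutral[OF fin(2)]) (use tQ X in auto)
  also have "\<dots> = asum X X t (P \<inter> Q)"
    by (rule asum_cong) (use tQ X in auto)
  finally show ?thesis .
qed

text \<open>Shared by sums over degrees and sums over pairs of degrees: to see that such a sum is
  equivariant, it remains to check that its index set is stable.\<close>

lemma asum_sact:
  assumes X: "eo (carrier F) X" and x: "x \<in> carrier F" and P: "finite P" "inj_on r P"
    and ty: "\<And>p. p \<in> P \<Longrightarrow> t p \<Colon> fst X \<leadsto> fst X" "\<And>p. p \<in> P \<Longrightarrow> t (r p) \<Colon> fst X \<leadsto> fst X"
    and t: "\<And>p. p \<in> P \<Longrightarrow> sact X x \<cdot> act x (t p) = t (r p) \<cdot> sact X x"
  shows "sact X x \<cdot> act x (asum (fst X) (fst X) t P) = asum (fst X) (fst X) t (r ` P) \<cdot> sact X x"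
proof -
  note [simp] = eo_obj[OF X order_refl] eo_arr[OF X order_refl x] x
  let ?X = "fst X" and ?s = "sact X x"
  have s: "?s \<Colon> ActO T x ?X \<leadsto> ?X" by simp
  have "?s \<cdot> act x (asum ?X ?X t P) = ?s \<cdot> asum (ActO T x ?X) (ActO T x ?X) (\<lambda>p. act x (t p)) P"
    using ty(1) by (subst act_asum[OF x P(1)]) auto
  also have "\<dots> = asum (ActO T x ?X) ?X (\<lambda>p. ?s \<cdot> act x (t p)) P"
    by (rule cmp_asum_right[OF P(1)]) (use ty(1) s in auto)
  also have "\<dots> = asum (ActO T x ?X) ?X (\<lambda>p. t (r p) \<cdot> ?s) P"
  proof (rule asum_cong)
    fix p assume p: "p \<in> P"
    show "?s \<cdot> act x (t p) = t (r p) \<cdot> ?s" by (rule t[OF p])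
    show "?s \<cdot> act x (t p) \<Colon> ActO T x ?X \<leadsto> ?X" using ty(1)[OF p] s by auto
  qed (use s in auto)
  also have "\<dots> = asum ?X ?X (\<lambda>p. t (r p)) P \<cdot> ?s"
    by (rule cmp_asum_left[symmetric, OF P(1) ty(2) s]) auto
  also have "asum ?X ?X (\<lambda>p. t (r p)) P = asum ?X ?X t (r ` P)"
    by (rule asum_reindex[symmetric, OF P(2)]) (use ty(2) in auto)
  finally show ?thesis .
qed

section \<open>Homogeneous parts of a tensor product\<close>

abbreviation GG where "GG \<equiv> carrier G \<times> carrier G"

definition te where "te M N hk = gr (fst hk) M \<star> gr (snd hk) N"

text \<open>The idempotent projecting onto the sum of the \<open>M\<^sub>h \<boxtimes> N\<^sub>k\<close> with \<open>(h, k)\<close> in \<open>P\<close>.\<close>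

definition eps where "eps M N P = asum (M \<boxtimes> N) (M \<boxtimes> N) (te M N) P"

context
  fixes M N
  assumes M [simp]: "M \<in> Obj C" and N [simp]: "N \<in> Obj C"
begin

lemma te_typed [simp]: "p \<in> GG \<Longrightarrow> arr (te M N p)" "p \<in> GG \<Longrightarrow> src (te M N p) = M \<boxtimes> N" "p \<in> GG \<Longrightarrow> tgt (te M N p) = M \<boxtimes> N"
  by (auto simp: te_def)

lemma te_te: "p \<in> GG \<Longrightarrow> q \<in> GG \<Longrightarrow> te M N p \<cdot> te M N q = (if p = q then te M N p else zer (M \<boxtimes> N) (M \<boxtimes> N))"
  by (auto simp: te_def gr_cmp prod_eq_iff)

lemma finite_GG: "finite GG"
  using finite_G by simp

lemma fin: "P \<subseteq> GG \<Longrightarrow> finite P"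
  using finite_GG finite_subset by blast

lemma eps_typed [simp]: "P \<subseteq> GG \<Longrightarrow> arr (eps M N P)" "src (eps M N P) = M \<boxtimes> N" "tgt (eps M N P) = M \<boxtimes> N"
  unfolding eps_def by (auto intro!: arr_asum simp: subset_iff)

lemma eps_eps:
  assumes P: "P \<subseteq> GG" "Q \<subseteq> GG"
  shows "eps M N P \<cdot> eps M N Q = eps M N (P \<inter> Q)"
  unfolding eps_def
proof (rule orth_asum_cmp[OF fin[OF P(1)] fin[OF P(2)]])
  show "te M N p \<Colon> M \<boxtimes> N \<leadsto> M \<boxtimes> N" if "p \<in> P \<union> Q" for p using that P te_typed by blast
  show "te M N p \<cdot> te M N q = (if p = q then te M N p else zer (M \<boxtimes> N) (M \<boxtimes> N))" if "p \<in> P" "q \<in> Q" for p q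
    using te_te subsetD[OF P(1) that(1)] subsetD[OF P(2) that(2)] by blast
qed simp

lemma eps_empty: "eps M N {} = zer (M \<boxtimes> N) (M \<boxtimes> N)"
  by (simp add: eps_def)

lemma eps_single: "p \<in> GG \<Longrightarrow> eps M N {p} = te M N p"
  unfolding eps_def by (rule asum_singleton) auto

lemma eps_UN:
  assumes "finite I" "\<And>i. i \<in> I \<Longrightarrow> P i \<subseteq> GG" "\<And>i j. i \<in> I \<Longrightarrow> j \<in> I \<Longrightarrow> i \<noteq> j \<Longrightarrow> P i \<inter> P j = {}"
  shows "eps M N (\<Union>i\<in>I. P i) = asum (M \<boxtimes> N) (M \<boxtimes> N) (\<lambda>i. eps M N (P i)) I"
  unfolding eps_def
proof (rule asum_UN[OF assms(1) _ assms(3)])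
  show "finite (P i)" if "i \<in> I" for i using fin assms(2)[OF that] by blast
  show "te M N p \<Colon> M \<boxtimes> N \<leadsto> M \<boxtimes> N" if "i \<in> I" "p \<in> P i" for i p
    using subsetD[OF assms(2)[OF that(1)] that(2)] te_typed by blast
qed auto

lemma ten_asum_left:
  assumes "finite I" "\<And>i. i \<in> I \<Longrightarrow> f i \<Colon> A \<leadsto> B" "A \<in> Obj C" "B \<in> Obj C" "g \<Colon> A' \<leadsto> B'"
  shows "asum A B f I \<star> g = asum (A \<boxtimes> A') (B \<boxtimes> B') (\<lambda>i. f i \<star> g) I"
  by (rule asum_linear[OF assms(1,3,4,2), where \<phi> = "\<lambda>f. f \<star> g"]) (use assms(5) in \<open>auto simp: ten_plus_left\<close>)

lemma ten_asum_right:
  assumes "finite I" "\<And>i. i \<in> I \<Longrightarrow> f i \<Colon> A \<leadsto> B" "A \<in> Obj C" "B \<in> Obj C" "g \<Colon> A' \<leadsto> B'"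
  shows "g \<star> asum A B f I = asum (A' \<boxtimes> A) (B' \<boxtimes> B) (\<lambda>i. g \<star> f i) I"
  by (rule asum_linear[OF assms(1,3,4,2), where \<phi> = "\<lambda>f. g \<star> f"]) (use assms(5) in \<open>auto simp: ten_plus_right\<close>)

lemma eps_GG: "eps M N GG = ide (M \<boxtimes> N)"
proof -
  let ?X = "M \<boxtimes> N"
  have "ide ?X = asum M M (\<lambda>g. gr g M) (carrier G) \<star> ide N" by (simp add: gr_sum)
  also have "\<dots> = asum ?X ?X (\<lambda>g. gr g M \<star> ide N) (carrier G)"
    by (rule ten_asum_left[OF finite_G]) auto
  also have "\<dots> = asum ?X ?X (\<lambda>g. eps M N ({g} \<times> carrier G)) (carrier G)"
  proof (rule asum_cong)
    fix g assume g: "g \<in> carrier G"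
    have "gr g M \<star> ide N = gr g M \<star> asum N N (\<lambda>g. gr g N) (carrier G)" by (simp add: gr_sum)
    also have "\<dots> = asum ?X ?X (\<lambda>k. gr g M \<star> gr k N) (carrier G)"
      by (rule ten_asum_right[OF finite_G]) (use g in auto)
    also have "\<dots> = asum ?X ?X (te M N) (Pair g ` carrier G)"
      by (subst asum_reindex) (use g in \<open>auto simp: te_def inj_on_def\<close>)
    also have "Pair g ` carrier G = {g} \<times> carrier G" by auto
    finally show "gr g M \<star> ide N = eps M N ({g} \<times> carrier G)" by (simp add: eps_def)
  qed auto
  also have "\<dots> = eps M N (\<Union>g\<in>carrier G. {g} \<times> carrier G)"
    by (rule eps_UN[symmetric, OF finite_G]) auto
  also have "(\<Union>g\<in>carrier G. {g} \<times> carrier G) = GG" by auto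
  finally show ?thesis ..
qed

text \<open>The image of the idempotent of a pair is a tensor product of homogeneous objects, and
  degrees multiply.\<close>

lemma gr_te:
  assumes g: "g \<in> carrier G" and p: "p \<in> GG"
  shows "gr g (M \<boxtimes> N) \<cdot> te M N p = (if fst p \<otimes>\<^bsub>G\<^esub> snd p = g then te M N p else zer (M \<boxtimes> N) (M \<boxtimes> N))"
proof -
  obtain h k where hk: "p = (h, k)" "h \<in> carrier G" "k \<in> carrier G" using p by auto
  obtain V j q where V: "V \<in> Cg h" "j \<Colon> V \<leadsto> M" "q \<Colon> M \<leadsto> V" "j \<cdot> q = gr h M" using gr_factor[OF M hk(2)] by blast
  obtain V' j' q' where V': "V' \<in> Cg k" "j' \<Colon> V' \<leadsto> N" "q' \<Colon> N \<leadsto> V'" "j' \<cdot> q' = gr k N" using gr_factor[OF N hk(3)] by blast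
  have O: "V \<in> Obj C" "V' \<in> Obj C" using typed_obj(1)[OF V(2)] typed_obj(1)[OF V'(2)] .
  have te: "te M N p = (j \<star> j') \<cdot> (q \<star> q')" unfolding te_def hk fst_conv snd_conv V(4)[symmetric] V'(4)[symmetric] using V(2,3) V'(2,3) by simp
  have t: "j \<star> j' \<Colon> V \<boxtimes> V' \<leadsto> M \<boxtimes> N" using V V' by auto
  have "gr g (M \<boxtimes> N) \<cdot> te M N p = (gr g (M \<boxtimes> N) \<cdot> (j \<star> j')) \<cdot> (q \<star> q')" unfolding te using V(2,3) V'(2,3) g by simp
  also have "\<dots> = (if g = h \<otimes>\<^bsub>G\<^esub> k then j \<star> j' else zer (V \<boxtimes> V') (M \<boxtimes> N)) \<cdot> (q \<star> q')"
    using gr_of[OF _ Cg_TensO[OF hk(2,3) V(1) V'(1)] t g] hk by simp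
  finally show ?thesis unfolding te using V(2,3) V'(2,3) O hk by auto
qed

text \<open>Expresses the projection to degree \<open>g\<close> through pairs of degrees of the
  factors, a form that can be cut along orbits.\<close>

lemma gr_eps:
  assumes g: "g \<in> carrier G"
  shows "gr g (M \<boxtimes> N) = eps M N {p \<in> GG. fst p \<otimes>\<^bsub>G\<^esub> snd p = g}"
proof -
  let ?X = "M \<boxtimes> N"
  have "gr g ?X = gr g ?X \<cdot> eps M N GG" using g by (simp add: eps_GG)
  also have "\<dots> = asum ?X ?X (\<lambda>p. gr g ?X \<cdot> te M N p) GG"
    unfolding eps_def by (rule cmp_asum_right[OF finite_GG]) (use g in auto)
  also have "\<dots> = asum ?X ?X (\<lambda>p. if fst p \<otimes>\<^bsub>G\<^esub> snd p = g then te M N p else zer ?X ?X) GG"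
    by (rule asum_cong) (use gr_te[OF g] g in auto)
  also have "\<dots> = asum ?X ?X (\<lambda>p. if fst p \<otimes>\<^bsub>G\<^esub> snd p = g then te M N p else zer ?X ?X) {p \<in> GG. fst p \<otimes>\<^bsub>G\<^esub> snd p = g}"
    by (rule asum_neutral[OF finite_GG]) auto
  also have "\<dots> = eps M N {p \<in> GG. fst p \<otimes>\<^bsub>G\<^esub> snd p = g}"
    unfolding eps_def by (rule asum_cong) auto
  finally show ?thesis .
qed

end

definition rr where "rr x p = (\<rho> x (fst p), \<rho> x (snd p))"

lemma rr_GG: "x \<in> carrier F \<Longrightarrow> p \<in> GG \<Longrightarrow> rr x p \<in> GG"
  by (auto simp: rr_def)

lemma inj_rr: "x \<in> carrier F \<Longrightarrow> P \<subseteq> GG \<Longrightarrow> inj_on (rr x) P"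
  by (auto simp: inj_on_def rr_def subset_iff)

lemma eps_sact:
  assumes M: "eo (carrier F) M" "eo (carrier F) N" and x: "x \<in> carrier F" and P: "P \<subseteq> GG"
  shows "sact (tob (carrier F) M N) x \<cdot> act x (eps (fst M) (fst N) P) =
    eps (fst M) (fst N) (rr x ` P) \<cdot> sact (tob (carrier F) M N) x"
proof -
  note [simp] = eo_obj[OF M(1) order_refl] eo_obj[OF M(2) order_refl] eo_arr[OF M(1) order_refl] eo_arr[OF M(2) order_refl] x
  let ?A = "fst M" and ?B = "fst N"
  let ?X = "?A \<boxtimes> ?B"
  let ?s = "sact (tob (carrier F) M N) x"
  have *: "?s \<cdot> act x (te ?A ?B p) = te ?A ?B (rr x p) \<cdot> ?s" if p: "p \<in> P" for p
  proof -
    have "p \<in> GG" using p P by blast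
    then have hk: "fst p \<in> carrier G" "snd p \<in> carrier G" by auto
    note [simp] = hk
    have n: "jt x ?A ?B \<cdot> act x (gr (fst p) ?A \<star> gr (snd p) ?B) = (act x (gr (fst p) ?A) \<star> act x (gr (snd p) ?B)) \<cdot> jt x ?A ?B"
      using jt_natural[of x "gr (fst p) ?A" "gr (snd p) ?B"] by simp
    show ?thesis
      unfolding te_def rr_def
      by (simp add: sact_tob n gr_sact[OF order_refl M(1)] gr_sact[OF order_refl M(2)])
  qed
  have fP: "finite P" by (rule fin[OF eo_obj[OF M(1) order_refl] eo_obj[OF M(2) order_refl] P])
  have ty: "te ?A ?B p \<Colon> fst (tob (carrier F) M N) \<leadsto> fst (tob (carrier F) M N)"
      "te ?A ?B (rr x p) \<Colon> fst (tob (carrier F) M N) \<leadsto> fst (tob (carrier F) M N)" if "p \<in> P" for p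
    using te_typed[of ?A ?B p] te_typed[of ?A ?B "rr x p"] rr_GG[OF x] subsetD[OF P that] by simp_all
  have "?s \<cdot> act x (asum (fst (tob (carrier F) M N)) (fst (tob (carrier F) M N)) (te ?A ?B) P) =
      asum (fst (tob (carrier F) M N)) (fst (tob (carrier F) M N)) (te ?A ?B) (rr x ` P) \<cdot> ?s"
    by (rule asum_sact[OF eo_tob[OF subgroup_F M] x fP inj_rr[OF x P]]) (use ty * in blast)+
  then show ?thesis by (simp add: eps_def)
qed

text \<open>That the unit object has degree \<open>1\<close> is not among the axioms of a grading.
  Being simple, it is concentrated in a single degree \<open>g\<close>, and the unit isomorphism
  forces \<open>g g = g\<close>.\<close>

lemma gr_Unit: "gr \<one>\<^bsub>G\<^esub> (Unit C) = ide (Unit C)"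
proof -
  let ?U = "Unit C"
  have nz: "ide ?U \<noteq> zer ?U ?U" using simple_Unit unfolding simple_object_def zero_object_iff by auto
  \<comment> \<open>A nonzero endomorphism of a simple object is invertible, and an invertible
    idempotent is the identity.\<close>
  have *: "gr g ?U = ide ?U" if g: "g \<in> carrier G" and z: "gr g ?U \<noteq> zer ?U ?U" for g
  proof (rule cmp_cancel_left)
    show "gr g ?U \<cdot> gr g ?U = gr g ?U \<cdot> ide ?U" using g by (simp add: gr_cmp)
    show "aiso (gr g ?U)" by (rule Schur[OF simple_Unit simple_Unit]) (use g z in auto)
  qed (use g in auto)
  have "\<exists>g\<in>carrier G. gr g ?U \<noteq> zer ?U ?U"
  proof (rule ccontr)
    assume "\<not> (\<exists>g\<in>carrier G. gr g ?U \<noteq> zer ?U ?U)"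
    then have "asum ?U ?U (\<lambda>g. gr g ?U) (carrier G) = asum ?U ?U (\<lambda>g. zer ?U ?U) (carrier G)"
      by (intro asum_cong) auto
    then show False using nz finite_G by (simp add: gr_sum asum_zer)
  qed
  then obtain g where g: "g \<in> carrier G" "gr g ?U = ide ?U" using * by blast
  let ?g2 = "g \<otimes>\<^bsub>G\<^esub> g"
  have "gr ?g2 (?U \<boxtimes> ?U) \<cdot> te ?U ?U (g, g) = te ?U ?U (g, g)"
    using gr_te[of ?U ?U ?g2 "(g, g)"] g by simp
  then have "gr ?g2 (?U \<boxtimes> ?U) = ide (?U \<boxtimes> ?U)" using g by (simp add: te_def)
  moreover have "gr ?g2 ?U \<cdot> lun ?U = lun ?U \<cdot> gr ?g2 (?U \<boxtimes> ?U)"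
    by (rule gr_natural) (use g in auto)
  ultimately have "gr ?g2 ?U \<cdot> lun ?U = ide ?U \<cdot> lun ?U" by simp
  then have "gr ?g2 ?U = ide ?U" by (rule cmp_cancel_right) (use g in auto)
  \<comment> \<open>Both idempotents are the identity, whereas different degrees would have product
    zero.\<close>
  then have "?g2 = g" using gr_cmp[of ?U ?g2 g] g nz by (auto split: if_splits)
  then have "g = \<one>\<^bsub>G\<^esub>" using g G_idem by blast
  then show ?thesis using g by simp
qed

end

section \<open>Restriction\<close>

context action
begin

lemma fst_Res [simp]: "fst (Res H X) = fst X"
  by (simp add: Res_def)

lemma sact_Res: "h \<in> H \<Longrightarrow> sact (Res H X) h = sact X h"
  by (simp add: Res_def sact_def)

text \<open>Equivariance for \<open>H\<close> does not notice whether a structure has been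
  restricted, so \<open>Res\<close> appears only where an object over exactly \<open>H\<close> is
  demanded.\<close>

lemma eqv_Res: "H \<subseteq> H' \<Longrightarrow> eqv H (Res H' X) Y f \<longleftrightarrow> eqv H X Y f" "H \<subseteq> H' \<Longrightarrow> eqv H X (Res H' Y) f \<longleftrightarrow> eqv H X Y f"
  by (auto simp: eqv_def sact_Res subset_iff)

lemma smd_Res: "H \<subseteq> H' \<Longrightarrow> smd H X (Res H' M) j p \<longleftrightarrow> smd H X M j p" "H \<subseteq> H' \<Longrightarrow> smd H (Res H' X) M j p \<longleftrightarrow> smd H X M j p"
  by (auto simp: smd_def eqv_Res)

lemma eo_Res:
  assumes H: "subgroup H F" "H \<subseteq> H'" "H' \<subseteq> carrier F" and X: "eo H' X"
  shows "eo H (Res H X)"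
proof (rule eoI[OF H(1)])
  note [simp] = subgroup.mem_carrier[OF H(1)] subgroup.m_closed[OF H(1)] subgroup.one_closed[OF H(1)] sact_Res
  have [simp]: "h \<in> H'" if "h \<in> H" for h using that H(2) by blast
  show "sact (Res H X) h \<cdot> act h (sact (Res H X) k) = sact (Res H X) (h \<otimes>\<^bsub>F\<^esub> k) \<cdot> cp h k (fst (Res H X))"
    if "h \<in> H" "k \<in> H" for h k using that eo_cocycle[OF X H(3)] by simp
  show "sact (Res H X) \<one>\<^bsub>F\<^esub> = ide (fst (Res H X))" using eo_one[OF X H(3)] by simp
  show "arr (sact (Res H X) h)" if "h \<in> H" for h using that eo_arr[OF X H(3)] by simp
  show "fst (Res H X) \<in> Obj C" using eo_obj[OF X H(3)] by simp
qed (simp add: Res_def)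

lemma tob_Res: "H \<subseteq> H1 \<Longrightarrow> H \<subseteq> H2 \<Longrightarrow> tob H (Res H1 X) (Res H2 Y) = tob H X Y"
  unfolding tob_def by (auto simp: sact_Res subset_iff intro!: restrict_ext)

lemma split_exact_Res:
  assumes "split_exact H' X Y Z i p" "H \<subseteq> H'"
  shows "split_exact H (Res H X) (Res H Y) (Res H Z) i p"
  using assms eqv_mono[OF _ assms(2)] unfolding split_exact_def by (auto simp: eqv_Res)

context
  fixes H H' M D
  assumes H: "subgroup H F" "H \<subseteq> H'" "H' \<subseteq> carrier F" and M: "eo H' M" and D: "idem_complete D"
begin

text \<open>The inclusion is a split mono, so equivariance of the projection follows from that of
  the inclusion and of the idempotent.\<close>

lemma smdI:
  assumes X: "eo H X" and j: "eqv H X M j" and p: "p \<Colon> fst M \<leadsto> fst X" "p \<cdot> j = ide (fst X)" and jp: "eqv H M M (j \<cdot> p)"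
  shows "smd H X M j p"
proof -
  have "eqv H (Res H M) X p"
    by (rule eqv_cancel_mono[OF subgroup.subset[OF H(1)] eo_Res[OF H M] X eo_Res[OF H M]])
      (use j p jp in \<open>auto simp: eqv_Res\<close>)
  then show ?thesis using j p by (simp add: smd_def eqv_Res)
qed

lemma cls_smd_same_Res:
  assumes "X \<in> EO D H" "Y \<in> EO D H" "smd H X M j p" "smd H Y M j' p'" "j \<cdot> p = j' \<cdot> p'"
  shows "K0_class (EQ D H) X = K0_class (EQ D H) Y"
  by (rule cls_smd_same[OF H(1) D assms(1,2) eo_Res[OF H M] _ _ assms(5)]) (use assms(3,4) in \<open>simp_all add: smd_Res\<close>)

lemma smd_ex_Res:
  assumes "eqv H M M e" "e \<cdot> e = e" "V \<in> D" "j \<Colon> V \<leadsto> fst M" "p \<Colon> fst M \<leadsto> V" "p \<cdot> j = ide V" "j \<cdot> p \<cdot> e = e" "e \<cdot> j \<cdot> p = e"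
  shows "\<exists>X j' p'. X \<in> EO D H \<and> smd H X M j' p' \<and> j' \<cdot> p' = e"
proof (rule smd_ex[OF H(1) D eo_Res[OF H M], of e V j p])
  show "eqv H (Res H M) (Res H M) e" using assms(1) by (simp add: eqv_Res)
  fix X j' p' assume "X \<in> EO D H" "smd H X (Res H M) j' p'" "j' \<cdot> p' = e"
  then show ?thesis using smd_Res(1)[OF order_refl, of H X M] by blast
qed (use assms in simp_all)

end

lemma left_transversal_unique:
  assumes A: "subgroup A F" and B: "subgroup B F" and R: "left_transversal F A B R" and ts: "t \<in> R" "s \<in> R" "b \<in> B" "s = t \<otimes>\<^bsub>F\<^esub> b"
  shows "s = t"
proof -
  have "s \<in> A" using R ts by (auto simp: left_transversal_def)
  then have "\<exists>!r. r \<in> R \<and> (\<exists>b\<in>B. s = r \<otimes>\<^bsub>F\<^esub> b)" using R by (simp add: left_transversal_def)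
  moreover have "s = s \<otimes>\<^bsub>F\<^esub> \<one>\<^bsub>F\<^esub>" using \<open>s \<in> A\<close> subgroup.mem_carrier[OF A] by simp
  then have "\<exists>b\<in>B. s = s \<otimes>\<^bsub>F\<^esub> b" using subgroup.one_closed[OF B] by blast
  ultimately show ?thesis using ts by blast
qed

end

section \<open>Objects of the components as summands of objects of the equivariantization\<close>

context gaction
begin

abbreviation FF where "FF \<equiv> carrier F"

text \<open>Cosets of the stabilizer correspond to the elements of the orbit of \<open>g\<close>,
  and \<open>s\<close> chooses a representative for each. The coset of \<open>1\<close> is given the
  representative \<open>1\<close>, so that \<open>T^1 V = V\<close> is literally a summand of the
  induced object.\<close>

lemma ex_transversal:
  assumes g: "g \<in> carrier G"
  obtains R where "left_transversal F FF (St g) R" "\<one>\<^bsub>F\<^esub> \<in> R" "finite R"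
proof -
  define s where "s k = (if k = g then \<one>\<^bsub>F\<^esub> else SOME x. x \<in> FF \<and> \<rho> x g = k)" for k
  have s: "s (\<rho> x g) \<in> FF \<and> \<rho> (s (\<rho> x g)) g = \<rho> x g" if x: "x \<in> FF" for x
    using someI[of "\<lambda>y. y \<in> FF \<and> \<rho> y g = \<rho> x g" x] x g by (auto simp: s_def)
  let ?R = "(\<lambda>x. s (\<rho> x g)) ` FF"
  have "left_transversal F FF (St g) ?R"
    unfolding left_transversal_def
  proof (intro conjI ballI)
    show "?R \<subseteq> FF" using s by blast
    fix a assume a: "a \<in> FF"
    let ?t = "s (\<rho> a g)"
    show "\<exists>!t. t \<in> ?R \<and> (\<exists>b\<in>St g. a = t \<otimes>\<^bsub>F\<^esub> b)"
    proof (rule ex1I[of _ ?t])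
      have t: "?t \<in> FF" "\<rho> ?t g = \<rho> a g" using s[OF a] by auto
      have "\<rho> (inv\<^bsub>F\<^esub> ?t \<otimes>\<^bsub>F\<^esub> a) g = \<rho> (inv\<^bsub>F\<^esub> ?t) (\<rho> ?t g)" using t a g by (simp add: rho_comp)
      also have "\<dots> = g" by (rule rho_inv(1)[OF t(1) g])
      finally have "inv\<^bsub>F\<^esub> ?t \<otimes>\<^bsub>F\<^esub> a \<in> St g" using t(1) a by (simp add: St_iff)
      moreover have "a = ?t \<otimes>\<^bsub>F\<^esub> (inv\<^bsub>F\<^esub> ?t \<otimes>\<^bsub>F\<^esub> a)" using t a by (simp add: F_assoc[symmetric])
      ultimately show "?t \<in> ?R \<and> (\<exists>b\<in>St g. a = ?t \<otimes>\<^bsub>F\<^esub> b)" using a by blast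
      fix r assume r: "r \<in> ?R \<and> (\<exists>b\<in>St g. a = r \<otimes>\<^bsub>F\<^esub> b)"
      then obtain x b where x: "x \<in> FF" "r = s (\<rho> x g)" and b: "b \<in> St g" "a = r \<otimes>\<^bsub>F\<^esub> b" by blast
      have "\<rho> a g = \<rho> r g" unfolding b(2) using b(1) s[OF x(1)] x(2) g by (simp add: rho_comp St_iff)
      then show "r = ?t" using s[OF x(1)] x(2) by simp
    qed
  qed
  moreover have "s (\<rho> \<one>\<^bsub>F\<^esub> g) = \<one>\<^bsub>F\<^esub>" using g by (simp add: s_def)
  then have "\<one>\<^bsub>F\<^esub> \<in> ?R" by (metis F_simps(2) imageI)
  ultimately show ?thesis using that finite_F by blast
qed

lemma EO_Cg: "g \<in> carrier G \<Longrightarrow> V \<in> EO (Cg g) (St g) \<longleftrightarrow> eo (St g) V \<and> fst V \<in> Cg g"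
  by (rule EO_iff[OF Cg_subset])

lemma St_subset: "St g \<subseteq> FF"
  by (auto simp: St_iff)

text \<open>In the induced object the summand \<open>T^t V\<close> has degree
  \<open>\<rho> t g\<close>, and different representatives give different degrees. So the part of
  degree \<open>g\<close> is the summand at \<open>1\<close>, and degrees outside the orbit do not
  occur.\<close>

lemma host:
  assumes g: "g \<in> carrier G" and V: "V \<in> EO (Cg g) (St g)" and R: "left_transversal F FF (St g) R" "\<one>\<^bsub>F\<^esub> \<in> R"
    and Y: "eo FF Y" and i: "ind_data FF (St g) R V Y j p"
  shows "smd (St g) V Y (j \<one>\<^bsub>F\<^esub>) (p \<one>\<^bsub>F\<^esub>)" "j \<one>\<^bsub>F\<^esub> \<cdot> p \<one>\<^bsub>F\<^esub> = gr g (fst Y)"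
    "\<And>k. k \<in> carrier G \<Longrightarrow> k \<notin> (\<lambda>x. \<rho> x g) ` FF \<Longrightarrow> gr k (fst Y) = zer (fst Y) (fst Y)"
proof -
  have Ve: "eo (St g) V" "fst V \<in> Cg g" using V g by (simp_all add: EO_Cg)
  have b: "bip R (\<lambda>t. ActO T t (fst V)) (fst Y) j p" using i by (simp add: ind_data_def)
  note d = bipD[OF b]
  have RF: "t \<in> FF" if "t \<in> R" for t using that R by (auto simp: left_transversal_def)
  note [simp] = eo_obj[OF Y order_refl] eo_obj[OF Ve(1) St_subset]
  let ?X = "fst Y"
  have grk: "gr k ?X = asum ?X ?X (\<lambda>t. if k = \<rho> t g then j t \<cdot> p t else zer ?X ?X) R" if k: "k \<in> carrier G" for k
  proof -
    have "gr k ?X = gr k ?X \<cdot> asum ?X ?X (\<lambda>t. j t \<cdot> p t) R" using d(8) k by simp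
    also have "\<dots> = asum ?X ?X (\<lambda>t. gr k ?X \<cdot> (j t \<cdot> p t)) R"
      by (rule cmp_asum_right[OF d(1)]) (use d(4,5) k in auto)
    also have "\<dots> = asum ?X ?X (\<lambda>t. if k = \<rho> t g then j t \<cdot> p t else zer ?X ?X) R"
    proof (rule asum_cong)
      fix t assume t: "t \<in> R"
      have "gr k ?X \<cdot> j t = (if k = \<rho> t g then j t else zer (ActO T t (fst V)) ?X)"
        by (rule gr_of[OF rho_closed[OF RF[OF t] g] Act_Cg[OF RF[OF t] g Ve(2)] d(4)[OF t] k])
      then show "gr k ?X \<cdot> (j t \<cdot> p t) = (if k = \<rho> t g then j t \<cdot> p t else zer ?X ?X)"
        using d(4,5)[OF t] d(3)[OF t] k by (subst cmp_rewrite) auto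
    qed (use d(4,5) k in auto)
    finally show ?thesis .
  qed
  show "gr k ?X = zer ?X ?X" if "k \<in> carrier G" "k \<notin> (\<lambda>x. \<rho> x g) ` FF" for k
  proof -
    have "asum ?X ?X (\<lambda>t. if k = \<rho> t g then j t \<cdot> p t else zer ?X ?X) R = asum ?X ?X (\<lambda>t. zer ?X ?X) R"
      by (rule asum_cong) (use that RF d(4,5) in auto)
    then show ?thesis using grk[OF that(1)] d(1) by (simp add: asum_zer)
  qed
  \<comment> \<open>A representative that fixes \<open>g\<close> lies in the coset of
    \<open>1\<close>, which is already represented by \<open>1\<close>.\<close>
  have one: "t = \<one>\<^bsub>F\<^esub>" if t: "t \<in> R" "\<rho> t g = g" for t
  proof -
    have "t \<in> St g" using t RF by (simp add: St_iff)
    moreover have "t = \<one>\<^bsub>F\<^esub> \<otimes>\<^bsub>F\<^esub> t" using RF[OF t(1)] by simp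
    ultimately show ?thesis using left_transversal_unique[OF subgroup_F subgroup_St[OF g] R(1) R(2) t(1)] by blast
  qed
  have "gr g ?X = (\<lambda>t. if g = \<rho> t g then j t \<cdot> p t else zer ?X ?X) \<one>\<^bsub>F\<^esub>"
    unfolding grk[OF g] by (rule asum_single[OF d(1) R(2)]) (use one d(4,5)[OF R(2)] g in auto)
  then show jp: "j \<one>\<^bsub>F\<^esub> \<cdot> p \<one>\<^bsub>F\<^esub> = gr g ?X" using g by simp
  have j1: "j \<one>\<^bsub>F\<^esub> \<Colon> fst V \<leadsto> ?X" "p \<one>\<^bsub>F\<^esub> \<Colon> ?X \<leadsto> fst V" "p \<one>\<^bsub>F\<^esub> \<cdot> j \<one>\<^bsub>F\<^esub> = ide (fst V)"
    using d(4,5,6)[OF R(2)] by simp_all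
  show "smd (St g) V Y (j \<one>\<^bsub>F\<^esub>) (p \<one>\<^bsub>F\<^esub>)"
  proof (rule smdI[OF subgroup_St[OF g] St_subset order_refl Y idem_complete_Obj Ve(1) _ j1(2,3)])
    show "eqv (St g) Y Y (j \<one>\<^bsub>F\<^esub> \<cdot> p \<one>\<^bsub>F\<^esub>)" unfolding jp by (rule gr_eqv[OF order_refl Y St_subset order_refl g])
    show "eqv (St g) V Y (j \<one>\<^bsub>F\<^esub>)"
      unfolding eqv_def
    proof (intro conjI ballI)
      fix b assume b: "b \<in> St g"
      have bF: "b \<in> FF" using b by (simp add: St_iff)
      have "sact Y b \<cdot> act b (j \<one>\<^bsub>F\<^esub>) = j \<one>\<^bsub>F\<^esub> \<cdot> act \<one>\<^bsub>F\<^esub> (sact V b) \<cdot> ainv (cp \<one>\<^bsub>F\<^esub> b (fst V)) \<cdot> cp b \<one>\<^bsub>F\<^esub> (fst V)"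
        using i b bF R(2) unfolding ind_data_def by simp
      then show "j \<one>\<^bsub>F\<^esub> \<cdot> sact V b = sact Y b \<cdot> act b (j \<one>\<^bsub>F\<^esub>)"
        using bF eo_arr[OF Ve(1) St_subset b] j1 by simp
    qed (use j1 in auto)
  qed
qed

lemma ex_host:
  assumes g: "g \<in> carrier G" and V: "V \<in> EO (Cg g) (St g)"
  obtains M j p where "eo FF M" "smd (St g) V M j p" "j \<cdot> p = gr g (fst M)"
proof -
  obtain R where R: "left_transversal F FF (St g) R" "\<one>\<^bsub>F\<^esub> \<in> R" "finite R" using ex_transversal[OF g] .
  have "eo (St g) V" using V g by (simp add: EO_Cg)
  then obtain Y j p where Y: "eo FF Y" "ind_data FF (St g) R V Y j p"
    using ind_exists[OF subgroup_F subgroup_St[OF g] St_subset R(1,3)] by blast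
  show ?thesis using host[OF g V R(1,2) Y] that Y by blast
qed

text \<open>The grading provides an object of \<open>Cg g\<close> that is the image of
  \<open>gr g (fst M)\<close>; every smaller equivariant idempotent can be split inside it.\<close>

lemma piece:
  assumes g: "g \<in> carrier G" and M: "eo FF M" and e: "eqv (St g) M M e" "e \<cdot> e = e" "gr g (fst M) \<cdot> e = e"
  shows "\<exists>X j p. X \<in> EO (Cg g) (St g) \<and> smd (St g) X M j p \<and> j \<cdot> p = e"
proof -
  have O: "fst M \<in> Obj C" by (rule eo_obj[OF M order_refl])
  obtain V j p where V: "V \<in> Cg g" "j \<Colon> V \<leadsto> fst M" "p \<Colon> fst M \<leadsto> V" "p \<cdot> j = ide V" "j \<cdot> p = gr g (fst M)"
    using gr_factor[OF O g] by blast
  have "e \<cdot> gr g (fst M) = e" using gr_natural[OF g eqvD(1)[OF e(1)]] e(3) by simp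
  then have 1: "e \<cdot> j \<cdot> p = e" using V(5) by simp
  have "(j \<cdot> p) \<cdot> e = e" unfolding V(5) by (rule e(3))
  then have 2: "j \<cdot> p \<cdot> e = e" using V(2,3) eqvD(1)[OF e(1)] by simp
  show ?thesis
    by (rule smd_ex_Res[OF subgroup_St[OF g] St_subset order_refl M idem_complete_Cg[OF g] e(1,2) V(1-4) 2 1])
qed

text \<open>The part of degree \<open>g\<close> as an object over the stabilizer. Its class is
  independent of the choice, since all candidates split one idempotent.\<close>

definition pc where
  "pc g M = (SOME X. X \<in> EO (Cg g) (St g) \<and> (\<exists>j p. smd (St g) X M j p \<and> j \<cdot> p = gr g (fst M)))"

lemma pc:
  assumes g: "g \<in> carrier G" and M: "eo FF M"
  shows "pc g M \<in> EO (Cg g) (St g)" "\<exists>j p. smd (St g) (pc g M) M j p \<and> j \<cdot> p = gr g (fst M)"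
proof -
  have O: "fst M \<in> Obj C" by (rule eo_obj[OF M order_refl])
  have "\<exists>X j p. X \<in> EO (Cg g) (St g) \<and> smd (St g) X M j p \<and> j \<cdot> p = gr g (fst M)"
    by (rule piece[OF g M gr_eqv[OF order_refl M St_subset order_refl g]]) (use O g in \<open>simp_all add: gr_cmp\<close>)
  then have "\<exists>X. X \<in> EO (Cg g) (St g) \<and> (\<exists>j p. smd (St g) X M j p \<and> j \<cdot> p = gr g (fst M))" by blast
  from someI_ex[OF this] show "pc g M \<in> EO (Cg g) (St g)" "\<exists>j p. smd (St g) (pc g M) M j p \<and> j \<cdot> p = gr g (fst M)"
    unfolding pc_def by blast+
qed

lemma conj_summand:
  assumes g: "g \<in> carrier G" and x: "x \<in> FF" and M: "eo FF M" and V: "V \<in> EO (Cg g) (St g)" "smd (St g) V M j p"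
    and e: "eqv (St (\<rho> x g)) M M e" "sact M x \<cdot> act x (j \<cdot> p) = e \<cdot> sact M x"
  shows "conj_object C F T (St g) x V \<in> EO (Cg (\<rho> x g)) (St (\<rho> x g))"
    "\<exists>j p. smd (St (\<rho> x g)) (conj_object C F T (St g) x V) M j p \<and> j \<cdot> p = e"
proof -
  have Ve: "eo (St g) V" "fst V \<in> Cg g" using V g by (simp_all add: EO_Cg)
  have xg: "\<rho> x g \<in> carrier G" using x g by simp
  note c = conj_smd[OF subgroup_St[OF g] subgroup_St[OF xg] x St_rho[OF x g] M Ve(1) V(2) e]
  show "conj_object C F T (St g) x V \<in> EO (Cg (\<rho> x g)) (St (\<rho> x g))"
    using c(1) fst_conj_object[OF subgroup_St[OF g] subgroup_St[OF xg] x St_rho[OF x g]] Act_Cg[OF x g Ve(2)] xg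
    by (simp add: EO_Cg)
  show "\<exists>j p. smd (St (\<rho> x g)) (conj_object C F T (St g) x V) M j p \<and> j \<cdot> p = e" using c by blast
qed

text \<open>\<open>V\<close> is placed in a host, where its conjugate is again a summand and
  inherits the axioms of an equivariant object.\<close>

lemma conj_EO:
  assumes g: "g \<in> carrier G" and x: "x \<in> FF" and V: "V \<in> EO (Cg g) (St g)"
  shows "conj_object C F T (St g) x V \<in> EO (Cg (\<rho> x g)) (St (\<rho> x g))"
proof -
  obtain M j p where M: "eo FF M" "smd (St g) V M j p" "j \<cdot> p = gr g (fst M)" using ex_host[OF g V] .
  have xg: "\<rho> x g \<in> carrier G" using x g by simp
  show ?thesis
    by (rule conj_summand(1)[OF g x M(1) V M(2) gr_eqv[OF order_refl M(1) St_subset order_refl xg]])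
      (simp add: M(3) gr_sact[OF order_refl M(1) x g])
qed

section \<open>Orbits of pairs of degrees and the summands they cut out\<close>

definition orb where "orb h k = (\<lambda>x. rr x (h, k)) ` St (h \<otimes>\<^bsub>G\<^esub> k)"

lemma orb_GG: "h \<in> carrier G \<Longrightarrow> k \<in> carrier G \<Longrightarrow> orb h k \<subseteq> GG"
  by (auto simp: orb_def rr_def St_iff)

lemma orb_prod: "h \<in> carrier G \<Longrightarrow> k \<in> carrier G \<Longrightarrow> p \<in> orb h k \<Longrightarrow> fst p \<otimes>\<^bsub>G\<^esub> snd p = h \<otimes>\<^bsub>G\<^esub> k"
  by (auto simp: orb_def rr_def St_iff rho_mult[symmetric])

lemma rr_rr: "x \<in> FF \<Longrightarrow> y \<in> FF \<Longrightarrow> p \<in> GG \<Longrightarrow> rr x (rr y p) = rr (x \<otimes>\<^bsub>F\<^esub> y) p"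
  by (auto simp: rr_def rho_comp)

text \<open>Conjugation by \<open>x\<close> carries the stabilizer of \<open>h k\<close> to that of
  the translated product, so translating an orbit gives the orbit of the translated pair.\<close>

lemma rr_orb:
  assumes "h \<in> carrier G" "k \<in> carrier G" "x \<in> FF"
  shows "rr x ` orb h k = orb (\<rho> x h) (\<rho> x k)"
proof
  have hk: "(h, k) \<in> GG" using assms by simp
  show "rr x ` orb h k \<subseteq> orb (\<rho> x h) (\<rho> x k)"
  proof
    fix q assume "q \<in> rr x ` orb h k"
    then obtain y where y: "y \<in> St (h \<otimes>\<^bsub>G\<^esub> k)" "q = rr x (rr y (h, k))" by (auto simp: orb_def)
    let ?z = "x \<otimes>\<^bsub>F\<^esub> y \<otimes>\<^bsub>F\<^esub> inv\<^bsub>F\<^esub> x"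
    have yF: "y \<in> FF" using y by (simp add: St_iff)
    have "?z \<in> St (\<rho> x (h \<otimes>\<^bsub>G\<^esub> k))" using St_rho[of x "h \<otimes>\<^bsub>G\<^esub> k"] assms y(1) by simp
    then have z: "?z \<in> St (\<rho> x h \<otimes>\<^bsub>G\<^esub> \<rho> x k)" using assms by (simp add: rho_mult)
    have "q = rr ?z (\<rho> x h, \<rho> x k)" using y(2) assms yF by (simp add: rr_def rho_comp)
    then show "q \<in> orb (\<rho> x h) (\<rho> x k)" unfolding orb_def using z by blast
  qed
  show "orb (\<rho> x h) (\<rho> x k) \<subseteq> rr x ` orb h k"
  proof
    fix q assume "q \<in> orb (\<rho> x h) (\<rho> x k)"
    then obtain z where z: "z \<in> St (\<rho> x h \<otimes>\<^bsub>G\<^esub> \<rho> x k)" "q = rr z (\<rho> x h, \<rho> x k)" by (auto simp: orb_def)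
    then have "z \<in> St (\<rho> x (h \<otimes>\<^bsub>G\<^esub> k))" using assms by (simp add: rho_mult)
    then obtain y where y: "y \<in> St (h \<otimes>\<^bsub>G\<^esub> k)" "z = x \<otimes>\<^bsub>F\<^esub> y \<otimes>\<^bsub>F\<^esub> inv\<^bsub>F\<^esub> x"
      using St_rho[of x "h \<otimes>\<^bsub>G\<^esub> k"] assms by auto
    have yF: "y \<in> FF" using y by (simp add: St_iff)
    have "q = rr x (rr y (h, k))" using z(2) y(2) assms yF by (simp add: rr_def rho_comp)
    then show "q \<in> rr x ` orb h k" unfolding orb_def using y(1) by blast
  qed
qed

lemma eps_eqv:
  assumes M: "eo FF M" "eo FF N" and P: "P \<subseteq> GG" and H: "H \<subseteq> FF" and inv: "\<And>x. x \<in> H \<Longrightarrow> rr x ` P = P"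
  shows "eqv H (tob FF M N) (tob FF M N) (eps (fst M) (fst N) P)"
  unfolding eqv_def
proof (intro conjI ballI)
  note o = eo_obj[OF M(1) order_refl] eo_obj[OF M(2) order_refl]
  show "arr (eps (fst M) (fst N) P)" "src (eps (fst M) (fst N) P) = fst (tob FF M N)" "tgt (eps (fst M) (fst N) P) = fst (tob FF M N)"
    using eps_typed[OF o] P by auto
  fix h assume "h \<in> H"
  then show "eps (fst M) (fst N) P \<cdot> sact (tob FF M N) h = sact (tob FF M N) h \<cdot> act h (eps (fst M) (fst N) P)"
    using eps_sact[OF M _ P, of h] inv[of h] H by auto
qed

lemma eps_gr:
  assumes o: "M \<in> Obj C" "N \<in> Obj C" and P: "P \<subseteq> GG" "\<And>p. p \<in> P \<Longrightarrow> fst p \<otimes>\<^bsub>G\<^esub> snd p = g" and g: "g \<in> carrier G"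
  shows "gr g (M \<boxtimes> N) \<cdot> eps M N P = eps M N P"
proof -
  have "{p \<in> GG. fst p \<otimes>\<^bsub>G\<^esub> snd p = g} \<inter> P = P" using P by auto
  then show ?thesis unfolding gr_eps[OF o g] using eps_eps[OF o, of "{p \<in> GG. fst p \<otimes>\<^bsub>G\<^esub> snd p = g}" P] P by auto
qed

text \<open>The orbit is stable under the stabilizer of \<open>h k\<close>, so the sum of its
  idempotents is equivariant for that group; it lies in degree \<open>h k\<close> and can be split
  there.\<close>

lemma ex_orb_summand:
  assumes hk: "h \<in> carrier G" "k \<in> carrier G" and M: "eo FF M" "eo FF N"
  obtains W J P where "W \<in> EO (Cg (h \<otimes>\<^bsub>G\<^esub> k)) (St (h \<otimes>\<^bsub>G\<^esub> k))" "smd (St (h \<otimes>\<^bsub>G\<^esub> k)) W (tob FF M N) J P"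
    "J \<cdot> P = eps (fst M) (fst N) (orb h k)"
proof -
  note o = eo_obj[OF M(1) order_refl] eo_obj[OF M(2) order_refl]
  have g: "h \<otimes>\<^bsub>G\<^esub> k \<in> carrier G" using hk by simp
  have inv: "rr x ` orb h k = orb h k" if x: "x \<in> St (h \<otimes>\<^bsub>G\<^esub> k)" for x
  proof -
    have "x \<in> FF" using x by (simp add: St_iff)
    have *: "rr y ` orb h k \<subseteq> orb h k" if y: "y \<in> St (h \<otimes>\<^bsub>G\<^esub> k)" for y
    proof
      fix q assume "q \<in> rr y ` orb h k"
      then obtain z where z: "z \<in> St (h \<otimes>\<^bsub>G\<^esub> k)" "q = rr y (rr z (h, k))" by (auto simp: orb_def)
      then have "q = rr (y \<otimes>\<^bsub>F\<^esub> z) (h, k)" using hk y by (simp add: rr_rr St_iff)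
      moreover have "y \<otimes>\<^bsub>F\<^esub> z \<in> St (h \<otimes>\<^bsub>G\<^esub> k)" using subgroup.m_closed[OF subgroup_St[OF g] y z(1)] .
      ultimately show "q \<in> orb h k" by (auto simp: orb_def)
    qed
    have xi: "inv\<^bsub>F\<^esub> x \<in> St (h \<otimes>\<^bsub>G\<^esub> k)" using subgroup.m_inv_closed[OF subgroup_St[OF g] x] .
    have "orb h k \<subseteq> rr x ` orb h k"
    proof
      fix q assume q: "q \<in> orb h k"
      then have "rr (inv\<^bsub>F\<^esub> x) q \<in> orb h k" using *[OF xi] by blast
      moreover have "q \<in> GG" using q orb_GG[OF hk] by blast
      then have "q = rr x (rr (inv\<^bsub>F\<^esub> x) q)" using \<open>x \<in> FF\<close> by (auto simp: rr_def)
      ultimately show "q \<in> rr x ` orb h k" by blast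
    qed
    then show ?thesis using *[OF x] by blast
  qed
  have "\<exists>W J P. W \<in> EO (Cg (h \<otimes>\<^bsub>G\<^esub> k)) (St (h \<otimes>\<^bsub>G\<^esub> k)) \<and> smd (St (h \<otimes>\<^bsub>G\<^esub> k)) W (tob FF M N) J P \<and> J \<cdot> P = eps (fst M) (fst N) (orb h k)"
  proof (rule piece[OF g eo_tob[OF subgroup_F M]])
    show "eqv (St (h \<otimes>\<^bsub>G\<^esub> k)) (tob FF M N) (tob FF M N) (eps (fst M) (fst N) (orb h k))"
      by (rule eps_eqv[OF M orb_GG[OF hk] St_subset inv])
    show "eps (fst M) (fst N) (orb h k) \<cdot> eps (fst M) (fst N) (orb h k) = eps (fst M) (fst N) (orb h k)"
      using eps_eps[OF o orb_GG[OF hk] orb_GG[OF hk]] by simp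
    show "gr (h \<otimes>\<^bsub>G\<^esub> k) (fst (tob FF M N)) \<cdot> eps (fst M) (fst N) (orb h k) = eps (fst M) (fst N) (orb h k)"
      using eps_gr[OF o orb_GG[OF hk] orb_prod[OF hk] g] by simp
  qed
  then show ?thesis using that by blast
qed

lemma subgroup_Int: "h \<in> carrier G \<Longrightarrow> k \<in> carrier G \<Longrightarrow> subgroup (St h \<inter> St k) F"
  using group.subgroups_Inter_pair[OF group_F subgroup_St subgroup_St] .

lemma Int_subset: "h \<in> carrier G \<Longrightarrow> k \<in> carrier G \<Longrightarrow> St h \<inter> St k \<subseteq> St (h \<otimes>\<^bsub>G\<^esub> k)"
  by (auto simp: St_iff rho_mult)

lemma res_tensor_eq: "res_tensor C F \<rho> T h k M N = tob (St h \<inter> St k) M N"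
  unfolding res_tensor_def Let_def TensO_EQ by (rule tob_Res) auto

text \<open>Over the intersection of the two stabilizers both summands carry structures, so their
  tensor product is a summand of the tensor product of the hosts.\<close>

lemma smd_ten:
  assumes hk: "h \<in> carrier G" "k \<in> carrier G" and M: "eo FF M" "eo FF N"
    and V: "V \<in> EO (Cg h) (St h)" "smd (St h) V M j p" and V': "V' \<in> EO (Cg k) (St k)" "smd (St k) V' N j' p'"
  defines "B \<equiv> St h \<inter> St k"
  shows "eo B (tob B V V')" "smd B (tob B V V') (tob FF M N) (j \<star> j') (p \<star> p')"
proof -
  have Ve: "eo (St h) V" "eo (St k) V'" using V V' hk by (simp_all add: EO_Cg)
  have B: "subgroup B F" "B \<subseteq> FF" "B \<subseteq> St h" "B \<subseteq> St k" using subgroup_Int[OF hk] St_subset by (auto simp: B_def)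
  have "eo B (tob B (Res B V) (Res B V'))"
    by (rule eo_tob[OF B(1) eo_Res[OF B(1,3) St_subset Ve(1)] eo_Res[OF B(1,4) St_subset Ve(2)]])
  then show "eo B (tob B V V')" by (simp add: tob_Res)
  note v = smdD[OF V(2)] and v' = smdD[OF V'(2)]
  have a: "arr (sact V h)" "arr (sact V' h)" "arr (sact M h)" "arr (sact N h)" if "h \<in> B" for h
    using that B eo_arr[OF Ve(1) St_subset] eo_arr[OF Ve(2) St_subset] eo_arr[OF M(1) order_refl] eo_arr[OF M(2) order_refl] by auto
  have "eqv B (tob B V V') (tob FF M N) (j \<star> j')"
    by (rule eqv_ten[OF B(2) order_refl B(2)]) (use a eqv_mono[OF v(3) B(3)] eqv_mono[OF v'(3) B(4)] in auto)
  moreover have "eqv B (tob FF M N) (tob B V V') (p \<star> p')"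
    by (rule eqv_ten[OF B(2) B(2) order_refl]) (use a eqv_mono[OF v(4) B(3)] eqv_mono[OF v'(4) B(4)] in auto)
  moreover have "fst V \<in> Obj C" "fst V' \<in> Obj C" using typed_obj(1)[OF v(1)] typed_obj(1)[OF v'(1)] .
  ultimately show "smd B (tob B V V') (tob FF M N) (j \<star> j') (p \<star> p')"
    unfolding smd_def using v v' by simp
qed

text \<open>The stabilizer of the pair \<open>(h, k)\<close> is \<open>St h \<inter> St k\<close>. A
  transversal therefore enumerates the orbit without repetition, and the projections to the
  translated pairs form the system of imprimitivity.\<close>

lemma ind_data_orb:
  assumes hk: "h \<in> carrier G" "k \<in> carrier G" and M: "eo FF M" "eo FF N"
    and V: "V \<in> EO (Cg h) (St h)" "smd (St h) V M j p" "j \<cdot> p = gr h (fst M)"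
    and V': "V' \<in> EO (Cg k) (St k)" "smd (St k) V' N j' p'" "j' \<cdot> p' = gr k (fst N)"
    and R: "left_transversal F (St (h \<otimes>\<^bsub>G\<^esub> k)) (St h \<inter> St k) R"
    and W: "W \<in> EO (Cg (h \<otimes>\<^bsub>G\<^esub> k)) (St (h \<otimes>\<^bsub>G\<^esub> k))" "smd (St (h \<otimes>\<^bsub>G\<^esub> k)) W (tob FF M N) J P"
    "J \<cdot> P = eps (fst M) (fst N) (orb h k)"
  shows "\<exists>j p. ind_data (St (h \<otimes>\<^bsub>G\<^esub> k)) (St h \<inter> St k) R (tob (St h \<inter> St k) V V') W j p"
proof -
  let ?g = "h \<otimes>\<^bsub>G\<^esub> k" let ?B = "St h \<inter> St k" let ?X = "tob FF M N"
  have g: "?g \<in> carrier G" using hk by simp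
  note o = eo_obj[OF M(1) order_refl] eo_obj[OF M(2) order_refl]
  note S = subgroup_St[OF g] and B = subgroup_Int[OF hk] and BS = Int_subset[OF hk]
  have X: "eo FF ?X" by (rule eo_tob[OF subgroup_F M])
  have RS: "R \<subseteq> St ?g" using R by (simp add: left_transversal_def)
  have RF: "t \<in> FF" if "t \<in> R" for t using that RS St_subset by blast
  have fR: "finite R" by (rule finite_subset[OF _ finite_F]) (use RF in blast)
  note st = smd_ten[OF hk M V(1,2) V'(1,2)]
  have We: "eo (St ?g) W" using W(1) g by (simp add: EO_Cg)
  have hkG: "(h, k) \<in> GG" using hk by simp
  let ?e = "\<lambda>t. te (fst M) (fst N) (rr t (h, k))"
  have jp: "(j \<star> j') \<cdot> (p \<star> p') = te (fst M) (fst N) (h, k)"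
    using smdD(1,2)[OF V(2)] smdD(1,2)[OF V'(2)] V(3) V'(3) by (simp add: te_def)
  have rG: "rr t (h, k) \<in> GG" if "t \<in> R" for t by (rule rr_GG[OF RF[OF that] hkG])
  \<comment> \<open>Equal translates of the pair mean that the quotient of \<open>s\<close> by
    \<open>t\<close> fixes both \<open>h\<close> and \<open>k\<close>, so \<open>s\<close> and
    \<open>t\<close> lie in one coset.\<close>
  have inj: "s = t" if st: "s \<in> R" "t \<in> R" "rr s (h, k) = rr t (h, k)" for s t
  proof -
    have "inv\<^bsub>F\<^esub> t \<otimes>\<^bsub>F\<^esub> s \<in> ?B" using st RF hk by (simp add: rr_def St_iff rho_comp)
    moreover have "s = t \<otimes>\<^bsub>F\<^esub> (inv\<^bsub>F\<^esub> t \<otimes>\<^bsub>F\<^esub> s)" using st RF by (simp add: F_assoc[symmetric])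
    ultimately show ?thesis using left_transversal_unique[OF S B R st(2,1)] by blast
  qed
  have img: "(\<lambda>t. rr t (h, k)) ` R = orb h k"
  proof
    show "(\<lambda>t. rr t (h, k)) ` R \<subseteq> orb h k" unfolding orb_def using RS by blast
    show "orb h k \<subseteq> (\<lambda>t. rr t (h, k)) ` R"
    proof
      fix q assume "q \<in> orb h k"
      then obtain x where x: "x \<in> St ?g" "q = rr x (h, k)" by (auto simp: orb_def)
      then obtain t b where t: "t \<in> R" "b \<in> ?B" "x = t \<otimes>\<^bsub>F\<^esub> b" using R unfolding left_transversal_def by blast
      then have "q = rr t (h, k)" using x(2) hk RF[OF t(1)] by (simp add: rr_def rho_comp St_iff)
      then show "q \<in> (\<lambda>t. rr t (h, k)) ` R" using t(1) by blast
    qed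
  qed
  show ?thesis
  proof (rule ind_data_imprimitivity[OF S B BS RS fR eo_Res[OF S St_subset order_refl X] st(1) _ We, where e = ?e])
    show "smd ?B (tob ?B V V') (Res (St ?g) ?X) (j \<star> j') (p \<star> p')" using st(2) BS by (simp add: smd_Res)
    show "smd (St ?g) W (Res (St ?g) ?X) J P" using W(2) by (simp add: smd_Res)
    show "?e t \<Colon> fst (Res (St ?g) ?X) \<leadsto> fst (Res (St ?g) ?X)" if "t \<in> R" for t
      using te_typed[OF o rG[OF that]] by simp
    show "sact (Res (St ?g) ?X) t \<cdot> act t ((j \<star> j') \<cdot> (p \<star> p')) = ?e t \<cdot> sact (Res (St ?g) ?X) t" if t: "t \<in> R" for t
    proof -
      have "sact ?X t \<cdot> act t (eps (fst M) (fst N) {(h, k)}) = eps (fst M) (fst N) (rr t ` {(h, k)}) \<cdot> sact ?X t"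
        by (rule eps_sact[OF M RF[OF t]]) (use hk in auto)
      then have "sact ?X t \<cdot> act t (te (fst M) (fst N) (h, k)) = ?e t \<cdot> sact ?X t"
        using eps_single[OF o hkG] eps_single[OF o rG[OF t]] by simp
      then show ?thesis using t RS by (subst jp) (simp add: sact_Res subset_iff)
    qed
    show "?e s \<cdot> ?e t = zer (fst (Res (St ?g) ?X)) (fst (Res (St ?g) ?X))" if "s \<in> R" "t \<in> R" "s \<noteq> t" for s t
      using te_te[OF o rG[OF that(1)] rG[OF that(2)]] inj[OF that(1,2)] that(3) by auto
    have "eps (fst M) (fst N) (orb h k) = asum (fst M \<boxtimes> fst N) (fst M \<boxtimes> fst N) ?e R"
      unfolding eps_def img[symmetric]
      by (rule asum_reindex) (use inj te_typed[OF o rG] o in \<open>auto intro: inj_onI\<close>)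
    then show "J \<cdot> P = asum (fst (Res (St ?g) ?X)) (fst (Res (St ?g) ?X)) ?e R" unfolding W(3) by simp
  qed
qed

end

section \<open>Bilinear maps, and finite sums of linear maps and of classes\<close>

lemma bilinear_eqI:
  assumes "\<And>Y. Y \<in> carrier (K0 D) \<Longrightarrow> linear_map_on (K0 C) B (\<lambda>X. f X Y)"
    "\<And>X. X \<in> carrier (K0 C) \<Longrightarrow> linear_map_on (K0 D) B (\<lambda>Y. f X Y)"
    "\<And>Y. Y \<in> carrier (K0 D) \<Longrightarrow> linear_map_on (K0 C) B (\<lambda>X. g X Y)"
    "\<And>X. X \<in> carrier (K0 C) \<Longrightarrow> linear_map_on (K0 D) B (\<lambda>Y. g X Y)"
    "module scalars B" "\<And>M N. M \<in> Obj C \<Longrightarrow> N \<in> Obj D \<Longrightarrow> f (K0_class C M) (K0_class D N) = g (K0_class C M) (K0_class D N)"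
    and X: "X \<in> carrier (K0 C)" and Y: "Y \<in> carrier (K0 D)"
  shows "f X Y = g X Y"
proof (rule linear_map_on_eqI[OF assms(1)[OF Y] assms(3)[OF Y] assms(5) _ X])
  fix M assume M: "M \<in> Obj C"
  show "f (K0_class C M) Y = g (K0_class C M) Y"
    by (rule linear_map_on_eqI[OF assms(2) assms(4) assms(5) _ Y]) (use M assms(6) in auto)
qed

lemma linear_map_on_closed: "linear_map_on A B f \<Longrightarrow> x \<in> carrier A \<Longrightarrow> f x \<in> carrier B"
  by (auto simp: linear_map_on_def)

lemma linear_map_on_finsum:
  assumes B: "module scalars B" and I: "finite I" and f: "\<And>i. i \<in> I \<Longrightarrow> linear_map_on A B (f i)"
  shows "linear_map_on A B (\<lambda>x. finsum B (\<lambda>i. f i x) I)"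
proof -
  interpret B: module scalars B by (rule B)
  have cl: "(\<lambda>i. f i x) \<in> I \<rightarrow> carrier B" if "x \<in> carrier A" for x
    using linear_map_on_closed[OF f that] by blast
  show ?thesis
    unfolding linear_map_on_def
  proof (intro conjI ballI allI funcsetI)
    show "finsum B (\<lambda>i. f i x) I \<in> carrier B" if "x \<in> carrier A" for x using cl[OF that] by (rule B.finsum_closed)
    show "finsum B (\<lambda>i. f i (x \<oplus>\<^bsub>A\<^esub> y)) I = finsum B (\<lambda>i. f i x) I \<oplus>\<^bsub>B\<^esub> finsum B (\<lambda>i. f i y) I" if x: "x \<in> carrier A" and y: "y \<in> carrier A" for x y
    proof -
      have "finsum B (\<lambda>i. f i (x \<oplus>\<^bsub>A\<^esub> y)) I = finsum B (\<lambda>i. f i x \<oplus>\<^bsub>B\<^esub> f i y) I"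
        by (rule B.finsum_cong') (use cl[OF x] cl[OF y] f x y in \<open>auto simp: linear_map_on_def\<close>)
      then show ?thesis using B.finsum_addf[OF cl[OF x] cl[OF y]] by simp
    qed
    show "finsum B (\<lambda>i. f i (r \<odot>\<^bsub>A\<^esub> x)) I = r \<odot>\<^bsub>B\<^esub> finsum B (\<lambda>i. f i x) I" if x: "x \<in> carrier A" for r x
    proof -
      have r: "r \<in> carrier scalars" by (simp add: scalars_def)
      have "finsum B (\<lambda>i. f i (r \<odot>\<^bsub>A\<^esub> x)) I = finsum B (\<lambda>i. r \<odot>\<^bsub>B\<^esub> f i x) I"
        by (rule B.finsum_cong') (use cl[OF x] f x r in \<open>auto simp: linear_map_on_def intro!: B.smult_closed\<close>)
      then show ?thesis using B.finsum_smult_ldistr[OF I r cl[OF x]] by simp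
    qed
  qed
qed

lemma linear_map_on_finsum_arg:
  assumes A: "module scalars A" and B: "module scalars B" and f: "linear_map_on A B f"
    and I: "finite I" and x: "x \<in> I \<rightarrow> carrier A"
  shows "f (finsum A x I) = finsum B (\<lambda>i. f (x i)) I"
proof -
  interpret A: module scalars A by (rule A)
  interpret B: module scalars B by (rule B)
  have fB: "f a \<in> carrier B" if "a \<in> carrier A" for a using f that by (auto simp: linear_map_on_def)
  show ?thesis using I x
  proof (induction I)
    case empty
    then show ?case using linear_map_on_zero[OF A B f] by simp
  next
    case (insert i I)
    then have "x i \<in> carrier A" "x \<in> I \<rightarrow> carrier A" by auto
    moreover have "(\<lambda>i. f (x i)) \<in> I \<rightarrow> carrier B" using calculation(2) fB by auto
    ultimately show ?case using insert.hyps insert.IH f fB by (simp add: linear_map_on_def)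
  qed
qed

context action
begin

lemma split_exactI:
  "\<lbrakk>eqv H X Y i; eqv H Y Z p; p \<cdot> i = zer (fst X) (fst Z); r \<Colon> fst Y \<leadsto> fst X; s \<Colon> fst Z \<leadsto> fst Y;
    r \<cdot> i = ide (fst X); p \<cdot> s = ide (fst Z); i \<cdot> r \<boxplus> s \<cdot> p = ide (fst Y)\<rbrakk> \<Longrightarrow> split_exact H X Y Z i p"
  unfolding split_exact_def by blast

text \<open>Here orthogonality is a condition on the idempotents alone; inclusions and projections
  of the summands are chosen inside the proof.\<close>

lemma cls_sum:
  assumes H: "subgroup H F" and D: "idem_complete D" and M: "eo H M" and I: "finite I"
    and X: "X \<in> EO D H" "smd H X M j p" "j \<cdot> p = asum (fst M) (fst M) e I"
    and Xs: "\<And>i. i \<in> I \<Longrightarrow> Xs i \<in> EO D H" "\<And>i. i \<in> I \<Longrightarrow> \<exists>j p. smd H (Xs i) M j p \<and> j \<cdot> p = e i"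
    and o: "\<And>i k. i \<in> I \<Longrightarrow> k \<in> I \<Longrightarrow> i \<noteq> k \<Longrightarrow> e i \<cdot> e k = zer (fst M) (fst M)"
  shows "K0_class (EQ D H) X = finsum (K0 (EQ D H) :: ('r::comm_ring_1, _) module) (\<lambda>i. K0_class (EQ D H) (Xs i)) I"
proof -
  have "\<forall>i\<in>I. \<exists>j p. smd H (Xs i) M j p \<and> j \<cdot> p = e i" using Xs(2) by blast
  then obtain js ps where s: "\<And>i. i \<in> I \<Longrightarrow> smd H (Xs i) M (js i) (ps i)" "\<And>i. i \<in> I \<Longrightarrow> js i \<cdot> ps i = e i"
    by metis
  have MO: "fst M \<in> Obj C" by (rule eo_obj[OF M subgroup.subset[OF H]])
  show ?thesis
  proof (rule cls_smd_sum[OF H D M I X(1,2) Xs(1) s(1)])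
    fix i k assume ik: "i \<in> I" "k \<in> I" "i \<noteq> k"
    note di = smdD[OF s(1)[OF ik(1)]] and dk = smdD[OF s(1)[OF ik(2)]]
    have O: "fst (Xs i) \<in> Obj C" "fst (Xs k) \<in> Obj C" using typed_obj(1)[OF di(1)] typed_obj(1)[OF dk(1)] .
    have "ps k \<cdot> js i = ps k \<cdot> ((js k \<cdot> ps k) \<cdot> (js i \<cdot> ps i)) \<cdot> js i"
      using di(1,2,5) dk(1,2,5) smd_cancel[OF s(1)[OF ik(2)]] by simp
    also have "(js k \<cdot> ps k) \<cdot> (js i \<cdot> ps i) = zer (fst M) (fst M)" unfolding s(2)[OF ik(1)] s(2)[OF ik(2)] using o ik by blast
    finally show "ps k \<cdot> js i = zer (fst (Xs i)) (fst (Xs k))" using di(1,2) dk(1,2) O MO by simp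
  next
    have "asum (fst M) (fst M) e I = asum (fst M) (fst M) (\<lambda>i. js i \<cdot> ps i) I"
    proof (rule asum_cong)
      fix i assume i: "i \<in> I"
      show "e i = js i \<cdot> ps i" using s(2)[OF i] by simp
      show "e i \<Colon> fst M \<leadsto> fst M" using smdD(1,2)[OF s(1)[OF i]] s(2)[OF i, symmetric] by simp
    qed (rule MO)+
    then show "j \<cdot> p = asum (fst M) (fst M) (\<lambda>i. js i \<cdot> ps i) I" using X(3) by simp
  qed
qed

end

section \<open>The structure maps\<close>

context gaction
begin

text \<open>\<open>V\<close>, an object of the component of degree \<open>g\<close>, splits the idempotent \<open>e\<close> of the object \<open>M\<close> of \<open>C\<^sup>F\<close>.\<close>

definition pco where
  "pco g V M e \<longleftrightarrow> V \<in> EO (Cg g) (St g) \<and> (\<exists>j p. smd (St g) V M j p \<and> j \<cdot> p = e)"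

lemma pcoD: "pco g V M e \<Longrightarrow> V \<in> EO (Cg g) (St g)"
  by (simp add: pco_def)

lemma pco_eo: "g \<in> carrier G \<Longrightarrow> pco g V M e \<Longrightarrow> eo (St g) V"
  by (simp add: pco_def EO_Cg)

lemma pco_pc: "g \<in> carrier G \<Longrightarrow> eo FF M \<Longrightarrow> pco g (pc g M) M (gr g (fst M))"
  using pc by (simp add: pco_def)

lemma pco_ex_host:
  assumes "g \<in> carrier G" "V \<in> EO (Cg g) (St g)"
  obtains M where "eo FF M" "pco g V M (gr g (fst M))"
  using ex_host[OF assms] assms unfolding pco_def by metis

lemma pco_eqv:
  assumes g: "g \<in> carrier G" and M: "eo FF M" and V: "pco g V M e"
  shows "eqv (St g) M M e"
proof -
  obtain j p where j: "smd (St g) V M j p" "j \<cdot> p = e" using V by (auto simp: pco_def)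
  have "eqv (St g) (Res (St g) M) (Res (St g) M) (j \<cdot> p)"
    by (rule eqv_smd[OF St_subset pco_eo[OF g V] eo_Res[OF subgroup_St[OF g] St_subset order_refl M]])
      (use j(1) in \<open>simp add: smd_Res\<close>)
  then show ?thesis using j(2) by (simp add: eqv_Res)
qed

lemma pco_unique:
  assumes g: "g \<in> carrier G" and M: "eo FF M" and V: "pco g V M e" "pco g W M e"
  shows "K0_class (EQ (Cg g) (St g)) V = K0_class (EQ (Cg g) (St g)) W"
proof -
  obtain j p where j: "smd (St g) V M j p" "j \<cdot> p = e" using V(1) by (auto simp: pco_def)
  obtain j' p' where j': "smd (St g) W M j' p'" "j' \<cdot> p' = e" using V(2) by (auto simp: pco_def)
  show ?thesis
    by (rule cls_smd_same_Res[OF subgroup_St[OF g] St_subset order_refl M idem_complete_Cg[OF g] pcoD[OF V(1)] pcoD[OF V(2)] j(1) j'(1)])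
      (simp add: j(2) j'(2))
qed

lemma pco_conj:
  assumes g: "g \<in> carrier G" and x: "x \<in> FF" and M: "eo FF M" and V: "pco g V M e"
    and e: "eqv (St (\<rho> x g)) M M e'" "sact M x \<cdot> act x e = e' \<cdot> sact M x"
  shows "pco (\<rho> x g) (conj_object C F T (St g) x V) M e'"
proof -
  obtain j p where j: "smd (St g) V M j p" "j \<cdot> p = e" using V by (auto simp: pco_def)
  have e2: "sact M x \<cdot> act x (j \<cdot> p) = e' \<cdot> sact M x" unfolding j(2) by (rule e(2))
  show ?thesis unfolding pco_def
    using conj_summand[OF g x M pcoD[OF V] j(1) e(1) e2] by blast
qed

lemma pco_conj_gr:
  assumes g: "g \<in> carrier G" and x: "x \<in> FF" and M: "eo FF M" and V: "pco g V M (gr g (fst M))"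
  shows "pco (\<rho> x g) (conj_object C F T (St g) x V) M (gr (\<rho> x g) (fst M))"
  by (rule pco_conj[OF g x M V gr_eqv[OF order_refl M St_subset order_refl]])
    (use g x gr_sact[OF order_refl M x g] in simp_all)

text \<open>For hosts that are isomorphic and not equal, such as an object and its tensor product
  with the unit object.\<close>

lemma pco_transport:
  assumes g: "g \<in> carrier G" and M: "eo FF M" and N: "eo FF N" and f: "eqv (St g) M N f" "aiso f"
    and V: "pco g V M e" and e: "eqv (St g) N N e'" "f \<cdot> e = e' \<cdot> f"
  shows "pco g V N e'"
proof -
  obtain j p where j: "smd (St g) V M j p" "j \<cdot> p = e" using V by (auto simp: pco_def)
  note d = smdD[OF j(1)] and ft = eqvD(1)[OF f(1)] and et = eqvD(1)[OF e(1)]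
  note S = subgroup_St[OF g] and eV = pco_eo[OF g V]
  note [simp] = d(1,2) ft et f(2)
  have pf: "p \<cdot> ainv f \<cdot> f \<cdot> j = ide (fst V)" using d(5) by (simp add: cmp_rewrite[OF ainv_cmp])
  have [simp]: "e \<Colon> fst M \<leadsto> fst M" using eqvD(1)[OF pco_eqv[OF g M V]] .
  have "f \<cdot> (j \<cdot> p) \<cdot> ainv f = (f \<cdot> e) \<cdot> ainv f" unfolding j(2) by simp
  also have "\<dots> = e' \<cdot> (f \<cdot> ainv f)" unfolding e(2) by simp
  also have "\<dots> = e'" by (simp add: cmp_ainv)
  finally have fj: "(f \<cdot> j) \<cdot> (p \<cdot> ainv f) = e'" by simp
  have "eqv (St g) V (Res (St g) N) (f \<cdot> j)"
    by (rule eqv_cmp[OF St_subset eV eo_Res[OF S St_subset order_refl M] eo_Res[OF S St_subset order_refl N]])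
      (use d(3) f(1) in \<open>simp_all add: eqv_Res\<close>)
  then have fe: "eqv (St g) V N (f \<cdot> j)" by (simp add: eqv_Res)
  have "smd (St g) V N (f \<cdot> j) (p \<cdot> ainv f)"
    by (rule smdI[OF S St_subset order_refl N idem_complete_Obj eV fe])
      (use pf e(1) in \<open>simp_all add: fj\<close>)
  then show ?thesis using pcoD[OF V] fj unfolding pco_def by blast
qed

lemma pco_sum:
  assumes g: "g \<in> carrier G" and M: "eo FF M" and I: "finite I" and V: "pco g V M (asum (fst M) (fst M) e I)"
    and Vs: "\<And>i. i \<in> I \<Longrightarrow> pco g (Vs i) M (e i)"
    and o: "\<And>i k. i \<in> I \<Longrightarrow> k \<in> I \<Longrightarrow> i \<noteq> k \<Longrightarrow> e i \<cdot> e k = zer (fst M) (fst M)"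
  shows "K0_class (EQ (Cg g) (St g)) V = finsum (K0 (EQ (Cg g) (St g)) :: ('r::comm_ring_1, _) module) (\<lambda>i. K0_class (EQ (Cg g) (St g)) (Vs i)) I"
proof -
  obtain j p where j: "smd (St g) V M j p" "j \<cdot> p = asum (fst M) (fst M) e I" using V by (auto simp: pco_def)
  show ?thesis
  proof (rule cls_sum[OF subgroup_St[OF g] idem_complete_Cg[OF g] eo_Res[OF subgroup_St[OF g] St_subset order_refl M] I pcoD[OF V]])
    show "smd (St g) V (Res (St g) M) j p" using j(1) by (simp add: smd_Res)
    show "\<exists>j p. smd (St g) (Vs i) (Res (St g) M) j p \<and> j \<cdot> p = e i" if "i \<in> I" for i
      using Vs[OF that] by (simp add: pco_def smd_Res)
  qed (use j(2) o pcoD[OF Vs] in simp_all)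
qed

text \<open>By naturality the idempotent in the middle can be moved outward, where it is absorbed.
  So passing to the parts of degree \<open>g\<close> respects composition of arbitrary arrows of
  \<open>C\<close>.\<close>

lemma gr_sandwich:
  assumes g: "g \<in> carrier G" and f: "f \<Colon> M \<leadsto> N" "h \<Colon> N \<leadsto> P"
    and j: "jM \<Colon> V \<leadsto> M" "jN \<Colon> W \<leadsto> N" "pN \<Colon> N \<leadsto> W" "jP \<Colon> X \<leadsto> P" "pP \<Colon> P \<leadsto> X"
    and e: "jN \<cdot> pN = gr g N" "jP \<cdot> pP = gr g P" "pP \<cdot> jP = ide X"
  shows "(pP \<cdot> h \<cdot> jN) \<cdot> (pN \<cdot> f \<cdot> jM) = pP \<cdot> (h \<cdot> f) \<cdot> jM"
proof -
  note [simp] = f j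
  note O = typed_obj[OF f(2)]
  note [simp] = O
  have "(pP \<cdot> h \<cdot> jN) \<cdot> (pN \<cdot> f \<cdot> jM) = pP \<cdot> (h \<cdot> (jN \<cdot> pN)) \<cdot> (f \<cdot> jM)" by simp
  also have "h \<cdot> (jN \<cdot> pN) = gr g P \<cdot> h" unfolding e(1) by (rule gr_natural[OF g f(2), symmetric])
  also have "pP \<cdot> (gr g P \<cdot> h) \<cdot> (f \<cdot> jM) = (pP \<cdot> jP) \<cdot> pP \<cdot> h \<cdot> f \<cdot> jM"
    unfolding e(2)[symmetric] by simp
  finally show ?thesis unfolding e(3) by simp
qed

section \<open>Orbits of degrees, and induction from stabilizers to \<open>F\<close>\<close>

definition gamma where "gamma M P = asum (fst M) (fst M) (\<lambda>g. gr g (fst M)) P"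

context
  fixes M assumes M: "eo FF M"
begin

lemma M_obj [simp]: "fst M \<in> Obj C"
  by (rule eo_obj[OF M order_refl])

lemma gamma_typed: "P \<subseteq> carrier G \<Longrightarrow> gamma M P \<Colon> fst M \<leadsto> fst M"
  unfolding gamma_def using gr_typed[OF M_obj] by (auto intro!: arr_asum)

lemma gamma_gamma:
  assumes "P \<subseteq> carrier G" "Q \<subseteq> carrier G"
  shows "gamma M P \<cdot> gamma M Q = gamma M (P \<inter> Q)"
  unfolding gamma_def
proof (rule orth_asum_cmp)
  show "finite P" "finite Q" using assms finite_G finite_subset by blast+
  show "gr p (fst M) \<Colon> fst M \<leadsto> fst M" if "p \<in> P \<union> Q" for p using gr_typed[OF M_obj] that assms by blast
  show "gr p (fst M) \<cdot> gr q (fst M) = (if p = q then gr p (fst M) else zer (fst M) (fst M))" if "p \<in> P" "q \<in> Q" for p q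
    using gr_cmp[OF M_obj] that assms by blast
qed simp

lemma gamma_eqv:
  assumes P: "P \<subseteq> carrier G" and inv: "\<And>x. x \<in> FF \<Longrightarrow> \<rho> x ` P = P"
  shows "eqv FF M M (gamma M P)"
  unfolding eqv_def
proof (intro conjI ballI)
  show "arr (gamma M P)" "src (gamma M P) = fst M" "tgt (gamma M P) = fst M" using gamma_typed[OF P] by simp_all
  fix x assume x: "x \<in> FF"
  have "sact M x \<cdot> act x (gamma M P) = gamma M (\<rho> x ` P) \<cdot> sact M x"
    unfolding gamma_def
  proof (rule asum_sact[OF M x])
    show "finite P" using P finite_G finite_subset by blast
    show "inj_on (\<rho> x) P" using P x by (auto simp: inj_on_def subset_iff)
    fix p assume "p \<in> P"
    then have p: "p \<in> carrier G" using P by blast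
    show "gr p (fst M) \<Colon> fst M \<leadsto> fst M" "gr (\<rho> x p) (fst M) \<Colon> fst M \<leadsto> fst M" using gr_typed[OF M_obj] p x by simp_all
    show "sact M x \<cdot> act x (gr p (fst M)) = gr (\<rho> x p) (fst M) \<cdot> sact M x" by (rule gr_sact[OF order_refl M x p])
  qed
  then show "gamma M P \<cdot> sact M x = sact M x \<cdot> act x (gamma M P)" using inv[OF x] by simp
qed

end

definition orbit where "orbit g = (\<lambda>x. \<rho> x g) ` FF"

text \<open>The representative is chosen as a function of the orbit as a set, so elements of one
  orbit receive the same one.\<close>

definition oreps where "oreps = (\<lambda>g. SOME k. k \<in> orbit g) ` carrier G"

lemma orbit_subset: "g \<in> carrier G \<Longrightarrow> orbit g \<subseteq> carrier G"
  by (auto simp: orbit_def)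

lemma orbit_self: "g \<in> carrier G \<Longrightarrow> g \<in> orbit g"
  unfolding orbit_def by (rule image_eqI[of _ _ "\<one>\<^bsub>F\<^esub>"]) simp_all

lemma orbit_eq:
  assumes g: "g \<in> carrier G" and k: "k \<in> orbit g"
  shows "orbit k = orbit g"
proof -
  obtain x where x: "x \<in> FF" "k = \<rho> x g" using k by (auto simp: orbit_def)
  have 1: "\<rho> y k \<in> orbit g" if "y \<in> FF" for y
    unfolding orbit_def by (rule image_eqI[of _ _ "y \<otimes>\<^bsub>F\<^esub> x"]) (use x g that in \<open>simp_all add: rho_comp\<close>)
  have 2: "\<rho> y g \<in> orbit k" if "y \<in> FF" for y
    unfolding orbit_def by (rule image_eqI[of _ _ "y \<otimes>\<^bsub>F\<^esub> inv\<^bsub>F\<^esub> x"]) (use x g that in \<open>simp_all add: rho_comp\<close>)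
  show ?thesis using 1 2 unfolding orbit_def[of k] orbit_def[of g] by auto
qed

lemma rho_orbit:
  assumes g: "g \<in> carrier G" and x: "x \<in> FF"
  shows "\<rho> x ` orbit g = orbit g"
proof -
  have 1: "\<rho> y ` orbit g \<subseteq> orbit g" if "y \<in> FF" for y
  proof
    fix k assume "k \<in> \<rho> y ` orbit g"
    then obtain z where z: "z \<in> FF" "k = \<rho> y (\<rho> z g)" by (auto simp: orbit_def)
    then show "k \<in> orbit g" unfolding orbit_def
      by (intro image_eqI[of _ _ "y \<otimes>\<^bsub>F\<^esub> z"]) (use that g in \<open>simp_all add: rho_comp\<close>)
  qed
  have "k \<in> \<rho> x ` orbit g" if k: "k \<in> orbit g" for k
  proof (rule image_eqI[of _ _ "\<rho> (inv\<^bsub>F\<^esub> x) k"])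
    show "k = \<rho> x (\<rho> (inv\<^bsub>F\<^esub> x) k)" using x subsetD[OF orbit_subset[OF g] k] by simp
    show "\<rho> (inv\<^bsub>F\<^esub> x) k \<in> orbit g" using 1[of "inv\<^bsub>F\<^esub> x"] x k by auto
  qed
  then show ?thesis using 1[OF x] by blast
qed

lemma oreps_subset: "oreps \<subseteq> carrier G"
  using orbit_subset someI[of "\<lambda>k. k \<in> orbit g" g for g] orbit_self unfolding oreps_def by blast

lemma finite_oreps: "finite oreps"
  unfolding oreps_def using finite_G by simp

lemma oreps_cover: "g \<in> carrier G \<Longrightarrow> \<exists>k\<in>oreps. g \<in> orbit k"
proof
  assume g: "g \<in> carrier G"
  let ?k = "SOME k. k \<in> orbit g"
  have "?k \<in> orbit g" using someI[of "\<lambda>k. k \<in> orbit g" g] orbit_self[OF g] .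
  from orbit_eq[OF g this] show "g \<in> orbit ?k" using orbit_self[OF g] by blast
  show "?k \<in> oreps" using g by (simp add: oreps_def)
qed

lemma oreps_disjoint:
  assumes k: "k \<in> oreps" and l: "l \<in> oreps" and kl: "k \<noteq> l"
  shows "orbit k \<inter> orbit l = {}"
proof (rule ccontr)
  assume "orbit k \<inter> orbit l \<noteq> {}"
  then obtain i where "i \<in> orbit k" "i \<in> orbit l" by blast
  then have e: "orbit k = orbit l" using orbit_eq k l oreps_subset by blast
  obtain g where g: "g \<in> carrier G" "k = (SOME k. k \<in> orbit g)" using k by (auto simp: oreps_def)
  obtain h where h: "h \<in> carrier G" "l = (SOME k. k \<in> orbit h)" using l by (auto simp: oreps_def)
  have kg: "k \<in> orbit g" and lh: "l \<in> orbit h"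
    unfolding g(2) h(2) using someI[of "\<lambda>k. k \<in> orbit g" g] someI[of "\<lambda>k. k \<in> orbit h" h] orbit_self g(1) h(1) by blast+
  then have "orbit g = orbit h" using e orbit_eq[OF g(1) kg] orbit_eq[OF h(1) lh] by blast
  then show False using g(2) h(2) kl by simp
qed

lemma oreps_UN: "(\<Union>k\<in>oreps. orbit k) = carrier G"
  using oreps_cover oreps_subset orbit_subset by blast

definition RR where "RR g = (SOME R. left_transversal F FF (St g) R \<and> \<one>\<^bsub>F\<^esub> \<in> R \<and> finite R)"

lemma RR: "g \<in> carrier G \<Longrightarrow> left_transversal F FF (St g) (RR g)" "g \<in> carrier G \<Longrightarrow> \<one>\<^bsub>F\<^esub> \<in> RR g" "g \<in> carrier G \<Longrightarrow> finite (RR g)"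
proof -
  assume g: "g \<in> carrier G"
  have "\<exists>R. left_transversal F FF (St g) R \<and> \<one>\<^bsub>F\<^esub> \<in> R \<and> finite R" using ex_transversal[OF g] by metis
  from someI_ex[OF this] show "left_transversal F FF (St g) (RR g)" "\<one>\<^bsub>F\<^esub> \<in> RR g" "finite (RR g)" unfolding RR_def by blast+
qed

text \<open>Induction from the stabilizer to \<open>F\<close> along a transversal containing
  \<open>1\<close>. It provides a host for \<open>V\<close> and is the building block of the inverse
  of \<open>Phi\<close>.\<close>

definition indF where "indF g V = (SOME Y. eo FF Y \<and> (\<exists>j p. ind_data FF (St g) (RR g) V Y j p))"

lemma indF:
  assumes g: "g \<in> carrier G" and V: "V \<in> EO (Cg g) (St g)"
  shows "eo FF (indF g V)" "\<exists>j p. ind_data FF (St g) (RR g) V (indF g V) j p"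
proof -
  have "eo (St g) V" using V g by (simp add: EO_Cg)
  then have "\<exists>Y. eo FF Y \<and> (\<exists>j p. ind_data FF (St g) (RR g) V Y j p)"
    using ind_exists[OF subgroup_F subgroup_St[OF g] St_subset RR(1,3)[OF g]] by blast
  from someI_ex[OF this, folded indF_def] show "eo FF (indF g V)" "\<exists>j p. ind_data FF (St g) (RR g) V (indF g V) j p" by blast+
qed

lemma indF_host:
  assumes g: "g \<in> carrier G" and V: "V \<in> EO (Cg g) (St g)"
  shows "pco g V (indF g V) (gr g (fst (indF g V)))"
    "\<And>k. k \<in> carrier G \<Longrightarrow> k \<notin> orbit g \<Longrightarrow> gr k (fst (indF g V)) = zer (fst (indF g V)) (fst (indF g V))"
proof -
  obtain j p where "ind_data FF (St g) (RR g) V (indF g V) j p" using indF(2)[OF assms] by blast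
  note h = host[OF g V RR(1,2)[OF g] indF(1)[OF assms] this]
  show "pco g V (indF g V) (gr g (fst (indF g V)))" unfolding pco_def by (intro conjI exI) (rule V h(1) h(2))+
  show "\<And>k. k \<in> carrier G \<Longrightarrow> k \<notin> orbit g \<Longrightarrow> gr k (fst (indF g V)) = zer (fst (indF g V)) (fst (indF g V))"
    using h(3) unfolding orbit_def .
qed

lemma pco_zero:
  assumes g: "g \<in> carrier G" and V: "pco g V M (zer (fst M) (fst M))"
  shows "K0_class (EQ (Cg g) (St g)) V = \<zero>\<^bsub>K0 (EQ (Cg g) (St g)) :: ('r::comm_ring_1, _) module\<^esub>"
proof -
  obtain j p where j: "smd (St g) V M j p" "j \<cdot> p = zer (fst M) (fst M)" using V by (auto simp: pco_def)
  note d = smdD[OF j(1)]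
  have O: "fst V \<in> Obj C" "fst M \<in> Obj C" using typed_obj[OF d(1)] .
  have "ide (fst V) = p \<cdot> (j \<cdot> p) \<cdot> j" using d(1,2,5) smd_cancel[OF j(1)] by simp
  then have "ide (fst V) = zer (fst V) (fst V)" unfolding j(2) using d(1,2) O by simp
  then show ?thesis by (rule cls_zero[OF subgroup_St[OF g] Cg_subset[OF g] pcoD[OF V]])
qed

text \<open>The parameter \<open>r0\<close> fixes the type of the coefficients, which the
  abbreviations below mention in their type constraints.\<close>

context
  fixes r0 :: "'r::comm_ring_1 itself"
begin

abbreviation (input) KA where "KA g \<equiv> (K0 (EQ (Cg g) (St g)) :: ('r, (('o \<times> ('f \<Rightarrow> 'm)) \<Rightarrow>\<^sub>0 'r) set) module)"
abbreviation (input) kc where "kc g X \<equiv> (K0_class (EQ (Cg g) (St g)) X :: (('o \<times> ('f \<Rightarrow> 'm)) \<Rightarrow>\<^sub>0 'r) set)"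
abbreviation (input) cc where "cc x g X \<equiv> c_map C F \<rho> Cg T x g (X :: (('o \<times> ('f \<Rightarrow> 'm)) \<Rightarrow>\<^sub>0 'r) set)"
abbreviation (input) cob where "cob g x V \<equiv> conj_object C F T (St g) x V"

section \<open>Conjugation on Grothendieck groups\<close>

lemma cob_additive:
  assumes x: "x \<in> FF" and g: "g \<in> carrier G"
  shows "K0_additive (EQ (Cg g) (St g)) (\<lambda>V. kc (\<rho> x g) (cob g x V)) (KA (\<rho> x g))"
proof (rule K0_additiveI[OF subgroup_St[OF g] idem_complete_Cg[OF g]])
  have xg: "\<rho> x g \<in> carrier G" using x g by simp
  show "kc (\<rho> x g) (cob g x V) \<in> carrier (KA (\<rho> x g))" if "V \<in> EO (Cg g) (St g)" for V
    by (rule K0_class_closed) (use conj_EO[OF g x that] in simp)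
  fix X Y Z i p assume *: "X \<in> EO (Cg g) (St g)" "Y \<in> EO (Cg g) (St g)" "Z \<in> EO (Cg g) (St g)" "split_exact (St g) X Y Z i p"
  have e: "eo (St g) X" "eo (St g) Y" "eo (St g) Z" using *(1-3) g by (simp_all add: EO_Cg)
  show "kc (\<rho> x g) (cob g x Y) = kc (\<rho> x g) (cob g x X) \<oplus>\<^bsub>KA (\<rho> x g)\<^esub> kc (\<rho> x g) (cob g x Z)"
    by (rule cls_split[OF subgroup_St[OF xg] Cg_subset[OF xg] conj_EO[OF g x *(1)] conj_EO[OF g x *(2)] conj_EO[OF g x *(3)]
          conj_split_exact[OF subgroup_St[OF g] subgroup_St[OF xg] x St_rho[OF x g] e *(4)]])
qed

lemma cc_class: "x \<in> FF \<Longrightarrow> g \<in> carrier G \<Longrightarrow> cc x g (kc g V) = kc (\<rho> x g) (cob g x V)"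
  unfolding c_map_def by (rule K0_map_class[OF cob_additive])

lemma cc_linear: "x \<in> FF \<Longrightarrow> g \<in> carrier G \<Longrightarrow> linear_map_on (KA g) (KA (\<rho> x g)) (\<lambda>X. cc x g X)"
  unfolding c_map_def by (rule K0_map_linear[OF cob_additive]) (use conj_EO in auto)

lemmas cc_closed = linear_map_on_closed[OF cc_linear]

text \<open>The working form of the definition of \<open>c\<close>: among the parts of one host,
  \<open>c\<close> at \<open>x\<close> replaces the part of degree \<open>g\<close> by that of
  degree \<open>\<rho> x g\<close>.\<close>

lemma cc_pco:
  assumes x: "x \<in> FF" and g: "g \<in> carrier G" and M: "eo FF M" and V: "pco g V M (gr g (fst M))" "pco (\<rho> x g) W M (gr (\<rho> x g) (fst M))"
  shows "cc x g (kc g V) = kc (\<rho> x g) W"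
  unfolding cc_class[OF x g]
  by (rule pco_unique[OF _ M pco_conj_gr[OF g x M V(1)] V(2)]) (use x g in simp)

lemma linear_id: "linear_map_on A A (\<lambda>X. X)"
  by (simp add: linear_map_on_def)

lemma cc_stab:
  assumes g: "g \<in> carrier G" and x: "x \<in> St g" and X: "X \<in> carrier (KA g)"
  shows "cc x g X = X"
proof -
  have xF: "x \<in> FF" "\<rho> x g = g" using x by (auto simp: St_iff)
  have l: "linear_map_on (KA g) (KA g) (\<lambda>X. cc x g X)" using cc_linear[OF xF(1) g] xF by simp
  show ?thesis
  proof (rule linear_map_on_eqI[OF l linear_id module_K0 _ X])
    fix V assume "V \<in> Obj (EQ (Cg g) (St g))"
    then have V: "V \<in> EO (Cg g) (St g)" by simp
    obtain M where M: "eo FF M" "pco g V M (gr g (fst M))" using pco_ex_host[OF g V] .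
    show "cc x g (kc g V) = kc g V" using cc_pco[OF xF(1) g M, of V] M(2) xF by simp
  qed
qed

text \<open>Conjugating in two steps or by the product gives objects that split the same idempotent
  of a host. The isomorphism between them is never written down.\<close>

lemma cc_comp:
  assumes g: "g \<in> carrier G" and x: "x \<in> FF" and y: "y \<in> FF" and X: "X \<in> carrier (KA g)"
  shows "cc x (\<rho> y g) (cc y g X) = cc (x \<otimes>\<^bsub>F\<^esub> y) g X"
proof -
  have yg: "\<rho> y g \<in> carrier G" and xy: "x \<otimes>\<^bsub>F\<^esub> y \<in> FF" using x y g by simp_all
  note r = rho_comp[OF x y g]
  note l = linear_map_on_compose[OF cc_linear[OF y g] cc_linear[OF x yg]]
  have l': "linear_map_on (KA g) (KA (\<rho> x (\<rho> y g))) (\<lambda>X. cc (x \<otimes>\<^bsub>F\<^esub> y) g X)" using cc_linear[OF xy g] r by simp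
  show ?thesis
  proof (rule linear_map_on_eqI[OF l l' module_K0 _ X])
    fix V assume "V \<in> Obj (EQ (Cg g) (St g))"
    then have V: "V \<in> EO (Cg g) (St g)" by simp
    obtain M where M: "eo FF M" "pco g V M (gr g (fst M))" using pco_ex_host[OF g V] .
    note 1 = pco_conj_gr[OF g y M]
    note 2 = pco_conj_gr[OF yg x M(1) 1]
    have "cc y g (kc g V) = kc (\<rho> y g) (cob g y V)" by (rule cc_class[OF y g])
    then show "cc x (\<rho> y g) (cc y g (kc g V)) = cc (x \<otimes>\<^bsub>F\<^esub> y) g (kc g V)"
      using cc_pco[OF x yg M(1) 1 2] cc_pco[OF xy g M, unfolded r, OF 2] by simp
  qed
qed

definition unit_class where "unit_class = kc \<one>\<^bsub>G\<^esub> (pc \<one>\<^bsub>G\<^esub> (unob FF))"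

lemma eo_U: "eo FF (unob FF)"
  by (rule eo_unob[OF subgroup_F])

lemma unit_closed': "unit_class \<in> carrier (KA \<one>\<^bsub>G\<^esub>)"
  unfolding unit_class_def by (rule K0_class_closed) (use pc(1)[OF _ eo_U] in simp)

lemma cc_unit: "x \<in> FF \<Longrightarrow> cc x \<one>\<^bsub>G\<^esub> unit_class = unit_class"
  unfolding unit_class_def
  using cc_pco[OF _ _ eo_U pco_pc[OF _ eo_U], of x "\<one>\<^bsub>G\<^esub>" "pc \<one>\<^bsub>G\<^esub> (unob FF)"] pco_pc[OF _ eo_U, of "\<one>\<^bsub>G\<^esub>"] by simp

section \<open>The isomorphism\<close>

abbreviation (input) KC where "KC \<equiv> (K0 (EQ (Obj C) FF) :: ('r, (('o \<times> ('f \<Rightarrow> 'm)) \<Rightarrow>\<^sub>0 'r) set) module)"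
abbreviation (input) cF where "cF X \<equiv> (K0_class (EQ (Obj C) FF) X :: (('o \<times> ('f \<Rightarrow> 'm)) \<Rightarrow>\<^sub>0 'r) set)"
abbreviation (input) unc where "unc \<equiv> (unit_class :: (('o \<times> ('f \<Rightarrow> 'm)) \<Rightarrow>\<^sub>0 'r) set)"
abbreviation (input) ph where "ph g \<equiv> (K0_map (EQ (Cg g) (St g)) (pc g) :: (('o \<times> ('f \<Rightarrow> 'm)) \<Rightarrow>\<^sub>0 'r) set \<Rightarrow> _)"
abbreviation (input) ps where "ps g \<equiv> (K0_map (EQ (Obj C) FF) (indF g) :: (('o \<times> ('f \<Rightarrow> 'm)) \<Rightarrow>\<^sub>0 'r) set \<Rightarrow> _)"

text \<open>Passing to the part of degree \<open>g\<close> is exact: the splitting arrows,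
  compressed to the parts, still split, because compression respects composites.\<close>

lemma pc_additive:
  assumes g: "g \<in> carrier G"
  shows "K0_additive (EQ (Obj C) FF) (\<lambda>M. kc g (pc g M)) (KA g)"
proof (rule K0_additiveI[OF subgroup_F idem_complete_Obj])
  show "kc g (pc g M) \<in> carrier (KA g)" if "M \<in> EO (Obj C) FF" for M
    by (rule K0_class_closed) (use pc(1)[OF g, of M] that in \<open>simp add: EO_Obj\<close>)
  fix X Y Z i p assume XYZ: "X \<in> EO (Obj C) FF" "Y \<in> EO (Obj C) FF" "Z \<in> EO (Obj C) FF" and se: "split_exact FF X Y Z i p"
  have X: "eo FF X" and Y: "eo FF Y" and Z: "eo FF Z" using XYZ by (simp_all add: EO_Obj)
  obtain r s where ip: "eqv FF X Y i" "eqv FF Y Z p" and pi: "p \<cdot> i = zer (fst X) (fst Z)"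
    and rs: "r \<Colon> fst Y \<leadsto> fst X" "s \<Colon> fst Z \<leadsto> fst Y" "r \<cdot> i = ide (fst X)" "p \<cdot> s = ide (fst Z)"
    "i \<cdot> r \<boxplus> s \<cdot> p = ide (fst Y)" using se unfolding split_exact_def by blast
  note S = subgroup_St[OF g]
  obtain jX pX where x: "smd (St g) (pc g X) X jX pX" "jX \<cdot> pX = gr g (fst X)" using pc(2)[OF g X] by blast
  obtain jY pY where y: "smd (St g) (pc g Y) Y jY pY" "jY \<cdot> pY = gr g (fst Y)" using pc(2)[OF g Y] by blast
  obtain jZ pZ where z: "smd (St g) (pc g Z) Z jZ pZ" "jZ \<cdot> pZ = gr g (fst Z)" using pc(2)[OF g Z] by blast
  note dx = smdD[OF x(1)] and dy = smdD[OF y(1)] and dz = smdD[OF z(1)]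
  note ti = eqvD(1)[OF ip(1)] and tp = eqvD(1)[OF ip(2)]
  have e: "eo (St g) (pc g X)" "eo (St g) (pc g Y)" "eo (St g) (pc g Z)"
    using pc(1)[OF g X] pc(1)[OF g Y] pc(1)[OF g Z] g by (simp_all add: EO_Cg)
  have eR: "eo (St g) (Res (St g) X)" "eo (St g) (Res (St g) Y)" "eo (St g) (Res (St g) Z)"
    by (rule eo_Res[OF S St_subset order_refl], fact)+
  have O: "fst (pc g X) \<in> Obj C" "fst (pc g Y) \<in> Obj C" "fst (pc g Z) \<in> Obj C" "fst X \<in> Obj C" "fst Y \<in> Obj C" "fst Z \<in> Obj C"
    using typed_obj[OF dx(1)] typed_obj[OF dy(1)] typed_obj[OF dz(1)] by blast+
  note [simp] = dx(1,2,5) dy(1,2,5) dz(1,2,5) ti tp rs(1,2) O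
  have "split_exact (St g) (pc g X) (pc g Y) (pc g Z) (pY \<cdot> i \<cdot> jX) (pZ \<cdot> p \<cdot> jY)"
  proof (rule split_exactI[where r = "pX \<cdot> r \<cdot> jY" and s = "pY \<cdot> s \<cdot> jZ"])
    have *: "eqv (St g) (pc g X) (Res (St g) Y) (i \<cdot> jX)" "eqv (St g) (pc g Y) (Res (St g) Z) (p \<cdot> jY)"
      by (rule eqv_cmp[OF St_subset e(1) eR(1) eR(2)] eqv_cmp[OF St_subset e(2) eR(2) eR(3)];
        use dx(3) dy(3) eqv_mono[OF ip(1) St_subset] eqv_mono[OF ip(2) St_subset] in \<open>simp add: eqv_Res\<close>)+
    show "eqv (St g) (pc g X) (pc g Y) (pY \<cdot> i \<cdot> jX)"
      by (rule eqv_cmp[OF St_subset e(1) eR(2) e(2) *(1)]) (use dy(4) in \<open>simp add: eqv_Res\<close>)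
    show "eqv (St g) (pc g Y) (pc g Z) (pZ \<cdot> p \<cdot> jY)"
      by (rule eqv_cmp[OF St_subset e(2) eR(3) e(3) *(2)]) (use dz(4) in \<open>simp add: eqv_Res\<close>)
    show "(pZ \<cdot> p \<cdot> jY) \<cdot> (pY \<cdot> i \<cdot> jX) = zer (fst (pc g X)) (fst (pc g Z))"
      unfolding gr_sandwich[OF g ti tp dx(1) dy(1,2) dz(1,2) y(2) z(2) dz(5)] pi by simp
    show "(pX \<cdot> r \<cdot> jY) \<cdot> (pY \<cdot> i \<cdot> jX) = ide (fst (pc g X))"
      unfolding gr_sandwich[OF g ti rs(1) dx(1) dy(1,2) dx(1,2) y(2) x(2) dx(5)] rs(3) by simp
    show "(pZ \<cdot> p \<cdot> jY) \<cdot> (pY \<cdot> s \<cdot> jZ) = ide (fst (pc g Z))"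
      unfolding gr_sandwich[OF g rs(2) tp dz(1) dy(1,2) dz(1,2) y(2) z(2) dz(5)] rs(4) by simp
    have "(pY \<cdot> i \<cdot> jX) \<cdot> (pX \<cdot> r \<cdot> jY) \<boxplus> (pY \<cdot> s \<cdot> jZ) \<cdot> (pZ \<cdot> p \<cdot> jY) = pY \<cdot> (i \<cdot> r) \<cdot> jY \<boxplus> pY \<cdot> (s \<cdot> p) \<cdot> jY"
      unfolding gr_sandwich[OF g rs(1) ti dy(1) dx(1,2) dy(1,2) x(2) y(2) dy(5)]
        gr_sandwich[OF g tp rs(2) dy(1) dz(1,2) dy(1,2) z(2) y(2) dy(5)] ..
    also have "\<dots> = pY \<cdot> (i \<cdot> r \<boxplus> s \<cdot> p) \<cdot> jY"
      by (simp add: cmp_plus_left cmp_plus_right)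
    also have "\<dots> = ide (fst (pc g Y))" unfolding rs(5) by simp
    finally show "(pY \<cdot> i \<cdot> jX) \<cdot> (pX \<cdot> r \<cdot> jY) \<boxplus> (pY \<cdot> s \<cdot> jZ) \<cdot> (pZ \<cdot> p \<cdot> jY) = ide (fst (pc g Y))" .
  qed simp_all
  then show "kc g (pc g Y) = kc g (pc g X) \<oplus>\<^bsub>KA g\<^esub> kc g (pc g Z)"
    by (rule cls_split[OF S Cg_subset[OF g] pc(1)[OF g X] pc(1)[OF g Y] pc(1)[OF g Z]])
qed

lemma ph_class: "g \<in> carrier G \<Longrightarrow> ph g (cF M) = kc g (pc g M)"
  by (rule K0_map_class[OF pc_additive])

lemma ph_linear: "g \<in> carrier G \<Longrightarrow> linear_map_on KC (KA g) (ph g)"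
  by (rule K0_map_linear[OF pc_additive]) (auto simp: EO_Obj pc(1))

lemma indF_additive:
  assumes g: "g \<in> carrier G"
  shows "K0_additive (EQ (Cg g) (St g)) (\<lambda>V. cF (indF g V)) KC"
proof (rule K0_additiveI[OF subgroup_St[OF g] idem_complete_Cg[OF g]])
  show "cF (indF g V) \<in> carrier KC" if "V \<in> EO (Cg g) (St g)" for V
    by (rule K0_class_closed) (use indF(1)[OF g that] in \<open>simp add: EO_Obj\<close>)
  fix X Y Z i p assume XYZ: "X \<in> EO (Cg g) (St g)" "Y \<in> EO (Cg g) (St g)" "Z \<in> EO (Cg g) (St g)" and se: "split_exact (St g) X Y Z i p"
  have e: "eo (St g) X" "eo (St g) Y" "eo (St g) Z" using XYZ g by (simp_all add: EO_Cg)
  note eF = indF(1)[OF g XYZ(1)] indF(1)[OF g XYZ(2)] indF(1)[OF g XYZ(3)]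
  obtain j1 p1 j2 p2 j3 p3 where i: "ind_data FF (St g) (RR g) X (indF g X) j1 p1" "ind_data FF (St g) (RR g) Y (indF g Y) j2 p2"
    "ind_data FF (St g) (RR g) Z (indF g Z) j3 p3"
    using indF(2)[OF g XYZ(1)] indF(2)[OF g XYZ(2)] indF(2)[OF g XYZ(3)] by blast
  show "cF (indF g Y) = cF (indF g X) \<oplus>\<^bsub>KC\<^esub> cF (indF g Z)"
    by (rule cls_split[OF subgroup_F order_refl _ _ _
      ind_split_exact[OF subgroup_F subgroup_St[OF g] RR(1)[OF g] e eF i se]])
      (use eF in \<open>simp_all add: EO_Obj\<close>)
qed

lemma ps_class: "g \<in> carrier G \<Longrightarrow> ps g (kc g V) = cF (indF g V)"
  by (rule K0_map_class[OF indF_additive])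

lemma ps_linear: "g \<in> carrier G \<Longrightarrow> linear_map_on (KA g) KC (ps g)"
  by (rule K0_map_linear[OF indF_additive]) (auto simp: EO_Obj indF(1))

lemma cc_ph:
  assumes x: "x \<in> FF" and g: "g \<in> carrier G" and X: "X \<in> carrier KC"
  shows "cc x g (ph g X) = ph (\<rho> x g) X"
proof -
  have xg: "\<rho> x g \<in> carrier G" using x g by simp
  show ?thesis
  proof (rule linear_map_on_eqI[OF linear_map_on_compose[OF ph_linear[OF g] cc_linear[OF x g]] ph_linear[OF xg] module_K0 _ X])
    fix M assume "M \<in> Obj (EQ (Obj C) FF)"
    then have M: "eo FF M" by (simp add: EO_Obj)
    show "cc x g (ph g (cF M)) = ph (\<rho> x g) (cF M)"
      unfolding ph_class[OF g] ph_class[OF xg] by (rule cc_pco[OF x g M pco_pc[OF g M] pco_pc[OF xg M]])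
  qed
qed

lemma ph_ps_zero:
  assumes g: "g \<in> carrier G" and k: "k \<in> carrier G" "k \<notin> orbit g" and X: "X \<in> carrier (KA g)"
  shows "ph k (ps g X) = \<zero>\<^bsub>KA k\<^esub>"
proof -
  interpret k: module scalars "KA k" by (rule module_K0)
  have z: "linear_map_on (KA g) (KA k) (\<lambda>X. \<zero>\<^bsub>KA k\<^esub>)"
    unfolding linear_map_on_def using k.smult_r_null by (auto simp: scalars_def)
  show ?thesis
  proof (rule linear_map_on_eqI[OF linear_map_on_compose[OF ps_linear[OF g] ph_linear[OF k(1)]] z module_K0 _ X])
    fix V assume "V \<in> Obj (EQ (Cg g) (St g))"
    then have V: "V \<in> EO (Cg g) (St g)" by simp
    have "pco k (pc k (indF g V)) (indF g V) (zer (fst (indF g V)) (fst (indF g V)))"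
      using pco_pc[OF k(1) indF(1)[OF g V]] unfolding indF_host(2)[OF g V k] .
    then show "ph k (ps g (kc g V)) = \<zero>\<^bsub>KA k\<^esub>"
      unfolding ps_class[OF g] ph_class[OF k(1)] by (rule pco_zero[OF k(1)])
  qed
qed

text \<open>Together with \<open>ph_ps_zero\<close> this determines all parts of an induced object:
  the conjugates of \<open>V\<close> in the degrees of the orbit and zero elsewhere.\<close>

lemma ph_ps:
  assumes g: "g \<in> carrier G" and x: "x \<in> FF" and X: "X \<in> carrier (KA g)"
  shows "ph (\<rho> x g) (ps g X) = cc x g X"
proof -
  have xg: "\<rho> x g \<in> carrier G" using x g by simp
  show ?thesis
  proof (rule linear_map_on_eqI[OF linear_map_on_compose[OF ps_linear[OF g] ph_linear[OF xg]] cc_linear[OF x g] module_K0 _ X])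
    fix V assume "V \<in> Obj (EQ (Cg g) (St g))"
    then have V: "V \<in> EO (Cg g) (St g)" by simp
    show "ph (\<rho> x g) (ps g (kc g V)) = cc x g (kc g V)"
      unfolding ps_class[OF g] ph_class[OF xg]
      by (rule cc_pco[symmetric, OF x g indF(1)[OF g V] indF_host(1)[OF g V] pco_pc[OF xg indF(1)[OF g V]]])
  qed
qed

text \<open>\<open>M\<close> is the sum of its parts over the orbits of degrees, and the part over
  the orbit of \<open>g\<close> is induced from the part of degree \<open>g\<close>.\<close>

lemma ps_ph:
  assumes X: "X \<in> carrier KC"
  shows "finsum KC (\<lambda>g. ps g (ph g X)) oreps = X"
proof (rule linear_map_on_eqI[OF linear_map_on_finsum[OF module_K0 finite_oreps] linear_id module_K0 _ X])
  show "linear_map_on KC KC (\<lambda>X. ps g (ph g X))" if "g \<in> oreps" for g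
    using linear_map_on_compose[OF ph_linear ps_linear] that oreps_subset by blast
  fix M assume "M \<in> Obj (EQ (Obj C) FF)"
  then have M: "eo FF M" by (simp add: EO_Obj)
  have O: "fst M \<in> Obj C" by (rule eo_obj[OF M order_refl])
  have ti: "ide (fst M) \<Colon> fst M \<leadsto> fst M" using O by simp
  \<comment> \<open>The projection to all degrees of one orbit commutes with all of
    \<open>F\<close>, so it splits in the equivariantization.\<close>
  have ex: "\<exists>W j p. W \<in> EO (Obj C) FF \<and> smd FF W M j p \<and> j \<cdot> p = gamma M (orbit g)" if "g \<in> oreps" for g
  proof -
    have g: "g \<in> carrier G" using that oreps_subset by blast
    note t = gamma_typed[OF M orbit_subset[OF g]]
    show ?thesis
      by (rule smd_ex[OF subgroup_F idem_complete_Obj M gamma_eqv[OF M orbit_subset[OF g] rho_orbit[OF g]] _ O ti ti])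
        (use gamma_gamma[OF M orbit_subset[OF g] orbit_subset[OF g]] t O in auto)
  qed
  then obtain W where W: "\<And>g. g \<in> oreps \<Longrightarrow> W g \<in> EO (Obj C) FF"
    "\<And>g. g \<in> oreps \<Longrightarrow> \<exists>j p. smd FF (W g) M j p \<and> j \<cdot> p = gamma M (orbit g)" by metis
  have "cF M = finsum KC (\<lambda>g. cF (W g)) oreps"
  proof (rule cls_sum[OF subgroup_F idem_complete_Obj M finite_oreps _ _ _ W])
    show "M \<in> EO (Obj C) FF" using M by (simp add: EO_Obj)
    show "smd FF M M (ide (fst M)) (ide (fst M))" unfolding smd_def using eqv_ide[OF order_refl M] O by simp
    have "gamma M (\<Union>g\<in>oreps. orbit g) = asum (fst M) (fst M) (\<lambda>g. gamma M (orbit g)) oreps"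
      unfolding gamma_def
    proof (rule asum_UN[OF finite_oreps _ oreps_disjoint O O])
      show "finite (orbit g)" for g unfolding orbit_def using finite_F by simp
      show "gr k (fst M) \<Colon> fst M \<leadsto> fst M" if "g \<in> oreps" "k \<in> orbit g" for g k
        using gr_typed[OF O] that oreps_UN by blast
    qed
    then have "asum (fst M) (fst M) (\<lambda>g. gamma M (orbit g)) oreps = ide (fst M)"
      unfolding oreps_UN gamma_def[of M "carrier G"] gr_sum[OF O] by simp
    then show "ide (fst M) \<cdot> ide (fst M) = asum (fst M) (fst M) (\<lambda>g. gamma M (orbit g)) oreps"
      using O by simp
    show "gamma M (orbit g) \<cdot> gamma M (orbit h) = zer (fst M) (fst M)" if "g \<in> oreps" "h \<in> oreps" "g \<noteq> h" for g h
    proof -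
      have gh: "g \<in> carrier G" "h \<in> carrier G" using that oreps_subset by blast+
      show ?thesis
        unfolding gamma_gamma[OF M orbit_subset[OF gh(1)] orbit_subset[OF gh(2)]] oreps_disjoint[OF that] using O by (simp add: gamma_def)
    qed
  qed
  also have "\<dots> = finsum KC (\<lambda>g. ps g (ph g (cF M))) oreps"
  proof -
    interpret KC: module scalars KC by (rule module_K0)
    show ?thesis
    proof (rule KC.finsum_cong'[OF refl])
      show "(\<lambda>g. ps g (ph g (cF M))) \<in> oreps \<rightarrow> carrier KC"
        using linear_map_on_closed[OF linear_map_on_compose[OF ph_linear ps_linear]] oreps_subset M by (auto simp: EO_Obj)
      fix g assume gO: "g \<in> oreps"
      have g: "g \<in> carrier G" using gO oreps_subset by blast
      obtain J P where J: "smd FF (W g) M J P" "J \<cdot> P = gamma M (orbit g)" using W(2)[OF gO] by blast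
      have We: "eo FF (W g)" using W(1)[OF gO] by (simp add: EO_Obj)
      obtain j p where j: "smd (St g) (pc g M) M j p" "j \<cdot> p = gr g (fst M)" using pc(2)[OF g M] by blast
      have Ve: "eo (St g) (pc g M)" using pc(1)[OF g M] g by (simp add: EO_Cg)
      have RF: "t \<in> FF" if "t \<in> RR g" for t using RR(1)[OF g] that by (auto simp: left_transversal_def)
      have inj: "s = t" if st: "s \<in> RR g" "t \<in> RR g" "\<rho> s g = \<rho> t g" for s t
      proof -
        have "inv\<^bsub>F\<^esub> t \<otimes>\<^bsub>F\<^esub> s \<in> St g" using st RF g by (simp add: St_iff rho_comp)
        moreover have "s = t \<otimes>\<^bsub>F\<^esub> (inv\<^bsub>F\<^esub> t \<otimes>\<^bsub>F\<^esub> s)" using st RF by (simp add: F_assoc[symmetric])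
        ultimately show ?thesis using left_transversal_unique[OF subgroup_F subgroup_St[OF g] RR(1)[OF g] st(2,1)] by blast
      qed
      have img: "(\<lambda>t. \<rho> t g) ` RR g = orbit g"
      proof
        show "(\<lambda>t. \<rho> t g) ` RR g \<subseteq> orbit g" using RF by (auto simp: orbit_def)
        show "orbit g \<subseteq> (\<lambda>t. \<rho> t g) ` RR g"
        proof
          fix k assume "k \<in> orbit g"
          then obtain x where x: "x \<in> FF" "k = \<rho> x g" by (auto simp: orbit_def)
          then obtain t b where t: "t \<in> RR g" "b \<in> St g" "x = t \<otimes>\<^bsub>F\<^esub> b" using RR(1)[OF g] unfolding left_transversal_def by blast
          then have "k = \<rho> t g" using x(2) g RF[OF t(1)] by (simp add: rho_comp St_iff)
          then show "k \<in> (\<lambda>t. \<rho> t g) ` RR g" using t(1) by blast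
        qed
      qed
      have "\<exists>j p. ind_data FF (St g) (RR g) (pc g M) (W g) j p"
      proof (rule ind_data_imprimitivity[OF subgroup_F subgroup_St[OF g] St_subset _ RR(3)[OF g] M Ve j(1) We J(1), where e = "\<lambda>t. gr (\<rho> t g) (fst M)"])
        show "RR g \<subseteq> FF" using RF by blast
        show "gr (\<rho> t g) (fst M) \<Colon> fst M \<leadsto> fst M" if "t \<in> RR g" for t using gr_typed[OF O] RF[OF that] g by simp
        show "sact M t \<cdot> act t (j \<cdot> p) = gr (\<rho> t g) (fst M) \<cdot> sact M t" if "t \<in> RR g" for t
          unfolding j(2) by (rule gr_sact[OF order_refl M RF[OF that] g])
        show "gr (\<rho> s g) (fst M) \<cdot> gr (\<rho> t g) (fst M) = zer (fst M) (fst M)" if "s \<in> RR g" "t \<in> RR g" "s \<noteq> t" for s t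
          using gr_cmp[OF O, of "\<rho> s g" "\<rho> t g"] inj[OF that(1,2)] that(3) RF[OF that(1)] RF[OF that(2)] g by auto
        show "J \<cdot> P = asum (fst M) (fst M) (\<lambda>t. gr (\<rho> t g) (fst M)) (RR g)"
          unfolding J(2) gamma_def img[symmetric]
          by (rule asum_reindex) (use inj O gr_typed[OF O] RF g in \<open>auto intro: inj_onI\<close>)
      qed
      then obtain j1 p1 where i1: "ind_data FF (St g) (RR g) (pc g M) (W g) j1 p1" by blast
      obtain j2 p2 where i2: "ind_data FF (St g) (RR g) (pc g M) (indF g (pc g M)) j2 p2" using indF(2)[OF g pc(1)[OF g M]] by blast
      have "indF g (pc g M) \<in> EO (Obj C) FF" using indF(1)[OF g pc(1)[OF g M]] by (simp add: EO_Obj)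
      \<comment> \<open>Both objects are induced from \<open>pc g M\<close> along the transversal
        \<open>RR g\<close>, one by imprimitivity and one by construction.\<close>
      then have "cF (W g) = cF (indF g (pc g M))"
        by (rule ind_unique[OF subgroup_F subgroup_St[OF g] RR(1)[OF g] idem_complete_Obj Ve W(1)[OF gO] _ i1 i2])
      then show "cF (W g) = ps g (ph g (cF M))" unfolding ph_class[OF g] ps_class[OF g] .
    qed
  qed
  finally show "finsum KC (\<lambda>g. ps g (ph g (cF M))) oreps = cF M" ..
qed

section \<open>The bijection with the invariants\<close>

definition Phi where "Phi X = (\<lambda>g\<in>carrier G. ph g X)"

definition Psi where "Psi \<alpha> = finsum KC (\<lambda>g. ps g (\<alpha> g)) oreps"

abbreviation (input) GI where "GI \<equiv> graded_invariants F G \<rho> (\<lambda>g. KA g) (c_map C F \<rho> Cg T)"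

lemma Phi_GI:
  assumes X: "X \<in> carrier KC"
  shows "Phi X \<in> GI"
proof -
  have 1: "Phi X \<in> graded_space G (\<lambda>g. KA g)"
    using linear_map_on_closed[OF ph_linear X] by (auto simp: Phi_def graded_space_def)
  have "total_map F G \<rho> (c_map C F \<rho> Cg T) x (Phi X) = Phi X" if x: "x \<in> FF" for x
    unfolding total_map_def Phi_def
  proof (rule restrict_ext)
    fix g assume g: "g \<in> carrier G"
    then show "c_map C F \<rho> Cg T x (\<rho> (inv\<^bsub>F\<^esub> x) g) ((\<lambda>g\<in>carrier G. ph g X) (\<rho> (inv\<^bsub>F\<^esub> x) g)) = ph g X"
      using cc_ph[OF x _ X, of "\<rho> (inv\<^bsub>F\<^esub> x) g"] x by simp
  qed
  then show ?thesis using 1 by (simp add: graded_invariants_def)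
qed

lemma GI_D:
  assumes a: "\<alpha> \<in> GI"
  shows "g \<in> carrier G \<Longrightarrow> \<alpha> g \<in> carrier (KA g)" "g \<in> carrier G \<Longrightarrow> x \<in> FF \<Longrightarrow> cc x g (\<alpha> g) = \<alpha> (\<rho> x g)"
    "\<alpha> \<in> extensional (carrier G)"
proof -
  have gs: "\<alpha> \<in> graded_space G (\<lambda>g. KA g)" and t: "\<And>x. x \<in> FF \<Longrightarrow> total_map F G \<rho> (c_map C F \<rho> Cg T) x \<alpha> = \<alpha>"
    using a by (auto simp: graded_invariants_def)
  show "g \<in> carrier G \<Longrightarrow> \<alpha> g \<in> carrier (KA g)" "\<alpha> \<in> extensional (carrier G)" using gs by (auto simp: graded_space_def PiE_iff)
  assume g: "g \<in> carrier G" and x: "x \<in> FF"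
  show "cc x g (\<alpha> g) = \<alpha> (\<rho> x g)" using fun_cong[OF t[OF x], of "\<rho> x g"] g x by (simp add: total_map_def)
qed

lemma ps_GI: "\<alpha> \<in> GI \<Longrightarrow> (\<lambda>g. ps g (\<alpha> g)) \<in> oreps \<rightarrow> carrier KC"
  using linear_map_on_closed[OF ps_linear GI_D(1)] oreps_subset by blast

lemma Psi_closed: "\<alpha> \<in> GI \<Longrightarrow> Psi \<alpha> \<in> carrier KC"
proof -
  interpret KC: module scalars KC by (rule module_K0)
  show "\<alpha> \<in> GI \<Longrightarrow> Psi \<alpha> \<in> carrier KC" unfolding Psi_def using ps_GI by (rule KC.finsum_closed)
qed

text \<open>In degree \<open>g\<close> only the representative \<open>k\<close> of the orbit of
  \<open>g\<close> contributes. The contribution is a conjugate of \<open>\<alpha> k\<close>, which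
  equals \<open>\<alpha> g\<close> because \<open>\<alpha>\<close> is invariant.\<close>

lemma Phi_Psi:
  assumes a: "\<alpha> \<in> GI"
  shows "Phi (Psi \<alpha>) = \<alpha>"
proof (rule extensionalityI)
  show "Phi (Psi \<alpha>) \<in> extensional (carrier G)" by (simp add: Phi_def)
  show "\<alpha> \<in> extensional (carrier G)" by (rule GI_D(3)[OF a])
  fix g assume g: "g \<in> carrier G"
  interpret B: module scalars "KA g" by (rule module_K0)
  obtain k where k: "k \<in> oreps" "g \<in> orbit k" using oreps_cover[OF g] by blast
  obtain x where x: "x \<in> FF" "g = \<rho> x k" using k(2) by (auto simp: orbit_def)
  have kG: "k \<in> carrier G" using k(1) oreps_subset by blast
  have "ph g (Psi \<alpha>) = finsum (KA g) (\<lambda>l. ph g (ps l (\<alpha> l))) oreps"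
    unfolding Psi_def by (rule linear_map_on_finsum_arg[OF module_K0 module_K0 ph_linear[OF g] finite_oreps ps_GI[OF a]])
  also have "\<dots> = finsum (KA g) (\<lambda>l. if k = l then \<alpha> g else \<zero>\<^bsub>KA g\<^esub>) oreps"
  proof (rule B.finsum_cong'[OF refl])
    show "(\<lambda>l. if k = l then \<alpha> g else \<zero>\<^bsub>KA g\<^esub>) \<in> oreps \<rightarrow> carrier (KA g)" using GI_D(1)[OF a g] by auto
    fix l assume l: "l \<in> oreps"
    then have lG: "l \<in> carrier G" using oreps_subset by blast
    show "ph g (ps l (\<alpha> l)) = (if k = l then \<alpha> g else \<zero>\<^bsub>KA g\<^esub>)"
    proof (cases "k = l")
      case True
      then show ?thesis using ph_ps[OF kG x(1) GI_D(1)[OF a kG]] GI_D(2)[OF a kG x(1)] x(2) by simp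
    next
      case False
      then have "g \<notin> orbit l" using oreps_disjoint[OF k(1) l] k(2) by blast
      then show ?thesis using ph_ps_zero[OF lG g _ GI_D(1)[OF a lG]] False by simp
    qed
  qed
  also have "\<dots> = \<alpha> g" using B.finsum_singleton[OF k(1) finite_oreps, of "\<lambda>l. \<alpha> g"] GI_D(1)[OF a g] by simp
  finally show "Phi (Psi \<alpha>) g = \<alpha> g" using g by (simp add: Phi_def)
qed

lemma Psi_Phi:
  assumes X: "X \<in> carrier KC"
  shows "Psi (Phi X) = X"
proof -
  interpret KC: module scalars KC by (rule module_K0)
  have "Psi (Phi X) = finsum KC (\<lambda>g. ps g (ph g X)) oreps"
    unfolding Psi_def
  proof (rule KC.finsum_cong'[OF refl])
    show "(\<lambda>g. ps g (ph g X)) \<in> oreps \<rightarrow> carrier KC"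
      using linear_map_on_closed[OF linear_map_on_compose[OF ph_linear ps_linear] X] oreps_subset by blast
    show "ps g (Phi X g) = ps g (ph g X)" if "g \<in> oreps" for g using that oreps_subset by (auto simp: Phi_def)
  qed
  then show ?thesis using ps_ph[OF X] by simp
qed

section \<open>Products of components\<close>

context
  fixes tr
  assumes tr: "transversal_choice F tr"
begin

abbreviation (input) mm where "mm h k X Y \<equiv> m_map C F G \<rho> Cg T tr h k (X :: (('o \<times> ('f \<Rightarrow> 'm)) \<Rightarrow>\<^sub>0 'r) set) Y"
abbreviation (input) isI where "isI h k V V' Y \<equiv> is_induced C F T (Cg (h \<otimes>\<^bsub>G\<^esub> k)) (St (h \<otimes>\<^bsub>G\<^esub> k)) (St h \<inter> St k)
  (tr (St (h \<otimes>\<^bsub>G\<^esub> k)) (St h \<inter> St k)) (res_tensor C F \<rho> T h k V V') Y"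
abbreviation (input) IN where "IN h k V V' \<equiv> Ind C F T (Cg (h \<otimes>\<^bsub>G\<^esub> k)) (St (h \<otimes>\<^bsub>G\<^esub> k)) (St h \<inter> St k)
  (tr (St (h \<otimes>\<^bsub>G\<^esub> k)) (St h \<inter> St k)) (res_tensor C F \<rho> T h k V V')"

context
  fixes h k
  assumes hk: "h \<in> carrier G" "k \<in> carrier G"
begin

lemma hk_closed: "h \<otimes>\<^bsub>G\<^esub> k \<in> carrier G"
  using hk by simp

lemma tr_hk: "left_transversal F (St (h \<otimes>\<^bsub>G\<^esub> k)) (St h \<inter> St k) (tr (St (h \<otimes>\<^bsub>G\<^esub> k)) (St h \<inter> St k))"
  using tr subgroup_St[OF hk_closed] subgroup_Int[OF hk] Int_subset[OF hk] by (simp add: transversal_choice_def)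

lemma isI_iff: "isI h k V V' Y \<longleftrightarrow> Y \<in> EO (Cg (h \<otimes>\<^bsub>G\<^esub> k)) (St (h \<otimes>\<^bsub>G\<^esub> k)) \<and>
   (\<exists>j p. ind_data (St (h \<otimes>\<^bsub>G\<^esub> k)) (St h \<inter> St k) (tr (St (h \<otimes>\<^bsub>G\<^esub> k)) (St h \<inter> St k)) (tob (St h \<inter> St k) V V') Y j p)"
  unfolding res_tensor_eq by (rule is_induced_iff[OF Cg_subset[OF hk_closed]])

text \<open>The link between \<open>m\<close> and hosts: a summand of the tensor product that
  belongs to the orbit of \<open>(h, k)\<close> is induced from the tensor product of the parts of
  degrees \<open>h\<close> and \<open>k\<close>.\<close>

lemma isI_pco:
  assumes M: "eo FF M" "eo FF N" and V: "pco h V M (gr h (fst M))" "pco k V' N (gr k (fst N))"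
    and W: "pco (h \<otimes>\<^bsub>G\<^esub> k) W (tob FF M N) (eps (fst M) (fst N) (orb h k))"
  shows "isI h k V V' W"
proof -
  obtain j p where j: "smd (St h) V M j p" "j \<cdot> p = gr h (fst M)" using V(1) by (auto simp: pco_def)
  obtain j' p' where j': "smd (St k) V' N j' p'" "j' \<cdot> p' = gr k (fst N)" using V(2) by (auto simp: pco_def)
  obtain J P where J: "smd (St (h \<otimes>\<^bsub>G\<^esub> k)) W (tob FF M N) J P" "J \<cdot> P = eps (fst M) (fst N) (orb h k)" using W by (auto simp: pco_def)
  show ?thesis unfolding isI_iff
    using ind_data_orb[OF hk M pcoD[OF V(1)] j pcoD[OF V(2)] j' tr_hk pcoD[OF W] J] pcoD[OF W] by blast
qed

lemma ex_pco_orb: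
  assumes M: "eo FF M" "eo FF N"
  obtains W where "pco (h \<otimes>\<^bsub>G\<^esub> k) W (tob FF M N) (eps (fst M) (fst N) (orb h k))"
  using ex_orb_summand[OF hk M] unfolding pco_def by metis

context
  fixes V V'
  assumes V: "V \<in> EO (Cg h) (St h)" and V': "V' \<in> EO (Cg k) (St k)"
begin

text \<open>The general construction of induced objects gives no control over the underlying object.
  Splitting the idempotent of an orbit in a tensor product of hosts yields one in the component of
  degree \<open>h k\<close>.\<close>

lemma ex_isI: "\<exists>Y. isI h k V V' Y"
proof -
  obtain M where M: "eo FF M" "pco h V M (gr h (fst M))" using pco_ex_host[OF hk(1) V] .
  obtain N where N: "eo FF N" "pco k V' N (gr k (fst N))" using pco_ex_host[OF hk(2) V'] .
  obtain W where "pco (h \<otimes>\<^bsub>G\<^esub> k) W (tob FF M N) (eps (fst M) (fst N) (orb h k))" using ex_pco_orb[OF M(1) N(1)] .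
  then show ?thesis using isI_pco[OF M(1) N(1) M(2) N(2)] by blast
qed

lemma isI_IN: "isI h k V V' (IN h k V V')"
  unfolding Ind_def by (rule someI_ex[OF ex_isI])

lemma eo_tob_VV': "eo (St h \<inter> St k) (tob (St h \<inter> St k) V V')"
proof -
  obtain M j p where M: "eo FF M" "smd (St h) V M j p" using ex_host[OF hk(1) V] by metis
  obtain N j' p' where N: "eo FF N" "smd (St k) V' N j' p'" using ex_host[OF hk(2) V'] by metis
  show ?thesis by (rule smd_ten(1)[OF hk M(1) N(1) V M(2) V' N(2)])
qed

lemma isI_unique: "isI h k V V' Y \<Longrightarrow> isI h k V V' Y' \<Longrightarrow> kc (h \<otimes>\<^bsub>G\<^esub> k) Y = kc (h \<otimes>\<^bsub>G\<^esub> k) Y'"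
  unfolding isI_iff
  using ind_unique[OF subgroup_St[OF hk_closed] subgroup_Int[OF hk] tr_hk idem_complete_Cg[OF hk_closed] eo_tob_VV'] by blast

end

lemma IN_split:
  assumes V: "V1 \<in> EO (Cg h) (St h)" "V2 \<in> EO (Cg h) (St h)" "V3 \<in> EO (Cg h) (St h)"
    and W: "W1 \<in> EO (Cg k) (St k)" "W2 \<in> EO (Cg k) (St k)" "W3 \<in> EO (Cg k) (St k)"
    and se: "split_exact (St h \<inter> St k) (tob (St h \<inter> St k) V1 W1) (tob (St h \<inter> St k) V2 W2) (tob (St h \<inter> St k) V3 W3) f g"
  shows "kc (h \<otimes>\<^bsub>G\<^esub> k) (IN h k V2 W2) = kc (h \<otimes>\<^bsub>G\<^esub> k) (IN h k V1 W1) \<oplus>\<^bsub>KA (h \<otimes>\<^bsub>G\<^esub> k)\<^esub> kc (h \<otimes>\<^bsub>G\<^esub> k) (IN h k V3 W3)"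
proof -
  note I1 = isI_IN[OF V(1) W(1), unfolded isI_iff] and I2 = isI_IN[OF V(2) W(2), unfolded isI_iff] and I3 = isI_IN[OF V(3) W(3), unfolded isI_iff]
  have eo: "eo (St (h \<otimes>\<^bsub>G\<^esub> k)) (IN h k V1 W1)" "eo (St (h \<otimes>\<^bsub>G\<^esub> k)) (IN h k V2 W2)" "eo (St (h \<otimes>\<^bsub>G\<^esub> k)) (IN h k V3 W3)"
    using I1 I2 I3 EO_Cg[OF hk_closed] by blast+
  obtain j1 p1 j2 p2 j3 p3 where i: "ind_data (St (h \<otimes>\<^bsub>G\<^esub> k)) (St h \<inter> St k) (tr (St (h \<otimes>\<^bsub>G\<^esub> k)) (St h \<inter> St k)) (tob (St h \<inter> St k) V1 W1) (IN h k V1 W1) j1 p1"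
    "ind_data (St (h \<otimes>\<^bsub>G\<^esub> k)) (St h \<inter> St k) (tr (St (h \<otimes>\<^bsub>G\<^esub> k)) (St h \<inter> St k)) (tob (St h \<inter> St k) V2 W2) (IN h k V2 W2) j2 p2"
    "ind_data (St (h \<otimes>\<^bsub>G\<^esub> k)) (St h \<inter> St k) (tr (St (h \<otimes>\<^bsub>G\<^esub> k)) (St h \<inter> St k)) (tob (St h \<inter> St k) V3 W3) (IN h k V3 W3) j3 p3"
    using I1 I2 I3 by blast
  show ?thesis
    by (rule cls_split[OF subgroup_St[OF hk_closed] Cg_subset[OF hk_closed] conjunct1[OF I1] conjunct1[OF I2] conjunct1[OF I3]
      ind_split_exact[OF subgroup_St[OF hk_closed] subgroup_Int[OF hk] tr_hk eo_tob_VV'[OF V(1) W(1)] eo_tob_VV'[OF V(2) W(2)]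
        eo_tob_VV'[OF V(3) W(3)] eo i se]])
qed

lemma eo_ResB: "V \<in> EO (Cg h) (St h) \<Longrightarrow> eo (St h \<inter> St k) (Res (St h \<inter> St k) V)"
  "V' \<in> EO (Cg k) (St k) \<Longrightarrow> eo (St h \<inter> St k) (Res (St h \<inter> St k) V')"
  using eo_Res[OF subgroup_Int[OF hk] Int_lower1 St_subset] eo_Res[OF subgroup_Int[OF hk] Int_lower2 St_subset] hk
  by (auto simp: EO_Cg)

text \<open>\<open>Ind\<close> selects an object separately for each pair. Additivity is unaffected,
  since a splitting can be induced between whatever biproducts come with the selected
  objects.\<close>

lemma IN_additive:
  shows "V' \<in> EO (Cg k) (St k) \<Longrightarrow> K0_additive (EQ (Cg h) (St h)) (\<lambda>V. kc (h \<otimes>\<^bsub>G\<^esub> k) (IN h k V V')) (KA (h \<otimes>\<^bsub>G\<^esub> k))"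
    and "V \<in> EO (Cg h) (St h) \<Longrightarrow> K0_additive (EQ (Cg k) (St k)) (\<lambda>V'. kc (h \<otimes>\<^bsub>G\<^esub> k) (IN h k V V')) (KA (h \<otimes>\<^bsub>G\<^esub> k))"
proof -
  let ?B = "St h \<inter> St k"
  have cl: "kc (h \<otimes>\<^bsub>G\<^esub> k) (IN h k V V') \<in> carrier (KA (h \<otimes>\<^bsub>G\<^esub> k))" if "V \<in> EO (Cg h) (St h)" "V' \<in> EO (Cg k) (St k)" for V V'
    by (rule K0_class_closed) (use isI_IN[OF that] isI_iff in simp)
  show "K0_additive (EQ (Cg h) (St h)) (\<lambda>V. kc (h \<otimes>\<^bsub>G\<^esub> k) (IN h k V V')) (KA (h \<otimes>\<^bsub>G\<^esub> k))" if V': "V' \<in> EO (Cg k) (St k)"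
  proof (rule K0_additiveI[OF subgroup_St[OF hk(1)] idem_complete_Cg[OF hk(1)] cl[OF _ V']])
    fix X Y Z i p assume *: "X \<in> EO (Cg h) (St h)" "Y \<in> EO (Cg h) (St h)" "Z \<in> EO (Cg h) (St h)" "split_exact (St h) X Y Z i p"
    have "split_exact ?B (tob ?B (Res ?B X) (Res ?B V')) (tob ?B (Res ?B Y) (Res ?B V')) (tob ?B (Res ?B Z) (Res ?B V'))
       (i \<star> ide (fst (Res ?B V'))) (p \<star> ide (fst (Res ?B V')))"
      by (rule tob_split_exact(1)[OF subgroup_Int[OF hk] eo_ResB(1)[OF *(1)] eo_ResB(1)[OF *(2)] eo_ResB(1)[OF *(3)] eo_ResB(2)[OF V']
        split_exact_Res[OF *(4)]]) simp
    then show "kc (h \<otimes>\<^bsub>G\<^esub> k) (IN h k Y V') = kc (h \<otimes>\<^bsub>G\<^esub> k) (IN h k X V') \<oplus>\<^bsub>KA (h \<otimes>\<^bsub>G\<^esub> k)\<^esub> kc (h \<otimes>\<^bsub>G\<^esub> k) (IN h k Z V')"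
      unfolding tob_Res[OF order_refl order_refl] by (rule IN_split[OF *(1-3) V' V' V'])
  qed
  show "K0_additive (EQ (Cg k) (St k)) (\<lambda>V'. kc (h \<otimes>\<^bsub>G\<^esub> k) (IN h k V V')) (KA (h \<otimes>\<^bsub>G\<^esub> k))" if V: "V \<in> EO (Cg h) (St h)"
  proof (rule K0_additiveI[OF subgroup_St[OF hk(2)] idem_complete_Cg[OF hk(2)] cl[OF V]])
    fix X Y Z i p assume *: "X \<in> EO (Cg k) (St k)" "Y \<in> EO (Cg k) (St k)" "Z \<in> EO (Cg k) (St k)" "split_exact (St k) X Y Z i p"
    have "split_exact ?B (tob ?B (Res ?B V) (Res ?B X)) (tob ?B (Res ?B V) (Res ?B Y)) (tob ?B (Res ?B V) (Res ?B Z))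
       (ide (fst (Res ?B V)) \<star> i) (ide (fst (Res ?B V)) \<star> p)"
      by (rule tob_split_exact(2)[OF subgroup_Int[OF hk] eo_ResB(2)[OF *(1)] eo_ResB(2)[OF *(2)] eo_ResB(2)[OF *(3)] eo_ResB(1)[OF V]
        split_exact_Res[OF *(4)]]) simp
    then show "kc (h \<otimes>\<^bsub>G\<^esub> k) (IN h k V Y) = kc (h \<otimes>\<^bsub>G\<^esub> k) (IN h k V X) \<oplus>\<^bsub>KA (h \<otimes>\<^bsub>G\<^esub> k)\<^esub> kc (h \<otimes>\<^bsub>G\<^esub> k) (IN h k V Z)"
      unfolding tob_Res[OF order_refl order_refl] by (rule IN_split[OF V V V *(1-3)])
  qed
qed

lemma IN_closed: "V \<in> EO (Cg h) (St h) \<Longrightarrow> V' \<in> EO (Cg k) (St k) \<Longrightarrow> IN h k V V' \<in> EO (Cg (h \<otimes>\<^bsub>G\<^esub> k)) (St (h \<otimes>\<^bsub>G\<^esub> k))"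
  using isI_IN isI_iff by blast

lemma mm_IN: "V \<in> EO (Cg h) (St h) \<Longrightarrow> V' \<in> EO (Cg k) (St k) \<Longrightarrow> mm h k (kc h V) (kc k V') = kc (h \<otimes>\<^bsub>G\<^esub> k) (IN h k V V')"
  unfolding m_map_def Let_def by (rule K0_map2_class) (simp_all add: IN_additive IN_closed)

lemma mm_linear_left: "Y \<in> carrier (KA k) \<Longrightarrow> linear_map_on (KA h) (KA (h \<otimes>\<^bsub>G\<^esub> k)) (\<lambda>X. mm h k X Y)"
  unfolding m_map_def Let_def by (rule K0_map2_linear_left) (simp_all add: IN_additive IN_closed)

lemma mm_linear_right: "X \<in> carrier (KA h) \<Longrightarrow> linear_map_on (KA k) (KA (h \<otimes>\<^bsub>G\<^esub> k)) (\<lambda>Y. mm h k X Y)"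
  unfolding m_map_def Let_def by (rule K0_map2_linear_right) (simp_all add: IN_additive IN_closed)

lemma mm_class: "V \<in> EO (Cg h) (St h) \<Longrightarrow> V' \<in> EO (Cg k) (St k) \<Longrightarrow> isI h k V V' Y \<Longrightarrow>
    mm h k (kc h V) (kc k V') = kc (h \<otimes>\<^bsub>G\<^esub> k) Y"
  using mm_IN isI_unique[OF _ _ isI_IN] by metis

text \<open>Values of \<open>m\<close> in terms of hosts alone. The arguments on conjugation, unit
  and product below use this form and leave \<open>Ind\<close> and the transversals aside.\<close>

lemma mm_pco:
  assumes "eo FF M" "eo FF N" "pco h V M (gr h (fst M))" "pco k V' N (gr k (fst N))"
    "pco (h \<otimes>\<^bsub>G\<^esub> k) W (tob FF M N) (eps (fst M) (fst N) (orb h k))"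
  shows "mm h k (kc h V) (kc k V') = kc (h \<otimes>\<^bsub>G\<^esub> k) W"
  by (rule mm_class[OF pcoD[OF assms(3)] pcoD[OF assms(4)] isI_pco[OF assms]])

end

section \<open>The axioms for the structure maps\<close>

lemma cc_mm:
  assumes x: "x \<in> FF" and hk: "h \<in> carrier G" "k \<in> carrier G" and X: "X \<in> carrier (KA h)" and Y: "Y \<in> carrier (KA k)"
  shows "cc x (h \<otimes>\<^bsub>G\<^esub> k) (mm h k X Y) = mm (\<rho> x h) (\<rho> x k) (cc x h X) (cc x k Y)"
proof -
  have g: "h \<otimes>\<^bsub>G\<^esub> k \<in> carrier G" and xhk: "\<rho> x h \<in> carrier G" "\<rho> x k \<in> carrier G" using x hk by simp_all
  have r: "\<rho> x (h \<otimes>\<^bsub>G\<^esub> k) = \<rho> x h \<otimes>\<^bsub>G\<^esub> \<rho> x k" by (rule rho_mult[OF x hk])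
  have cg: "linear_map_on (KA (h \<otimes>\<^bsub>G\<^esub> k)) (KA (\<rho> x h \<otimes>\<^bsub>G\<^esub> \<rho> x k)) (\<lambda>X. cc x (h \<otimes>\<^bsub>G\<^esub> k) X)"
    using cc_linear[OF x g] unfolding r .
  show ?thesis
  proof (rule bilinear_eqI[where f = "\<lambda>X Y. cc x (h \<otimes>\<^bsub>G\<^esub> k) (mm h k X Y)" and g = "\<lambda>X Y. mm (\<rho> x h) (\<rho> x k) (cc x h X) (cc x k Y)",
        OF _ _ _ _ module_K0 _ X Y])
    show "linear_map_on (KA h) (KA (\<rho> x h \<otimes>\<^bsub>G\<^esub> \<rho> x k)) (\<lambda>X. cc x (h \<otimes>\<^bsub>G\<^esub> k) (mm h k X Y))" if "Y \<in> carrier (KA k)" for Y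
      by (rule linear_map_on_compose[OF mm_linear_left[OF hk that] cg])
    show "linear_map_on (KA k) (KA (\<rho> x h \<otimes>\<^bsub>G\<^esub> \<rho> x k)) (\<lambda>Y. cc x (h \<otimes>\<^bsub>G\<^esub> k) (mm h k X Y))" if "X \<in> carrier (KA h)" for X
      by (rule linear_map_on_compose[OF mm_linear_right[OF hk that] cg])
    show "linear_map_on (KA h) (KA (\<rho> x h \<otimes>\<^bsub>G\<^esub> \<rho> x k)) (\<lambda>X. mm (\<rho> x h) (\<rho> x k) (cc x h X) (cc x k Y))" if "Y \<in> carrier (KA k)" for Y
      by (rule linear_map_on_compose[OF cc_linear[OF x hk(1)] mm_linear_left[OF xhk cc_closed[OF x hk(2) that]]])
    show "linear_map_on (KA k) (KA (\<rho> x h \<otimes>\<^bsub>G\<^esub> \<rho> x k)) (\<lambda>Y. mm (\<rho> x h) (\<rho> x k) (cc x h X) (cc x k Y))" if "X \<in> carrier (KA h)" for X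
      by (rule linear_map_on_compose[OF cc_linear[OF x hk(2)] mm_linear_right[OF xhk cc_closed[OF x hk(1) that]]])
    fix V V' assume "V \<in> Obj (EQ (Cg h) (St h))" and "V' \<in> Obj (EQ (Cg k) (St k))"
    then have V: "V \<in> EO (Cg h) (St h)" and V': "V' \<in> EO (Cg k) (St k)" by simp_all
    obtain M where M: "eo FF M" "pco h V M (gr h (fst M))" using pco_ex_host[OF hk(1) V] .
    obtain N where N: "eo FF N" "pco k V' N (gr k (fst N))" using pco_ex_host[OF hk(2) V'] .
    note o = eo_obj[OF M(1) order_refl] eo_obj[OF N(1) order_refl]
    have MN: "eo FF (tob FF M N)" by (rule eo_tob[OF subgroup_F M(1) N(1)])
    obtain W where W: "pco (h \<otimes>\<^bsub>G\<^esub> k) W (tob FF M N) (eps (fst M) (fst N) (orb h k))" using ex_pco_orb[OF hk M(1) N(1)] .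
    obtain W' where W': "pco (\<rho> x h \<otimes>\<^bsub>G\<^esub> \<rho> x k) W' (tob FF M N) (eps (fst M) (fst N) (orb (\<rho> x h) (\<rho> x k)))" using ex_pco_orb[OF xhk M(1) N(1)] .
    \<comment> \<open>Conjugation by \<open>x\<close> moves the summand of the orbit of
      \<open>(h, k)\<close> to that of the orbit of the translated pair, within the same tensor
      product of hosts.\<close>
    have "pco (\<rho> x (h \<otimes>\<^bsub>G\<^esub> k)) (cob (h \<otimes>\<^bsub>G\<^esub> k) x W) (tob FF M N) (eps (fst M) (fst N) (orb (\<rho> x h) (\<rho> x k)))"
    proof (rule pco_conj[OF g x MN W])
      show "eqv (St (\<rho> x (h \<otimes>\<^bsub>G\<^esub> k))) (tob FF M N) (tob FF M N) (eps (fst M) (fst N) (orb (\<rho> x h) (\<rho> x k)))"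
        unfolding r by (rule pco_eqv[OF _ MN W']) (use xhk in simp)
      show "sact (tob FF M N) x \<cdot> act x (eps (fst M) (fst N) (orb h k)) = eps (fst M) (fst N) (orb (\<rho> x h) (\<rho> x k)) \<cdot> sact (tob FF M N) x"
        using eps_sact[OF M(1) N(1) x orb_GG[OF hk]] unfolding rr_orb[OF hk x] .
    qed
    then have cW: "pco (\<rho> x h \<otimes>\<^bsub>G\<^esub> \<rho> x k) (cob (h \<otimes>\<^bsub>G\<^esub> k) x W) (tob FF M N) (eps (fst M) (fst N) (orb (\<rho> x h) (\<rho> x k)))" unfolding r .
    have "cc x (h \<otimes>\<^bsub>G\<^esub> k) (mm h k (kc h V) (kc k V')) = kc (\<rho> x h \<otimes>\<^bsub>G\<^esub> \<rho> x k) (cob (h \<otimes>\<^bsub>G\<^esub> k) x W)"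
      unfolding mm_pco[OF hk M(1) N(1) M(2) N(2) W] cc_class[OF x g] r ..
    also have "\<dots> = mm (\<rho> x h) (\<rho> x k) (kc (\<rho> x h) (cob h x V)) (kc (\<rho> x k) (cob k x V'))"
      by (rule mm_pco[symmetric, OF xhk M(1) N(1) pco_conj_gr[OF hk(1) x M] pco_conj_gr[OF hk(2) x N] cW])
    also have "\<dots> = mm (\<rho> x h) (\<rho> x k) (cc x h (kc h V)) (cc x k (kc k V'))"
      unfolding cc_class[OF x hk(1)] cc_class[OF x hk(2)] ..
    finally show "cc x (h \<otimes>\<^bsub>G\<^esub> k) (mm h k (kc h V) (kc k V')) = mm (\<rho> x h) (\<rho> x k) (cc x h (kc h V)) (cc x k (kc k V'))" .
  qed
qed

lemma orb_one: "g \<in> carrier G \<Longrightarrow> orb \<one>\<^bsub>G\<^esub> g = {(\<one>\<^bsub>G\<^esub>, g)}" "g \<in> carrier G \<Longrightarrow> orb g \<one>\<^bsub>G\<^esub> = {(g, \<one>\<^bsub>G\<^esub>)}"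
  using subgroup.one_closed[OF subgroup_St[of g]] by (auto simp: orb_def rr_def St_iff image_iff intro!: exI[of _ "\<one>\<^bsub>F\<^esub>"])

text \<open>The orbit of the pair \<open>1\<close>, \<open>g\<close> is a single element, and the
  unit object has degree \<open>1\<close>. So the summand in question is the part of degree
  \<open>g\<close> of \<open>M\<close> tensored with the unit object, which the unit isomorphism
  carries to that of \<open>M\<close>.\<close>

lemma mm_unit:
  assumes g: "g \<in> carrier G" and X: "X \<in> carrier (KA g)"
  shows "mm \<one>\<^bsub>G\<^esub> g unit_class X = X" "mm g \<one>\<^bsub>G\<^esub> X unit_class = X"
proof -
  have one: "\<one>\<^bsub>G\<^esub> \<in> carrier G" by simp
  let ?U = "unob FF"
  have Ut: "pco \<one>\<^bsub>G\<^esub> (pc \<one>\<^bsub>G\<^esub> ?U) ?U (gr \<one>\<^bsub>G\<^esub> (fst ?U))" by (rule pco_pc[OF one eo_U])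
  have l: "linear_map_on (KA g) (KA g) (\<lambda>X. mm \<one>\<^bsub>G\<^esub> g unit_class X)" "linear_map_on (KA g) (KA g) (\<lambda>X. mm g \<one>\<^bsub>G\<^esub> X unit_class)"
    using mm_linear_right[OF one g unit_closed'] mm_linear_left[OF g one unit_closed'] g by simp_all
  {
    fix V assume "V \<in> Obj (EQ (Cg g) (St g))"
    then have V: "V \<in> EO (Cg g) (St g)" by simp
    obtain M where M: "eo FF M" "pco g V M (gr g (fst M))" using pco_ex_host[OF g V] .
    have o: "fst M \<in> Obj C" by (rule eo_obj[OF M(1) order_refl])
    have UO: "Unit C \<in> Obj C" by simp
    have ge: "eqv (St g) M M (gr g (fst M))" by (rule gr_eqv[OF order_refl M(1) St_subset order_refl g])
    have e: "eps (Unit C) (fst M) (orb \<one>\<^bsub>G\<^esub> g) = ide (Unit C) \<star> gr g (fst M)" "eps (fst M) (Unit C) (orb g \<one>\<^bsub>G\<^esub>) = gr g (fst M) \<star> ide (Unit C)"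
      unfolding orb_one[OF g] using eps_single[OF UO o, of "(\<one>\<^bsub>G\<^esub>, g)"] eps_single[OF o UO, of "(g, \<one>\<^bsub>G\<^esub>)"] g gr_Unit
      by (simp_all add: te_def)
    have "mm \<one>\<^bsub>G\<^esub> g unit_class (kc g V) = kc g V"
    proof -
      obtain W where W: "pco (\<one>\<^bsub>G\<^esub> \<otimes>\<^bsub>G\<^esub> g) W (tob FF ?U M) (eps (fst ?U) (fst M) (orb \<one>\<^bsub>G\<^esub> g))" using ex_pco_orb[OF one g eo_U M(1)] .
      have W': "pco g W (tob FF ?U M) (ide (Unit C) \<star> gr g (fst M))" using W g e(1) by simp
      have "pco g W M (gr g (fst M))"
        by (rule pco_transport[OF g eo_tob[OF subgroup_F eo_U M(1)] M(1) eqv_mono[OF eqv_lun[OF subgroup_F M(1)] St_subset] _ W' ge])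
          (use o g lun_natural[of "gr g (fst M)"] in simp_all)
      then have "kc g W = kc g V" by (rule pco_unique[OF g M(1) _ M(2)])
      then show ?thesis unfolding unit_class_def using mm_pco[OF one g eo_U M(1) Ut M(2) W] g by simp
    qed
    moreover have "mm g \<one>\<^bsub>G\<^esub> (kc g V) unit_class = kc g V"
    proof -
      obtain W where W: "pco (g \<otimes>\<^bsub>G\<^esub> \<one>\<^bsub>G\<^esub>) W (tob FF M ?U) (eps (fst M) (fst ?U) (orb g \<one>\<^bsub>G\<^esub>))" using ex_pco_orb[OF g one M(1) eo_U] .
      have W': "pco g W (tob FF M ?U) (gr g (fst M) \<star> ide (Unit C))" using W g e(2) by simp
      have "pco g W M (gr g (fst M))"
        by (rule pco_transport[OF g eo_tob[OF subgroup_F M(1) eo_U] M(1) eqv_mono[OF eqv_run[OF subgroup_F M(1)] St_subset] _ W' ge])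
          (use o g run_natural[of "gr g (fst M)"] in simp_all)
      then have "kc g W = kc g V" by (rule pco_unique[OF g M(1) _ M(2)])
      then show ?thesis unfolding unit_class_def using mm_pco[OF g one M(1) eo_U M(2) Ut W] g by simp
    qed
    ultimately have "mm \<one>\<^bsub>G\<^esub> g unit_class (kc g V) = kc g V" "mm g \<one>\<^bsub>G\<^esub> (kc g V) unit_class = kc g V" by blast+
  } note * = this
  show "mm \<one>\<^bsub>G\<^esub> g unit_class X = X" by (rule linear_map_on_eqI[OF l(1) linear_id module_K0 *(1) X])
  show "mm g \<one>\<^bsub>G\<^esub> X unit_class = X" by (rule linear_map_on_eqI[OF l(2) linear_id module_K0 *(2) X])
qed

lemma structure_maps: "graded_structure_maps F G \<rho> (\<lambda>g. KA g) (\<lambda>h k X Y. mm h k X Y) (\<lambda>x g X. cc x g X) unit_class"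
proof -
  have gs: "\<alpha> g \<in> carrier (KA g)" if "\<alpha> \<in> graded_space G (\<lambda>g. KA g)" "g \<in> carrier G" for \<alpha> g
    using that by (auto simp: graded_space_def)
  show ?thesis
  proof (intro graded_structure_maps.intro group_F group_G hom_rho graded_structure_maps_axioms.intro)
    show "module scalars (KA g)" for g by (rule module_K0)
    show "linear_map_on (KA g) (KA (g \<otimes>\<^bsub>G\<^esub> h)) (\<lambda>a. mm g h a b)" if "g \<in> carrier G" "h \<in> carrier G" "b \<in> carrier (KA h)" for g h b
      by (rule mm_linear_left[OF that])
    show "linear_map_on (KA h) (KA (g \<otimes>\<^bsub>G\<^esub> h)) (\<lambda>b. mm g h a b)" if "g \<in> carrier G" "h \<in> carrier G" "a \<in> carrier (KA g)" for g h a
      by (rule mm_linear_right[OF that])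
    show "linear_map_on (KA g) (KA (\<rho> x g)) (\<lambda>X. cc x g X)" if "x \<in> FF" "g \<in> carrier G" for x g
      by (rule cc_linear[OF that])
    show "cc x g a = a" if "g \<in> carrier G" "x \<in> St g" "a \<in> carrier (KA g)" for g x a
      by (rule cc_stab[OF that])
    show "cc x (g \<otimes>\<^bsub>G\<^esub> h) (mm g h a b) = mm (\<rho> x g) (\<rho> x h) (cc x g a) (cc x h b)"
      if "x \<in> FF" "g \<in> carrier G" "h \<in> carrier G" "a \<in> carrier (KA g)" "b \<in> carrier (KA h)" for x g h a b
      by (rule cc_mm[OF that])
    show "unit_class \<in> carrier (KA \<one>\<^bsub>G\<^esub>)" by (rule unit_closed')
    show "cc x \<one>\<^bsub>G\<^esub> unit_class = unit_class" if "x \<in> FF" for x by (rule cc_unit[OF that])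
    show "mm \<one>\<^bsub>G\<^esub> g unit_class a = a" "mm g \<one>\<^bsub>G\<^esub> a unit_class = a" if "g \<in> carrier G" "a \<in> carrier (KA g)" for g a
      using mm_unit[OF that] .
    show "total_map F G \<rho> (\<lambda>x g X. cc x g X) \<one>\<^bsub>F\<^esub> \<alpha> = \<alpha>" if a: "\<alpha> \<in> graded_space G (\<lambda>g. KA g)" for \<alpha>
    proof
      fix g show "total_map F G \<rho> (\<lambda>x g X. cc x g X) \<one>\<^bsub>F\<^esub> \<alpha> g = \<alpha> g"
      proof (cases "g \<in> carrier G")
        case True
        have i: "inv\<^bsub>F\<^esub> \<one>\<^bsub>F\<^esub> = \<one>\<^bsub>F\<^esub>" by (rule monoid.inv_one[OF group.is_monoid[OF group_F]])
        have "\<one>\<^bsub>F\<^esub> \<in> St g" using True by (simp add: St_iff)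
        then show ?thesis using True cc_stab[OF True _ gs[OF a True]] by (simp add: total_map_def i)
      next
        case False
        then show ?thesis using a by (auto simp: total_map_def graded_space_def PiE_def extensional_def)
      qed
    qed
    show "total_map F G \<rho> (\<lambda>x g X. cc x g X) (x \<otimes>\<^bsub>F\<^esub> y) \<alpha> =
        total_map F G \<rho> (\<lambda>x g X. cc x g X) x (total_map F G \<rho> (\<lambda>x g X. cc x g X) y \<alpha>)"
      if x: "x \<in> FF" and y: "y \<in> FF" and a: "\<alpha> \<in> graded_space G (\<lambda>g. KA g)" for x y \<alpha>
      unfolding total_map_def
    proof (rule restrict_ext)
      fix g assume g: "g \<in> carrier G"
      let ?k = "\<rho> (inv\<^bsub>F\<^esub> y) (\<rho> (inv\<^bsub>F\<^esub> x) g)"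
      have i: "inv\<^bsub>F\<^esub> (x \<otimes>\<^bsub>F\<^esub> y) = inv\<^bsub>F\<^esub> y \<otimes>\<^bsub>F\<^esub> inv\<^bsub>F\<^esub> x" by (rule group.inv_mult_group[OF group_F x y])
      have k: "\<rho> (inv\<^bsub>F\<^esub> (x \<otimes>\<^bsub>F\<^esub> y)) g = ?k" "?k \<in> carrier G" "\<rho> y ?k = \<rho> (inv\<^bsub>F\<^esub> x) g" using x y g by (simp_all add: i rho_comp)
      have "cc (x \<otimes>\<^bsub>F\<^esub> y) ?k (\<alpha> ?k) = cc x (\<rho> (inv\<^bsub>F\<^esub> x) g) (cc y ?k (\<alpha> ?k))"
        using cc_comp[OF k(2) x y gs[OF a k(2)]] unfolding k(3) by simp
      then show "cc (x \<otimes>\<^bsub>F\<^esub> y) (\<rho> (inv\<^bsub>F\<^esub> (x \<otimes>\<^bsub>F\<^esub> y)) g) (\<alpha> (\<rho> (inv\<^bsub>F\<^esub> (x \<otimes>\<^bsub>F\<^esub> y)) g)) =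
         cc x (\<rho> (inv\<^bsub>F\<^esub> x) g) ((\<lambda>g\<in>carrier G. cc y (\<rho> (inv\<^bsub>F\<^esub> y) g) (\<alpha> (\<rho> (inv\<^bsub>F\<^esub> y) g))) (\<rho> (inv\<^bsub>F\<^esub> x) g))"
        unfolding k(1) using x g by simp
    qed
  qed
qed

section \<open>The product over representatives of orbits of pairs\<close>

context
  fixes reps
  assumes reps: "\<And>g. g \<in> carrier G \<Longrightarrow> orbit_representatives F G \<rho> g (reps g)"
begin

abbreviation (input) IR where "IR \<equiv> invariant_ring F G \<rho> (\<lambda>g. KA g) (m_map C F G \<rho> Cg T tr) (c_map C F \<rho> Cg T) unc reps"

lemma orb_back:
  assumes hk: "h \<in> carrier G" "k \<in> carrier G" and q: "q \<in> orb h k"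
  shows "\<exists>x\<in>St (h \<otimes>\<^bsub>G\<^esub> k). (h, k) = rr x q"
proof -
  have g: "h \<otimes>\<^bsub>G\<^esub> k \<in> carrier G" using hk by simp
  obtain x where x: "x \<in> St (h \<otimes>\<^bsub>G\<^esub> k)" "q = rr x (h, k)" using q by (auto simp: orb_def)
  have "inv\<^bsub>F\<^esub> x \<in> St (h \<otimes>\<^bsub>G\<^esub> k)" by (rule subgroup.m_inv_closed[OF subgroup_St[OF g] x(1)])
  moreover have "(h, k) = rr (inv\<^bsub>F\<^esub> x) q" using x hk by (simp add: rr_def St_iff)
  ultimately show ?thesis by blast
qed

lemma reps_D:
  assumes g: "g \<in> carrier G" and p: "p \<in> reps g"
  shows "fst p \<in> carrier G" "snd p \<in> carrier G" "fst p \<otimes>\<^bsub>G\<^esub> snd p = g"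
  using reps[OF g] p unfolding orbit_representatives_def by auto

lemma finite_reps: "g \<in> carrier G \<Longrightarrow> finite (reps g)"
proof (rule finite_subset[of _ GG])
  assume g: "g \<in> carrier G"
  show "reps g \<subseteq> GG" using reps_D(1,2)[OF g] by (simp add: subset_iff mem_Times_iff)
  show "finite GG" using finite_G by simp
qed

lemma reps_disjoint:
  assumes g: "g \<in> carrier G" and p: "p \<in> reps g" and q: "q \<in> reps g" and pq: "p \<noteq> q"
  shows "orb (fst p) (snd p) \<inter> orb (fst q) (snd q) = {}"
proof (rule ccontr)
  assume "orb (fst p) (snd p) \<inter> orb (fst q) (snd q) \<noteq> {}"
  then obtain s where s: "s \<in> orb (fst p) (snd p)" "s \<in> orb (fst q) (snd q)" by blast
  note dp = reps_D[OF g p] and dq = reps_D[OF g q]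
  have sG: "fst s \<in> carrier G" "snd s \<in> carrier G" "fst s \<otimes>\<^bsub>G\<^esub> snd s = g"
    using subsetD[OF orb_GG[OF dp(1,2)] s(1)] orb_prod[OF dp(1,2) s(1)] dp(3) by auto
  have "\<exists>!p. p \<in> reps g \<and> (\<exists>x\<in>St g. p = (\<rho> x (fst s), \<rho> x (snd s)))"
    using reps[OF g] sG unfolding orbit_representatives_def by blast
  moreover have "\<exists>x\<in>St g. p = (\<rho> x (fst s), \<rho> x (snd s))" "\<exists>x\<in>St g. q = (\<rho> x (fst s), \<rho> x (snd s))"
    using orb_back[OF dp(1,2) s(1)] orb_back[OF dq(1,2) s(2)] dp(3) dq(3) by (simp_all add: rr_def)
  ultimately have "p = q" using p q by (elim ex1E) metis
  then show False using pq by simp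
qed

text \<open>The given representatives are reached from a pair, whereas \<open>orb\<close> starts
  from the representative; inverses in the stabilizer pass from one description to the
  other.\<close>

lemma reps_UN:
  assumes g: "g \<in> carrier G"
  shows "(\<Union>p\<in>reps g. orb (fst p) (snd p)) = {p \<in> GG. fst p \<otimes>\<^bsub>G\<^esub> snd p = g}"
proof
  show "(\<Union>p\<in>reps g. orb (fst p) (snd p)) \<subseteq> {p \<in> GG. fst p \<otimes>\<^bsub>G\<^esub> snd p = g}"
  proof
    fix s assume "s \<in> (\<Union>p\<in>reps g. orb (fst p) (snd p))"
    then obtain p where p: "p \<in> reps g" "s \<in> orb (fst p) (snd p)" by blast
    note d = reps_D[OF g p(1)]
    show "s \<in> {p \<in> GG. fst p \<otimes>\<^bsub>G\<^esub> snd p = g}"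
      using subsetD[OF orb_GG[OF d(1,2)] p(2)] orb_prod[OF d(1,2) p(2)] d(3) by simp
  qed
  show "{p \<in> GG. fst p \<otimes>\<^bsub>G\<^esub> snd p = g} \<subseteq> (\<Union>p\<in>reps g. orb (fst p) (snd p))"
  proof
    fix s assume "s \<in> {p \<in> GG. fst p \<otimes>\<^bsub>G\<^esub> snd p = g}"
    then have s: "fst s \<in> carrier G" "snd s \<in> carrier G" "fst s \<otimes>\<^bsub>G\<^esub> snd s = g" by auto
    then obtain p x where p: "p \<in> reps g" and x: "x \<in> St g" "p = (\<rho> x (fst s), \<rho> x (snd s))"
      using reps[OF g] unfolding orbit_representatives_def by blast
    have "inv\<^bsub>F\<^esub> x \<in> St (fst p \<otimes>\<^bsub>G\<^esub> snd p)"
      unfolding reps_D(3)[OF g p] by (rule subgroup.m_inv_closed[OF subgroup_St[OF g] x(1)])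
    moreover have "s = rr (inv\<^bsub>F\<^esub> x) (fst p, snd p)" using x s by (simp add: rr_def St_iff)
    ultimately have "s \<in> orb (fst p) (snd p)" unfolding orb_def by blast
    then show "s \<in> (\<Union>p\<in>reps g. orb (fst p) (snd p))" using p by blast
  qed
qed

text \<open>Each representative pair contributes one summand \<open>W p\<close> of the tensor
  product, whose class is a value of \<open>m\<close>. The orbits partition the pairs with product
  \<open>g\<close>, so their idempotents are orthogonal with sum \<open>gr g\<close>.\<close>

lemma ph_tob:
  assumes g: "g \<in> carrier G" and M: "eo FF M" and N: "eo FF N"
  shows "ph g (cF (tob FF M N)) = finsum (KA g) (\<lambda>p. mm (fst p) (snd p) (ph (fst p) (cF M)) (ph (snd p) (cF N))) (reps g)"
proof -
  interpret B: module scalars "KA g" by (rule module_K0)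
  note o = eo_obj[OF M order_refl] eo_obj[OF N order_refl]
  let ?e = "\<lambda>p. eps (fst M) (fst N) (orb (fst p) (snd p))"
  have MN: "eo FF (tob FF M N)" by (rule eo_tob[OF subgroup_F M N])
  have "\<exists>W. pco g W (tob FF M N) (?e p)" if p: "p \<in> reps g" for p
    using ex_pco_orb[OF reps_D(1,2)[OF g p] M N] unfolding reps_D(3)[OF g p] by metis
  then obtain W where W: "\<And>p. p \<in> reps g \<Longrightarrow> pco g (W p) (tob FF M N) (?e p)" by metis
  have sub: "orb (fst p) (snd p) \<subseteq> GG" if "p \<in> reps g" for p by (rule orb_GG[OF reps_D(1,2)[OF g that]])
  have "gr g (fst (tob FF M N)) = asum (fst (tob FF M N)) (fst (tob FF M N)) ?e (reps g)"
    using gr_eps[OF o g] eps_UN[OF o finite_reps[OF g], where P = "\<lambda>p. orb (fst p) (snd p)", OF sub reps_disjoint[OF g]]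
    unfolding reps_UN[OF g] by simp
  then have "pco g (pc g (tob FF M N)) (tob FF M N) (asum (fst (tob FF M N)) (fst (tob FF M N)) ?e (reps g))"
    using pco_pc[OF g MN] by simp
  then have "kc g (pc g (tob FF M N)) = finsum (KA g) (\<lambda>p. kc g (W p)) (reps g)"
  proof (rule pco_sum[OF g MN finite_reps[OF g] _ W])
    show "?e p \<cdot> ?e q = zer (fst (tob FF M N)) (fst (tob FF M N))" if "p \<in> reps g" "q \<in> reps g" "p \<noteq> q" for p q
      using eps_eps[OF o sub[OF that(1)] sub[OF that(2)]] reps_disjoint[OF g that] eps_empty[OF o] by simp
  qed
  also have "\<dots> = finsum (KA g) (\<lambda>p. mm (fst p) (snd p) (ph (fst p) (cF M)) (ph (snd p) (cF N))) (reps g)"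
  proof (rule B.finsum_cong'[OF refl])
    have *: "mm (fst p) (snd p) (ph (fst p) (cF M)) (ph (snd p) (cF N)) = kc g (W p)" if p: "p \<in> reps g" for p
    proof -
      note d = reps_D[OF g p]
      have "pco (fst p \<otimes>\<^bsub>G\<^esub> snd p) (W p) (tob FF M N) (?e p)" using W[OF p] d(3) by simp
      from mm_pco[OF d(1,2) M N pco_pc[OF d(1) M] pco_pc[OF d(2) N] this]
      show ?thesis unfolding ph_class[OF d(1)] ph_class[OF d(2)] d(3) .
    qed
    then show "\<And>p. p \<in> reps g \<Longrightarrow> kc g (W p) = mm (fst p) (snd p) (ph (fst p) (cF M)) (ph (snd p) (cF N))" by simp
    have "kc g (W p) \<in> carrier (KA g)" if "p \<in> reps g" for p
      by (rule K0_class_closed) (use pcoD[OF W[OF that]] in simp)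
    then show "(\<lambda>p. mm (fst p) (snd p) (ph (fst p) (cF M)) (ph (snd p) (cF N))) \<in> reps g \<rightarrow> carrier (KA g)" using * by simp
  qed
  finally show ?thesis unfolding ph_class[OF g] .
qed

abbreviation (input) KR where "KR \<equiv> (K0_ring (EQ (Obj C) FF) :: ('r, (('o \<times> ('f \<Rightarrow> 'm)) \<Rightarrow>\<^sub>0 'r) set) module)"

lemma KR_simps: "carrier KR = carrier KC" "add KR = add KC" "zero KR = zero KC" "smult KR = smult KC" "one KR = cF (unob FF)"
  using K_simps[OF subgroup_F refl] by auto

lemma ph_mult:
  assumes g: "g \<in> carrier G" and X: "X \<in> carrier KC" and Y: "Y \<in> carrier KC"
  shows "ph g (X \<otimes>\<^bsub>KR\<^esub> Y) = finsum (KA g) (\<lambda>p. mm (fst p) (snd p) (ph (fst p) X) (ph (snd p) Y)) (reps g)"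
proof (rule bilinear_eqI[where f = "\<lambda>X Y. ph g (X \<otimes>\<^bsub>KR\<^esub> Y)" and
      g = "\<lambda>X Y. finsum (KA g) (\<lambda>p. mm (fst p) (snd p) (ph (fst p) X) (ph (snd p) Y)) (reps g)", OF _ _ _ _ module_K0 _ X Y])
  show "linear_map_on KC (KA g) (\<lambda>X. ph g (X \<otimes>\<^bsub>KR\<^esub> Y))" if "Y \<in> carrier KC" for Y
    by (rule linear_map_on_compose[OF K_linear_left[OF subgroup_F refl] ph_linear[OF g]]) (use that KR_simps in simp)
  show "linear_map_on KC (KA g) (\<lambda>Y. ph g (X \<otimes>\<^bsub>KR\<^esub> Y))" if "X \<in> carrier KC" for X
    by (rule linear_map_on_compose[OF K_linear_right[OF subgroup_F refl] ph_linear[OF g]]) (use that KR_simps in simp)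
  show "linear_map_on KC (KA g) (\<lambda>X. finsum (KA g) (\<lambda>p. mm (fst p) (snd p) (ph (fst p) X) (ph (snd p) Y)) (reps g))" if Y: "Y \<in> carrier KC" for Y
  proof (rule linear_map_on_finsum[OF module_K0 finite_reps[OF g]])
    fix p assume p: "p \<in> reps g"
    note d = reps_D[OF g p]
    show "linear_map_on KC (KA g) (\<lambda>X. mm (fst p) (snd p) (ph (fst p) X) (ph (snd p) Y))"
      using linear_map_on_compose[OF ph_linear[OF d(1)] mm_linear_left[OF d(1,2) linear_map_on_closed[OF ph_linear[OF d(2)] Y]]] unfolding d(3) .
  qed
  show "linear_map_on KC (KA g) (\<lambda>Y. finsum (KA g) (\<lambda>p. mm (fst p) (snd p) (ph (fst p) X) (ph (snd p) Y)) (reps g))" if X: "X \<in> carrier KC" for X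
  proof (rule linear_map_on_finsum[OF module_K0 finite_reps[OF g]])
    fix p assume p: "p \<in> reps g"
    note d = reps_D[OF g p]
    show "linear_map_on KC (KA g) (\<lambda>Y. mm (fst p) (snd p) (ph (fst p) X) (ph (snd p) Y))"
      using linear_map_on_compose[OF ph_linear[OF d(2)] mm_linear_right[OF d(1,2) linear_map_on_closed[OF ph_linear[OF d(1)] X]]] unfolding d(3) .
  qed
  fix M N assume "M \<in> Obj (EQ (Obj C) FF)" "N \<in> Obj (EQ (Obj C) FF)"
  then have MN: "eo FF M" "eo FF N" by (simp_all add: EO_Obj)
  show "ph g (cF M \<otimes>\<^bsub>KR\<^esub> cF N) = finsum (KA g) (\<lambda>p. mm (fst p) (snd p) (ph (fst p) (cF M)) (ph (snd p) (cF N))) (reps g)"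
    unfolding K_mult_class[OF subgroup_F refl MN] by (rule ph_tob[OF g MN])
qed

lemma ph_one:
  assumes g: "g \<in> carrier G"
  shows "ph g (cF (unob FF)) = (if g = \<one>\<^bsub>G\<^esub> then unc else \<zero>\<^bsub>KA g\<^esub>)"
proof (cases "g = \<one>\<^bsub>G\<^esub>")
  case True
  then show ?thesis using ph_class[OF g, of "unob FF"] by (simp add: unit_class_def)
next
  case False
  have "gr g (Unit C) = gr g (Unit C) \<cdot> gr \<one>\<^bsub>G\<^esub> (Unit C)" using gr_Unit g by simp
  also have "\<dots> = zer (Unit C) (Unit C)" using gr_cmp[of "Unit C" g "\<one>\<^bsub>G\<^esub>"] g False by simp
  finally have "pco g (pc g (unob FF)) (unob FF) (zer (fst (unob FF)) (fst (unob FF)))"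
    using pco_pc[OF g eo_U] by simp
  from pco_zero[OF g this] show ?thesis unfolding ph_class[OF g] using False by simp
qed

lemma Phi_linear: "linear_map_on KR IR Phi"
proof -
  have "Phi \<in> carrier KC \<rightarrow> carrier IR" using Phi_GI by (auto simp: invariant_ring_def)
  moreover have "Phi (X \<oplus>\<^bsub>KC\<^esub> Y) = Phi X \<oplus>\<^bsub>IR\<^esub> Phi Y" if "X \<in> carrier KC" "Y \<in> carrier KC" for X Y
    unfolding Phi_def invariant_ring_def using ph_linear that by (auto simp: linear_map_on_def intro!: restrict_ext)
  moreover have "Phi (r \<odot>\<^bsub>KC\<^esub> X) = r \<odot>\<^bsub>IR\<^esub> Phi X" if "X \<in> carrier KC" for r X
    unfolding Phi_def invariant_ring_def using ph_linear that by (auto simp: linear_map_on_def intro!: restrict_ext)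
  ultimately show ?thesis unfolding linear_map_on_def KR_simps by blast
qed

lemma Phi_iso: "Phi \<in> ring_iso KR IR"
proof -
  have "Phi \<in> ring_hom KR IR"
  proof (rule ring_hom_memI)
    fix X assume X: "X \<in> carrier KR"
    show "Phi X \<in> carrier IR" using linear_map_on_closed[OF Phi_linear X] .
    fix Y assume Y: "Y \<in> carrier KR"
    show "Phi (X \<oplus>\<^bsub>KR\<^esub> Y) = Phi X \<oplus>\<^bsub>IR\<^esub> Phi Y" using Phi_linear X Y by (simp add: linear_map_on_def)
    have XY: "X \<in> carrier KC" "Y \<in> carrier KC" using X Y KR_simps by simp_all
    have "finsum (KA g) (\<lambda>p. mm (fst p) (snd p) (ph (fst p) X) (ph (snd p) Y)) (reps g) =
        finsum (KA g) (\<lambda>(h, k). mm h k (Phi X h) (Phi Y k)) (reps g)" if g: "g \<in> carrier G" for g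
    proof -
      interpret B: module scalars "KA g" by (rule module_K0)
      show ?thesis
      proof (rule B.finsum_cong'[OF refl])
        fix p assume p: "p \<in> reps g"
        note d = reps_D[OF g p]
        show "mm (fst p) (snd p) (ph (fst p) X) (ph (snd p) Y) = (case p of (h, k) \<Rightarrow> mm h k (Phi X h) (Phi Y k))"
          using d by (simp add: Phi_def case_prod_beta)
      next
        show "(\<lambda>(h, k). mm h k (Phi X h) (Phi Y k)) \<in> reps g \<rightarrow> carrier (KA g)"
        proof
          fix p assume p: "p \<in> reps g"
          note d = reps_D[OF g p]
          have "mm (fst p) (snd p) (ph (fst p) X) (ph (snd p) Y) \<in> carrier (KA g)"
            using linear_map_on_closed[OF mm_linear_left[OF d(1,2) linear_map_on_closed[OF ph_linear[OF d(2)] XY(2)]]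
              linear_map_on_closed[OF ph_linear[OF d(1)] XY(1)]] unfolding d(3) .
          then show "(case p of (h, k) \<Rightarrow> mm h k (Phi X h) (Phi Y k)) \<in> carrier (KA g)"
            using d by (simp add: Phi_def case_prod_beta)
        qed
      qed
    qed
    then show "Phi (X \<otimes>\<^bsub>KR\<^esub> Y) = Phi X \<otimes>\<^bsub>IR\<^esub> Phi Y"
      using ph_mult[OF _ XY] by (simp add: invariant_ring_def Phi_def[of "X \<otimes>\<^bsub>KR\<^esub> Y"] restrict_def fun_eq_iff)
  next
    show "Phi \<one>\<^bsub>KR\<^esub> = \<one>\<^bsub>IR\<^esub>"
      unfolding KR_simps Phi_def invariant_ring_def using ph_one by (auto intro!: restrict_ext)
  qed
  moreover have "bij_betw Phi (carrier KR) (carrier IR)"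
    unfolding KR_simps
    by (rule bij_betw_byWitness[where f' = Psi])
      (use Psi_Phi Phi_Psi Phi_GI Psi_closed in \<open>auto simp: invariant_ring_def\<close>)
  ultimately show ?thesis by (simp add: ring_iso_def)
qed

lemma Phi_zero: "Phi \<zero>\<^bsub>KR\<^esub> = \<zero>\<^bsub>IR\<^esub>"
  unfolding KR_simps Phi_def invariant_ring_def
  using linear_map_on_zero[OF module_K0 module_K0 ph_linear] by (auto intro!: restrict_ext)

text \<open>Transport along the bijection gives the ring axioms with the image of zero as zero
  element; linearity of the components of \<open>Phi\<close> identifies it with the given
  one.\<close>

lemma ring_IR: "ring IR"
proof -
  have "ring (IR\<lparr>zero := Phi \<zero>\<^bsub>KR\<^esub>\<rparr>)"
    by (rule ring.ring_iso_imp_img_ring[OF ring_K[OF subgroup_F refl] Phi_iso])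
  then show ?thesis unfolding Phi_zero by (simp add: invariant_ring_def)
qed

end

end

end

end

text \<open>The witnesses \<open>unit_class\<close> and \<open>Phi\<close> are built without
  reference to transversals or representatives of pairs, which is why one pair of witnesses serves
  for all choices. Only \<open>m_map\<close> mentions the former, and only the multiplication of
  \<open>invariant_ring\<close> the latter.\<close>

theorem theorem5p23:
  fixes C :: "('o, 'm, 'k::alg_closed_field) moncat"
    and F :: "('f, 'x) monoid_scheme" and G :: "('g, 'y) monoid_scheme"
    and \<rho> :: "'f \<Rightarrow> 'g \<Rightarrow> 'g" and Cg :: "'g \<Rightarrow> 'o set" and T :: "('f, 'o, 'm) action_data"
    and A :: "'g \<Rightarrow> ('r::comm_ring_1, (('o \<times> ('f \<Rightarrow> 'm)) \<Rightarrow>\<^sub>0 'r) set) module"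
    and CF :: "('o \<times> ('f \<Rightarrow> 'm), 'm, 'k) moncat"
    and K :: "('r, (('o \<times> ('f \<Rightarrow> 'm)) \<Rightarrow>\<^sub>0 'r) set) module"
    and c :: "'f \<Rightarrow> 'g \<Rightarrow> (('o \<times> ('f \<Rightarrow> 'm)) \<Rightarrow>\<^sub>0 'r) set \<Rightarrow> (('o \<times> ('f \<Rightarrow> 'm)) \<Rightarrow>\<^sub>0 'r) set"
  assumes action: "coherent_action C F G \<rho> Cg T"
  defines "A \<equiv> (\<lambda>g. K0 (component C F \<rho> Cg T g))"
    and "CF \<equiv> equivariantization C F T (Obj C) (carrier F)"
    and "K \<equiv> K0_ring CF"
    and "c \<equiv> c_map C F \<rho> Cg T"
  shows "ring K \<and> module scalars K \<and>
    (\<forall>M\<in>Obj CF. \<forall>N\<in>Obj CF. K0_class CF M \<otimes>\<^bsub>K\<^esub> K0_class CF N = K0_class CF (M \<boxtimes>\<^bsub>CF\<^esub> N)) \<and>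
    (\<forall>x\<in>carrier F. \<forall>g\<in>carrier G. \<forall>M\<in>Obj (component C F \<rho> Cg T g).
       c x g (K0_class (component C F \<rho> Cg T g) M) =
       K0_class (component C F \<rho> Cg T (\<rho> x g)) (conj_object C F T (stabilizer F \<rho> g) x M)) \<and>
    (\<exists>u \<Phi>. \<forall>tr. transversal_choice F tr \<longrightarrow>
       (let m = m_map C F G \<rho> Cg T tr in
         graded_structure_maps F G \<rho> A m c u \<and>
         (\<forall>g\<in>carrier G. \<forall>h\<in>carrier G.
            \<forall>M\<in>Obj (component C F \<rho> Cg T g). \<forall>N\<in>Obj (component C F \<rho> Cg T h).
            let S = stabilizer F \<rho> (g \<otimes>\<^bsub>G\<^esub> h); B = stabilizer F \<rho> g \<inter> stabilizer F \<rho> h;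
                ind = is_induced C F T (Cg (g \<otimes>\<^bsub>G\<^esub> h)) S B (tr S B) (res_tensor C F \<rho> T g h M N)
            in (\<exists>Y. ind Y) \<and>
               (\<forall>Y. ind Y \<longrightarrow>
                  m g h (K0_class (component C F \<rho> Cg T g) M) (K0_class (component C F \<rho> Cg T h) N)
                  = K0_class (component C F \<rho> Cg T (g \<otimes>\<^bsub>G\<^esub> h)) Y)) \<and>
         (\<forall>reps. (\<forall>g\<in>carrier G. orbit_representatives F G \<rho> g (reps g)) \<longrightarrow>
            ring (invariant_ring F G \<rho> A m c u reps) \<and>
            \<Phi> \<in> ring_iso K (invariant_ring F G \<rho> A m c u reps) \<and>
            linear_map_on K (invariant_ring F G \<rho> A m c u reps) \<Phi>)))"
proof -
  have "tensor_action C F T" "semisimple_category C"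
    using action unfolding coherent_action_def graded_fusion_category_def fusion_category_def by blast+
  then have "gaction C F G \<rho> Cg T"
    using action by (simp add: gaction_def action_def)
  then interpret gaction C F G \<rho> Cg T .
  show ?thesis
    unfolding A_def CF_def K_def c_def Let_def
  proof (intro conjI ballI exI[of _ unit_class] exI[of _ Phi] allI impI)
    show "ring (K0_ring (EQ (Obj C) FF) :: ('r, _) module)" by (rule ring_K[OF subgroup_F refl])
    show "module scalars (K0_ring (EQ (Obj C) FF) :: ('r, _) module)" by (rule module_K[OF subgroup_F refl])
    show "K0_class (EQ (Obj C) FF) M \<otimes>\<^bsub>K0_ring (EQ (Obj C) FF)\<^esub> K0_class (EQ (Obj C) FF) N =
        (K0_class (EQ (Obj C) FF) (M \<boxtimes>\<^bsub>EQ (Obj C) FF\<^esub> N) :: (_ \<Rightarrow>\<^sub>0 'r) set)"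
      if "M \<in> Obj (EQ (Obj C) FF)" "N \<in> Obj (EQ (Obj C) FF)" for M N
      unfolding TensO_EQ by (rule K_mult_class[OF subgroup_F refl]) (use that in \<open>simp_all add: EO_Obj\<close>)
    show "c_map C F \<rho> Cg T x g (K0_class (EQ (Cg g) (St g)) M) =
        (K0_class (EQ (Cg (\<rho> x g)) (St (\<rho> x g))) (conj_object C F T (St g) x M) :: (_ \<Rightarrow>\<^sub>0 'r) set)"
      if "x \<in> FF" "g \<in> carrier G" for x g M
      by (rule cc_class[OF that])
    fix tr assume tr: "transversal_choice F tr"
    show "graded_structure_maps F G \<rho> (\<lambda>g. K0 (EQ (Cg g) (St g)) :: ('r, _) module) (m_map C F G \<rho> Cg T tr) (c_map C F \<rho> Cg T) unit_class"
      by (rule structure_maps[OF tr])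
    {
      fix g h M N
      assume gh: "g \<in> carrier G" "h \<in> carrier G" and M: "M \<in> Obj (EQ (Cg g) (St g))" and N: "N \<in> Obj (EQ (Cg h) (St h))"
      show "\<exists>Y. is_induced C F T (Cg (g \<otimes>\<^bsub>G\<^esub> h)) (St (g \<otimes>\<^bsub>G\<^esub> h)) (St g \<inter> St h) (tr (St (g \<otimes>\<^bsub>G\<^esub> h)) (St g \<inter> St h)) (res_tensor C F \<rho> T g h M N) Y"
        by (rule ex_isI[OF tr gh]) (use M N in simp_all)
      fix Y
      assume "is_induced C F T (Cg (g \<otimes>\<^bsub>G\<^esub> h)) (St (g \<otimes>\<^bsub>G\<^esub> h)) (St g \<inter> St h) (tr (St (g \<otimes>\<^bsub>G\<^esub> h)) (St g \<inter> St h)) (res_tensor C F \<rho> T g h M N) Y"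
      then show "m_map C F G \<rho> Cg T tr g h (K0_class (EQ (Cg g) (St g)) M) (K0_class (EQ (Cg h) (St h)) N)
          = (K0_class (EQ (Cg (g \<otimes>\<^bsub>G\<^esub> h)) (St (g \<otimes>\<^bsub>G\<^esub> h))) Y :: (_ \<Rightarrow>\<^sub>0 'r) set)"
        by (rule mm_class[OF tr gh, rotated 2]) (use M N in simp_all)
    }
    fix reps assume "\<forall>g\<in>carrier G. orbit_representatives F G \<rho> g (reps g)"
    then have reps: "\<And>g. g \<in> carrier G \<Longrightarrow> orbit_representatives F G \<rho> g (reps g)" by blast
    let ?I = "invariant_ring F G \<rho> (\<lambda>g. K0 (EQ (Cg g) (St g)) :: ('r, _) module) (m_map C F G \<rho> Cg T tr) (c_map C F \<rho> Cg T) unit_class reps"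
    show "ring ?I" by (rule ring_IR[OF tr reps])
    show "Phi \<in> ring_iso (K0_ring (EQ (Obj C) FF)) ?I" by (rule Phi_iso[OF tr reps])
    show "linear_map_on (K0_ring (EQ (Obj C) FF)) ?I Phi" by (rule Phi_linear[OF tr reps])
  qed
qed

end
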